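(* Let $\gamma\in\Gamma_{1,1}:=(-\infty,-1)\cup(0,\infty)$, $s,s_1\in[0,1)$, $p,p_1\in(1,\infty)$, and $\theta\in(0,1)$ satisfy $$s=1-\theta+\theta s_1\quad\text{and}\quad\frac1p=1-\theta+\frac\theta{p_1}.$$ Assume that $X$ is a ball Banach function space having an absolutely continuous norm and that either (a) the Hardy--Littlewood maximal operator $M$ is bounded on $X'$, or (b) $M$ is endpoint bounded on $X'$ and the centered ball average operators $\{\mathcal{B}_r\}_{r\in(0,\infty)}$ are uniformly bounded on $X$. Then there exists a positive constant $C$ such that, for any $f\in\dot W^{1,X}$, $$\sup_{\lambda\in(0,\infty)}\lambda\left\|\int_{\mathbb{R}^n}\mathbf{1}_{E_{\lambda,\frac\gamma p+s-1}[f]}(\cdot,y)|\cdot-y|^{\gamma-n}\,dy\right\|_X^{\frac1p}\le C\left\{\sup_{\lambda\in(0,\infty)}\lambda\left\|\int_{\mathbb{R}^n}\mathbf{1}_{E_{\lambda,\frac\gamma{p_1}+s_1-1}[f]}(\cdot,y)|\cdot-y|^{\gamma-n}\,dy\right\|_X^{\frac1{p_1}}\right\}^{\theta}\left\|\,|\nabla f|\,\right\|_X^{1-\theta}.$$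
   Context: Everything is on $\mathbb{R}^n$; $\mathscr{M}$ is the set of all measurable functions. $E_{\lambda,b}[f]:=\{(x,y)\in\mathbb{R}^n\times\mathbb{R}^n:x\ne y,\ |f(x)-f(y)|>\lambda|x-y|^{1+b}\}$. A quasi-Banach space $X\subset\mathscr{M}$, with quasi-norm making sense (possibly $\infty$) on all of $\mathscr{M}$, is a ball Banach function space if: (1) $\|f\|_X=0$ implies $f=0$ a.e.; (2) $|g|\le|f|$ a.e. implies $\|g\|_X\le\|f\|_X$; (3) $0\le f_m\uparrow f$ a.e. implies $\|f_m\|_X\uparrow\|f\|_X$; (4) $\mathbf{1}_B\in X$ for every ball $B$; (5) $\|f+g\|_X\le\|f\|_X+\|g\|_X$ for $f,g\in X$; (6) for each ball $B$ there is $C_{(B)}>0$ with $\int_B|f|\,dx\le C_{(B)}\|f\|_X$ for $f\in X$. For $r\in(0,\infty)$, $X^r:=\{f\in\mathscr{M}:|f|^r\in X\}$ with $\|f\|_{X^r}:=\|\,|f|^r\|_X^{1/r}$. $X':=\{f\in\mathscr{M}:\|f\|_{X'}:=\sup_{\|g\|_X=1}\|fg\|_{L^1}<\infty\}$. $X$ has an absolutely continuous norm if $\|f\mathbf{1}_{E_j}\|_X\to0$ for every $f\in X$ and every sequence of measurable sets with $\mathbf{1}_{E_j}\to0$ a.e. $M(f)(x):=\sup_{Q\ni x}\frac1{|Q|}\int_Q|f|$ over cubes $Q$; $\mathcal{B}_r(f)(x):=\frac1{|B(x,r)|}\int_{B(x,r)}|f|$. $M$ is endpoint bounded on $X'$ if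 there is a sequence $\{\theta_m\}_{m\in\mathbb{N}}\subset(0,1)$ with $\theta_m\to1$ such that, for each $m$, $X^{\frac1{\theta_m}}$ is a ball Banach function space, $M$ is bounded on $(X^{\frac1{\theta_m}})'$, and $\lim_{m\to\infty}\|M\|_{(X^{1/\theta_m})'\to(X^{1/\theta_m})'}<\infty$. $\dot W^{1,X}$ is the set of all distributions $f$ with $|\nabla f|\in X$; such $f$ are automatically locally integrable functions. The right-hand side is allowed to be $\infty$. *)

theory Defs
  imports "HOL-Analysis.Analysis"
begin

section \<open>Function spaces given by a norm functional\<close>

text \<open>
  A space of measurable functions on \<open>real ^ 'n\<close> is represented by its (quasi-)norm functional
  \<open>N\<close> with values in \<open>[0, \<infinity>]\<close>, the elements of the space being the measurable functions with
  finite norm. All axioms are imposed on measurable functions only, and functions are never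
  identified when they agree almost everywhere. By the lattice property a norm only depends on
  the absolute value, so it suffices to consider real-valued functions here.
\<close>

type_synonym 'n fnorm = "(real ^ 'n \<Rightarrow> real) \<Rightarrow> ennreal"

abbreviation Meas :: "(real ^ 'n::finite \<Rightarrow> real) set" where
  "Meas \<equiv> borel_measurable lebesgue"

definition fspace :: "'n::finite fnorm \<Rightarrow> (real ^ 'n \<Rightarrow> real) set" where
  "fspace N = {f \<in> Meas. N f < \<infinity>}"

definition quasi_norm :: "'n::finite fnorm \<Rightarrow> bool" where
  "quasi_norm N \<longleftrightarrow>
     (\<forall>f\<in>Meas. \<forall>c. N (\<lambda>x. c * f x) = ennreal \<bar>c\<bar> * N f) \<and>
     (\<exists>K::real. \<forall>f\<in>Meas. \<forall>g\<in>Meas. N (\<lambda>x. f x + g x) \<le> ennreal K * (N f + N g)) \<and>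
     (\<forall>f\<in>Meas. N f = 0 \<longrightarrow> (AE x in lebesgue. f x = 0))"

definition complete_fspace :: "'n::finite fnorm \<Rightarrow> bool" where
  "complete_fspace N \<longleftrightarrow>
     (\<forall>F. (\<forall>m. F m \<in> fspace N) \<and>
          (\<forall>e>0. \<exists>k. \<forall>i\<ge>k. \<forall>j\<ge>k. N (\<lambda>x. F i x - F j x) < ennreal e) \<longrightarrow>
          (\<exists>f\<in>fspace N. (\<lambda>m. N (\<lambda>x. F m x - f x)) \<longlonglongrightarrow> 0))"

definition ball_banach_function_space :: "'n::finite fnorm \<Rightarrow> bool" where
  "ball_banach_function_space N \<longleftrightarrow>
     quasi_norm N \<and> complete_fspace N \<and>
     (\<forall>f\<in>Meas. N f = 0 \<longrightarrow> (AE x in lebesgue. f x = 0)) \<and>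
     (\<forall>f\<in>Meas. \<forall>g\<in>Meas. (AE x in lebesgue. \<bar>g x\<bar> \<le> \<bar>f x\<bar>) \<longrightarrow> N g \<le> N f) \<and>
     (\<forall>F. \<forall>f\<in>Meas. (\<forall>m. F m \<in> Meas) \<and>
          (AE x in lebesgue. 0 \<le> F 0 x \<and> incseq (\<lambda>m. F m x) \<and> (\<lambda>m. F m x) \<longlonglongrightarrow> f x) \<longrightarrow>
          incseq (\<lambda>m. N (F m)) \<and> (\<lambda>m. N (F m)) \<longlonglongrightarrow> N f) \<and>
     (\<forall>a. \<forall>r>0. indicator (ball a r) \<in> fspace N) \<and>
     (\<forall>f\<in>fspace N. \<forall>g\<in>fspace N. N (\<lambda>x. f x + g x) \<le> N f + N g) \<and>
     (\<forall>a. \<forall>r>0. \<exists>C::real. C > 0 \<and>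
          (\<forall>f\<in>fspace N. (\<integral>\<^sup>+x\<in>ball a r. ennreal \<bar>f x\<bar> \<partial>lebesgue) \<le> ennreal C * N f))"

definition absolutely_continuous_norm :: "'n::finite fnorm \<Rightarrow> bool" where
  "absolutely_continuous_norm N \<longleftrightarrow>
     (\<forall>f\<in>fspace N. \<forall>E. (\<forall>j. E j \<in> sets lebesgue) \<and>
          (AE x in lebesgue. (\<lambda>j. indicator (E j) x :: real) \<longlonglongrightarrow> 0) \<longrightarrow>
          (\<lambda>j. N (\<lambda>x. f x * indicator (E j) x)) \<longlonglongrightarrow> 0)"

text \<open>
  The norm of a measurable function with values in \<open>[0, \<infinity>]\<close>, as the limit along its truncations.
  On finite-valued functions this is \<open>N\<close> by the monotone convergence axiom. If the function is
  infinite on a set of positive measure, the value is \<open>\<infinity>\<close>.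
\<close>

definition ext_norm :: "'n::finite fnorm \<Rightarrow> (real ^ 'n \<Rightarrow> ennreal) \<Rightarrow> ennreal" where
  "ext_norm N F = (SUP k::nat. N (\<lambda>x. enn2real (min (F x) (of_nat k))))"

text \<open>Real powers on \<open>[0, \<infinity>]\<close>, only used with positive exponents.\<close>

definition epowr :: "ennreal \<Rightarrow> real \<Rightarrow> ennreal" where
  "epowr x a = (if x = \<infinity> then \<infinity> else ennreal (enn2real x powr a))"

text \<open>The norms of \<open>X\<^sup>r\<close> and of the associate space \<open>X'\<close>.\<close>

definition convexified_norm :: "'n::finite fnorm \<Rightarrow> real \<Rightarrow> 'n fnorm" where
  "convexified_norm N r f = epowr (N (\<lambda>x. \<bar>f x\<bar> powr r)) (1 / r)"

definition assoc_norm :: "'n::finite fnorm \<Rightarrow> 'n fnorm" where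
  "assoc_norm N f = (SUP g\<in>{g \<in> Meas. N g = 1}. \<integral>\<^sup>+x. ennreal \<bar>f x * g x\<bar> \<partial>lebesgue)"

section \<open>Averaging operators\<close>

text \<open>Cubes have edges parallel to the coordinate axes.\<close>

definition cubes :: "(real ^ 'n::finite) set set" where
  "cubes = {cbox a (a + (\<chi> i. l)) | a l. l > 0}"

definition HL_maximal :: "(real ^ 'n::finite \<Rightarrow> real) \<Rightarrow> real ^ 'n \<Rightarrow> ennreal" where
  "HL_maximal f x =
     (SUP Q\<in>{Q \<in> cubes. x \<in> Q}. (\<integral>\<^sup>+y\<in>Q. ennreal \<bar>f y\<bar> \<partial>lebesgue) / emeasure lebesgue Q)"

definition ball_average :: "real \<Rightarrow> (real ^ 'n::finite \<Rightarrow> real) \<Rightarrow> real ^ 'n \<Rightarrow> ennreal" where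
  "ball_average r f x =
     (\<integral>\<^sup>+y\<in>ball x r. ennreal \<bar>f y\<bar> \<partial>lebesgue) / emeasure lebesgue (ball x r)"

definition operator_norm ::
    "'n::finite fnorm \<Rightarrow> ((real ^ 'n \<Rightarrow> real) \<Rightarrow> real ^ 'n \<Rightarrow> ennreal) \<Rightarrow> ennreal" where
  "operator_norm N T = Inf {C. \<forall>f\<in>fspace N. ext_norm N (T f) \<le> C * N f}"

definition bounded_operator ::
    "'n::finite fnorm \<Rightarrow> ((real ^ 'n \<Rightarrow> real) \<Rightarrow> real ^ 'n \<Rightarrow> ennreal) \<Rightarrow> bool" where
  "bounded_operator N T \<longleftrightarrow>
     (\<exists>C::real. \<forall>f\<in>fspace N. ext_norm N (T f) \<le> ennreal C * N f)"

definition HL_endpoint_bounded_on_assoc :: "'n::finite fnorm \<Rightarrow> bool" where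
  "HL_endpoint_bounded_on_assoc N \<longleftrightarrow>
     (\<exists>\<theta> :: nat \<Rightarrow> real. (\<forall>m. 0 < \<theta> m \<and> \<theta> m < 1) \<and> \<theta> \<longlonglongrightarrow> 1 \<and>
        (\<forall>m. ball_banach_function_space (convexified_norm N (1 / \<theta> m)) \<and>
             bounded_operator (assoc_norm (convexified_norm N (1 / \<theta> m))) HL_maximal) \<and>
        (\<exists>L::real. (\<lambda>m. operator_norm (assoc_norm (convexified_norm N (1 / \<theta> m))) HL_maximal)
                     \<longlonglongrightarrow> ennreal L))"

definition ball_averages_uniformly_bounded :: "'n::finite fnorm \<Rightarrow> bool" where
  "ball_averages_uniformly_bounded N \<longleftrightarrow>
     (\<exists>C::real. \<forall>r>0. \<forall>f\<in>fspace N. ext_norm N (ball_average r f) \<le> ennreal C * N f)"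

section \<open>Homogeneous Sobolev spaces\<close>

abbreviation partial_deriv :: "'n \<Rightarrow> (real ^ 'n::finite \<Rightarrow> real) \<Rightarrow> real ^ 'n \<Rightarrow> real" where
  "partial_deriv i \<phi> x \<equiv> frechet_derivative \<phi> (at x) (axis i 1)"

primrec C_diff :: "nat \<Rightarrow> (real ^ 'n::finite \<Rightarrow> real) \<Rightarrow> bool" where
  "C_diff 0 \<phi> \<longleftrightarrow> continuous_on UNIV \<phi>"
| "C_diff (Suc k) \<phi> \<longleftrightarrow> (\<forall>x. \<phi> differentiable (at x)) \<and> (\<forall>i. C_diff k (partial_deriv i \<phi>))"

definition test_functions :: "(real ^ 'n::finite \<Rightarrow> real) set" where
  "test_functions = {\<phi>. (\<forall>k. C_diff k \<phi>) \<and> (\<exists>K. compact K \<and> (\<forall>x. x \<notin> K \<longrightarrow> \<phi> x = 0))}"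

definition locally_integrable :: "(real ^ 'n::finite \<Rightarrow> 'b::euclidean_space) \<Rightarrow> bool" where
  "locally_integrable f \<longleftrightarrow> (\<forall>K. compact K \<longrightarrow> f absolutely_integrable_on K)"

text \<open>
  The functions \<open>f\<close> are complex-valued, which includes the real-valued ones; integrating against
  real test functions suffices by linearity. The norm of \<open>complex ^ 'n\<close> is the Euclidean one, so
  \<open>norm (g x)\<close> is the length of the gradient.
\<close>

definition has_weak_gradient :: "(real ^ 'n::finite \<Rightarrow> complex) \<Rightarrow> (real ^ 'n \<Rightarrow> complex ^ 'n) \<Rightarrow> bool" where
  "has_weak_gradient f g \<longleftrightarrow> locally_integrable f \<and> locally_integrable g \<and>
     (\<forall>\<phi>\<in>test_functions. \<forall>i.
        (\<integral>x. partial_deriv i \<phi> x *\<^sub>R f x \<partial>lebesgue) = - (\<integral>x. \<phi> x *\<^sub>R (g x $ i) \<partial>lebesgue))"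

text \<open>
  Distributions with gradient in the space are locally integrable functions, and the elements are
  taken to be such functions.
\<close>

definition hom_sobolev :: "'n::finite fnorm \<Rightarrow> (real ^ 'n \<Rightarrow> complex) set" where
  "hom_sobolev N = {f. \<exists>g. has_weak_gradient f g \<and> (\<lambda>x. norm (g x)) \<in> fspace N}"

section \<open>The level set functional\<close>

definition level_set :: "real \<Rightarrow> real \<Rightarrow> (real ^ 'n::finite \<Rightarrow> complex) \<Rightarrow> ((real ^ 'n) \<times> (real ^ 'n)) set" where
  "level_set lam b f = {(x, y). x \<noteq> y \<and> norm (f x - f y) > lam * norm (x - y) powr (1 + b)}"

text \<open>\<open>sup_{\<lambda>>0} \<lambda> \<parallel> \<integral> 1_{E_{\<lambda>,b}[f]}(\<cdot>, y) |\<cdot> - y|^{\<gamma>-n} dy \<parallel>_X^{1/p}\<close>\<close>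

definition level_functional ::
    "'n::finite fnorm \<Rightarrow> real \<Rightarrow> real \<Rightarrow> real \<Rightarrow> (real ^ 'n \<Rightarrow> complex) \<Rightarrow> ennreal" where
  "level_functional N \<gamma> b p f =
     (SUP lam\<in>{0<..}. ennreal lam *
        epowr (ext_norm N (\<lambda>x. \<integral>\<^sup>+y. indicator (level_set lam b f) (x, y) *
                 ennreal (norm (x - y) powr (\<gamma> - real CARD('n))) \<partial>lebesgue)) (1 / p))"

end

theory Submission
  imports Defs
begin

text \<open>
  The heart of the matter is the case in which all exponents are 1: for \<open>f\<close> with weak gradient \<open>g\<close>,
    \<open>\<lambda> \<parallel> \<integral> 1_{E_{\<lambda>,\<gamma>}[f]}(\<cdot>, y) |\<cdot> - y|^{\<gamma>-n} dy \<parallel>_X \<le> C \<parallel> |g| \<parallel>_X\<close>     (1)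
  for all \<open>\<lambda> > 0\<close> (\<open>sobolev_level_estimate\<close>). The theorem follows from it by real interpolation on the level of
  sets. If \<open>\<lambda> = \<lambda>_0^{1-\<theta>} \<lambda>_1^\<theta>\<close> and \<open>1 + b = (1-\<theta>)(1+\<gamma>) + \<theta>(1+b_1)\<close>, then a pair of points outside both
  \<open>E_{\<lambda>_0,\<gamma>}\<close> and \<open>E_{\<lambda>_1,b_1}\<close> is outside \<open>E_{\<lambda>,b}\<close>, because a nonnegative number is the product of its powers with
  exponents \<open>1-\<theta>\<close> and \<open>\<theta>\<close>. Hence the integral for \<open>E_{\<lambda>,b}\<close> is at most the sum of the other two; the first is controlled by
  (1), the second by the supremum on the right-hand side, and choosing \<open>\<lambda>_0, \<lambda>_1\<close> so that both have the same
  size gives the product of powers. The hypotheses on \<open>s\<close> and \<open>p\<close> say exactly that \<open>b_1 = \<gamma>/p_1 + s_1 - 1\<close> leads to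
  \<open>b = \<gamma>/p + s - 1\<close>.

  For (1) the norm is first replaced by weights. A norm that is absolutely continuous is attained on dual
  functions (\<open>norming_weight\<close>), and if the maximal operator is bounded on the associate space, the
  iteration of Rubio de Francia majorises each dual function by one with the \<open>A\<^sub>1\<close> property without leaving the
  dual space (\<open>rubio_de_francia\<close>). So it suffices to prove the weighted inequality
  \<open>\<lambda> \<integral> w(x) \<integral> 1_{E_{\<lambda>,\<gamma>}[f]}(x, y) |x - y|^{\<gamma>-n} dy dx \<le> C \<integral> |\<nabla>f| w\<close> with \<open>C\<close> depending only on the
  \<open>A\<^sub>1\<close> constant (\<open>weighted_level_estimate\<close>), and only for regular \<open>f\<close> and truncated level sets.

  The weighted inequality is proved by counting dyadic cubes. If \<open>|f(x) - f(y)|\<close> is large, then telescoping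
  typical values of \<open>f\<close> along the dyadic cubes shrinking to \<open>x\<close> and to \<open>y\<close> shows that on one of these cubes \<open>f\<close>
  oscillates noticeably at the right height (\<open>oscillation_cube_of_pair\<close>). A cube \<open>Q\<close> of side \<open>l\<close> on which \<open>f\<close>
  oscillates by \<open>\<mu> l^{1+\<gamma>}\<close> carries gradient mass \<open>\<ge> c \<mu> l^{\<gamma>+n}\<close>, so by the \<open>A\<^sub>1\<close> property
  \<open>l^\<gamma> w(Q) \<le> C \<mu>\<^sup>-\<^sup>1 \<integral>_Q |\<nabla>f| w\<close>. Summing this over all oscillating cubes would count the
  gradient once for every scale. The assumption \<open>\<gamma> < -1\<close> or \<open>\<gamma> > 0\<close> prevents this
  (\<open>oscillating_cubes_sum\<close>). For \<open>\<gamma> > 0\<close> the largest cubes dominate the sum of \<open>l^\<gamma> w(Q)\<close>, so a cube that meets a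
  much larger one can be discarded. For \<open>\<gamma> < -1\<close> the small cubes dominate: a cube either meets so many
  much smaller ones that they absorb it, or the smaller ones have so little \<open>(n-1)\<close>-dimensional
  content that most axis-parallel lines avoid them, and then \<open>f\<close> has to oscillate outside of them
  (\<open>oscillation_of_good_lines\<close>). In both cases the gradient is counted boundedly often.

  A function with weak gradient \<open>g\<close> is reached by mollification: by the weak formulation the gradient of the mollified
  function is at most a constant times a ball average of \<open>|g|\<close>, and the ball averages are uniformly bounded on \<open>X\<close>, either by
  assumption or by duality from the maximal operator (\<open>ball_averages_bounded_by_duality\<close>). The lemma of
  Fatou removes the truncation and the mollification. If the maximal operator is only endpoint bounded, the
  truncated estimate is applied in \<open>X\<^bsup>1/\<theta>\<^esup>\<close> and survives the limit \<open>\<theta> \<rightarrow> 1\<close>, as its constant does not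
  depend on the space (\<open>endpoint_truncated_level_norm\<close>).
\<close>

section \<open>Norming functionals\<close>

text \<open>
  The theorem of Hahn and Banach, for spaces of functions that are given as subsets of a function type. The functional
  \<open>t h \<mapsto> t p(h)\<close> is extended by Zorn's lemma; partial functionals are represented by their graphs, for which
  the union of a chain is again one.
\<close>
lemma hahn_banach_function_space:
  fixes V :: "('b \<Rightarrow> real) set" and p :: "('b \<Rightarrow> real) \<Rightarrow> real"
  assumes add: "\<And>x y. x \<in> V \<Longrightarrow> y \<in> V \<Longrightarrow> (\<lambda>b. x b + y b) \<in> V"
    and scale: "\<And>x c. x \<in> V \<Longrightarrow> (\<lambda>b. c * x b) \<in> V"
    and p_add: "\<And>x y. x \<in> V \<Longrightarrow> y \<in> V \<Longrightarrow> p (\<lambda>b. x b + y b) \<le> p x + p y"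
    and p_scale: "\<And>x c. x \<in> V \<Longrightarrow> 0 \<le> c \<Longrightarrow> p (\<lambda>b. c * x b) = c * p x"
    and h: "h \<in> V"
  obtains L where "\<And>x y. x \<in> V \<Longrightarrow> y \<in> V \<Longrightarrow> L (\<lambda>b. x b + y b) = L x + L y"
    "\<And>x c. x \<in> V \<Longrightarrow> L (\<lambda>b. c * x b) = c * L x"
    "\<And>x. x \<in> V \<Longrightarrow> L x \<le> p x" "L h = p h"
proof -
  define lin where "lin g \<longleftrightarrow> g \<subseteq> V \<times> UNIV \<and>
      (\<forall>x r y s. (x, r) \<in> g \<longrightarrow> (y, s) \<in> g \<longrightarrow> ((\<lambda>b. x b + y b), r + s) \<in> g) \<and>
      (\<forall>x r c. (x, r) \<in> g \<longrightarrow> ((\<lambda>b. c * x b), c * r) \<in> g) \<and>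
      (\<forall>x r. (x, r) \<in> g \<longrightarrow> r \<le> p x)" for g :: "(('b \<Rightarrow> real) \<times> real) set"
  have p0: "p (\<lambda>b. 0) = 0" using p_scale[OF h, of 0] by simp
  have p_neg: "- p x \<le> p (\<lambda>b. - x b)" if "x \<in> V" for x
    using p_add[OF that scale[OF that, of "-1"]] p0 by simp
  define g0 where "g0 = {((\<lambda>b. t * h b), t * p h) | t. True}"
  have "t * p h \<le> p (\<lambda>b. t * h b)" for t
  proof (cases "t \<ge> 0")
    case True then show ?thesis using p_scale[OF h] by simp
  next
    case False
    have "p (\<lambda>b. (-t) * h b) = (-t) * p h" using False p_scale[OF h, of "-t"] by simp
    moreover have "- p (\<lambda>b. (-t) * h b) \<le> p (\<lambda>b. - ((-t) * h b))" by (rule p_neg[OF scale[OF h]])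
    ultimately show ?thesis by simp
  qed
  moreover have "\<exists>t. (\<lambda>b. t1 * h b + t2 * h b) = (\<lambda>b. t * h b) \<and> t1 * p h + t2 * p h = t * p h" for t1 t2
    by (rule exI[of _ "t1 + t2"]) (auto simp: algebra_simps)
  moreover have "\<exists>t. (\<lambda>b. c * (t1 * h b)) = (\<lambda>b. t * h b) \<and> c * (t1 * p h) = t * p h" for t1 c
    by (rule exI[of _ "c * t1"]) (auto simp: algebra_simps)
  ultimately have g0: "lin g0"
    unfolding lin_def g0_def using scale[OF h] by auto
  (* The graph g0 is the functional on the line through h, and p h is attained there. *)
  define S where "S = {g. lin g \<and> g0 \<subseteq> g}"
  have "\<exists>u\<in>S. \<forall>x\<in>C. x \<subseteq> u" if C: "subset.chain S C" for C
  proof (cases "C = {}")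
    case True then show ?thesis using g0 by (auto simp: S_def)
  next
    case False
    have CS: "C \<subseteq> S" and ch: "\<And>x y. x \<in> C \<Longrightarrow> y \<in> C \<Longrightarrow> x \<subseteq> y \<or> y \<subseteq> x"
      using C by (auto simp: subset.chain_def)
    have "lin (\<Union>C)"
      unfolding lin_def
    proof (intro conjI allI impI)
      show "\<Union>C \<subseteq> V \<times> UNIV" using CS by (auto simp: S_def lin_def)
    next
      fix x r y s assume "(x, r) \<in> \<Union>C" "(y, s) \<in> \<Union>C"
      then obtain a b where ab: "a \<in> C" "b \<in> C" "(x, r) \<in> a" "(y, s) \<in> b" by auto
      then obtain d where "d \<in> C" "(x, r) \<in> d" "(y, s) \<in> d" using ch[of a b] by blast
      moreover have "lin d" using CS `d \<in> C` by (auto simp: S_def)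
      ultimately show "((\<lambda>b. x b + y b), r + s) \<in> \<Union>C" unfolding lin_def by blast
    next
      fix x r c assume "(x, r) \<in> \<Union>C"
      then obtain d where "d \<in> C" "(x, r) \<in> d" by auto
      moreover from this have "lin d" using CS by (auto simp: S_def)
      ultimately show "((\<lambda>b. c * x b), c * r) \<in> \<Union>C" unfolding lin_def by blast
    next
      fix x r assume "(x, r) \<in> \<Union>C"
      then obtain d where "d \<in> C" "(x, r) \<in> d" by auto
      moreover from this have "lin d" using CS by (auto simp: S_def)
      ultimately show "r \<le> p x" unfolding lin_def by blast
    qed
    moreover have "g0 \<subseteq> \<Union>C" using False CS by (auto simp: S_def)
    ultimately show ?thesis by (auto simp: S_def)
  qed
  then obtain G where G: "G \<in> S" and max: "\<And>X. X \<in> S \<Longrightarrow> G \<subseteq> X \<Longrightarrow> X = G"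
    using subset_Zorn[of S] by (metis (no_types, lifting))
  have lG: "lin G" "g0 \<subseteq> G" using G by (auto simp: S_def)
  have GV: "x \<in> V" if "(x, r) \<in> G" for x r using lG that by (auto simp: lin_def)
  have Ga: "((\<lambda>b. x b + y b), r + s) \<in> G" if "(x, r) \<in> G" "(y, s) \<in> G" for x r y s
    using lG that by (auto simp: lin_def)
  have Gs: "((\<lambda>b. c * x b), c * r) \<in> G" if "(x, r) \<in> G" for x r c
    using lG that by (auto simp: lin_def)
  have Gp: "r \<le> p x" if "(x, r) \<in> G" for x r using lG that by (auto simp: lin_def)
  have G0: "((\<lambda>b. 0), 0) \<in> G" using lG(2) by (auto simp: g0_def intro: exI[of _ 0])
  have uniq: "r = s" if "(x, r) \<in> G" "(x, s) \<in> G" for x r s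
    using Gp[OF Ga[OF that(1) Gs[OF that(2), of "-1"]]] Gp[OF Ga[OF that(2) Gs[OF that(1), of "-1"]]] p0
    by simp
  have dom: "\<exists>r. (v, r) \<in> G" if v: "v \<in> V" for v
  proof -
    define A where "A = {r - p (\<lambda>b. x b - v b) | x r. (x, r) \<in> G}"
    have subV: "(\<lambda>b. x b - v b) \<in> V" if "x \<in> V" for x
      using add[OF that scale[OF v, of "-1"]] by simp
    have cross: "r - p (\<lambda>b. x b - v b) \<le> p (\<lambda>b. y b + v b) - s" if "(x, r) \<in> G" "(y, s) \<in> G" for x r y s
    proof -
      have "r + s \<le> p (\<lambda>b. x b + y b)" using Gp[OF Ga[OF that]] .
      also have "(\<lambda>b. x b + y b) = (\<lambda>b. (x b - v b) + (y b + v b))" by auto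
      also have "p \<dots> \<le> p (\<lambda>b. x b - v b) + p (\<lambda>b. y b + v b)"
        using that by (intro p_add subV add v GV)
      finally show ?thesis by simp
    qed
    define a where "a = Sup A"
    have bdd: "bdd_above A" using cross[OF _ G0] by (auto simp: A_def bdd_above_def)
    have a1: "r - p (\<lambda>b. x b - v b) \<le> a" if "(x, r) \<in> G" for x r
      unfolding a_def using that by (intro cSup_upper bdd) (auto simp: A_def)
    have a2: "a \<le> p (\<lambda>b. y b + v b) - s" if "(y, s) \<in> G" for y s
      unfolding a_def using G0 cross[OF _ that] by (intro cSup_least) (auto simp: A_def)
    define G' where "G' = {((\<lambda>b. x b + t * v b), r + t * a) | x r t. (x, r) \<in> G}"
    have G'I: "(y, q) \<in> G'" if "(x, r) \<in> G" "y = (\<lambda>b. x b + t * v b)" "q = r + t * a" for x r t y q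
      unfolding G'_def using that by blast
    have dominated: "r + t * a \<le> p (\<lambda>b. x b + t * v b)" if xr: "(x, r) \<in> G" for x r t
    proof (cases t "0::real" rule: linorder_cases)
      case equal then show ?thesis using Gp[OF xr] by simp
    next
      case greater
      have "a \<le> p (\<lambda>b. (1/t) * x b + v b) - (1/t) * r" by (rule a2[OF Gs[OF xr]])
      then have "t * a \<le> t * p (\<lambda>b. (1/t) * x b + v b) - r"
        using greater by (simp add: field_simps)
      also have "t * p (\<lambda>b. (1/t) * x b + v b) = p (\<lambda>b. t * ((1/t) * x b + v b))"
        using greater by (intro p_scale[symmetric] add scale v GV[OF xr]) auto
      also have "(\<lambda>b. t * ((1/t) * x b + v b)) = (\<lambda>b. x b + t * v b)"
        using greater by (auto simp: algebra_simps)
      finally show ?thesis by simp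
    next
      case less
      define u where "u = - t"
      have u: "u > 0" using less by (simp add: u_def)
      have "(1/u) * r - p (\<lambda>b. (1/u) * x b - v b) \<le> a" by (rule a1[OF Gs[OF xr]])
      then have "r - u * p (\<lambda>b. (1/u) * x b - v b) \<le> u * a"
        using u by (simp add: field_simps)
      moreover have "u * p (\<lambda>b. (1/u) * x b - v b) = p (\<lambda>b. u * ((1/u) * x b - v b))"
        using u by (intro p_scale[symmetric] subV scale GV[OF xr]) auto
      moreover have "(\<lambda>b. u * ((1/u) * x b - v b)) = (\<lambda>b. x b + t * v b)"
        using u by (auto simp: algebra_simps u_def)
      ultimately show ?thesis by (simp add: u_def)
    qed
    have "lin G'"
      unfolding lin_def
    proof (intro conjI allI impI)
      show "G' \<subseteq> V \<times> UNIV" using GV by (auto simp: G'_def intro!: add scale v)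
    next
      fix x r y s assume "(x, r) \<in> G'" "(y, s) \<in> G'"
      then obtain x1 r1 t1 x2 r2 t2 where *: "(x1, r1) \<in> G" "(x2, r2) \<in> G"
        "x = (\<lambda>b. x1 b + t1 * v b)" "r = r1 + t1 * a" "y = (\<lambda>b. x2 b + t2 * v b)" "s = r2 + t2 * a"
        by (auto simp: G'_def)
      show "((\<lambda>b. x b + y b), r + s) \<in> G'"
        by (rule G'I[OF Ga[OF *(1,2)], of _ "t1 + t2"]) (auto simp: *(3-) algebra_simps)
    next
      fix x r c assume "(x, r) \<in> G'"
      then obtain x1 r1 t1 where *: "(x1, r1) \<in> G" "x = (\<lambda>b. x1 b + t1 * v b)" "r = r1 + t1 * a"
        by (auto simp: G'_def)
      show "((\<lambda>b. c * x b), c * r) \<in> G'"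
        by (rule G'I[OF Gs[OF *(1), of c], where t = "c * t1"]) (auto simp: *(2-) distrib_left mult.assoc)
    next
      fix x r assume "(x, r) \<in> G'"
      then show "r \<le> p x" using dominated by (auto simp: G'_def)
    qed
    moreover have GG': "G \<subseteq> G'" by (auto intro: G'I[where t = 0])
    ultimately have "G' = G" using lG(2) by (intro max) (auto simp: S_def)
    moreover have "(v, a) \<in> G'" by (rule G'I[OF G0, of _ 1]) auto
    ultimately show ?thesis by auto
  qed
  define L where "L x = (THE r. (x, r) \<in> G)" for x
  have L: "(x, L x) \<in> G" if x: "x \<in> V" for x
    unfolding L_def using dom[OF x] uniq by (metis theI)
  have LI: "L x = r" if "(x, r) \<in> G" for x r using L[OF GV[OF that]] uniq that by blast
  show ?thesis
  proof (rule that)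
    show "L (\<lambda>b. x b + y b) = L x + L y" if "x \<in> V" "y \<in> V" for x y
      by (intro LI Ga L that)
    show "L (\<lambda>b. c * x b) = c * L x" if "x \<in> V" for x c
      by (intro LI Gs L that)
    show "L x \<le> p x" if "x \<in> V" for x using Gp[OF L[OF that]] .
    have "(h, p h) \<in> g0" by (auto simp: g0_def intro!: exI[of _ 1])
    then show "L h = p h" using lG(2) by (intro LI) auto
  qed
qed

section \<open>Elementary properties of the norms\<close>

lemma bbfs_cmult:
  assumes "ball_banach_function_space N" "f \<in> Meas"
  shows "N (\<lambda>x. c * f x) = ennreal \<bar>c\<bar> * N f"
  using assms by (simp add: ball_banach_function_space_def quasi_norm_def)

lemma bbfs_zero:
  assumes "ball_banach_function_space N"
  shows "N (\<lambda>x. 0) = 0"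
  using bbfs_cmult[OF assms, of "\<lambda>x. 0" 0] by simp

lemma bbfs_eq_0_AE:
  assumes "ball_banach_function_space N" "f \<in> Meas" "N f = 0"
  shows "AE x in lebesgue. f x = 0"
  using assms by (simp add: ball_banach_function_space_def)

lemma bbfs_mono:
  assumes "ball_banach_function_space N" "f \<in> Meas" "g \<in> Meas"
    "AE x in lebesgue. \<bar>g x\<bar> \<le> \<bar>f x\<bar>"
  shows "N g \<le> N f"
  using assms by (simp add: ball_banach_function_space_def)

lemma bbfs_triangle:
  assumes N: "ball_banach_function_space N" and "f \<in> Meas" "g \<in> Meas"
  shows "N (\<lambda>x. f x + g x) \<le> N f + N g"
proof (cases "N f < \<infinity> \<and> N g < \<infinity>")
  case True
  then show ?thesis using assms by (auto simp: ball_banach_function_space_def fspace_def)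
next
  case False
  then have "N f + N g = top" by (auto simp: not_less top_unique)
  then show ?thesis by (metis top_greatest)
qed

lemma bbfs_monotone_convergence:
  assumes "ball_banach_function_space N" "\<And>m. F m \<in> Meas" "f \<in> Meas"
    "AE x in lebesgue. 0 \<le> F 0 x \<and> incseq (\<lambda>m. F m x) \<and> (\<lambda>m. F m x) \<longlonglongrightarrow> f x"
  shows "incseq (\<lambda>m. N (F m))" "(\<lambda>m. N (F m)) \<longlonglongrightarrow> N f"
  using assms unfolding ball_banach_function_space_def by blast+

lemma bbfs_ball_finite:
  assumes "ball_banach_function_space N"
  shows "N (indicator (ball a r)) < \<infinity>"
proof (cases "r > 0")
  case True then show ?thesis using assms by (auto simp: ball_banach_function_space_def fspace_def)
next
  case False
  then have "ball a r = {}" by simp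
  then show ?thesis using bbfs_zero[OF assms] unfolding indicator_def \<open>ball a r = {}\<close> by simp
qed

lemma acn_tendsto:
  assumes "absolutely_continuous_norm N" "f \<in> Meas" "N f < \<infinity>" "\<And>j. E j \<in> sets lebesgue"
    "AE x in lebesgue. (\<lambda>j. indicator (E j) x :: real) \<longlonglongrightarrow> 0"
  shows "(\<lambda>j. N (\<lambda>x. f x * indicator (E j) x)) \<longlonglongrightarrow> 0"
  using assms unfolding absolutely_continuous_norm_def fspace_def by blast

lemma borel_imp_Meas: "f \<in> borel_measurable borel \<Longrightarrow> f \<in> Meas"
  by (simp add: measurable_completion)

text \<open>
  The elements of norm at most \<open>c\<close> in the associate space, as Borel functions with values in \<open>[0, \<infinity>]\<close>, so
  that suprema and series of weights can be formed without regard to convergence.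
\<close>
definition dual_weight :: "'n::finite fnorm \<Rightarrow> real \<Rightarrow> (real ^ 'n \<Rightarrow> ennreal) \<Rightarrow> bool" where
  "dual_weight N c \<psi> \<longleftrightarrow> \<psi> \<in> borel_measurable borel \<and>
     (\<forall>u\<in>Meas. (\<integral>\<^sup>+x. \<psi> x * ennreal \<bar>u x\<bar> \<partial>lborel) \<le> ennreal c * N u)"

text \<open>
  Existence of a dual function that attains the norm of \<open>h\<close>. Hahn--Banach gives a linear functional \<open>L\<close> on the bounded Borel
  functions with \<open>L s \<le> N((h s)\<^sup>+)\<close> and \<open>L 1 = N h\<close>. The positive part makes \<open>L\<close> positive, and absolute continuity of the norm
  makes \<open>A \<mapsto> L 1\<^sub>A\<close> countably additive. This measure vanishes on null sets, so it has a density \<open>\<rho>\<close>, and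
  \<open>\<psi> = \<rho> / h\<close> has the required properties.
\<close>
lemma norming_weight:
  fixes N :: "'n::finite fnorm"
  assumes N: "ball_banach_function_space N" and ac: "absolutely_continuous_norm N"
    and hm[measurable]: "h \<in> borel_measurable borel" and h0: "\<And>x. 0 \<le> h x" and hfin: "N h < \<infinity>"
  obtains \<psi> where "dual_weight N 1 \<psi>" "(\<integral>\<^sup>+x. \<psi> x * ennreal (h x) \<partial>lborel) = N h"
proof -
  define V :: "(real ^ 'n \<Rightarrow> real) set" where
    "V = {s \<in> borel_measurable borel. \<exists>B. \<forall>x. \<bar>s x\<bar> \<le> B}"
  have Vm: "s \<in> borel_measurable borel" if "s \<in> V" for s using that by (simp add: V_def)
  have Vfin: "N (\<lambda>x. max (h x * s x) 0) < \<infinity>" if s: "s \<in> V" for s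
  proof -
    obtain B where B: "\<And>x. \<bar>s x\<bar> \<le> B" using s by (auto simp: V_def)
    have [measurable]: "s \<in> borel_measurable borel" using s by (rule Vm)
    have "0 \<le> B" using B[of 0] by linarith
    have "max (h x * s x) 0 \<le> B * h x" for x
    proof -
      have "s x * h x \<le> B * h x" using B[of x] h0 by (intro mult_right_mono) auto
      then show ?thesis using h0 \<open>0 \<le> B\<close> by (simp add: mult.commute)
    qed
    then have "N (\<lambda>x. max (h x * s x) 0) \<le> N (\<lambda>x. B * h x)"
      using h0 \<open>0 \<le> B\<close> by (intro bbfs_mono[OF N] AE_I2 borel_imp_Meas) auto
    also have "\<dots> < \<infinity>"
      using hfin by (subst bbfs_cmult[OF N borel_imp_Meas[OF hm]]) (auto simp: ennreal_mult_less_top)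
    finally show ?thesis .
  qed
  define p where "p s = enn2real (N (\<lambda>x. max (h x * s x) 0))" for s
  have pN: "ennreal (p s) = N (\<lambda>x. max (h x * s x) 0)" if "s \<in> V" for s
    using Vfin[OF that] by (simp add: p_def)
  have pge: "0 \<le> p s" for s by (simp add: p_def)
  have Vadd: "(\<lambda>x. s x + t x) \<in> V" if "s \<in> V" "t \<in> V" for s t
  proof -
    obtain B C where "\<And>x. \<bar>s x\<bar> \<le> B" "\<And>x. \<bar>t x\<bar> \<le> C" using \<open>s \<in> V\<close> \<open>t \<in> V\<close> by (auto simp: V_def)
    then have "\<bar>s x + t x\<bar> \<le> B + C" for x
      using abs_triangle_ineq[of "s x" "t x"] by (meson add_mono order_trans)
    then show ?thesis using that by (auto simp: V_def)
  qed
  have Vscale: "(\<lambda>x. c * s x) \<in> V" if "s \<in> V" for s c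
  proof -
    obtain B where "\<And>x. \<bar>s x\<bar> \<le> B" using \<open>s \<in> V\<close> by (auto simp: V_def)
    then have "\<bar>c * s x\<bar> \<le> \<bar>c\<bar> * B" for x by (simp add: abs_mult mult_left_mono)
    then show ?thesis using that by (auto simp: V_def)
  qed
  have V1: "indicator A \<in> V" if "A \<in> sets borel" for A
    using that by (auto simp: V_def indicator_def intro!: exI[of _ 1])
  have padd: "p (\<lambda>x. s x + t x) \<le> p s + p t" if st: "s \<in> V" "t \<in> V" for s t
  proof -
    note [measurable] = Vm[OF st(1)] Vm[OF st(2)]
    have "ennreal (p (\<lambda>x. s x + t x)) = N (\<lambda>x. max (h x * (s x + t x)) 0)" by (intro pN Vadd st)
    also have "\<dots> \<le> N (\<lambda>x. max (h x * s x) 0 + max (h x * t x) 0)"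
    proof (intro bbfs_mono[OF N] AE_I2 borel_imp_Meas)
      fix x
      show "\<bar>max (h x * (s x + t x)) 0\<bar> \<le> \<bar>max (h x * s x) 0 + max (h x * t x) 0\<bar>"
        unfolding distrib_left by simp
    qed auto
    also have "\<dots> \<le> N (\<lambda>x. max (h x * s x) 0) + N (\<lambda>x. max (h x * t x) 0)"
      by (intro bbfs_triangle[OF N] borel_imp_Meas) auto
    also have "\<dots> = ennreal (p s + p t)" using st by (simp add: pN[symmetric] pge)
    finally show ?thesis using pge by (simp add: ennreal_plus[symmetric] del: ennreal_plus)
  qed
  have pscale: "p (\<lambda>x. c * s x) = c * p s" if s: "s \<in> V" and c: "0 \<le> c" for s c
  proof -
    note [measurable] = Vm[OF s]
    have "(\<lambda>x. max (h x * (c * s x)) 0) = (\<lambda>x. c * max (h x * s x) 0)"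
      using c by (auto simp: max_def algebra_simps mult_le_0_iff zero_le_mult_iff fun_eq_iff)
    then have "N (\<lambda>x. max (h x * (c * s x)) 0) = ennreal \<bar>c\<bar> * N (\<lambda>x. max (h x * s x) 0)"
      using bbfs_cmult[OF N, of "\<lambda>x. max (h x * s x) 0" c] by (simp add: borel_imp_Meas)
    then show ?thesis using c by (simp add: p_def enn2real_mult)
  qed
  have one: "(\<lambda>x. 1) \<in> V" by (auto simp: V_def intro!: exI[of _ 1])
  obtain L where Ladd: "\<And>s t. s \<in> V \<Longrightarrow> t \<in> V \<Longrightarrow> L (\<lambda>x. s x + t x) = L s + L t"
    and Lscale: "\<And>s c. s \<in> V \<Longrightarrow> L (\<lambda>x. c * s x) = c * L s"
    and Lp: "\<And>s. s \<in> V \<Longrightarrow> L s \<le> p s" and L1: "L (\<lambda>x. 1) = p (\<lambda>x. 1)"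
    by (rule hahn_banach_function_space[of V p "\<lambda>x. 1", OF Vadd Vscale padd pscale one]) auto
  have Lpos: "0 \<le> L s" if s: "s \<in> V" and s0: "\<And>x. 0 \<le> s x" for s
  proof -
    have "L (\<lambda>x. (-1) * s x) \<le> p (\<lambda>x. (-1) * s x)" by (intro Lp Vscale s)
    moreover have "(\<lambda>x. max (h x * ((-1) * s x)) 0) = (\<lambda>x. 0)" using h0 s0 by (auto simp: max_def)
    then have "p (\<lambda>x. (-1) * s x) = 0" using bbfs_zero[OF N] by (simp add: p_def)
    ultimately show ?thesis using Lscale[OF s, of "-1"] by simp
  qed
  have LN: "ennreal (L s) \<le> N (\<lambda>x. h x * s x)" if s: "s \<in> V" and s0: "\<And>x. 0 \<le> s x" for s
  proof -
    have "(\<lambda>x. max (h x * s x) 0) = (\<lambda>x. h x * s x)" using h0 s0 by auto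
    then show ?thesis using Lp[OF s] pN[OF s] by (metis ennreal_leI)
  qed
  have Lsum: "(\<lambda>x. \<Sum>i\<in>I. s i x) \<in> V \<and> L (\<lambda>x. \<Sum>i\<in>I. s i x) = (\<Sum>i\<in>I. L (s i))"
    if "finite I" "\<And>i. i \<in> I \<Longrightarrow> s i \<in> V" for I :: "'i set" and s
    using that
  proof (induction I rule: finite_induct)
    case empty
    then show ?case using Lscale[OF one, of 0] Vscale[OF one, of 0] by simp
  next
    case (insert i I)
    then show ?case by (auto intro!: Vadd simp: Ladd)
  qed
  (* Disjoint unions: the indicators of the tails tend to 0, so the norms of h on the tails do as well. *)
  define \<nu> where "\<nu> A = ennreal (L (indicator A))" for A :: "(real ^ 'n) set"
  have ca: "countably_additive (sets borel) \<nu>"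
    unfolding countably_additive_def
  proof (intro allI impI)
    fix A :: "nat \<Rightarrow> (real ^ 'n) set"
    assume A: "range A \<subseteq> sets borel" "disjoint_family A" and "(\<Union>i. A i) \<in> sets borel"
    have Am[measurable]: "A i \<in> sets borel" for i using A by auto
    define R where "R k = (\<Union>i\<in>{k..}. A i)" for k
    have Rm[measurable]: "R k \<in> sets borel" for k unfolding R_def by measurable
    have split: "L (indicator (\<Union>i. A i)) = (\<Sum>i<k. L (indicator (A i))) + L (indicator (R k))" for k
    proof -
      have "indicator (\<Union>i. A i) x = (\<Sum>i<k. indicator (A i) x) + (indicator (R k) x::real)" for x
      proof (cases "\<exists>j. x \<in> A j")
        case False then show ?thesis by (auto simp: R_def)
      next
        case True
        then obtain j where j: "x \<in> A j" by auto
        have u: "x \<in> A i \<longleftrightarrow> i = j" for i using A(2) j by (auto simp: disjoint_family_on_def)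
        have "(\<Sum>i<k. indicator (A i) x :: real) = (\<Sum>i<k. if i = j then 1 else 0)"
          by (intro sum.cong) (auto simp: indicator_def u)
        then show ?thesis by (auto simp: R_def indicator_def u)
      qed
      then have "L (indicator (\<Union>i. A i)) = L (\<lambda>x. (\<Sum>i<k. indicator (A i) x) + indicator (R k) x)"
        by (intro arg_cong[where f = L]) (auto simp: fun_eq_iff)
      also have "\<dots> = (\<Sum>i<k. L (indicator (A i))) + L (indicator (R k))"
        using Lsum[of "{..<k}" "\<lambda>i. indicator (A i)"] V1 by (subst Ladd) auto
      finally show ?thesis .
    qed
    have "(\<lambda>k. N (\<lambda>x. h x * indicator (R k) x)) \<longlonglongrightarrow> 0"
    proof (rule acn_tendsto[OF ac])
      show "AE x in lebesgue. (\<lambda>k. indicator (R k) x :: real) \<longlonglongrightarrow> 0"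
      proof (rule AE_I2)
        fix x
        have "\<forall>\<^sub>F k in sequentially. x \<notin> R k"
        proof (cases "\<exists>j. x \<in> A j")
          case False then show ?thesis by (auto simp: R_def)
        next
          case True
          then obtain j where j: "x \<in> A j" by auto
          have u: "x \<in> A i \<longleftrightarrow> i = j" for i using A(2) j by (auto simp: disjoint_family_on_def)
          show ?thesis using eventually_gt_at_top[of j] by eventually_elim (auto simp: R_def u)
        qed
        then show "(\<lambda>k. indicator (R k) x :: real) \<longlonglongrightarrow> 0"
          by (intro tendsto_eventually) (auto elim: eventually_mono)
      qed
    qed (use hfin borel_imp_Meas[OF hm] in auto)
    then have "(\<lambda>k. ennreal (L (indicator (R k)))) \<longlonglongrightarrow> 0"
      by (rule tendsto_sandwich[OF _ _ tendsto_const, rotated 2])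
        (auto intro!: always_eventually LN V1)
    then have "(\<lambda>k. L (indicator (R k))) \<longlonglongrightarrow> 0"
      using Lpos V1 by (subst (asm) ennreal_0[symmetric], subst (asm) tendsto_ennreal_iff) (auto intro!: always_eventually)
    then have "(\<lambda>k. L (indicator (\<Union>i. A i)) - L (indicator (R k))) \<longlonglongrightarrow> L (indicator (\<Union>i. A i)) - 0"
      by (intro tendsto_intros)
    then have "(\<lambda>i. L (indicator (A i))) sums L (indicator (\<Union>i. A i))"
      unfolding sums_def diff_0_right
      by (rule Lim_transform_eventually) (intro always_eventually allI, metis add_diff_cancel_right' split)
    then show "(\<Sum>i. \<nu> (A i)) = \<nu> (\<Union>i. A i)"
      unfolding \<nu>_def using Lpos V1 by (intro suminf_ennreal_eq) auto
  qed
  define M where "M = measure_of (UNIV :: (real ^ 'n) set) (sets borel) \<nu>"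
  have sM[simp, measurable_cong]: "sets M = sets borel" unfolding M_def
    by (metis sets.sets_measure_of_eq space_borel)
  have spM[simp]: "space M = UNIV" using sets_eq_imp_space_eq[OF sM] by simp
  have eM: "emeasure M A = \<nu> A" if "A \<in> sets borel" for A
  proof (rule emeasure_measure_of[OF M_def])
    show "positive (sets M) \<nu>" using Lscale[OF one, of 0]
      by (auto simp: positive_def \<nu>_def indicator_def[abs_def])
  qed (use ca that in auto)

  have ac': "absolutely_continuous lborel M"
    unfolding absolutely_continuous_def
  proof
    fix A :: "(real ^ 'n) set" assume A: "A \<in> null_sets lborel"
    then have [measurable]: "A \<in> sets borel" by auto
    have "ennreal (L (indicator A)) \<le> N (\<lambda>x. h x * indicator A x)" by (intro LN V1) auto
    also have "\<dots> \<le> N (\<lambda>x. 0)"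
      using AE_not_in[OF A] by (intro bbfs_mono[OF N] borel_imp_Meas AE_completion) auto
    finally have "\<nu> A = 0" using bbfs_zero[OF N] by (simp add: \<nu>_def)
    then show "A \<in> null_sets M" by (auto simp: null_sets_def eM)
  qed
  obtain \<rho> where \<rho>[measurable]: "\<rho> \<in> borel_measurable borel" and dens: "density lborel \<rho> = M"
    using sigma_finite_measure.Radon_Nikodym[OF sigma_finite_lborel ac'] by auto
  have simple: "(\<integral>\<^sup>+x. \<rho> x * ennreal (s x) \<partial>lborel) = ennreal (L s)"
    if s: "simple_function borel s" and s0: "\<And>x. 0 \<le> s x" for s
  proof -
    have fin: "finite (range s)" using simple_functionD(1)[OF s] by simp
    have sm[measurable]: "s \<in> borel_measurable borel" using s by (rule borel_measurable_simple_function)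
    have Am[measurable]: "s -` {y} \<in> sets borel" for y using simple_functionD(2)[OF s, of "{y}"] by simp
    have rep: "s x = (\<Sum>y\<in>range s. y * indicator (s -` {y}) x)" for x
    proof -
      have "(\<Sum>y\<in>range s. y * indicator (s -` {y}) x) = (\<Sum>y\<in>range s. if y = s x then y else 0)"
        by (intro sum.cong) (auto simp: indicator_def)
      then show ?thesis using fin by simp
    qed
    have "(\<integral>\<^sup>+x. \<rho> x * ennreal (s x) \<partial>lborel) = (\<integral>\<^sup>+x. ennreal (s x) \<partial>M)"
      unfolding dens[symmetric] by (subst nn_integral_density) auto
    also have "\<dots> = (\<integral>\<^sup>+x. (\<Sum>y\<in>range s. ennreal y * indicator (s -` {y}) x) \<partial>M)"
    proof (rule nn_integral_cong)
      fix x
      have "ennreal (s x) = ennreal (\<Sum>y\<in>range s. y * indicator (s -` {y}) x)"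
        by (rule arg_cong[OF rep])
      also have "\<dots> = (\<Sum>y\<in>range s. ennreal (y * indicator (s -` {y}) x))"
        using s0 by (subst sum_ennreal) auto
      also have "\<dots> = (\<Sum>y\<in>range s. ennreal y * indicator (s -` {y}) x)"
        by (intro sum.cong) (auto simp: indicator_def)
      finally show "ennreal (s x) = \<dots>" .
    qed
    also have "\<dots> = (\<Sum>y\<in>range s. ennreal y * \<nu> (s -` {y}))"
      by (subst nn_integral_sum) (auto simp: eM nn_integral_cmult_indicator)
    also have "\<dots> = (\<Sum>y\<in>range s. ennreal (L (\<lambda>x. y * indicator (s -` {y}) x)))"
      using s0 by (intro sum.cong) (auto simp: \<nu>_def Lscale V1 ennreal_mult' )
    also have "\<dots> = ennreal (\<Sum>y\<in>range s. L (\<lambda>x. y * indicator (s -` {y}) x))"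
      using s0 by (intro sum_ennreal Lpos Vscale V1) auto
    also have "(\<Sum>y\<in>range s. L (\<lambda>x. y * indicator (s -` {y}) x)) = L (\<lambda>x. \<Sum>y\<in>range s. y * indicator (s -` {y}) x)"
      by (intro Lsum[THEN conjunct2, symmetric] fin Vscale V1) auto
    also have "\<dots> = L s" by (intro arg_cong[where f = L] ext rep[symmetric])
    finally show ?thesis .
  qed
  define \<psi> where "\<psi> x = (if h x > 0 then \<rho> x / ennreal (h x) else 0)" for x
  have \<psi>m[measurable]: "\<psi> \<in> borel_measurable borel" unfolding \<psi>_def by measurable
  have "(\<integral>\<^sup>+x. \<psi> x * ennreal \<bar>u x\<bar> \<partial>lborel) \<le> N u" if u: "u \<in> Meas" for u
  proof -
    obtain v0 where v0[measurable]: "v0 \<in> borel_measurable borel" and uv0: "AE x in lborel. u x = v0 x"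
      using completion_ex_borel_measurable_real[OF u] by auto
    define q where "q x = (if h x > 0 then \<bar>v0 x\<bar> / h x else 0)" for x
    have qm: "q \<in> borel_measurable borel" unfolding q_def by measurable
    have q0: "0 \<le> q x" for x by (simp add: q_def)
    obtain F where F: "\<And>i. simple_function borel (F i)" "incseq F" "\<And>i x. F i x < top"
      "\<And>x. (SUP i. F i x) = ennreal (q x)"
      using borel_measurable_implies_simple_function_sequence'[of "\<lambda>x. ennreal (q x)" borel] qm by auto
    define U where "U i x = enn2real (F i x)" for i x
    have FU: "F i x = ennreal (U i x)" for i x using F(3)[of i x] by (simp add: U_def)
    have U1: "simple_function borel (U i)" for i
      unfolding U_def using simple_function_compose1[OF F(1)] .
    have U2: "incseq U"
      unfolding U_def incseq_def le_fun_def
      using F(2,3) by (auto intro!: enn2real_mono simp: incseq_def le_fun_def)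
    have U3: "0 \<le> U i x" for i x by (simp add: U_def)
    have U4: "U i x \<le> q x" for i x
    proof -
      have "F i x \<le> ennreal (q x)" unfolding F(4)[symmetric] by (rule SUP_upper) auto
      then show ?thesis using q0 by (simp add: FU)
    qed
    have U5: "(\<lambda>i. U i x) \<longlonglongrightarrow> q x" for x
    proof -
      have "(\<lambda>i. F i x) \<longlonglongrightarrow> (SUP i. F i x)"
        using F(2) by (intro LIMSEQ_SUP) (auto simp: incseq_def le_fun_def)
      then have "(\<lambda>i. ennreal (U i x)) \<longlonglongrightarrow> ennreal (q x)" unfolding F(4) by (simp only: FU)
      then show ?thesis using q0 U3 by (subst (asm) tendsto_ennreal_iff) auto
    qed
    note U = U1 U2 U3 U4 U5
    have "(\<integral>\<^sup>+x. \<psi> x * ennreal \<bar>u x\<bar> \<partial>lborel) = (\<integral>\<^sup>+x. \<rho> x * ennreal (q x) \<partial>lborel)"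
    proof (rule nn_integral_cong_AE, use uv0 in eventually_elim)
      fix x assume "u x = v0 x"
      then show "\<psi> x * ennreal \<bar>u x\<bar> = \<rho> x * ennreal (q x)"
        by (simp add: \<psi>_def q_def ennreal_divide_times divide_ennreal)
    qed
    also have "\<dots> = (SUP i. (\<integral>\<^sup>+x. \<rho> x * ennreal (U i x) \<partial>lborel))"
    proof (subst nn_integral_monotone_convergence_SUP[symmetric])
      show "incseq (\<lambda>i x. \<rho> x * ennreal (U i x))"
        using U(2) by (auto simp: incseq_def le_fun_def intro!: mult_left_mono ennreal_leI)
      show "(\<lambda>x. \<rho> x * ennreal (U i x)) \<in> borel_measurable lborel" for i
        using borel_measurable_simple_function[OF U(1)[of i]] by simp
      show "(\<integral>\<^sup>+x. \<rho> x * ennreal (q x) \<partial>lborel) = (\<integral>\<^sup>+x. (SUP i. \<rho> x * ennreal (U i x)) \<partial>lborel)"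
      proof (rule nn_integral_cong)
        fix x
        have "(\<lambda>i. ennreal (U i x)) \<longlonglongrightarrow> (SUP i. ennreal (U i x))"
          using U(2) by (intro LIMSEQ_SUP) (auto simp: incseq_def le_fun_def intro!: ennreal_leI)
        moreover have "(\<lambda>i. ennreal (U i x)) \<longlonglongrightarrow> ennreal (q x)"
          using U(5) by (rule tendsto_ennrealI)
        ultimately have "ennreal (q x) = (SUP i. ennreal (U i x))" by (rule LIMSEQ_unique[rotated])
        then show "\<rho> x * ennreal (q x) = (SUP i. \<rho> x * ennreal (U i x))"
          by (simp add: SUP_mult_left_ennreal)
      qed
    qed
    also have "\<dots> \<le> N v0"
    proof (rule SUP_least)
      fix i
      have Um[measurable]: "U i \<in> borel_measurable borel" using borel_measurable_simple_function[OF U(1)] .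
      have "U i \<in> V"
      proof -
        have "finite (range (U i))" using simple_functionD(1)[OF U(1)[of i]] by simp
        then have "bdd_above (range (\<lambda>x. \<bar>U i x\<bar>))" 
          by (metis bdd_above_finite finite_imageI image_image)
        then show ?thesis by (auto simp: V_def bdd_above_def)
      qed
      have "(\<integral>\<^sup>+x. \<rho> x * ennreal (U i x) \<partial>lborel) = ennreal (L (U i))" by (intro simple U)
      also have "\<dots> \<le> N (\<lambda>x. h x * U i x)" by (intro LN U \<open>U i \<in> V\<close>)
      also have "\<dots> \<le> N v0"
      proof (intro bbfs_mono[OF N] borel_imp_Meas AE_I2)
        fix x
        have "h x * U i x \<le> h x * q x" using h0 U(4) by (intro mult_left_mono) auto
        also have "\<dots> \<le> \<bar>v0 x\<bar>" by (auto simp: q_def)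
        finally show "\<bar>h x * U i x\<bar> \<le> \<bar>v0 x\<bar>" using h0 U(3) by auto
      qed auto
      finally show "(\<integral>\<^sup>+x. \<rho> x * ennreal (U i x) \<partial>lborel) \<le> N v0" .
    qed
    also have "\<dots> \<le> N u"
      by (intro bbfs_mono[OF N u borel_imp_Meas[OF v0]]) (use uv0 in \<open>auto intro!: AE_completion elim: eventually_mono\<close>)
    finally show ?thesis .
  qed
  then have "dual_weight N 1 \<psi>" by (auto simp: dual_weight_def)
  moreover have "(\<integral>\<^sup>+x. \<psi> x * ennreal (h x) \<partial>lborel) = N h"
  proof (rule antisym)
    show "(\<integral>\<^sup>+x. \<psi> x * ennreal (h x) \<partial>lborel) \<le> N h"
      using \<open>dual_weight N 1 \<psi>\<close> h0 borel_imp_Meas[OF hm] unfolding dual_weight_def by force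
    have z: "{x. h x = 0} \<in> sets borel" by measurable
    have "ennreal (L (indicator {x. h x = 0})) \<le> N (\<lambda>x. h x * indicator {x. h x = 0} x)"
      by (intro LN V1 z) auto
    also have "(\<lambda>x. h x * indicator {x. h x = 0} x) = (\<lambda>x. 0)" by (auto simp: indicator_def)
    finally have "(\<integral>\<^sup>+x. \<rho> x * indicator {x. h x = 0} x \<partial>lborel) = 0"
      using simple[of "indicator {x. h x = 0}"] z bbfs_zero[OF N]
      by (auto simp: ennreal_indicator[symmetric])
    then have ae: "AE x in lborel. \<rho> x * indicator {x. h x = 0} x = 0"
      using z by (subst (asm) nn_integral_0_iff_AE) auto
    have "(\<lambda>x. max (h x * 1) 0) = h" using h0 by auto
    then have "N h = ennreal (L (\<lambda>x. 1))" using pN[OF one] L1 by simp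
    also have "\<dots> = (\<integral>\<^sup>+x. \<rho> x * ennreal 1 \<partial>lborel)" by (intro simple[symmetric]) auto
    also have "\<dots> \<le> (\<integral>\<^sup>+x. \<psi> x * ennreal (h x) \<partial>lborel)"
    proof (rule nn_integral_mono_AE, use ae in eventually_elim)
      fix x assume "\<rho> x * indicator {x. h x = 0} x = 0"
      then show "\<rho> x * ennreal 1 \<le> \<psi> x * ennreal (h x)"
        using h0[of x] by (cases "h x = 0") (auto simp: \<psi>_def ennreal_divide_times divide_ennreal)
    qed
    finally show "N h \<le> (\<integral>\<^sup>+x. \<psi> x * ennreal (h x) \<partial>lborel)" .
  qed
  ultimately show ?thesis by (rule that)
qed

section \<open>Norms of functions with values in the extended half-line\<close>

lemma Meas_enn2real_min:
  assumes "F \<in> borel_measurable lebesgue"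
  shows "(\<lambda>x. enn2real (min (F x) (of_nat k))) \<in> Meas"
  using assms by measurable

lemma Meas_ennreal_abs: "u \<in> Meas \<Longrightarrow> (\<lambda>x. ennreal \<bar>u x\<bar>) \<in> borel_measurable lebesgue"
  by measurable

lemma of_nat_less_top_ennreal [simp]: "of_nat k < (top :: ennreal)"
  by (simp add: ennreal_of_nat_eq_real_of_nat)

lemma ball_in_borel [measurable]: "ball a r \<in> sets borel"
  by simp

lemma enn2real_min_mono:
  "a \<le> b \<Longrightarrow> enn2real (min a (of_nat k)) \<le> enn2real (min b (of_nat k))"
  by (intro enn2real_mono) (auto simp: min.coboundedI1 min_less_iff_disj)

lemma ennreal_min_of_nat: "ennreal (enn2real (min a (of_nat k))) = min a (of_nat k)"
  by (rule ennreal_enn2real) (simp add: min_less_iff_disj)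

lemma ext_norm_mono:
  assumes N: "ball_banach_function_space N"
    and "F \<in> borel_measurable lebesgue" "G \<in> borel_measurable lebesgue"
    and le: "AE x in lebesgue. F x \<le> G x"
  shows "ext_norm N F \<le> ext_norm N G"
  unfolding ext_norm_def
proof (rule SUP_mono')
  fix k
  show "N (\<lambda>x. enn2real (min (F x) (of_nat k))) \<le> N (\<lambda>x. enn2real (min (G x) (of_nat k)))"
    using le by (intro bbfs_mono[OF N] Meas_enn2real_min assms)
      (auto elim!: eventually_mono intro!: enn2real_min_mono)
qed

lemma ext_norm_ennreal:
  assumes N: "ball_banach_function_space N" and h: "h \<in> Meas" and h0: "\<And>x. 0 \<le> h x"
  shows "ext_norm N (\<lambda>x. ennreal (h x)) = N h"
proof -
  have eq: "enn2real (min (ennreal (h x)) (of_nat k)) = min (h x) (real k)" for x k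
    using h0[of x] by (auto simp: ennreal_of_nat_eq_real_of_nat min_def)
  have lim: "(\<lambda>m. min (h x) (real m)) \<longlonglongrightarrow> h x" for x
  proof -
    obtain k where k: "h x \<le> real k" using real_arch_simple by blast
    have "\<forall>\<^sub>F m in sequentially. min (h x) (real m) = h x"
      using eventually_ge_at_top[of k] by eventually_elim (use k in auto)
    then show ?thesis by (rule tendsto_eventually)
  qed
  have ae: "AE x in lebesgue. 0 \<le> min (h x) (real 0) \<and> incseq (\<lambda>k. min (h x) (real k)) \<and>
      (\<lambda>k. min (h x) (real k)) \<longlonglongrightarrow> h x"
    using lim h0 by (auto simp: incseq_def)
  have m: "(\<lambda>x. min (h x) (real k)) \<in> Meas" for k using h by measurable
  note * = bbfs_monotone_convergence[OF N m h ae]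
  show ?thesis unfolding ext_norm_def eq using LIMSEQ_unique[OF LIMSEQ_SUP[OF *(1)] *(2)] .
qed

lemma ext_norm_fatou:
  assumes N: "ball_banach_function_space N"
    and Fm: "\<And>m::nat. F m \<in> borel_measurable lebesgue" and G: "G \<in> borel_measurable lebesgue"
    and A: "\<And>m. ext_norm N (F m) \<le> A"
    and le: "AE x in lebesgue. G x \<le> liminf (\<lambda>m. F m x)"
  shows "ext_norm N G \<le> A"
  unfolding ext_norm_def
proof (rule SUP_least)
  fix k :: nat
  note [measurable] = Fm G
  define H where "H m x = enn2real (min (INF j\<in>{m..}. F j x) (of_nat k))" for m x
  define L where "L x = enn2real (min (liminf (\<lambda>m. F m x)) (of_nat k))" for x
  have Hm: "H m \<in> Meas" for m unfolding H_def by measurable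
  have Lm: "L \<in> Meas" unfolding L_def by measurable
  have "N (\<lambda>x. enn2real (min (G x) (of_nat k))) \<le> N L"
    unfolding L_def using le by (intro bbfs_mono[OF N] Lm[unfolded L_def] Meas_enn2real_min G)
      (auto elim!: eventually_mono intro!: enn2real_min_mono)
  also have "N L \<le> A"
  proof (rule LIMSEQ_le_const2)
    show "(\<lambda>m. N (H m)) \<longlonglongrightarrow> N L"
    proof (rule bbfs_monotone_convergence(2)[OF N Hm Lm], intro AE_I2 conjI)
      fix x
      have inc: "incseq (\<lambda>m. INF j\<in>{m..}. F j x)"
        by (auto simp: incseq_def intro!: INF_superset_mono)
      show "0 \<le> H 0 x" by (simp add: H_def)
      show "incseq (\<lambda>m. H m x)"
        using inc by (auto simp: incseq_def H_def intro!: enn2real_min_mono)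
      have "(\<lambda>m. INF j\<in>{m..}. F j x) \<longlonglongrightarrow> liminf (\<lambda>m. F m x)"
        unfolding liminf_SUP_INF using LIMSEQ_SUP[OF inc] by simp
      then have "(\<lambda>m. min (INF j\<in>{m..}. F j x) (of_nat k)) \<longlonglongrightarrow> min (liminf (\<lambda>m. F m x)) (of_nat k)"
        by (intro tendsto_min tendsto_const)
      then show "(\<lambda>m. H m x) \<longlonglongrightarrow> L x"
        unfolding H_def L_def by (intro tendsto_enn2real) (simp_all add: ennreal_min_of_nat)
    qed
    have "N (H m) \<le> A" for m
    proof -
      have "N (H m) \<le> N (\<lambda>x. enn2real (min (F m x) (of_nat k)))"
        unfolding H_def
        by (intro bbfs_mono[OF N] Hm[unfolded H_def] Meas_enn2real_min Fm AE_I2)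
          (auto intro!: enn2real_min_mono INF_lower)
      also have "\<dots> \<le> ext_norm N (F m)" unfolding ext_norm_def by (rule SUP_upper) auto
      finally show ?thesis using A order_trans by blast
    qed
    then show "\<exists>M. \<forall>m\<ge>M. N (H m) \<le> A" by auto
  qed
  finally show "N (\<lambda>x. enn2real (min (G x) (of_nat k))) \<le> A" .
qed

lemma ext_norm_triangle:
  assumes N: "ball_banach_function_space N"
    and F: "F \<in> borel_measurable lebesgue" and G: "G \<in> borel_measurable lebesgue"
  shows "ext_norm N (\<lambda>x. F x + G x) \<le> ext_norm N F + ext_norm N G"
  unfolding ext_norm_def[of N "\<lambda>x. F x + G x"]
proof (rule SUP_least)
  fix k :: nat
  let ?F = "\<lambda>x. enn2real (min (F x) (of_nat k))" and ?G = "\<lambda>x. enn2real (min (G x) (of_nat k))"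
  have "enn2real (min (F x + G x) (of_nat k)) \<le> ?F x + ?G x" for x
  proof -
    have "min (F x + G x) (of_nat k) \<le> min (F x) (of_nat k) + min (G x) (of_nat k)"
    proof (cases "F x \<le> of_nat k \<and> G x \<le> of_nat k")
      case True
      then show ?thesis by (simp add: min.coboundedI1)
    next
      case False
      then have "of_nat k \<le> min (F x) (of_nat k) + min (G x) (of_nat k)"
        by (auto simp: min_def add_increasing add_increasing2)
      then show ?thesis by (rule min.coboundedI2)
    qed
    then have "enn2real (min (F x + G x) (of_nat k)) \<le> enn2real (min (F x) (of_nat k) + min (G x) (of_nat k))"
      by (intro enn2real_mono) (auto simp: min_less_iff_disj)
    also have "\<dots> = ?F x + ?G x" by (intro enn2real_plus) (auto simp: min_less_iff_disj)
    finally show ?thesis .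
  qed
  then have "N (\<lambda>x. enn2real (min (F x + G x) (of_nat k))) \<le> N (\<lambda>x. ?F x + ?G x)"
    using F G by (intro bbfs_mono[OF N] AE_I2) (auto intro!: borel_measurable_add Meas_enn2real_min)
  also have "\<dots> \<le> N ?F + N ?G" by (intro bbfs_triangle[OF N] Meas_enn2real_min F G)
  also have "\<dots> \<le> ext_norm N F + ext_norm N G"
    unfolding ext_norm_def by (intro add_mono SUP_upper) auto
  finally show "N (\<lambda>x. enn2real (min (F x + G x) (of_nat k))) \<le> ext_norm N F + ext_norm N G" .
qed

text \<open>
  The truncations of \<open>F\<close> need not have finite norm, so the norming weights are taken for truncations of \<open>F\<close> that are also
  restricted to balls; the norm of \<open>F\<close> is the limit of their norms.
\<close>
lemma ext_norm_le_by_duality: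
  fixes N :: "'n::finite fnorm"
  assumes N: "ball_banach_function_space N" and ac: "absolutely_continuous_norm N"
    and F[measurable]: "F \<in> borel_measurable borel"
    and le: "\<And>\<psi>. dual_weight N 1 \<psi> \<Longrightarrow> (\<integral>\<^sup>+x. \<psi> x * F x \<partial>lborel) \<le> A"
  shows "ext_norm N F \<le> A"
proof -
  define H where "H k x = enn2real (min (F x) (of_nat k)) * indicator (ball 0 (real k)) x" for k x
  have Hm[measurable]: "H k \<in> borel_measurable borel" for k unfolding H_def by measurable
  have H0: "0 \<le> H k x" for k x by (simp add: H_def)
  have HF: "ennreal (H k x) \<le> F x" for k x
    by (auto simp: H_def indicator_def ennreal_min_of_nat)
  have NH: "N (H k) \<le> A" for k
  proof -
    have "N (H k) \<le> N (\<lambda>x. real k * indicator (ball 0 (real k)) x)"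
    proof (intro bbfs_mono[OF N] borel_imp_Meas AE_I2)
      fix x
      have "enn2real (min (F x) (of_nat k)) \<le> enn2real (of_nat k)"
        by (intro enn2real_mono) auto
      then show "\<bar>H k x\<bar> \<le> \<bar>real k * indicator (ball 0 (real k)) x\<bar>"
        by (auto simp: H_def indicator_def ennreal_of_nat_eq_real_of_nat)
    qed auto
    also have "\<dots> < \<infinity>"
      using bbfs_ball_finite[OF N]
      by (subst bbfs_cmult[OF N]) (auto intro!: borel_imp_Meas simp: ennreal_mult_less_top)
    finally obtain \<psi> where \<psi>: "dual_weight N 1 \<psi>" "(\<integral>\<^sup>+x. \<psi> x * ennreal (H k x) \<partial>lborel) = N (H k)"
      using norming_weight[OF N ac Hm H0] by blast
    have "N (H k) \<le> (\<integral>\<^sup>+x. \<psi> x * F x \<partial>lborel)"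
      unfolding \<psi>(2)[symmetric] using HF by (intro nn_integral_mono mult_left_mono) auto
    also have "\<dots> \<le> A" by (rule le[OF \<psi>(1)])
    finally show ?thesis .
  qed
  show ?thesis
  proof (rule ext_norm_fatou[OF N])
    show "(\<lambda>x. ennreal (H k x)) \<in> borel_measurable lebesgue" for k
      by (intro measurable_completion) simp
    show "F \<in> borel_measurable lebesgue" by (intro measurable_completion) simp
    show "ext_norm N (\<lambda>x. ennreal (H k x)) \<le> A" for k
      using NH by (subst ext_norm_ennreal[OF N]) (auto intro: H0 borel_imp_Meas)
    have "(\<lambda>k. ennreal (H k x)) \<longlonglongrightarrow> F x" for x
    proof -
      have "(\<lambda>k. min (F x) (of_nat k)) \<longlonglongrightarrow> min (F x) top"
        by (intro tendsto_min tendsto_const) (simp add: of_nat_tendsto_top_ennreal)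
      moreover have "\<forall>\<^sub>F k in sequentially. norm x < real k"
        using reals_Archimedean2[of "norm x"] eventually_ge_at_top by (metis (no_types, lifting) eventually_sequentially of_nat_mono order_less_le_trans)
      then have "\<forall>\<^sub>F k in sequentially. min (F x) (of_nat k) = ennreal (H k x)"
        by eventually_elim (auto simp: H_def ennreal_min_of_nat)
      ultimately show ?thesis by (auto intro: Lim_transform_eventually)
    qed
    then show "AE x in lebesgue. F x \<le> liminf (\<lambda>m. ennreal (H m x))"
      by (intro AE_I2) (metis lim_imp_Liminf order_refl sequentially_bot)
  qed
qed

section \<open>Weights from the maximal operator\<close>

abbreviation dyadic :: "int \<Rightarrow> real" where
  "dyadic k \<equiv> 2 powr of_int k"

text \<open>
  The closed cube of side \<open>2\<^sup>k (q + 1)\<close> whose lower corner is the point \<open>2\<^sup>k m\<close> of the dyadic grid. There are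
  only countably many of them, so the maximal function over them is measurable, yet they comprise
  the dilates of dyadic cubes needed below.
\<close>
definition dyadic_box :: "int \<Rightarrow> ('n::finite \<Rightarrow> int) \<Rightarrow> nat \<Rightarrow> (real ^ 'n) set" where
  "dyadic_box k m q = cbox (\<chi> i. dyadic k * of_int (m i)) (\<chi> i. dyadic k * (of_int (m i) + real (Suc q)))"

lemma dyadic_box_borel [measurable]: "dyadic_box k m q \<in> sets borel"
  by (simp add: dyadic_box_def)

lemma emeasure_cube:
  fixes a :: "real ^ 'n::finite"
  assumes "0 \<le> l"
  shows "emeasure lborel (cbox a (a + (\<chi> i. l))) = ennreal (l ^ CARD('n))"
proof -
  have "a \<bullet> b \<le> (a + (\<chi> i. l)) \<bullet> b" if "b \<in> Basis" for b
    using assms that by (auto simp: Basis_vec_def inner_axis)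
  then have "emeasure lborel (cbox a (a + (\<chi> i. l))) = ennreal (\<Prod>b\<in>(Basis :: (real ^ 'n) set). (\<chi> i. l) \<bullet> b)"
    by (subst emeasure_lborel_cbox) simp_all
  also have "(\<Prod>b\<in>(Basis :: (real ^ 'n) set). (\<chi> i. l) \<bullet> b) = (\<Prod>b\<in>(Basis :: (real ^ 'n) set). l)"
    by (intro prod.cong) (auto simp: Basis_vec_def inner_axis)
  finally show ?thesis by simp
qed

lemma dyadic_box_eq:
  "dyadic_box k m q = cbox (\<chi> i. dyadic k * of_int (m i))
     ((\<chi> i. dyadic k * of_int (m i)) + (\<chi> i. dyadic k * real (Suc q)))"
  unfolding dyadic_box_def by (rule arg_cong[where f = "cbox _"]) (auto simp: vec_eq_iff algebra_simps)

lemma emeasure_dyadic_box: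
  fixes m :: "'n::finite \<Rightarrow> int"
  shows "emeasure lborel (dyadic_box k m q) = ennreal ((dyadic k * real (Suc q)) ^ CARD('n))"
  unfolding dyadic_box_eq by (rule emeasure_cube) simp

lemma dyadic_box_in_cubes: "dyadic_box k m q \<in> cubes"
  unfolding cubes_def dyadic_box_eq by (intro CollectI exI[of _ "\<chi> i. dyadic k * of_int (m i)"] exI[of _ "dyadic k * real (Suc q)"]) auto

text \<open>
  The \<open>A\<^sub>1\<close> condition, required at every point and not just almost everywhere; weights obtained from the
  maximal function over the countable family of cubes satisfy it in this form.
\<close>
definition dyadic_A1 :: "real \<Rightarrow> (real ^ 'n::finite \<Rightarrow> ennreal) \<Rightarrow> bool" where
  "dyadic_A1 K w \<longleftrightarrow> w \<in> borel_measurable borel \<and>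
     (\<forall>k m q. \<forall>x\<in>dyadic_box k m q.
        (\<integral>\<^sup>+y\<in>dyadic_box k m q. w y \<partial>lborel) \<le> ennreal K * emeasure lborel (dyadic_box k m q) * w x)"

definition dyadic_maximal :: "(real ^ 'n::finite \<Rightarrow> ennreal) \<Rightarrow> real ^ 'n \<Rightarrow> ennreal" where
  "dyadic_maximal g x = (SUP (k, m, q)\<in>UNIV.
     (\<integral>\<^sup>+y\<in>dyadic_box k m q. g y \<partial>lborel) / emeasure lborel (dyadic_box k m q) * indicator (dyadic_box k m q) x)"

lemma dyadic_maximal_measurable [measurable]: "dyadic_maximal g \<in> borel_measurable borel"
  unfolding dyadic_maximal_def by (intro borel_measurable_SUP) (auto split: prod.splits)

lemma dyadic_maximal_ge:
  assumes "x \<in> dyadic_box k m q"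
  shows "(\<integral>\<^sup>+y\<in>dyadic_box k m q. g y \<partial>lborel) \<le> emeasure lborel (dyadic_box k m q) * dyadic_maximal g x"
proof -
  let ?v = "emeasure lborel (dyadic_box k m q)" and ?I = "\<integral>\<^sup>+y\<in>dyadic_box k m q. g y \<partial>lborel"
  have v: "?v \<noteq> 0" "?v \<noteq> top" by (simp_all add: emeasure_dyadic_box)
  have "?I / ?v \<le> dyadic_maximal g x"
    unfolding dyadic_maximal_def
    by (rule SUP_upper2[of "(k, m, q)"]) (use assms in auto)
  then have "?v * (?I / ?v) \<le> ?v * dyadic_maximal g x" by (intro mult_left_mono) auto
  moreover have "?v * (?I / ?v) = ?I"
    using v by (simp add: ennreal_times_divide mult.commute[of ?v] ennreal_mult_divide_eq)
  ultimately show ?thesis by simp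
qed

lemma dual_weightD:
  assumes "dual_weight N c w" "u \<in> Meas"
  shows "(\<integral>\<^sup>+x. w x * ennreal \<bar>u x\<bar> \<partial>lborel) \<le> ennreal c * N u"
  using assms by (simp add: dual_weight_def)

text \<open>
  Indicators of balls have finite norm, so a dual weight has finite integral over each ball.
\<close>
lemma dual_weight_finite_AE:
  fixes N :: "'n::finite fnorm"
  assumes N: "ball_banach_function_space N" and w: "dual_weight N c w"
  shows "AE x in lborel. w x < \<infinity>"
proof -
  have [measurable]: "w \<in> borel_measurable borel" using w by (simp add: dual_weight_def)
  have "AE x in lborel. w x * indicator (ball 0 (real j)) x \<noteq> \<infinity>" for j :: nat
  proof (rule nn_integral_PInf_AE)
    have "(\<integral>\<^sup>+x. w x * indicator (ball 0 (real j)) x \<partial>lborel) =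
        (\<integral>\<^sup>+x. w x * ennreal \<bar>indicator (ball 0 (real j)) x\<bar> \<partial>lborel)"
      by (intro nn_integral_cong) (auto simp: indicator_def)
    also have "\<dots> \<le> ennreal c * N (indicator (ball 0 (real j)))"
      by (intro dual_weightD[OF w] borel_imp_Meas) simp
    also have "\<dots> < \<infinity>" using bbfs_ball_finite[OF N] by (simp add: ennreal_mult_less_top)
    finally show "(\<integral>\<^sup>+x. w x * indicator (ball 0 (real j)) x \<partial>lborel) \<noteq> \<infinity>" by simp
  qed simp
  then have "AE x in lborel. \<forall>j. w x * indicator (ball 0 (real j)) x \<noteq> \<infinity>"
    by (simp add: AE_all_countable)
  then show ?thesis
  proof eventually_elim
    case (elim x)
    obtain j :: nat where "norm x < real j" using reals_Archimedean2 by blast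
    then show ?case using elim[rule_format, of j] by (simp add: less_top)
  qed
qed

lemma dual_weight_dyadic_maximal:
  fixes N :: "'n::finite fnorm"
  assumes N: "ball_banach_function_space N" and C: "1 \<le> C" and c: "0 < c"
    and M: "\<And>f. f \<in> fspace (assoc_norm N) \<Longrightarrow> ext_norm (assoc_norm N) (HL_maximal f) \<le> ennreal C * assoc_norm N f"
    and w: "dual_weight N c w"
  shows "dual_weight N (C * c) (dyadic_maximal w)"
proof -
  have wm[measurable]: "w \<in> borel_measurable borel" using w by (simp add: dual_weight_def)
  define g where "g x = enn2real (w x)" for x
  have gm[measurable]: "g \<in> borel_measurable borel" unfolding g_def by measurable
  have wg: "AE x in lborel. w x = ennreal (g x)"
    using dual_weight_finite_AE[OF N w] by eventually_elim (simp add: g_def)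
  have ag: "assoc_norm N g \<le> ennreal c"
    unfolding assoc_norm_def
  proof (rule SUP_least)
    fix u assume "u \<in> {u \<in> Meas. N u = 1}"
    then have u: "u \<in> Meas" "N u = 1" by auto
    have "(\<integral>\<^sup>+x. ennreal \<bar>g x * u x\<bar> \<partial>lebesgue) = (\<integral>\<^sup>+x. w x * ennreal \<bar>u x\<bar> \<partial>lborel)"
      unfolding nn_integral_completion
      using wg by (intro nn_integral_cong_AE) (auto elim!: eventually_mono simp: abs_mult g_def ennreal_mult'')
    also have "\<dots> \<le> ennreal c * N u" using w u by (auto simp: dual_weight_def)
    finally show "(\<integral>\<^sup>+x. ennreal \<bar>g x * u x\<bar> \<partial>lebesgue) \<le> ennreal c" using u by simp
  qed
  then have "g \<in> fspace (assoc_norm N)"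
    using borel_imp_Meas[OF gm] by (auto simp: fspace_def intro: le_less_trans)
  from M[OF this] ag have HLb: "ext_norm (assoc_norm N) (HL_maximal g) \<le> ennreal (C * c)"
    using C c by (simp add: ennreal_mult) (meson mult_left_mono order_trans zero_le)
  have MH: "dyadic_maximal w x \<le> HL_maximal g x" for x
    unfolding dyadic_maximal_def
  proof (rule SUP_least, clarify)
    fix k q and m :: "'n \<Rightarrow> int"
    let ?Q = "dyadic_box k m q"
    have "(\<integral>\<^sup>+y\<in>?Q. w y \<partial>lborel) = (\<integral>\<^sup>+y\<in>?Q. ennreal \<bar>g y\<bar> \<partial>lebesgue)"
      unfolding nn_integral_completion
      using wg by (intro nn_integral_cong_AE) (auto elim!: eventually_mono simp: g_def)
    moreover have "emeasure lborel ?Q = emeasure lebesgue ?Q" by (simp add: emeasure_completion)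
    moreover have "(\<integral>\<^sup>+y\<in>?Q. ennreal \<bar>g y\<bar> \<partial>lebesgue) / emeasure lebesgue ?Q \<le> HL_maximal g x" if "x \<in> ?Q"
      unfolding HL_maximal_def using that dyadic_box_in_cubes[of k m q]
      by (intro SUP_upper2[of ?Q]) auto
    ultimately show "(\<integral>\<^sup>+y\<in>?Q. w y \<partial>lborel) / emeasure lborel ?Q * indicator ?Q x \<le> HL_maximal g x"
      by (auto simp: indicator_def)
  qed
  have unit: "(\<integral>\<^sup>+x. dyadic_maximal w x * ennreal \<bar>u x\<bar> \<partial>lebesgue) \<le> ennreal (C * c)"
    if u: "u \<in> Meas" "N u = 1" for u
  proof -
    let ?D = "\<lambda>k x. min (dyadic_maximal w x) (of_nat k)"
    have Dm: "?D k \<in> borel_measurable lebesgue" for k by (intro measurable_completion) measurable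
    have "(\<lambda>k. ?D k x) \<longlonglongrightarrow> min (dyadic_maximal w x) top" for x
      by (intro tendsto_min tendsto_const of_nat_tendsto_top_ennreal)
    moreover have incD: "incseq (\<lambda>k. ?D k x)" for x
      unfolding incseq_def by (intro allI impI min.mono) auto
    ultimately have sup: "(SUP k. ?D k x) = dyadic_maximal w x" for x
      using LIMSEQ_unique[OF LIMSEQ_SUP[OF incD]] by simp
    have "(\<integral>\<^sup>+x. dyadic_maximal w x * ennreal \<bar>u x\<bar> \<partial>lebesgue) =
        (\<integral>\<^sup>+x. (SUP k. ?D k x * ennreal \<bar>u x\<bar>) \<partial>lebesgue)"
      by (simp add: SUP_mult_right_ennreal[symmetric] sup)
    also have "\<dots> = (SUP k. \<integral>\<^sup>+x. ?D k x * ennreal \<bar>u x\<bar> \<partial>lebesgue)"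
      using incD u Dm by (intro nn_integral_monotone_convergence_SUP)
        (auto simp: incseq_def le_fun_def intro!: mult_right_mono)
    also have "\<dots> \<le> ext_norm (assoc_norm N) (HL_maximal g)"
      unfolding ext_norm_def
    proof (rule SUP_mono')
      fix k
      have "(\<integral>\<^sup>+x. ?D k x * ennreal \<bar>u x\<bar> \<partial>lebesgue)
        \<le> (\<integral>\<^sup>+x. ennreal \<bar>enn2real (min (HL_maximal g x) (of_nat k)) * u x\<bar> \<partial>lebesgue)"
        by (intro nn_integral_mono)
          (auto simp: abs_mult ennreal_mult'' ennreal_min_of_nat intro!: mult_right_mono min.mono MH)
      also have "\<dots> \<le> assoc_norm N (\<lambda>x. enn2real (min (HL_maximal g x) (of_nat k)))"
        unfolding assoc_norm_def using u by (intro SUP_upper) auto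
      finally show "(\<integral>\<^sup>+x. ?D k x * ennreal \<bar>u x\<bar> \<partial>lebesgue)
        \<le> assoc_norm N (\<lambda>x. enn2real (min (HL_maximal g x) (of_nat k)))" .
    qed
    finally show ?thesis using HLb by (rule order_trans)
  qed
  have "(\<integral>\<^sup>+x. dyadic_maximal w x * ennreal \<bar>u x\<bar> \<partial>lborel) \<le> ennreal (C * c) * N u" if u: "u \<in> Meas" for u
  proof (cases "N u = 0 \<or> N u = top")
    case True
    then show ?thesis
    proof
      assume "N u = 0"
      then have "AE x in lebesgue. u x = 0" by (rule bbfs_eq_0_AE[OF N u])
      then have "(\<integral>\<^sup>+x. dyadic_maximal w x * ennreal \<bar>u x\<bar> \<partial>lebesgue) = (\<integral>\<^sup>+x. 0 \<partial>(lebesgue :: (real ^ 'n) measure))"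
        by (intro nn_integral_cong_AE) (auto elim!: eventually_mono)
      then show ?thesis by (simp add: nn_integral_completion)
    next
      assume "N u = top"
      then show ?thesis using C c by (simp add: ennreal_mult_top)
    qed
  next
    case False
    define a where "a = enn2real (N u)"
    have a: "0 < a" "N u = ennreal a"
      using False by (auto simp: a_def enn2real_positive_iff less_top zero_less_iff_neq_zero)
    have DL: "dyadic_maximal w \<in> borel_measurable lebesgue" by (intro measurable_completion) simp
    have "N (\<lambda>x. (1 / a) * u x) = 1"
      using a by (subst bbfs_cmult[OF N u]) (simp add: ennreal_mult[symmetric])
    moreover have "(\<lambda>x. (1 / a) * u x) \<in> Meas" using u by measurable
    ultimately have "(\<integral>\<^sup>+x. dyadic_maximal w x * ennreal \<bar>(1 / a) * u x\<bar> \<partial>lebesgue) \<le> ennreal (C * c)"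
      by (intro unit)
    then have "ennreal a * (\<integral>\<^sup>+x. dyadic_maximal w x * ennreal \<bar>(1 / a) * u x\<bar> \<partial>lebesgue) \<le> ennreal a * ennreal (C * c)"
      by (intro mult_left_mono) auto
    also have "ennreal a * (\<integral>\<^sup>+x. dyadic_maximal w x * ennreal \<bar>(1 / a) * u x\<bar> \<partial>lebesgue) =
      (\<integral>\<^sup>+x. ennreal a * (dyadic_maximal w x * ennreal \<bar>(1 / a) * u x\<bar>) \<partial>lebesgue)"
      by (intro nn_integral_cmult[symmetric] borel_measurable_times_ennreal DL Meas_ennreal_abs
          borel_measurable_times borel_measurable_const u)
    also have "\<dots> = (\<integral>\<^sup>+x. dyadic_maximal w x * ennreal \<bar>u x\<bar> \<partial>lebesgue)"
    proof (rule nn_integral_cong)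
      fix x
      have "ennreal \<bar>u x\<bar> = ennreal a * ennreal \<bar>(1 / a) * u x\<bar>"
        using a by (simp add: ennreal_mult[symmetric] abs_mult)
      then show "ennreal a * (dyadic_maximal w x * ennreal \<bar>(1 / a) * u x\<bar>) = dyadic_maximal w x * ennreal \<bar>u x\<bar>"
        by (simp add: mult.left_commute)
    qed
    finally show ?thesis using a by (simp add: nn_integral_completion mult.commute)
  qed
  then show ?thesis by (simp add: dual_weight_def)
qed

text \<open>
  The weight is the series of \<open>(2 C)\<^sup>-\<^sup>j\<close> times the \<open>j\<close>-th iterate of the maximal function at \<open>\<psi>\<close>. It converges in the dual space because
  each iteration costs a factor \<open>C\<close>, and applying the maximal function to it shifts the series by one index, which costs a factor \<open>2 C\<close>.
\<close>
lemma rubio_de_francia: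
  fixes N :: "'n::finite fnorm"
  assumes N: "ball_banach_function_space N" and C: "1 \<le> C"
    and M: "\<And>f. f \<in> fspace (assoc_norm N) \<Longrightarrow> ext_norm (assoc_norm N) (HL_maximal f) \<le> ennreal C * assoc_norm N f"
    and psi: "dual_weight N 1 \<psi>"
  obtains w where "dyadic_A1 (2 * C) w" "dual_weight N 2 w" "\<And>x. \<psi> x \<le> w x"
proof -
  define W where "W j = (dyadic_maximal ^^ j) \<psi>" for j
  have W: "dual_weight N (C ^ j) (W j)" for j
    using C by (induction j) (auto simp: W_def psi intro!: dual_weight_dyadic_maximal[OF N C _ M])
  have Wm[measurable]: "W j \<in> borel_measurable borel" for j using W by (simp add: dual_weight_def)
  have WL: "W j \<in> borel_measurable lebesgue" for j by (intro measurable_completion) simp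
  define d where "d j = ennreal (1 / (2 * C) ^ j)" for j :: nat
  define w where "w x = (\<Sum>j. d j * W j x)" for x
  have wm[measurable]: "w \<in> borel_measurable borel" unfolding w_def by measurable
  have dS: "d j = ennreal (2 * C) * d (Suc j)" for j
    using C by (simp add: d_def ennreal_mult[symmetric] del: ennreal_1)
  show ?thesis
  proof (rule that)
    show "\<psi> x \<le> w x" for x
    proof -
      have "(\<Sum>j<1. d j * W j x) \<le> w x" unfolding w_def by (intro sum_le_suminf) auto
      then show ?thesis by (simp add: d_def W_def)
    qed
    show "dual_weight N 2 w"
      unfolding dual_weight_def
    proof (intro conjI ballI wm)
      fix u :: "real ^ 'n \<Rightarrow> real" assume u: "u \<in> Meas"
      have um: "(\<lambda>x. d j * W j x * ennreal \<bar>u x\<bar>) \<in> borel_measurable lebesgue" for j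
        by (intro borel_measurable_times_ennreal WL Meas_ennreal_abs u borel_measurable_const)
      have "(\<integral>\<^sup>+x. w x * ennreal \<bar>u x\<bar> \<partial>lborel) = (\<integral>\<^sup>+x. (\<Sum>j. d j * W j x * ennreal \<bar>u x\<bar>) \<partial>lebesgue)"
        unfolding w_def nn_integral_completion ennreal_suminf_multc ..
      also have "\<dots> = (\<Sum>j. \<integral>\<^sup>+x. d j * W j x * ennreal \<bar>u x\<bar> \<partial>lebesgue)"
        by (intro nn_integral_suminf um)
      also have "\<dots> \<le> (\<Sum>j. ennreal ((1/2) ^ j) * N u)"
      proof (intro suminf_le ballI allI)
        fix j
        have "(\<integral>\<^sup>+x. d j * W j x * ennreal \<bar>u x\<bar> \<partial>lebesgue) = (\<integral>\<^sup>+x. d j * (W j x * ennreal \<bar>u x\<bar>) \<partial>lebesgue)"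
          by (simp add: mult.assoc)
        also have "\<dots> = d j * (\<integral>\<^sup>+x. W j x * ennreal \<bar>u x\<bar> \<partial>lebesgue)"
          by (intro nn_integral_cmult borel_measurable_times_ennreal WL Meas_ennreal_abs u)
        also have "\<dots> \<le> d j * (ennreal (C ^ j) * N u)"
          using W[of j] u by (intro mult_left_mono) (auto simp: dual_weight_def nn_integral_completion)
        also have "\<dots> = ennreal ((1/2) ^ j) * N u"
          using C by (simp add: d_def mult.assoc[symmetric] ennreal_mult[symmetric] power_mult_distrib power_one_over)
        finally show "(\<integral>\<^sup>+x. d j * W j x * ennreal \<bar>u x\<bar> \<partial>lebesgue) \<le> ennreal ((1/2) ^ j) * N u" .
      qed auto
      also have "\<dots> = (\<Sum>j. ennreal ((1/2) ^ j)) * N u" by (rule ennreal_suminf_multc)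
      also have "(\<Sum>j. ennreal ((1/2) ^ j)) = ennreal 2"
        using geometric_sums[of "1/2::real"] by (intro suminf_ennreal_eq) auto
      finally show "(\<integral>\<^sup>+x. w x * ennreal \<bar>u x\<bar> \<partial>lborel) \<le> ennreal 2 * N u" .
    qed
    show "dyadic_A1 (2 * C) w"
      unfolding dyadic_A1_def
    proof (intro conjI allI ballI wm)
      fix k q and m :: "'n \<Rightarrow> int" and x assume x: "x \<in> dyadic_box k m q"
      let ?Q = "dyadic_box k m q" let ?v = "emeasure lborel ?Q"
      have "(\<integral>\<^sup>+y\<in>?Q. w y \<partial>lborel) = (\<integral>\<^sup>+y. (\<Sum>j. d j * (W j y * indicator ?Q y)) \<partial>lborel)"
        unfolding w_def by (intro nn_integral_cong) (simp add: ennreal_suminf_multc mult.assoc[symmetric])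
      also have "\<dots> = (\<Sum>j. d j * (\<integral>\<^sup>+y\<in>?Q. W j y \<partial>lborel))"
        by (subst nn_integral_suminf) (auto simp: nn_integral_cmult)
      also have "\<dots> \<le> (\<Sum>j. (ennreal (2 * C) * ?v) * (d (Suc j) * W (Suc j) x))"
      proof (intro suminf_le allI)
        fix j
        have "d j * (\<integral>\<^sup>+y\<in>?Q. W j y \<partial>lborel) \<le> d j * (?v * W (Suc j) x)"
          using dyadic_maximal_ge[OF x, of "W j"] by (intro mult_left_mono) (auto simp: W_def)
        then show "d j * (\<integral>\<^sup>+y\<in>?Q. W j y \<partial>lborel) \<le> (ennreal (2 * C) * ?v) * (d (Suc j) * W (Suc j) x)"
          unfolding dS[of j] by (simp add: ac_simps)
      qed auto
      also have "\<dots> = (ennreal (2 * C) * ?v) * (\<Sum>j. d (Suc j) * W (Suc j) x)"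
        by (rule ennreal_suminf_cmult)
      also have "\<dots> \<le> (ennreal (2 * C) * ?v) * w x"
      proof (intro mult_left_mono)
        have "w x = (\<Sum>j. d (j + 1) * W (j + 1) x) + (\<Sum>j<1. d j * W j x)"
          unfolding w_def by (rule suminf_offset) simp
        then show "(\<Sum>j. d (Suc j) * W (Suc j) x) \<le> w x" by (simp add: add_increasing2)
      qed auto
      finally show "(\<integral>\<^sup>+y\<in>?Q. w y \<partial>lborel) \<le> ennreal (2 * C) * ?v * w x" .
    qed
  qed
qed

section \<open>Oscillation on cubes\<close>

text \<open>
  A symmetric involution that permutes the standard basis preserves Lebesgue measure. It is applied to
  exchanges of some coordinates between two points.
\<close>
lemma lborel_basis_involution:
  fixes T :: "'a::euclidean_space \<Rightarrow> 'a"
  assumes Tm[measurable]: "T \<in> borel_measurable borel"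
    and adj: "\<And>x y. T x \<bullet> y = x \<bullet> T y" and inv: "\<And>x. T (T x) = x" and bas: "\<And>b. b \<in> Basis \<Longrightarrow> T b \<in> Basis"
  shows "distr lborel borel T = lborel"
proof (rule lborel_eqI[symmetric])
  fix l u :: 'a assume lu: "\<And>b. b \<in> Basis \<Longrightarrow> l \<bullet> b \<le> u \<bullet> b"
  have bij: "bij_betw T Basis Basis"
    by (rule bij_betw_byWitness[where f' = T]) (use inv bas in auto)
  have "T -` box l u = box (T l) (T u)"
  proof -
    have "(\<forall>b\<in>Basis. l \<bullet> b < T x \<bullet> b \<and> T x \<bullet> b < u \<bullet> b) \<longleftrightarrow>
        (\<forall>b\<in>Basis. T l \<bullet> b < x \<bullet> b \<and> x \<bullet> b < T u \<bullet> b)" for x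
      unfolding adj using bas inv by metis
    then show ?thesis by (auto simp: mem_box)
  qed
  then have "emeasure (distr lborel borel T) (box l u) = emeasure lborel (box (T l) (T u))"
    by (subst emeasure_distr) auto
  also have "\<dots> = ennreal (\<Prod>b\<in>Basis. (T u - T l) \<bullet> b)"
    using lu bas by (subst emeasure_lborel_box) (auto simp: adj)
  also have "(\<Prod>b\<in>Basis. (T u - T l) \<bullet> b) = (\<Prod>b\<in>Basis. (u - l) \<bullet> T b)"
    by (simp add: inner_diff_left adj)
  also have "\<dots> = (\<Prod>b\<in>Basis. (u - l) \<bullet> b)"
    by (rule prod.reindex_bij_betw[OF bij])
  finally show "emeasure (distr lborel borel T) (box l u) = ennreal (\<Prod>b\<in>Basis. (u - l) \<bullet> b)" .
qed simp

lemma nn_integral_basis_involution: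
  fixes T :: "'a::euclidean_space \<Rightarrow> 'a"
  assumes Tm[measurable]: "T \<in> borel_measurable borel"
    and "\<And>x y. T x \<bullet> y = x \<bullet> T y" "\<And>x. T (T x) = x" "\<And>b. b \<in> Basis \<Longrightarrow> T b \<in> Basis"
    and [measurable]: "h \<in> borel_measurable borel"
  shows "(\<integral>\<^sup>+x. h (T x) \<partial>lborel) = (\<integral>\<^sup>+x. h x \<partial>lborel)"
proof -
  have "(\<integral>\<^sup>+x. h x \<partial>lborel) = (\<integral>\<^sup>+x. h x \<partial>distr lborel borel T)"
    by (simp add: lborel_basis_involution[OF assms(1-4)])
  also have "\<dots> = (\<integral>\<^sup>+x. h (T x) \<partial>lborel)" by (intro nn_integral_distr) auto
  finally show ?thesis by simp
qed

lemma continuous_on_if_const: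
  "continuous_on S f \<Longrightarrow> continuous_on S g \<Longrightarrow> continuous_on S (\<lambda>x. if P then f x else g x)"
  by (cases P) auto

definition upd :: "real ^ 'n \<Rightarrow> 'n \<Rightarrow> real \<Rightarrow> real ^ 'n::finite" where
  "upd u i t = (\<chi> j. if j = i then t else u $ j)"

lemma upd_nth [simp]: "upd u i t $ j = (if j = i then t else u $ j)"
  by (simp add: upd_def)

lemma upd_measurable [measurable]:
  "(\<lambda>p. upd (fst p) i (snd p)) \<in> borel_measurable borel" for i :: "'n::finite"
  unfolding upd_def by (intro borel_measurable_continuous_onI continuous_on_vec_lambda continuous_on_if_const)
    (auto intro!: continuous_intros)

definition mix :: "'n set \<Rightarrow> real ^ 'n \<Rightarrow> real ^ 'n \<Rightarrow> real ^ 'n::finite" where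
  "mix A u v = (\<chi> j. if j \<in> A then v $ j else u $ j)"

lemma mix_nth [simp]: "mix A u v $ j = (if j \<in> A then v $ j else u $ j)"
  by (simp add: mix_def)

lemma mix_measurable [measurable]:
  "(\<lambda>p. mix A (fst p) (snd p)) \<in> borel_measurable borel" for A :: "'n::finite set"
  unfolding mix_def by (intro borel_measurable_continuous_onI continuous_on_vec_lambda continuous_on_if_const)
    (auto intro!: continuous_intros)

text \<open>
  Averaging over the cube and then over the line through the point in direction \<open>i\<close> is the same as averaging over the cube: the map
  that exchanges the \<open>i\<close>-th coordinate of \<open>u\<close> with \<open>t\<close> preserves the product measure.
\<close>
lemma nn_integral_upd:
  fixes h :: "real ^ 'n::finite \<Rightarrow> ennreal"
  assumes [measurable]: "h \<in> borel_measurable borel" and L: "0 \<le> L"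
  shows "(\<integral>\<^sup>+u\<in>cbox a (a + (\<chi> i. L)). (\<integral>\<^sup>+t\<in>{a$i..a$i+L}. h (upd u i t) \<partial>lborel) \<partial>lborel) =
    ennreal L * (\<integral>\<^sup>+u\<in>cbox a (a + (\<chi> i. L)). h u \<partial>lborel)"
proof -
  let ?S = "cbox a (a + (\<chi> i. L))" and ?I = "{a$i..a$i+L}"
  define T where "T p = (upd (fst p) i (snd p), fst p $ i)" for p :: "(real ^ 'n) \<times> real"
  have Tm: "T \<in> borel_measurable borel"
    unfolding T_def borel_prod[symmetric]
    by (intro measurable_Pair) (auto simp: borel_prod intro!: borel_measurable_continuous_onI continuous_intros)
  define \<phi> where "\<phi> p = indicator ?S (fst p) * indicator ?I (snd p) * h (fst p)" for p :: "(real ^ 'n) \<times> real"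
  have fm: "fst \<in> borel_measurable (borel :: ((real ^ 'n) \<times> real) measure)" "snd \<in> borel_measurable (borel :: ((real ^ 'n) \<times> real) measure)"
    by (auto intro!: borel_measurable_continuous_onI continuous_intros)
  note [measurable] = fm Tm
  have \<phi>m[measurable]: "\<phi> \<in> borel_measurable borel" unfolding \<phi>_def by measurable
  have sw: "indicator ?S u * indicator ?I t = (indicator ?S (upd u i t) * indicator ?I (u $ i) :: ennreal)" for u t
  proof -
    have "u \<in> ?S \<and> t \<in> ?I \<longleftrightarrow> upd u i t \<in> ?S \<and> u $ i \<in> ?I"
      by (auto simp: mem_box_cart)
    then show ?thesis by (auto simp: indicator_def)
  qed
  have "(\<integral>\<^sup>+u\<in>?S. (\<integral>\<^sup>+t\<in>?I. h (upd u i t) \<partial>lborel) \<partial>lborel) =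
      (\<integral>\<^sup>+u. (\<integral>\<^sup>+t. \<phi> (T (u, t)) \<partial>lborel) \<partial>lborel)"
  proof (rule nn_integral_cong)
    fix u :: "real ^ 'n"
    have [measurable]: "(\<lambda>t. upd u i t) \<in> borel_measurable borel"
      unfolding upd_def by (intro borel_measurable_continuous_onI continuous_on_vec_lambda continuous_on_if_const) (auto intro!: continuous_intros)
    have "(\<integral>\<^sup>+t\<in>?I. h (upd u i t) \<partial>lborel) * indicator ?S u = (\<integral>\<^sup>+t. h (upd u i t) * indicator ?I t * indicator ?S u \<partial>lborel)"
      by (rule nn_integral_multc[symmetric]) measurable
    also have "\<dots> = (\<integral>\<^sup>+t. \<phi> (T (u, t)) \<partial>lborel)"
    proof (rule nn_integral_cong)
      fix t
      have "\<phi> (T (u, t)) = (indicator ?S (upd u i t) * indicator ?I (u $ i)) * h (upd u i t)"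
        by (simp add: \<phi>_def T_def del: upd_nth)
      also have "\<dots> = (indicator ?S u * indicator ?I t) * h (upd u i t)" 
        by (rule arg_cong[where f = "\<lambda>z. z * h (upd u i t)", OF sw[symmetric]])
      finally have "\<phi> (T (u, t)) = (indicator ?S u * indicator ?I t) * h (upd u i t)" .
      then show "h (upd u i t) * indicator ?I t * indicator ?S u = \<phi> (T (u, t))"
        by (simp only: mult.commute mult.left_commute mult.assoc)
    qed
    finally show "(\<integral>\<^sup>+t\<in>?I. h (upd u i t) \<partial>lborel) * indicator ?S u = (\<integral>\<^sup>+t. \<phi> (T (u, t)) \<partial>lborel)" .
  qed
  also have "\<dots> = (\<integral>\<^sup>+p. \<phi> (T p) \<partial>(lborel \<Otimes>\<^sub>M lborel))"
    by (intro lborel.nn_integral_fst) (simp add: lborel_prod)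
  also have "\<dots> = (\<integral>\<^sup>+p. \<phi> p \<partial>lborel)"
    unfolding lborel_prod
  proof (rule nn_integral_basis_involution)
    show "T x \<bullet> y = x \<bullet> T y" for x y
    proof -
      have "(\<Sum>j\<in>UNIV. upd (fst x) i (snd x) $ j * fst y $ j) = snd x * fst y $ i + (\<Sum>j\<in>UNIV-{i}. fst x $ j * fst y $ j)"
        by (subst sum.remove[of _ i]) (auto intro!: sum.cong)
      moreover have "(\<Sum>j\<in>UNIV. fst x $ j * upd (fst y) i (snd y) $ j) = fst x $ i * snd y + (\<Sum>j\<in>UNIV-{i}. fst x $ j * fst y $ j)"
        by (subst sum.remove[of _ i]) (auto intro!: sum.cong)
      ultimately show ?thesis by (simp add: T_def inner_prod_def inner_vec_def del: upd_nth)
    qed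
    show "T (T x) = x" for x by (auto simp: T_def prod_eq_iff vec_eq_iff)
    show "T b \<in> Basis" if b: "b \<in> Basis" for b
    proof -
      have ax: "upd (axis j 1) i 0 = (if j = i then 0 else axis j 1)" "upd 0 i 1 = axis i 1" for j
        by (auto simp: vec_eq_iff axis_def)
      have B: "(axis j 1, 0) \<in> (Basis :: ((real ^ 'n) \<times> real) set)" "(0, 1) \<in> (Basis :: ((real ^ 'n) \<times> real) set)" for j
        by (auto simp: Basis_prod_def Basis_vec_def image_iff)
      from b consider j where "b = (axis j 1, 0)" | "b = (0, 1)" by (auto simp: Basis_prod_def Basis_vec_def)
      then show ?thesis
      proof cases
        case (1 j)
        have "axis j (1::real) $ i = (if j = i then 1 else 0)" by (simp add: axis_def)
        then show ?thesis using B(1)[of j] B(2) by (simp add: 1 T_def ax)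
      next
        case 2
        then show ?thesis using B(1)[of i] by (simp add: T_def ax)
      qed
    qed
  qed (use Tm in auto)
  also have "\<dots> = (\<integral>\<^sup>+u. (\<integral>\<^sup>+t. \<phi> (u, t) \<partial>lborel) \<partial>lborel)"
    unfolding lborel_prod[symmetric] by (intro lborel.nn_integral_fst[symmetric]) (simp add: lborel_prod)
  also have "\<dots> = (\<integral>\<^sup>+u. ennreal L * (h u * indicator ?S u) \<partial>lborel)"
  proof (rule nn_integral_cong)
    fix u
    have "(\<integral>\<^sup>+t. \<phi> (u, t) \<partial>lborel) = (\<integral>\<^sup>+t. (indicator ?S u * h u) * indicator ?I t \<partial>lborel)"
      by (intro nn_integral_cong) (simp add: \<phi>_def ac_simps)
    also have "\<dots> = indicator ?S u * h u * ennreal L"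
      using L by (subst nn_integral_cmult_indicator) auto
    finally show "(\<integral>\<^sup>+t. \<phi> (u, t) \<partial>lborel) = ennreal L * (h u * indicator ?S u)" by (simp add: ac_simps)
  qed
  also have "\<dots> = ennreal L * (\<integral>\<^sup>+u\<in>?S. h u \<partial>lborel)" by (rule nn_integral_cmult) measurable
  finally show ?thesis .
qed

text \<open>
  Exchanging the coordinates in \<open>A\<close> between \<open>u\<close> and \<open>v\<close> preserves the product measure and the product of the cube
  with itself. So the mixed point is distributed uniformly over the cube, just as \<open>u\<close> is.
\<close>
lemma emeasure_mix:
  fixes B S :: "(real ^ 'n::finite) set"
  assumes [measurable]: "B \<in> sets borel"
    and BS: "B \<subseteq> cbox a b"
  shows "emeasure (lborel \<Otimes>\<^sub>M lborel) {(u, v). u \<in> cbox a b \<and> v \<in> cbox a b \<and> mix A u v \<in> B} =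
    emeasure lborel B * emeasure lborel (cbox a b)"
proof -
  let ?S = "cbox a b"
  define T where "T p = (mix A (fst p) (snd p), mix A (snd p) (fst p))" for p :: "(real ^ 'n) \<times> (real ^ 'n)"
  have Tm: "T \<in> borel_measurable borel"
    unfolding T_def mix_def by (intro borel_measurable_continuous_onI continuous_on_Pair continuous_on_vec_lambda continuous_on_if_const)
      (auto intro!: continuous_intros)
  have eq: "{(u, v). u \<in> ?S \<and> v \<in> ?S \<and> mix A u v \<in> B} = T -` (B \<times> ?S)"
  proof -
    have "u \<in> ?S \<and> v \<in> ?S \<longleftrightarrow> mix A u v \<in> ?S \<and> mix A v u \<in> ?S" for u v
      by (auto simp: mem_box_cart)
    then have "u \<in> ?S \<and> v \<in> ?S \<and> mix A u v \<in> B \<longleftrightarrow> mix A u v \<in> B \<and> mix A v u \<in> ?S" for u v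
      using BS by blast
    then show ?thesis unfolding T_def by auto
  qed
  have "emeasure (lborel \<Otimes>\<^sub>M lborel) {(u, v). u \<in> ?S \<and> v \<in> ?S \<and> mix A u v \<in> B} = emeasure (distr lborel borel T) (B \<times> ?S)"
  proof -
    have "B \<times> ?S \<in> sets (borel :: ((real ^ 'n) \<times> (real ^ 'n)) measure)"
      unfolding borel_prod[symmetric] by auto
    then show ?thesis unfolding eq lborel_prod using Tm by (subst emeasure_distr) auto
  qed
  also have "distr lborel borel T = lborel"
  proof (rule lborel_basis_involution[OF Tm])
    show "T x \<bullet> y = x \<bullet> T y" for x y
      by (auto simp: T_def inner_prod_def inner_vec_def sum.distrib[symmetric] intro!: sum.cong)
    show "T (T x) = x" for x by (auto simp: T_def prod_eq_iff vec_eq_iff)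
    show "T b \<in> Basis" if "b \<in> Basis" for b
    proof -
      have ax: "mix A (axis j 1) 0 = (if j \<in> A then 0 else axis j 1)" "mix A 0 (axis j 1) = (if j \<in> A then axis j 1 else 0)" for j
        by (auto simp: vec_eq_iff axis_def)
      have B: "(axis j 1, 0) \<in> (Basis :: ((real ^ 'n) \<times> (real ^ 'n)) set)"
        "(0, axis j 1) \<in> (Basis :: ((real ^ 'n) \<times> (real ^ 'n)) set)" for j
        by (auto simp: Basis_prod_def Basis_vec_def image_iff)
      from that consider j where "b = (axis j 1, 0)" | j where "b = (0, axis j 1)"
        by (auto simp: Basis_prod_def Basis_vec_def)
      then show ?thesis using B by cases (auto simp: T_def ax)
    qed
  qed
  also have "emeasure lborel (B \<times> ?S) = emeasure lborel B * emeasure lborel ?S"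
    unfolding lborel_prod[symmetric] by (intro lborel.emeasure_pair_measure_Times) auto
  finally show ?thesis .
qed

text \<open>
  Besides continuity, the only regularity that is used is that the variation of \<open>f\<close> along each segment parallel to a coordinate axis
  is bounded by the integral of \<open>G\<close> over the segment, for every such segment.
\<close>
definition axis_upper_gradient :: "(real ^ 'n::finite \<Rightarrow> complex) \<Rightarrow> (real ^ 'n \<Rightarrow> ennreal) \<Rightarrow> bool" where
  "axis_upper_gradient f G \<longleftrightarrow> continuous_on UNIV f \<and> G \<in> borel_measurable borel \<and>
     (\<forall>u i t. ennreal (norm (f (upd u i t) - f u)) \<le>
        (\<integral>\<^sup>+s\<in>{min t (u $ i)..max t (u $ i)}. G (upd u i s) \<partial>lborel))"

definition osc_set :: "(real ^ 'n::finite \<Rightarrow> complex) \<Rightarrow> real \<Rightarrow> (real ^ 'n) set \<Rightarrow> ((real ^ 'n) \<times> (real ^ 'n)) set" where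
  "osc_set f \<tau> S = {(u, v). u \<in> S \<and> v \<in> S \<and> norm (f u - f v) > \<tau>}"

lemma emeasure_line_cylinder:
  fixes a b :: "real ^ 'n::finite"
  assumes "0 \<le> L" "0 \<le> l"
  shows "emeasure lborel {u \<in> cbox a (a + (\<chi> i. L)). \<forall>j. j \<noteq> i \<longrightarrow> b $ j \<le> u $ j \<and> u $ j \<le> b $ j + l}
    \<le> ennreal (L * l ^ (CARD('n) - 1))"
proof -
  let ?l = "\<chi> j. if j = i then a $ j else b $ j" and ?u = "\<chi> j. if j = i then a $ j + L else b $ j + l"
  have "emeasure lborel {u \<in> cbox a (a + (\<chi> i. L)). \<forall>j. j \<noteq> i \<longrightarrow> b $ j \<le> u $ j \<and> u $ j \<le> b $ j + l}
    \<le> emeasure lborel (cbox ?l ?u)"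
    by (intro emeasure_mono) (auto simp: mem_box_cart)
  also have "emeasure lborel (cbox ?l ?u) = ennreal (\<Prod>c\<in>Basis. (?u - ?l) \<bullet> c)"
    using assms by (intro emeasure_lborel_cbox) (auto simp: Basis_vec_def inner_axis)
  also have "(\<Prod>c\<in>Basis. (?u - ?l) \<bullet> c) = (\<Prod>j\<in>UNIV. if j = i then L else l)"
  proof -
    have B: "(Basis :: (real ^ 'n) set) = range (\<lambda>j. axis j 1)" by (auto simp: Basis_vec_def)
    have inj: "inj (\<lambda>j :: 'n. axis j (1::real))" by (auto simp: inj_on_def axis_eq_axis)
    show ?thesis unfolding B by (subst prod.reindex[OF inj]) (auto simp: inner_axis intro!: prod.cong)
  qed
  also have "\<dots> = L * l ^ (CARD('n) - 1)"
    by (subst prod.remove[of _ i]) (auto simp: card_Diff_singleton)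
  finally show ?thesis .
qed

text \<open>
  Two points of the cube are joined by a path that changes one coordinate at a time. A path along lines
  that avoid the cubes in \<open>P\<close> and carry a small integral of \<open>G\<close> changes \<open>f\<close> by at most \<open>\<tau>\<close>. The lines meeting some
  cube of side \<open>l\<close> fill a set of measure \<open>L l\<^sup>n\<^sup>-\<^sup>1\<close>; this is the reason why the content with exponent \<open>n - 1\<close> of the cubes in \<open>P\<close>
  matters. The lines with a large integral are few by the inequality of Markov. As intermediate points of the path of a random pair
  are again uniformly distributed, few pairs have a bad path.
\<close>
lemma oscillation_of_good_lines:
  fixes a :: "real ^ 'n::finite" and b :: "'p \<Rightarrow> real ^ 'n" and l :: "'p \<Rightarrow> real"
  assumes ug: "axis_upper_gradient f G" and L: "0 < L" and \<tau>: "0 < \<tau>" and P: "finite P"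
    and l: "\<And>p. p \<in> P \<Longrightarrow> 0 \<le> l p" and c: "0 \<le> c1" "0 \<le> c2"
    and small: "(\<Sum>p\<in>P. l p ^ (CARD('n) - 1)) \<le> c1 * L ^ (CARD('n) - 1)"
    and int: "(\<integral>\<^sup>+x\<in>cbox a (a + (\<chi> i. L)) - (\<Union>p\<in>P. cbox (b p) (b p + (\<chi> i. l p))). G x \<partial>lborel)
      \<le> ennreal (c2 * \<tau> * L ^ (CARD('n) - 1))"
  shows "emeasure (lborel \<Otimes>\<^sub>M lborel) (osc_set f \<tau> (cbox a (a + (\<chi> i. L))))
    \<le> ennreal (real CARD('n) * (c1 + real CARD('n) * c2) * L ^ CARD('n)) * emeasure lborel (cbox a (a + (\<chi> i. L)))"
proof -
  let ?n = "CARD('n)" and ?S = "cbox a (a + (\<chi> i. L))" and ?U = "\<Union>p\<in>P. cbox (b p) (b p + (\<chi> i. l p))"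
  let ?m = "lborel \<Otimes>\<^sub>M lborel :: ((real ^ 'n) \<times> (real ^ 'n)) measure"
  have cf: "continuous_on UNIV f" and Gm[measurable]: "G \<in> borel_measurable borel"
    using ug by (auto simp: axis_upper_gradient_def)
  have fm[measurable]: "f \<in> borel_measurable borel" using cf by (rule borel_measurable_continuous_onI)
  have n1: "?n \<ge> 1" by (simp add: Suc_leI)
  have LL: "L * L ^ (?n - 1) = L ^ ?n" using n1 by (metis power_eq_if not_one_le_zero)
  have Um[measurable]: "?U \<in> sets borel" using P by auto
  define h where "h x = G x * indicator (- ?U) x" for x
  have hm[measurable]: "h \<in> borel_measurable borel" unfolding h_def by measurable
  define H where "H i u = (\<integral>\<^sup>+t\<in>{a$i..a$i+L}. h (upd u i t) \<partial>lborel)" for i and u :: "real ^ 'n"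
  have Hm[measurable]: "H i \<in> borel_measurable borel" for i
  proof -
    have [measurable]: "(\<lambda>x. upd (fst x) i (snd x)) \<in> borel \<Otimes>\<^sub>M lborel \<rightarrow>\<^sub>M borel"
      using upd_measurable[of i] unfolding borel_prod[symmetric] by (simp cong: measurable_cong_sets)
    show ?thesis unfolding H_def by (intro lborel.borel_measurable_nn_integral) (simp add: case_prod_beta)
  qed
  (* The points whose line in direction i is bad. *)
  define B where "B i = {u \<in> ?S. H i u \<ge> ennreal (\<tau> / ?n)} \<union>
      (\<Union>p\<in>P. {u \<in> ?S. \<forall>j. j \<noteq> i \<longrightarrow> b p $ j \<le> u $ j \<and> u $ j \<le> b p $ j + l p})" for i
  have Cm[measurable]: "{u \<in> ?S. \<forall>j. j \<noteq> i \<longrightarrow> b p $ j \<le> u $ j \<and> u $ j \<le> b p $ j + l p} \<in> sets borel" for i p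
    by measurable
  have Bm[measurable]: "B i \<in> sets borel" for i
    unfolding B_def using P by (intro sets.Un sets.finite_UN Cm) auto
  have BS: "B i \<subseteq> ?S" for i by (auto simp: B_def)
  have eB: "emeasure lborel (B i) \<le> ennreal ((c1 + ?n * c2) * L ^ ?n)" for i
  proof -
    have "(\<integral>\<^sup>+u\<in>?S. H i u \<partial>lborel) = ennreal L * (\<integral>\<^sup>+u\<in>?S. h u \<partial>lborel)"
      unfolding H_def using L by (intro nn_integral_upd) auto
    also have "(\<integral>\<^sup>+u\<in>?S. h u \<partial>lborel) = (\<integral>\<^sup>+x\<in>?S - ?U. G x \<partial>lborel)"
      by (intro nn_integral_cong) (auto simp: h_def indicator_def)
    also have "ennreal L * \<dots> \<le> ennreal L * ennreal (c2 * \<tau> * L ^ (?n - 1))"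
      using int by (intro mult_left_mono) auto
    also have "\<dots> = ennreal (c2 * \<tau> * L ^ ?n)"
      using L \<tau> c LL by (simp add: ennreal_mult[symmetric] mult.left_commute)
    finally have i1: "(\<integral>\<^sup>+u\<in>?S. H i u \<partial>lborel) \<le> ennreal (c2 * \<tau> * L ^ ?n)" .
    have "emeasure lborel {u \<in> ?S. H i u \<ge> ennreal (\<tau> / ?n)}
      \<le> emeasure lborel {u \<in> ?S. 1 \<le> ennreal (?n / \<tau>) * H i u}"
    proof (intro emeasure_mono subsetI CollectI conjI)
      fix u assume u: "u \<in> {u \<in> ?S. H i u \<ge> ennreal (\<tau> / ?n)}"
      have "1 = ennreal (?n / \<tau>) * ennreal (\<tau> / ?n)" using \<tau> by (simp add: ennreal_mult[symmetric])
      also have "\<dots> \<le> ennreal (?n / \<tau>) * H i u" using u by (intro mult_left_mono) auto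
      finally show "1 \<le> ennreal (?n / \<tau>) * H i u" .
    qed auto
    also have "\<dots> \<le> ennreal (?n / \<tau>) * (\<integral>\<^sup>+u\<in>?S. H i u \<partial>lborel)"
      by (rule nn_integral_Markov_inequality) auto
    also have "\<dots> \<le> ennreal (?n / \<tau>) * ennreal (c2 * \<tau> * L ^ ?n)" by (intro mult_left_mono i1) auto
    also have "\<dots> = ennreal (?n * c2 * L ^ ?n)" using \<tau> c L by (simp add: ennreal_mult[symmetric])
    finally have e1: "emeasure lborel {u \<in> ?S. H i u \<ge> ennreal (\<tau> / ?n)} \<le> ennreal (?n * c2 * L ^ ?n)" .
    have "emeasure lborel (\<Union>p\<in>P. {u \<in> ?S. \<forall>j. j \<noteq> i \<longrightarrow> b p $ j \<le> u $ j \<and> u $ j \<le> b p $ j + l p})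
      \<le> (\<Sum>p\<in>P. emeasure lborel {u \<in> ?S. \<forall>j. j \<noteq> i \<longrightarrow> b p $ j \<le> u $ j \<and> u $ j \<le> b p $ j + l p})"
      using P by (intro emeasure_subadditive_finite) auto
    also have "\<dots> \<le> (\<Sum>p\<in>P. ennreal (L * l p ^ (?n - 1)))"
      using L l by (intro sum_mono emeasure_line_cylinder) auto
    also have "\<dots> = ennreal (L * (\<Sum>p\<in>P. l p ^ (?n - 1)))"
      using L l by (simp add: sum_ennreal sum_distrib_left)
    also have "\<dots> \<le> ennreal (L * (c1 * L ^ (?n - 1)))" using L small by (intro ennreal_leI mult_left_mono) auto
    also have "L * (c1 * L ^ (?n - 1)) = c1 * L ^ ?n" using LL by (simp add: mult.left_commute)
    finally have e2: "emeasure lborel (\<Union>p\<in>P. {u \<in> ?S. \<forall>j. j \<noteq> i \<longrightarrow> b p $ j \<le> u $ j \<and> u $ j \<le> b p $ j + l p})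
      \<le> ennreal (c1 * L ^ ?n)" .
    have "emeasure lborel (B i) \<le> ennreal (?n * c2 * L ^ ?n) + ennreal (c1 * L ^ ?n)"
      unfolding B_def using P
      by (intro order_trans[OF emeasure_subadditive] add_mono e1 e2) auto
    also have "\<dots> = ennreal ((c1 + ?n * c2) * L ^ ?n)"
      using c L by (subst ennreal_plus[symmetric]) (auto simp: algebra_simps)
    finally show ?thesis .
  qed
  have step: "norm (f (upd z i t) - f z) < \<tau> / ?n" if z: "z \<in> ?S" "z \<notin> B i" and t: "a $ i \<le> t" "t \<le> a $ i + L" for z i t
  proof -
    have noU: "upd z i s \<notin> ?U" for s
    proof
      assume "upd z i s \<in> ?U"
      then obtain p where p: "p \<in> P" "upd z i s \<in> cbox (b p) (b p + (\<chi> i. l p))" by auto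
      then have "b p $ j \<le> z $ j \<and> z $ j \<le> b p $ j + l p" if "j \<noteq> i" for j
        using that by (auto simp: mem_box_cart split: if_splits)
      then show False using z p(1) by (auto simp: B_def)
    qed
    have zi: "a $ i \<le> z $ i" "z $ i \<le> a $ i + L" using z(1) by (auto simp: mem_box_cart)
    have "ennreal (norm (f (upd z i t) - f z)) \<le> (\<integral>\<^sup>+s\<in>{min t (z $ i)..max t (z $ i)}. G (upd z i s) \<partial>lborel)"
      using ug by (auto simp: axis_upper_gradient_def)
    also have "\<dots> \<le> H i z"
      unfolding H_def using noU t zi
      by (intro nn_integral_mono) (auto simp: h_def indicator_def min_le_iff_disj le_max_iff_disj)
    also have "\<dots> < ennreal (\<tau> / ?n)" using z by (auto simp: B_def not_le)
    finally show ?thesis using \<tau> by (simp add: ennreal_less_iff)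
  qed
  let ?\<beta> = "ennreal ((c1 + ?n * c2) * L ^ ?n) * emeasure lborel ?S"
  (* The pairs for which the change of the coordinates in A moves f too much. *)
  define E where "E A = {(u, v). u \<in> ?S \<and> v \<in> ?S \<and> norm (f u - f (mix A u v)) > card A * (\<tau> / ?n)}" for A
  have Em: "E A \<in> sets ?m" for A
  proof -
    have [measurable]: "(\<lambda>p. mix A (fst p) (snd p)) \<in> borel_measurable ?m"
      using mix_measurable[of A] unfolding borel_prod[symmetric] by (simp cong: measurable_cong_sets)
    have "E A = {p \<in> space ?m. fst p \<in> ?S \<and> snd p \<in> ?S \<and> norm (f (fst p) - f (mix A (fst p) (snd p))) > card A * (\<tau> / ?n)}"
      by (auto simp: E_def space_pair_measure)
    also have "\<dots> \<in> sets ?m" by measurable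
    finally show ?thesis .
  qed
  have main: "emeasure ?m (E A) \<le> of_nat (card A) * ?\<beta>" if "finite A" for A
    using that
  proof (induction A rule: finite_induct)
    case empty
    have "mix {} u v = u" for u v :: "real ^ 'n" by (simp add: vec_eq_iff)
    then have "E {} = {}" by (auto simp: E_def)
    then show ?case by simp
  next
    case (insert i A)
    let ?D = "{(u, v). u \<in> ?S \<and> v \<in> ?S \<and> mix A u v \<in> B i}"
    have D: "emeasure ?m ?D = emeasure lborel (B i) * emeasure lborel ?S"
      by (rule emeasure_mix[OF Bm BS])
    have Dm: "?D \<in> sets ?m"
    proof -
      have [measurable]: "(\<lambda>p. mix A (fst p) (snd p)) \<in> borel_measurable ?m"
        using mix_measurable[of A] unfolding borel_prod[symmetric] by (simp cong: measurable_cong_sets)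
      have "?D = {p \<in> space ?m. fst p \<in> ?S \<and> snd p \<in> ?S \<and> mix A (fst p) (snd p) \<in> B i}"
        by (auto simp: space_pair_measure)
      also have "\<dots> \<in> sets ?m" by measurable
      finally show ?thesis .
    qed
    have "E (insert i A) \<subseteq> E A \<union> ?D"
    proof (rule subsetI, rule ccontr)
      fix p assume p: "p \<in> E (insert i A)" "p \<notin> E A \<union> ?D"
      obtain u v where "p = (u, v)" by (cases p)
      note uv = p[unfolded this]
      then have S: "u \<in> ?S" "v \<in> ?S" and nB: "mix A u v \<notin> B i" by (auto simp: E_def)
      have mS: "mix A u v \<in> ?S" using S by (auto simp: mem_box_cart)
      have "mix (insert i A) u v = upd (mix A u v) i (v $ i)" by (auto simp: vec_eq_iff)
      then have "norm (f (mix (insert i A) u v) - f (mix A u v)) < \<tau> / ?n"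
        using step[OF mS nB, of "v $ i"] S by (auto simp: mem_box_cart)
      moreover have "norm (f u - f (mix (insert i A) u v)) > card A * (\<tau> / ?n) + \<tau> / ?n"
        using uv(1) insert.hyps by (simp add: E_def distrib_right add.commute add_divide_distrib)
      moreover have "norm (f u - f (mix (insert i A) u v)) \<le> norm (f u - f (mix A u v)) + norm (f (mix (insert i A) u v) - f (mix A u v))"
        by (metis norm_minus_commute norm_triangle_sub order_trans norm_triangle_ineq4 diff_diff_eq2 diff_add_cancel norm_triangle_ineq)
      ultimately have "(u, v) \<in> E A" using S by (auto simp: E_def)
      then show False using uv(2) by blast
    qed
    then have "emeasure ?m (E (insert i A)) \<le> emeasure ?m (E A \<union> ?D)"
      using Em Dm by (intro emeasure_mono) auto
    also have "\<dots> \<le> emeasure ?m (E A) + emeasure ?m ?D" using Em Dm by (intro emeasure_subadditive) auto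
    also have "\<dots> \<le> of_nat (card A) * ?\<beta> + ?\<beta>"
      unfolding D using eB by (intro add_mono insert.IH mult_right_mono) auto
    also have "\<dots> = of_nat (card (insert i A)) * ?\<beta>" using insert.hyps by (simp add: distrib_right add.commute)
    finally show ?case .
  qed
  have "E UNIV = osc_set f \<tau> ?S"
  proof -
    have "mix UNIV u v = v" for u v :: "real ^ 'n" by (simp add: vec_eq_iff)
    then show ?thesis by (auto simp: E_def osc_set_def)
  qed
  then have "emeasure ?m (osc_set f \<tau> ?S) \<le> of_nat ?n * ?\<beta>" using main[of UNIV] by simp
  also have "\<dots> = ennreal (?n * (c1 + ?n * c2) * L ^ ?n) * emeasure lborel ?S"
    using c L by (simp add: ennreal_of_nat_eq_real_of_nat mult.assoc[symmetric] ennreal_mult[symmetric])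
  finally show ?thesis .
qed

section \<open>Oscillation along chains of dyadic cubes\<close>

text \<open>
  The dyadic cube with index \<open>m\<close> of side \<open>2\<^sup>k\<close> dilated 3 times. Points at distance at most \<open>2\<^sup>k\<close> need not lie in the same
  dyadic cube, but the dilated cubes belonging to them overlap in a fixed proportion.
\<close>
definition star :: "int \<Rightarrow> ('n \<Rightarrow> int) \<Rightarrow> (real ^ 'n::finite) set" where
  "star k m = dyadic_box k (\<lambda>i. m i - 1) 2"

text \<open>
  The dilation by 9. It contains the dilation by 9 of every smaller dyadic cube whose dilation by 3 meets the dilation by 3 of
  the given one.
\<close>
definition wide :: "int \<Rightarrow> ('n \<Rightarrow> int) \<Rightarrow> (real ^ 'n::finite) set" where
  "wide k m = dyadic_box k (\<lambda>i. m i - 4) 8"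

definition cell :: "int \<Rightarrow> real ^ 'n::finite \<Rightarrow> 'n \<Rightarrow> int" where
  "cell k x i = \<lfloor>x $ i / dyadic k\<rfloor>"

text \<open>
  A proportion small enough that two typical values, one for each of two overlapping dilated cubes, are comparable at
  some point of their intersection.
\<close>
definition osc_bound :: "'n::finite itself \<Rightarrow> real" where
  "osc_bound _ = 1 / (8 * 3 ^ CARD('n))"

definition oscillates :: "(real ^ 'n::finite \<Rightarrow> complex) \<Rightarrow> real \<Rightarrow> (real ^ 'n) set \<Rightarrow> bool" where
  "oscillates f \<tau> S \<longleftrightarrow> emeasure (lborel \<Otimes>\<^sub>M lborel) (osc_set f \<tau> S) >
     ennreal (osc_bound TYPE('n)) * (emeasure lborel S * emeasure lborel S)"

text \<open>
  The value \<open>f v\<close> is typical on \<open>S\<close>: it differs by more than \<open>\<tau>\<close> from \<open>f\<close> only on a small part of \<open>S\<close>. The exceptional sets of two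
  overlapping cubes do not exhaust the intersection, which lets typical values be compared without integrability of \<open>f\<close>.
\<close>
definition near_value :: "(real ^ 'n::finite \<Rightarrow> complex) \<Rightarrow> real \<Rightarrow> (real ^ 'n) set \<Rightarrow> real ^ 'n \<Rightarrow> bool" where
  "near_value f \<tau> S v \<longleftrightarrow>
     emeasure lborel {u \<in> S. norm (f u - f v) > \<tau>} \<le> ennreal (2 * osc_bound TYPE('n)) * emeasure lborel S"

lemma osc_bound_pos: "osc_bound TYPE('n::finite) > 0"
  by (simp add: osc_bound_def)

lemma dyadic_box_pos:
  fixes m :: "'n::finite \<Rightarrow> int"
  shows "0 < emeasure lborel (dyadic_box k m q)" "emeasure lborel (dyadic_box k m q) < \<infinity>"
  by (simp_all add: emeasure_dyadic_box)

text \<open>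
  If almost all pairs are close, then by Fubini some \<open>v\<close> is close to almost all points.
\<close>
lemma near_value_exists:
  fixes f :: "real ^ 'n::finite \<Rightarrow> complex"
  assumes f: "continuous_on UNIV f" and bad: "\<not> oscillates f \<tau> S" and S: "S = dyadic_box k m q"
  obtains v where "v \<in> S" "near_value f \<tau> S v"
proof (rule ccontr)
  note obt = that
  assume neg: "\<not> thesis"
  have *: "ennreal (2 * osc_bound TYPE('n)) * emeasure lborel S < emeasure lborel {u \<in> S. norm (f u - f v) > \<tau>}"
    if "v \<in> S" for v
    using obt[OF that] neg unfolding near_value_def not_le[symmetric] by blast
  let ?m = "lborel \<Otimes>\<^sub>M lborel :: ((real ^ 'n) \<times> (real ^ 'n)) measure"
  have [measurable]: "f \<in> borel_measurable borel" using f by (rule borel_measurable_continuous_onI)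
  have Sm[measurable]: "S \<in> sets borel" by (simp add: S)
  have osc: "osc_set f \<tau> S \<in> sets ?m"
  proof -
    have "osc_set f \<tau> S = {p \<in> space ?m. fst p \<in> S \<and> snd p \<in> S \<and> norm (f (fst p) - f (snd p)) > \<tau>}"
      by (auto simp: osc_set_def space_pair_measure)
    also have "\<dots> \<in> sets ?m" by measurable
    finally show ?thesis .
  qed
  have S0: "emeasure lborel S \<noteq> 0" "emeasure lborel S < \<infinity>" unfolding S using dyadic_box_pos[of k m q] by auto
  define s where "s = enn2real (emeasure lborel S)"
  have s: "emeasure lborel S = ennreal s" "0 < s" using S0 by (auto simp: s_def enn2real_positive_iff zero_less_iff_neq_zero)
  have "ennreal (2 * osc_bound TYPE('n)) * emeasure lborel S * emeasure lborel S =
      (\<integral>\<^sup>+v. ennreal (2 * osc_bound TYPE('n)) * emeasure lborel S * indicator S v \<partial>lborel)"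
    by (subst nn_integral_cmult_indicator) auto
  also have "\<dots> \<le> (\<integral>\<^sup>+v. emeasure lborel ((\<lambda>u. (u, v)) -` osc_set f \<tau> S) \<partial>lborel)"
  proof (rule nn_integral_mono)
    fix v
    show "ennreal (2 * osc_bound TYPE('n)) * emeasure lborel S * indicator S v \<le> emeasure lborel ((\<lambda>u. (u, v)) -` osc_set f \<tau> S)"
    proof (cases "v \<in> S")
      case True
      have "(\<lambda>u. (u, v)) -` osc_set f \<tau> S = {u \<in> S. norm (f u - f v) > \<tau>}" using True by (auto simp: osc_set_def)
      then show ?thesis using *[OF True] True by simp
    qed simp
  qed
  also have "\<dots> = emeasure ?m (osc_set f \<tau> S)"
    by (rule lborel_pair.emeasure_pair_measure_alt2[OF osc, symmetric])
  also have "\<dots> \<le> ennreal (osc_bound TYPE('n)) * (emeasure lborel S * emeasure lborel S)"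
    using bad by (simp add: oscillates_def not_less)
  finally have "ennreal (2 * osc_bound TYPE('n) * s * s) \<le> ennreal (osc_bound TYPE('n) * (s * s))"
    using s osc_bound_pos[where 'n='n] by (simp add: ennreal_mult[symmetric])
  then show False using s osc_bound_pos[where 'n='n] by (simp add: mult_le_cancel_right)
qed

lemma near_values_close:
  fixes f :: "real ^ 'n::finite \<Rightarrow> complex"
  assumes f: "continuous_on UNIV f" and v: "near_value f \<tau>1 S1 v1" "near_value f \<tau>2 S2 v2"
    and D: "D \<subseteq> S1" "D \<subseteq> S2" and m[measurable]: "D \<in> sets borel" "S1 \<in> sets borel" "S2 \<in> sets borel"
    and large: "ennreal (2 * osc_bound TYPE('n)) * (emeasure lborel S1 + emeasure lborel S2) < emeasure lborel D"
  shows "norm (f v1 - f v2) \<le> \<tau>1 + \<tau>2"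
proof -
  have [measurable]: "f \<in> borel_measurable borel" using f by (rule borel_measurable_continuous_onI)
  let ?E1 = "{u \<in> S1. norm (f u - f v1) > \<tau>1}" and ?E2 = "{u \<in> S2. norm (f u - f v2) > \<tau>2}"
  have "\<not> D \<subseteq> ?E1 \<union> ?E2"
  proof
    assume "D \<subseteq> ?E1 \<union> ?E2"
    then have "emeasure lborel D \<le> emeasure lborel (?E1 \<union> ?E2)" by (intro emeasure_mono) auto
    also have "\<dots> \<le> emeasure lborel ?E1 + emeasure lborel ?E2" by (intro emeasure_subadditive) auto
    also have "\<dots> \<le> ennreal (2 * osc_bound TYPE('n)) * (emeasure lborel S1 + emeasure lborel S2)"
      unfolding distrib_left using v by (intro add_mono) (auto simp: near_value_def)
    finally show False using large by simp
  qed
  then obtain u where "u \<in> D" "norm (f u - f v1) \<le> \<tau>1" "norm (f u - f v2) \<le> \<tau>2"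
    using D by force
  then show ?thesis
    using norm_triangle_ineq4[of "f u - f v2" "f u - f v1"] by simp
qed

lemma dyadic_pos: "0 < dyadic k" by simp

lemma dyadic_step: "dyadic k = 2 * dyadic (k - 1)"
  by (simp add: powr_diff)

lemma dyadic_mono: "k \<le> l \<Longrightarrow> dyadic k \<le> dyadic l"
  by simp

lemma mem_dyadic_box:
  "x \<in> dyadic_box k m q \<longleftrightarrow> (\<forall>i. dyadic k * of_int (m i) \<le> x $ i \<and> x $ i \<le> dyadic k * (of_int (m i) + real (Suc q)))"
  by (simp add: dyadic_box_def mem_box_cart)

lemma mem_star:
  "x \<in> star k m \<longleftrightarrow> (\<forall>i. dyadic k * (of_int (m i) - 1) \<le> x $ i \<and> x $ i \<le> dyadic k * (of_int (m i) + 2))"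
  by (simp add: star_def mem_dyadic_box algebra_simps)

lemma mem_wide:
  "x \<in> wide k m \<longleftrightarrow> (\<forall>i. dyadic k * (of_int (m i) - 4) \<le> x $ i \<and> x $ i \<le> dyadic k * (of_int (m i) + 5))"
  by (simp add: wide_def mem_dyadic_box algebra_simps)

lemma star_borel [measurable]: "star k m \<in> sets borel" by (simp add: star_def)
lemma wide_borel [measurable]: "wide k m \<in> sets borel" by (simp add: wide_def)

lemma cell_bounds:
  "dyadic k * of_int (cell k x i) \<le> x $ i" "x $ i < dyadic k * (of_int (cell k x i) + 1)"
proof -
  have "of_int (cell k x i) \<le> x $ i / dyadic k" "x $ i / dyadic k < of_int (cell k x i) + 1"
    unfolding cell_def by linarith+
  then show "dyadic k * of_int (cell k x i) \<le> x $ i" "x $ i < dyadic k * (of_int (cell k x i) + 1)"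
    by (auto simp: field_simps)
qed

lemma star_cell_nested: "star (k - 1) (cell (k - 1) x) \<subseteq> star k (cell k x)"
proof
  fix y assume y: "y \<in> star (k - 1) (cell (k - 1) x)"
  show "y \<in> star k (cell k x)"
    unfolding mem_star
  proof
    fix i
    define d where "d = dyadic (k - 1)"
    have d: "0 < d" "dyadic k = 2 * d" unfolding d_def using dyadic_step[of k] by auto
    define a b where "a = cell k x i" and "b = cell (k - 1) x i"
    have ca: "2 * d * of_int a \<le> x $ i" "x $ i < 2 * d * (of_int a + 1)"
      using cell_bounds(1)[of k x i] cell_bounds(2)[of x i k] unfolding d(2) a_def by auto
    have cb: "d * of_int b \<le> x $ i" "x $ i < d * (of_int b + 1)"
      using cell_bounds(1)[of "k - 1" x i] cell_bounds(2)[of x i "k - 1"] unfolding d_def b_def by auto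
    have "2 * d * of_int a < d * (of_int b + 1)" using ca cb by linarith
    then have "2 * of_int a < (of_int b + 1 :: real)" using d(1) by (simp add: mult.assoc mult.left_commute[of 2])
    then have 1: "2 * a \<le> b" by linarith
    have "d * of_int b < 2 * d * (of_int a + 1)" using ca cb by linarith
    then have "of_int b < (of_int (2 * (a + 1)) :: real)" using d(1) by (simp add: mult.assoc mult.left_commute[of 2])
    then have "b < 2 * (a + 1)" by (simp only: of_int_less_iff)
    then have 2: "b \<le> 2 * a + 1" by simp
    have yb: "d * (of_int b - 1) \<le> y $ i" "y $ i \<le> d * (of_int b + 2)"
      using y by (auto simp: mem_star d_def b_def)
    have "d * (2 * (of_int a - 1)) \<le> d * (of_int b - 1)" using 1 d(1) by (intro mult_left_mono) auto
    moreover have "d * (of_int b + 2) \<le> d * (2 * (of_int a + 2))" using 2 d(1) by (intro mult_left_mono) auto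
    ultimately have "d * (2 * (of_int a - 1)) \<le> y $ i \<and> y $ i \<le> d * (2 * (of_int a + 2))" using yb by linarith
    then show "dyadic k * (of_int (cell k x i) - 1) \<le> y $ i \<and> y $ i \<le> dyadic k * (of_int (cell k x i) + 2)"
      unfolding d a_def by (simp add: mult_ac)
  qed
qed

lemma emeasure_star:
  fixes m :: "'n::finite \<Rightarrow> int"
  shows "emeasure lborel (star k m) = ennreal ((3 * dyadic k) ^ CARD('n))"
  unfolding star_def emeasure_dyadic_box by (simp add: mult.commute)

lemma emeasure_wide:
  fixes m :: "'n::finite \<Rightarrow> int"
  shows "emeasure lborel (wide k m) = ennreal ((9 * dyadic k) ^ CARD('n))"
  unfolding wide_def emeasure_dyadic_box by (simp add: mult.commute)

lemma near_values_nested: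
  fixes f :: "real ^ 'n::finite \<Rightarrow> complex"
  assumes f: "continuous_on UNIV f"
    and v: "near_value f \<tau>1 (star k (cell k x)) v1" "near_value f \<tau>2 (star (k - 1) (cell (k - 1) x)) v2"
  shows "norm (f v1 - f v2) \<le> \<tau>1 + \<tau>2"
proof (rule near_values_close[OF f v star_cell_nested order_refl])
  let ?n = "CARD('n)" and ?d = "dyadic (k - 1)"
  have e: "(3 * dyadic k) ^ ?n = 2 ^ ?n * (3 * ?d) ^ ?n"
    unfolding dyadic_step[of k] power_mult_distrib[symmetric] by (simp only: mult_ac)
  have "(2::real) ^ ?n \<le> 3 ^ ?n" by (intro power_mono) auto
  moreover have "(1::real) \<le> 3 ^ ?n" by simp
  ultimately have "(2::real) ^ ?n + 1 < 4 * 3 ^ ?n" by linarith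
  then have "2 * osc_bound TYPE('n) * (2 ^ ?n + 1) < 1"
    unfolding osc_bound_def by (simp add: field_simps)
  then have "2 * osc_bound TYPE('n) * (2 ^ ?n + 1) * (3 * ?d) ^ ?n < 1 * (3 * ?d) ^ ?n"
    by (intro mult_strict_right_mono) auto
  then have "2 * osc_bound TYPE('n) * ((3 * dyadic k) ^ ?n + (3 * ?d) ^ ?n) < (3 * ?d) ^ ?n"
    unfolding e by (simp add: algebra_simps)
  then show "ennreal (2 * osc_bound TYPE('n)) * (emeasure lborel (star k (cell k x)) + emeasure lborel (star (k - 1) (cell (k - 1) x)))
     < emeasure lborel (star (k - 1) (cell (k - 1) x))"
    unfolding emeasure_star using osc_bound_pos[where 'n='n]
    by (simp add: ennreal_plus[symmetric] ennreal_mult[symmetric] ennreal_less_iff del: ennreal_plus)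
qed auto

lemma star_contains_neighbour:
  assumes xy: "norm (x - y) \<le> dyadic k"
  shows "dyadic_box k (cell k x) 0 \<subseteq> star k (cell k y)"
proof
    fix z assume z: "z \<in> dyadic_box k (cell k x) 0"
    show "z \<in> star k (cell k y)"
      unfolding mem_star
    proof
      fix i
      define d where "d = dyadic k"
      have d: "0 < d" by (simp add: d_def)
      define a b where "a = cell k x i" and "b = cell k y i"
      have "\<bar>x $ i - y $ i\<bar> \<le> d" using xy component_le_norm_cart[of "x - y" i] by (simp add: d_def)
      moreover have "d * of_int a \<le> x $ i" "x $ i < d * (of_int a + 1)" "d * of_int b \<le> y $ i" "y $ i < d * (of_int b + 1)"
        unfolding a_def b_def d_def by (rule cell_bounds)+
      ultimately have "d * of_int a < d * (of_int b + 2)" "d * of_int b < d * (of_int a + 2)" by (auto simp: algebra_simps)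
      then have "of_int a < (of_int b + 2 :: real)" "of_int b < (of_int a + 2 :: real)" using d by auto
      then have ab: "a \<le> b + 1" "b \<le> a + 1" by linarith+
      have "d * of_int a \<le> z $ i" "z $ i \<le> d * (of_int a + 1)" using z by (auto simp: mem_dyadic_box a_def d_def)
      moreover have "d * (of_int b - 1) \<le> d * of_int a" "d * (of_int a + 1) \<le> d * (of_int b + 2)"
        using ab d by (auto intro!: mult_left_mono)
      ultimately show "dyadic k * (of_int (cell k y i) - 1) \<le> z $ i \<and> z $ i \<le> dyadic k * (of_int (cell k y i) + 2)"
        unfolding b_def d_def by linarith
    qed
  qed

lemma near_values_neighbours:
  fixes f :: "real ^ 'n::finite \<Rightarrow> complex"
  assumes f: "continuous_on UNIV f" and xy: "norm (x - y) \<le> dyadic k"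
    and v: "near_value f \<tau>1 (star k (cell k x)) v1" "near_value f \<tau>2 (star k (cell k y)) v2"
  shows "norm (f v1 - f v2) \<le> \<tau>1 + \<tau>2"
proof (rule near_values_close[OF f v])
  let ?n = "CARD('n)" and ?D = "dyadic_box k (cell k x) 0"
  show "?D \<subseteq> star k (cell k x)" by (rule star_contains_neighbour) simp
  show "?D \<subseteq> star k (cell k y)" by (rule star_contains_neighbour[OF xy])
  have "2 * osc_bound TYPE('n) * (2 * 3 ^ ?n) * dyadic k ^ ?n < 1 * dyadic k ^ ?n"
    by (intro mult_strict_right_mono) (auto simp: osc_bound_def)
  then have "2 * osc_bound TYPE('n) * ((3 * dyadic k) ^ ?n + (3 * dyadic k) ^ ?n) < dyadic k ^ ?n"
    by (simp add: power_mult_distrib algebra_simps)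
  then show "ennreal (2 * osc_bound TYPE('n)) * (emeasure lborel (star k (cell k x)) + emeasure lborel (star k (cell k y)))
     < emeasure lborel ?D"
    unfolding emeasure_star emeasure_dyadic_box using osc_bound_pos[where 'n='n]
    by (simp add: ennreal_plus[symmetric] ennreal_mult[symmetric] ennreal_less_iff del: ennreal_plus)
qed auto

text \<open>
  Telescoping along the dyadic cubes containing \<open>x\<close>, from scale \<open>k - J\<close> up to scale \<open>k\<close>. At the finest scale \<open>f\<close> is so close to \<open>f x\<close>
  that \<open>x\<close> itself can take the role of the typical value.
\<close>
lemma near_value_chain:
  fixes f :: "real ^ 'n::finite \<Rightarrow> complex"
  assumes f: "continuous_on UNIV f" and \<tau>0: "\<And>j. 0 \<le> \<tau> j"
    and good: "\<And>j. j \<le> J \<Longrightarrow> \<not> oscillates f (\<tau> j) (star (k - int j) (cell (k - int j) x))"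
    and fine: "\<And>u. u \<in> star (k - int J) (cell (k - int J) x) \<Longrightarrow> norm (f u - f x) \<le> \<tau> 0"
  obtains v where "near_value f (\<tau> 0) (star k (cell k x)) v" "norm (f v - f x) \<le> 2 * (\<Sum>j\<le>J. \<tau> j)"
proof -
  have "\<exists>v. v \<in> star (k - int j) (cell (k - int j) x) \<and> near_value f (\<tau> j) (star (k - int j) (cell (k - int j) x)) v" if "j \<le> J" for j
    using near_value_exists[OF f good[OF that] star_def] by metis
  then obtain v where v: "\<And>j. j \<le> J \<Longrightarrow> v j \<in> star (k - int j) (cell (k - int j) x)"
      "\<And>j. j \<le> J \<Longrightarrow> near_value f (\<tau> j) (star (k - int j) (cell (k - int j) x)) (v j)"
    by metis
  have step: "norm (f (v j) - f (v (Suc j))) \<le> \<tau> j + \<tau> (Suc j)" if "Suc j \<le> J" for j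
  proof -
    have e: "k - int (Suc j) = (k - int j) - 1" by simp
    show ?thesis
      using near_values_nested[OF f v(2)[of j] v(2)[of "Suc j", unfolded e]] that by simp
  qed
  have tele: "i \<le> J \<Longrightarrow> norm (f (v 0) - f (v i)) \<le> 2 * (\<Sum>j\<le>i. \<tau> j) - \<tau> 0 - \<tau> i" for i
  proof (induction i)
    case (Suc i)
    have "norm (f (v 0) - f (v (Suc i))) \<le> norm (f (v 0) - f (v i)) + norm (f (v i) - f (v (Suc i)))"
      using norm_triangle_ineq[of "f (v 0) - f (v i)" "f (v i) - f (v (Suc i))"] by simp
    then show ?case using Suc step[of i] by simp
  qed simp
  have "norm (f (v 0) - f x) \<le> norm (f (v 0) - f (v J)) + norm (f (v J) - f x)"
    using norm_triangle_ineq[of "f (v 0) - f (v J)" "f (v J) - f x"] by simp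
  also have "\<dots> \<le> (2 * (\<Sum>j\<le>J. \<tau> j) - \<tau> 0 - \<tau> J) + \<tau> 0" using tele[of J] fine[OF v(1)[of J]] by simp
  finally have "norm (f (v 0) - f x) \<le> 2 * (\<Sum>j\<le>J. \<tau> j)" using \<tau>0[of J] by simp
  then show ?thesis using v(2)[of 0] by (intro that[of "v 0"]) auto
qed

text \<open>
  If \<open>f\<close> oscillated on none of these cubes, the two chains starting at \<open>x\<close> and at \<open>y\<close> would end in neighbouring cubes at scale
  \<open>k\<close>, and \<open>f x\<close> and \<open>f y\<close> would be close.
\<close>
lemma oscillation_cube_of_pair:
  fixes f :: "real ^ 'n::finite \<Rightarrow> complex"
  assumes f: "continuous_on UNIV f" and xy: "norm (x - y) \<le> dyadic k" and \<tau>0: "\<And>j. 0 \<le> \<tau> j"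
    and fine: "\<And>z u. z \<in> {x, y} \<Longrightarrow> u \<in> star (k - int J) (cell (k - int J) z) \<Longrightarrow> norm (f u - f z) \<le> \<tau> 0"
    and large: "8 * (\<Sum>j\<le>J. \<tau> j) < norm (f x - f y)"
  obtains j z where "j \<le> J" "z \<in> {x, y}" "oscillates f (\<tau> j) (star (k - int j) (cell (k - int j) z))"
proof (rule ccontr)
  assume "\<not> thesis"
  then have good: "\<And>j z. j \<le> J \<Longrightarrow> z \<in> {x, y} \<Longrightarrow> \<not> oscillates f (\<tau> j) (star (k - int j) (cell (k - int j) z))"
    using that by blast
  obtain v where v: "near_value f (\<tau> 0) (star k (cell k x)) v" "norm (f v - f x) \<le> 2 * (\<Sum>j\<le>J. \<tau> j)"
    by (rule near_value_chain[OF f \<tau>0, where J = J and k = k and x = x]) (use good fine in auto)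
  obtain w where w: "near_value f (\<tau> 0) (star k (cell k y)) w" "norm (f w - f y) \<le> 2 * (\<Sum>j\<le>J. \<tau> j)"
    by (rule near_value_chain[OF f \<tau>0, where J = J and k = k and x = y]) (use good fine in auto)
  have vw: "norm (f v - f w) \<le> \<tau> 0 + \<tau> 0" by (rule near_values_neighbours[OF f xy v(1) w(1)])
  have "\<tau> 0 \<le> (\<Sum>j\<le>J. \<tau> j)" using \<tau>0 by (intro member_le_sum) auto
  moreover have "norm (f x - f y) \<le> norm (f v - f x) + norm (f v - f w) + norm (f w - f y)"
    using norm_triangle_ineq[of "(f v - f w) - (f v - f x)" "f w - f y"] norm_triangle_ineq4[of "f v - f w" "f v - f x"]
    by simp
  ultimately show False using large v(2) w(2) vw \<tau>0[of 0] by linarith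
qed

section \<open>Summing over oscillating cubes\<close>

type_synonym 'n cube = "int \<times> ('n \<Rightarrow> int)"

abbreviation star_of :: "'n cube \<Rightarrow> (real ^ 'n::finite) set" where
  "star_of p \<equiv> star (fst p) (snd p)"

abbreviation wide_of :: "'n cube \<Rightarrow> (real ^ 'n::finite) set" where
  "wide_of p \<equiv> wide (fst p) (snd p)"

definition touching :: "'n::finite cube \<Rightarrow> 'n cube \<Rightarrow> bool" where
  "touching p q \<longleftrightarrow> star_of p \<inter> star_of q \<noteq> {}"

lemma card_integer_box:
  fixes F :: "('n::finite cube) set"
  assumes F: "finite F" and box: "\<And>p i. p \<in> F \<Longrightarrow> lo i \<le> of_int (snd p i) \<and> of_int (snd p i) \<le> lo i + real q"
    and k: "\<And>p. p \<in> F \<Longrightarrow> fst p = k"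
  shows "card F \<le> Suc q ^ CARD('n)"
proof -
  let ?I = "\<lambda>i. {\<lceil>lo i\<rceil>..\<lceil>lo i\<rceil> + int q}"
  have "snd ` F \<subseteq> PiE UNIV ?I"
  proof (rule image_subsetI)
    fix p assume p: "p \<in> F"
    have "\<lceil>lo i\<rceil> \<le> snd p i \<and> snd p i \<le> \<lceil>lo i\<rceil> + int q" for i
    proof -
      have "real_of_int (snd p i) \<le> real_of_int (\<lceil>lo i\<rceil> + int q)"
        using box[OF p, of i] by simp linarith
      moreover have "\<lceil>lo i\<rceil> \<le> snd p i" using box[OF p, of i] by (simp add: ceiling_le_iff)
      ultimately show ?thesis by (simp only: of_int_le_iff)
    qed
    then show "snd p \<in> PiE UNIV ?I" by auto
  qed
  then have "card (snd ` F) \<le> card (PiE (UNIV :: 'n set) ?I)"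
    by (intro card_mono finite_PiE) auto
  also have "\<dots> = Suc q ^ CARD('n)" by (subst card_PiE) (auto simp: nat_add_distrib)
  also have "card (snd ` F) = card F"
    using k by (intro card_image) (auto simp: inj_on_def prod_eq_iff)
  finally show ?thesis .
qed

lemma card_star_containing:
  fixes F :: "('n::finite cube) set"
  assumes F: "finite F" and z: "\<And>p. p \<in> F \<Longrightarrow> z \<in> star_of p" and k: "\<And>p. p \<in> F \<Longrightarrow> fst p = k"
  shows "card F \<le> 4 ^ CARD('n)"
proof -
  have "card F \<le> Suc 3 ^ CARD('n)"
  proof (rule card_integer_box[OF F _ k])
    fix p i assume p: "p \<in> F"
    have "dyadic k * (of_int (snd p i) - 1) \<le> z $ i" "z $ i \<le> dyadic k * (of_int (snd p i) + 2)"
      using z[OF p] k[OF p] by (auto simp: mem_star)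
    then have "of_int (snd p i) - 1 \<le> z $ i / dyadic k" "z $ i / dyadic k \<le> of_int (snd p i) + 2"
      by (simp_all add: field_simps)
    then show "z $ i / dyadic k - 2 \<le> of_int (snd p i) \<and> of_int (snd p i) \<le> z $ i / dyadic k - 2 + real 3" by simp
  qed
  then show ?thesis by simp
qed

lemma card_wide_containing:
  fixes F :: "('n::finite cube) set"
  assumes F: "finite F" and z: "\<And>p. p \<in> F \<Longrightarrow> z \<in> wide_of p" and k: "\<And>p. p \<in> F \<Longrightarrow> fst p = k"
  shows "card F \<le> 10 ^ CARD('n)"
proof -
  have "card F \<le> Suc 9 ^ CARD('n)"
  proof (rule card_integer_box[OF F _ k])
    fix p i assume p: "p \<in> F"
    have "dyadic k * (of_int (snd p i) - 4) \<le> z $ i" "z $ i \<le> dyadic k * (of_int (snd p i) + 5)"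
      using z[OF p] k[OF p] by (auto simp: mem_wide)
    then have "of_int (snd p i) - 4 \<le> z $ i / dyadic k" "z $ i / dyadic k \<le> of_int (snd p i) + 5"
      by (simp_all add: field_simps)
    then show "z $ i / dyadic k - 5 \<le> of_int (snd p i) \<and> of_int (snd p i) \<le> z $ i / dyadic k - 5 + real 9" by simp
  qed
  then show ?thesis by simp
qed

text \<open>
  A cube has boundedly many neighbours at each larger scale. At smaller scales this fails, and there the weights have to be used.
\<close>
lemma card_touching_larger:
  fixes F :: "('n::finite cube) set"
  assumes F: "finite F" and t: "\<And>p. p \<in> F \<Longrightarrow> touching q p" and k: "\<And>p. p \<in> F \<Longrightarrow> fst p = k" and le: "fst q \<le> k"
  shows "card F \<le> 7 ^ CARD('n)"
proof -
  define a where "a i = dyadic (fst q) * (of_int (snd q i) - 1) / dyadic k - 2" for i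
  have "card F \<le> Suc 6 ^ CARD('n)"
  proof (rule card_integer_box[OF F _ k])
    fix p i assume p: "p \<in> F"
    obtain z where z: "z \<in> star_of q" "z \<in> star_of p" using t[OF p] by (auto simp: touching_def)
    have "dyadic k * (of_int (snd p i) - 1) \<le> z $ i" "z $ i \<le> dyadic k * (of_int (snd p i) + 2)"
      using z k[OF p] by (auto simp: mem_star)
    then have 1: "of_int (snd p i) - 1 \<le> z $ i / dyadic k" "z $ i / dyadic k \<le> of_int (snd p i) + 2"
      by (simp_all add: field_simps)
    have zq: "dyadic (fst q) * (of_int (snd q i) - 1) \<le> z $ i" "z $ i \<le> dyadic (fst q) * (of_int (snd q i) + 2)"
      using z by (auto simp: mem_star)
    have "z $ i \<le> dyadic (fst q) * (of_int (snd q i) - 1) + 3 * dyadic (fst q)"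
      using zq by (simp add: algebra_simps)
    also have "\<dots> \<le> dyadic (fst q) * (of_int (snd q i) - 1) + 3 * dyadic k"
      using dyadic_mono[OF le] by simp
    finally have "z $ i / dyadic k \<le> (dyadic (fst q) * (of_int (snd q i) - 1) + 3 * dyadic k) / dyadic k"
      by (intro divide_right_mono) auto
    then have 2: "z $ i / dyadic k \<le> a i + 5" by (simp add: a_def add_divide_distrib)
    have "dyadic (fst q) * (of_int (snd q i) - 1) / dyadic k \<le> z $ i / dyadic k"
      using zq by (intro divide_right_mono) auto
    then have 3: "a i + 2 \<le> z $ i / dyadic k" by (simp add: a_def)
    show "a i \<le> of_int (snd p i) \<and> of_int (snd p i) \<le> a i + real 6" using 1 2 3 by simp
  qed
  then show ?thesis by simp
qed

lemma wide_subset_of_touching: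
  assumes t: "touching p q" and le: "fst p < fst q"
  shows "wide_of p \<subseteq> wide_of q"
proof
  fix y assume y: "y \<in> wide_of p"
  obtain z where z: "z \<in> star_of p" "z \<in> star_of q" using t by (auto simp: touching_def)
  have "dyadic (fst p) \<le> dyadic (fst q - 1)" using le by simp
  then have d: "2 * dyadic (fst p) \<le> dyadic (fst q)" using dyadic_step[of "fst q"] by linarith
  show "y \<in> wide_of q"
    unfolding mem_wide
  proof
    fix i
    have "dyadic (fst p) * (of_int (snd p i) - 4) \<le> y $ i" "y $ i \<le> dyadic (fst p) * (of_int (snd p i) + 5)"
      using y by (auto simp: mem_wide)
    moreover have "dyadic (fst p) * (of_int (snd p i) - 1) \<le> z $ i" "z $ i \<le> dyadic (fst p) * (of_int (snd p i) + 2)"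
      "dyadic (fst q) * (of_int (snd q i) - 1) \<le> z $ i" "z $ i \<le> dyadic (fst q) * (of_int (snd q i) + 2)"
      using z by (auto simp: mem_star)
    ultimately show "dyadic (fst q) * (of_int (snd q i) - 4) \<le> y $ i \<and> y $ i \<le> dyadic (fst q) * (of_int (snd q i) + 5)"
      using d unfolding right_diff_distrib distrib_left by linarith
  qed
qed

text \<open>
  Exchange of a geometrically decaying factor with a sum that is bounded scale by scale.
\<close>
lemma sum_scales_le:
  fixes F :: "'p set" and h :: "'p \<Rightarrow> nat" and x b :: real and g :: "'p \<Rightarrow> real"
  assumes F: "finite F" and x: "0 < x" "x < 1" and h: "\<And>p. p \<in> F \<Longrightarrow> N \<le> h p"
    and b: "\<And>i. (\<Sum>p\<in>{p \<in> F. h p = i}. g p) \<le> b" and b0: "0 \<le> b"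
  shows "(\<Sum>p\<in>F. x ^ h p * g p) \<le> b * (x ^ N / (1 - x))"
proof -
  define M where "M = Suc (Max (insert N (h ` F)))"
  have hM: "h p < M" if "p \<in> F" for p
    using F that by (auto simp: M_def less_Suc_eq_le)
  have "(\<Sum>p\<in>F. x ^ h p * g p) = (\<Sum>i\<in>{N..<M}. \<Sum>p\<in>{p \<in> F. h p = i}. x ^ h p * g p)"
    by (rule sum.group[symmetric]) (use F h hM in auto)
  also have "\<dots> = (\<Sum>i\<in>{N..<M}. x ^ i * (\<Sum>p\<in>{p \<in> F. h p = i}. g p))"
    by (intro sum.cong) (auto simp: sum_distrib_left)
  also have "\<dots> \<le> (\<Sum>i\<in>{N..<M}. x ^ i * b)"
    using x b by (intro sum_mono mult_left_mono) auto
  also have "\<dots> = b * (\<Sum>i\<in>{N..<M}. x ^ i)" by (simp add: sum_distrib_left mult.commute)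
  finally have le: "(\<Sum>p\<in>F. x ^ h p * g p) \<le> b * (\<Sum>i\<in>{N..<M}. x ^ i)" .
  have "(\<Sum>i\<in>{N..<M}. x ^ i) \<le> x ^ N / (1 - x)"
  proof -
    have "N \<le> M" unfolding M_def by (intro le_SucI Max_ge) (use F in auto)
    then obtain d where d: "M = N + d" using le_Suc_ex by blast
    have "(\<Sum>i\<in>{N..<N+d}. x ^ i) * (1 - x) = x ^ N - x ^ (N + d)"
    proof (induction d)
      case (Suc d)
      have "(\<Sum>i\<in>{N..<N + Suc d}. x ^ i) = (\<Sum>i\<in>{N..<N + d}. x ^ i) + x ^ (N + d)" by simp
      then show ?case using Suc.IH by (simp add: distrib_right right_diff_distrib)
    qed simp
    then have "(\<Sum>i\<in>{N..<M}. x ^ i) = (x ^ N - x ^ M) / (1 - x)"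
      using x unfolding d by (simp add: eq_divide_eq)
    also have "\<dots> \<le> x ^ N / (1 - x)" using x by (intro divide_right_mono) auto
    finally show ?thesis .
  qed
  then have "b * (\<Sum>i\<in>{N..<M}. x ^ i) \<le> b * (x ^ N / (1 - x))" using b0 by (rule mult_left_mono)
  then show ?thesis using le by linarith
qed

lemma geometric_tail_small:
  fixes x b :: real
  assumes "0 < x" "x < 1" "0 \<le> b"
  obtains N where "1 \<le> N" "b * (x ^ N / (1 - x)) \<le> 1 / 2"
proof -
  have "(\<lambda>N. b * (x ^ N / (1 - x))) \<longlonglongrightarrow> b * (0 / (1 - x))"
    using assms by (intro tendsto_intros LIMSEQ_power_zero) auto
  then have "\<forall>\<^sub>F N in sequentially. b * (x ^ N / (1 - x)) < 1 / 2"
    by (rule order_tendstoD) simp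
  then have "\<forall>\<^sub>F N in sequentially. b * (x ^ N / (1 - x)) < 1 / 2 \<and> 1 \<le> N"
    using eventually_ge_at_top by (rule eventually_conj)
  then obtain N where "b * (x ^ N / (1 - x)) < 1 / 2" "1 \<le> N" by (auto simp: eventually_sequentially)
  then show ?thesis by (intro that[of N]) auto
qed

text \<open>
  The contrapositive of the estimate along good lines: oscillation that cannot be explained by the gradient on the given
  smaller cubes needs a definite amount of gradient outside of them.
\<close>
lemma oscillation_forces_gradient:
  fixes f :: "real ^ 'n::finite \<Rightarrow> complex" and P :: "('n cube) set"
  assumes ug: "axis_upper_gradient f G" and \<tau>: "0 < \<tau>" and P: "finite P"
    and osc: "oscillates f \<tau> (star k m)"
    and small: "(\<Sum>p\<in>P. dyadic (fst p) ^ (CARD('n) - 1)) \<le> osc_bound TYPE('n) / (2 * CARD('n)) * dyadic k ^ (CARD('n) - 1)"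
  shows "ennreal (osc_bound TYPE('n) / (2 * CARD('n) * CARD('n)) * \<tau> * (3 * dyadic k) ^ (CARD('n) - 1))
     \<le> (\<integral>\<^sup>+x\<in>star k m - (\<Union>p\<in>P. star_of p). G x \<partial>lborel)"
proof (rule ccontr)
  let ?n = "CARD('n)"
  let ?c1 = "osc_bound TYPE('n) / (2 * ?n)" and ?c2 = "osc_bound TYPE('n) / (2 * ?n * ?n)"
  let ?a = "\<lambda>p. (\<chi> i. dyadic (fst p) * of_int (snd p i - 1)) :: real ^ 'n"
  assume "\<not> ?thesis"
  moreover have st: "star_of p = cbox (?a p) (?a p + (\<chi> i. 3 * dyadic (fst p)))" for p :: "'n cube"
    unfolding star_def dyadic_box_eq by (simp add: mult.commute)
  ultimately have int: "(\<integral>\<^sup>+x\<in>cbox (?a (k, m)) (?a (k, m) + (\<chi> i. 3 * dyadic k)) - (\<Union>p\<in>P. cbox (?a p) (?a p + (\<chi> i. 3 * dyadic (fst p)))). G x \<partial>lborel)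
      \<le> ennreal (?c2 * \<tau> * (3 * dyadic k) ^ (?n - 1))"
    using st[of "(k, m)"] by simp
  have "emeasure (lborel \<Otimes>\<^sub>M lborel) (osc_set f \<tau> (cbox (?a (k, m)) (?a (k, m) + (\<chi> i. 3 * dyadic k))))
    \<le> ennreal (real ?n * (?c1 + real ?n * ?c2) * (3 * dyadic k) ^ ?n) * emeasure lborel (cbox (?a (k, m)) (?a (k, m) + (\<chi> i. 3 * dyadic k)))"
  proof (rule oscillation_of_good_lines[OF ug _ \<tau> P _ _ _ _ int])
    have "(\<Sum>p\<in>P. (3 * dyadic (fst p)) ^ (?n - 1)) = 3 ^ (?n - 1) * (\<Sum>p\<in>P. dyadic (fst p) ^ (?n - 1))"
      by (simp add: power_mult_distrib sum_distrib_left)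
    also have "\<dots> \<le> 3 ^ (?n - 1) * (?c1 * dyadic k ^ (?n - 1))" using small by (intro mult_left_mono) auto
    also have "\<dots> = ?c1 * (3 * dyadic k) ^ (?n - 1)" by (simp add: power_mult_distrib)
    finally show "(\<Sum>p\<in>P. (3 * dyadic (fst p)) ^ (?n - 1)) \<le> ?c1 * (3 * dyadic k) ^ (?n - 1)" .
  qed (use osc_bound_pos[where 'n='n] in \<open>auto intro: divide_nonneg_nonneg less_imp_le\<close>)
  then have "emeasure (lborel \<Otimes>\<^sub>M lborel) (osc_set f \<tau> (star k m))
    \<le> ennreal (real ?n * (?c1 + real ?n * ?c2) * (3 * dyadic k) ^ ?n) * emeasure lborel (star k m)"
    using st[of "(k, m)"] by simp
  (* The two constants of the lemma are chosen so that bad lines account for exactly the permitted proportion. *)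
  also have "real ?n * (?c1 + real ?n * ?c2) = osc_bound TYPE('n)" by (simp add: field_simps)
  also have "ennreal (osc_bound TYPE('n) * (3 * dyadic k) ^ ?n) = ennreal (osc_bound TYPE('n)) * emeasure lborel (star k m)"
    using osc_bound_pos[where 'n='n] unfolding emeasure_star by (intro ennreal_mult) auto
  finally show False using osc by (simp add: oscillates_def mult.assoc)
qed

section \<open>Absorbing redundant cubes\<close>

text \<open>
  Each cube has its own share \<open>star - U\<close> of the gradient. By the \<open>A\<^sub>1\<close> property the mass of the weight on the dilated cube is at most
  a constant times its volume times the value of the weight at any of its points, so the weight can be moved under the integral of the gradient. The
  shares overlap boundedly often.
\<close>
lemma residual_cubes_sum:
  fixes w G :: "real ^ 'n::finite \<Rightarrow> ennreal" and R :: "('n cube) set"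
  assumes A1: "dyadic_A1 K w" and K: "0 < K" and c: "0 < c" and \<mu>: "0 < \<mu>" and R: "finite R"
    and Gm[measurable]: "G \<in> borel_measurable borel" and Um[measurable]: "\<And>p. U p \<in> sets borel"
    and grad: "\<And>p. p \<in> R \<Longrightarrow> ennreal (c * (\<mu> * dyadic (fst p) powr (1 + \<gamma>)) * (3 * dyadic (fst p)) ^ (CARD('n) - 1))
        \<le> (\<integral>\<^sup>+x\<in>star_of p - U p. G x \<partial>lborel)"
    and overlap: "\<And>z. card {p \<in> R. z \<in> star_of p - U p} \<le> B"
  shows "(\<Sum>p\<in>R. ennreal (dyadic (fst p) powr \<gamma>) * (\<integral>\<^sup>+x\<in>wide_of p. w x \<partial>lborel))
    \<le> ennreal (K * 9 ^ CARD('n) * B / (c * 3 ^ (CARD('n) - 1)) / \<mu>) * (\<integral>\<^sup>+x\<in>(\<Union>p\<in>R. star_of p). G x * w x \<partial>lborel)"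
proof -
  let ?n = "CARD('n)"
  have wm[measurable]: "w \<in> borel_measurable borel" using A1 by (simp add: dyadic_A1_def)
  define C where "C = K * 9 ^ ?n / (c * 3 ^ (?n - 1)) / \<mu>"
  have C0: "0 \<le> C" using K c \<mu> by (simp add: C_def)
  have each: "ennreal (dyadic (fst p) powr \<gamma>) * (\<integral>\<^sup>+x\<in>wide_of p. w x \<partial>lborel)
      \<le> ennreal C * (\<integral>\<^sup>+x\<in>star_of p - U p. G x * w x \<partial>lborel)" if p: "p \<in> R" for p
  proof -
    define d where "d = dyadic (fst p)"
    have d: "0 < d" by (simp add: d_def)
    define v where "v = (\<integral>\<^sup>+x\<in>wide_of p. w x \<partial>lborel)"
    define a where "a = c * (\<mu> * d powr (1 + \<gamma>)) * (3 * d) ^ (?n - 1)"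
    have a0: "0 < a" using c \<mu> d by (simp add: a_def)
    have sub: "star_of p \<subseteq> wide_of p"
    proof
      fix x assume "x \<in> star_of p"
      moreover have "dyadic (fst p) * (of_int (snd p i) - 4) \<le> dyadic (fst p) * (of_int (snd p i) - 1)"
        "dyadic (fst p) * (of_int (snd p i) + 2) \<le> dyadic (fst p) * (of_int (snd p i) + 5)" for i
        by (auto intro!: mult_left_mono)
      ultimately show "x \<in> wide_of p" unfolding mem_star mem_wide by (meson order_trans)
    qed
    have vw: "v \<le> ennreal (K * (9 * d) ^ ?n) * w x" if "x \<in> star_of p" for x
    proof -
      have "v \<le> ennreal K * emeasure lborel (wide_of p) * w x"
        using A1 sub that unfolding dyadic_A1_def v_def wide_def by blast
      then show ?thesis using K unfolding emeasure_wide d_def by (simp add: ennreal_mult)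
    qed
    have "v * ennreal a \<le> v * (\<integral>\<^sup>+x\<in>star_of p - U p. G x \<partial>lborel)"
      using grad[OF p] unfolding a_def d_def by (intro mult_left_mono) auto
    also have "\<dots> = (\<integral>\<^sup>+x. v * (G x * indicator (star_of p - U p) x) \<partial>lborel)"
      by (intro nn_integral_cmult[symmetric]) measurable
    also have "\<dots> \<le> (\<integral>\<^sup>+x. ennreal (K * (9 * d) ^ ?n) * (G x * w x * indicator (star_of p - U p) x) \<partial>lborel)"
    proof (rule nn_integral_mono)
      fix x
      show "v * (G x * indicator (star_of p - U p) x) \<le> ennreal (K * (9 * d) ^ ?n) * (G x * w x * indicator (star_of p - U p) x)"
      proof (cases "x \<in> star_of p - U p")
        case True
        have "v * G x \<le> (ennreal (K * (9 * d) ^ ?n) * w x) * G x"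
          using vw[of x] True by (intro mult_right_mono) auto
        then show ?thesis using True by (simp add: mult.assoc mult.commute[of "G x"])
      qed simp
    qed
    also have "\<dots> = ennreal (K * (9 * d) ^ ?n) * (\<integral>\<^sup>+x\<in>star_of p - U p. G x * w x \<partial>lborel)"
      by (intro nn_integral_cmult) measurable
    finally have "v * ennreal a \<le> ennreal (K * (9 * d) ^ ?n) * (\<integral>\<^sup>+x\<in>star_of p - U p. G x * w x \<partial>lborel)" .
    then have "ennreal (d powr \<gamma> / a) * (v * ennreal a) \<le>
        ennreal (d powr \<gamma> / a) * (ennreal (K * (9 * d) ^ ?n) * (\<integral>\<^sup>+x\<in>star_of p - U p. G x * w x \<partial>lborel))"
      by (intro mult_left_mono) auto
    also have "ennreal (d powr \<gamma> / a) * (v * ennreal a) = ennreal (d powr \<gamma> / a * a) * v"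
      using a0 by (subst ennreal_mult) (auto simp: ac_simps)
    also have "d powr \<gamma> / a * a = d powr \<gamma>" using a0 by simp
    also have "ennreal (d powr \<gamma> / a) * (ennreal (K * (9 * d) ^ ?n) * (\<integral>\<^sup>+x\<in>star_of p - U p. G x * w x \<partial>lborel))
      = ennreal (d powr \<gamma> / a * (K * (9 * d) ^ ?n)) * (\<integral>\<^sup>+x\<in>star_of p - U p. G x * w x \<partial>lborel)"
      using a0 K d by (subst ennreal_mult) (auto simp: mult.assoc)
    also have "d powr \<gamma> / a * (K * (9 * d) ^ ?n) = C"
    proof -
      have n: "d ^ ?n = d * d ^ (?n - 1)" by (metis power_eq_if zero_less_card_finite less_numeral_extra(3))
      show ?thesis unfolding a_def C_def using d c \<mu>
        by (simp add: power_mult_distrib powr_add n field_simps)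
    qed
    finally show ?thesis by (simp add: v_def d_def)
  qed
  have "(\<Sum>p\<in>R. ennreal (dyadic (fst p) powr \<gamma>) * (\<integral>\<^sup>+x\<in>wide_of p. w x \<partial>lborel))
    \<le> (\<Sum>p\<in>R. ennreal C * (\<integral>\<^sup>+x\<in>star_of p - U p. G x * w x \<partial>lborel))"
    by (intro sum_mono each)
  also have "\<dots> = ennreal C * (\<integral>\<^sup>+x. (\<Sum>p\<in>R. G x * w x * indicator (star_of p - U p) x) \<partial>lborel)"
    by (subst nn_integral_sum) (auto simp: sum_distrib_left)
  also have "\<dots> \<le> ennreal C * (\<integral>\<^sup>+x. of_nat B * (G x * w x * indicator (\<Union>p\<in>R. star_of p) x) \<partial>lborel)"
  proof (intro mult_left_mono nn_integral_mono)
    fix x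
    have "(\<Sum>p\<in>R. G x * w x * indicator (star_of p - U p) x) = G x * w x * (\<Sum>p\<in>R. indicator (star_of p - U p) x)"
      by (simp add: sum_distrib_left)
    also have "(\<Sum>p\<in>R. indicator (star_of p - U p) x) = (of_nat (card {p \<in> R. x \<in> star_of p - U p}) :: ennreal)"
      using R by (simp add: indicator_def sum.If_cases Int_def conj_commute)
    also have "G x * w x * of_nat (card {p \<in> R. x \<in> star_of p - U p}) \<le> of_nat B * (G x * w x * indicator (\<Union>p\<in>R. star_of p) x)"
    proof (cases "x \<in> (\<Union>p\<in>R. star_of p)")
      case True
      have "G x * w x * of_nat (card {p \<in> R. x \<in> star_of p - U p}) \<le> G x * w x * of_nat B"
        using overlap[of x] by (intro mult_left_mono) auto
      then show ?thesis using True by (simp add: mult.commute)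
    next
      case False
      then have e: "{p \<in> R. x \<in> star_of p - U p} = {}" by auto
      show ?thesis unfolding e by simp
    qed
    finally show "(\<Sum>p\<in>R. G x * w x * indicator (star_of p - U p) x) \<le> of_nat B * (G x * w x * indicator (\<Union>p\<in>R. star_of p) x)" .
  qed auto
  also have "\<dots> = ennreal C * (of_nat B * (\<integral>\<^sup>+x\<in>(\<Union>p\<in>R. star_of p). G x * w x \<partial>lborel))"
    using R by (subst nn_integral_cmult) auto
  also have "\<dots> = ennreal (C * real B) * (\<integral>\<^sup>+x\<in>(\<Union>p\<in>R. star_of p). G x * w x \<partial>lborel)"
    using C0 by (simp add: ennreal_mult ennreal_of_nat_eq_real_of_nat mult.assoc)
  also have "C * real B = K * 9 ^ ?n * B / (c * 3 ^ (?n - 1)) / \<mu>" by (simp add: C_def field_simps)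
  finally show ?thesis .
qed

text \<open>
  Averages over the smaller cube are at least the infimum over the larger one.
\<close>
lemma wide_integral_ratio:
  fixes w :: "real ^ 'n::finite \<Rightarrow> ennreal"
  assumes A1: "dyadic_A1 K w" and K: "0 < K" and sub: "wide_of q \<subseteq> wide_of p"
    and fin: "(\<integral>\<^sup>+x\<in>wide_of p. w x \<partial>lborel) = ennreal Vp" "(\<integral>\<^sup>+x\<in>wide_of q. w x \<partial>lborel) = ennreal Vq"
    and V: "0 \<le> Vp" "0 \<le> Vq"
  shows "dyadic (fst q) ^ CARD('n) * Vp \<le> K * dyadic (fst p) ^ CARD('n) * Vq"
proof -
  have wm[measurable]: "w \<in> borel_measurable borel" using A1 by (simp add: dyadic_A1_def)
  have "ennreal Vp * emeasure lborel (wide_of q) = (\<integral>\<^sup>+x. ennreal Vp * indicator (wide_of q) x \<partial>lborel)"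
    by (simp add: nn_integral_cmult_indicator)
  also have "\<dots> \<le> (\<integral>\<^sup>+x. ennreal K * emeasure lborel (wide_of p) * (w x * indicator (wide_of q) x) \<partial>lborel)"
  proof (rule nn_integral_mono)
    fix x
    have "ennreal Vp \<le> ennreal K * emeasure lborel (wide_of p) * w x" if "x \<in> wide_of q"
      using A1 sub that unfolding dyadic_A1_def fin(1)[symmetric] wide_def by blast
    then show "ennreal Vp * indicator (wide_of q) x \<le> ennreal K * emeasure lborel (wide_of p) * (w x * indicator (wide_of q) x)"
      by (auto simp: indicator_def)
  qed
  also have "\<dots> = ennreal K * emeasure lborel (wide_of p) * ennreal Vq"
    unfolding fin(2)[symmetric] by (intro nn_integral_cmult) measurable
  finally have "ennreal (Vp * (9 * dyadic (fst q)) ^ CARD('n)) \<le> ennreal (K * (9 * dyadic (fst p)) ^ CARD('n) * Vq)"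
    using V K unfolding emeasure_wide by (simp add: ennreal_mult)
  then have "Vp * (9 * dyadic (fst q)) ^ CARD('n) \<le> K * (9 * dyadic (fst p)) ^ CARD('n) * Vq"
    using V K by (subst (asm) ennreal_le_iff) auto
  then have "9 ^ CARD('n) * (dyadic (fst q) ^ CARD('n) * Vp) \<le> 9 ^ CARD('n) * (K * dyadic (fst p) ^ CARD('n) * Vq)"
    by (simp only: power_mult_distrib mult_ac)
  then show ?thesis by (rule mult_left_le_imp_le) simp
qed

lemma dyadic_ratio_powr:
  assumes "l \<le> k"
  shows "dyadic k powr a = (2 powr a) ^ nat (k - l) * dyadic l powr a"
proof -
  have "dyadic k = 2 powr real (nat (k - l)) * dyadic l"
    using assms by (simp add: powr_add[symmetric])
  then have "dyadic k powr a = (2 powr real (nat (k - l))) powr a * dyadic l powr a"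
    by (simp add: powr_mult)
  also have "(2 powr real (nat (k - l))) powr a = (2 powr a) ^ nat (k - l)"
    by (simp add: powr_powr powr_realpow[symmetric] mult.commute)
  finally show ?thesis .
qed

text \<open>
  If the much smaller cubes touching \<open>p\<close> have large content with exponent \<open>n - 1\<close>, the term of \<open>p\<close> is dominated by the terms of these cubes:
  comparing the averages of the weight turns the content into the sum of \<open>2^{(1+\<gamma>) h}\<close> times the terms of the
  smaller cubes, where \<open>h\<close> is the difference of the scales. As \<open>1 + \<gamma> < 0\<close>, and as a cube touches boundedly many larger ones at each
  scale, the factors collected by a small cube form a geometric series whose sum over \<open>h \<ge> N\<close> is below one half.
\<close>
lemma heavy_cubes_absorbed:
  fixes F H :: "('n::finite cube) set" and V :: "'n cube \<Rightarrow> real"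
  assumes \<gamma>: "\<gamma> < -1" and F: "finite F" and HF: "H \<subseteq> F" and V: "\<And>p. 0 \<le> V p" and c1: "0 < c1" and K: "0 < K" and N: "1 \<le> N"
    and ratio: "\<And>p q. p \<in> F \<Longrightarrow> q \<in> F \<Longrightarrow> touching q p \<Longrightarrow> fst q < fst p \<Longrightarrow>
       dyadic (fst q) ^ CARD('n) * V p \<le> K * dyadic (fst p) ^ CARD('n) * V q"
    and heavy: "\<And>p. p \<in> H \<Longrightarrow> c1 * dyadic (fst p) ^ (CARD('n) - 1) <
       (\<Sum>q\<in>{q \<in> F. fst q \<le> fst p - int N \<and> touching q p}. dyadic (fst q) ^ (CARD('n) - 1))"
    and small: "(K / c1 * 7 ^ CARD('n)) * ((2 powr (1 + \<gamma>)) ^ N / (1 - 2 powr (1 + \<gamma>))) \<le> 1 / 2"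
  shows "(\<Sum>p\<in>H. dyadic (fst p) powr \<gamma> * V p) \<le> (\<Sum>p\<in>F. dyadic (fst p) powr \<gamma> * V p) / 2"
proof -
  let ?n = "CARD('n)"
  define A where "A p = dyadic (fst p) powr \<gamma> * V p" for p
  have A0: "0 \<le> A p" for p using V by (simp add: A_def)
  define x where "x = 2 powr (1 + \<gamma>)"
  have "2 powr (1 + \<gamma>) < (2::real) powr 0" using \<gamma> by (intro powr_less_mono) auto
  then have x: "0 < x" "x < 1" by (auto simp: x_def)
  define h where "h p q = nat (fst p - fst q)" for p q :: "'n cube"
  let ?Q = "\<lambda>p. {q \<in> F. fst q \<le> fst p - int N \<and> touching q p}"
  have n: "d ^ ?n = d * d ^ (?n - 1)" for d :: real by (metis power_eq_if zero_less_card_finite less_numeral_extra(3))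
  have each: "A p \<le> (\<Sum>q\<in>?Q p. K / c1 * x ^ h p q * A q)" if p: "p \<in> H" for p
  proof -
    let ?d = "\<lambda>p. dyadic (fst p)"
    have summand: "A p * ?d q ^ (?n - 1) \<le> c1 * ?d p ^ (?n - 1) * (K / c1 * x ^ h p q * A q)" if q: "q \<in> ?Q p" for q
    proof -
      have lt: "fst q < fst p" using q N by auto
      have "?d q ^ ?n * V p \<le> K * ?d p ^ ?n * V q" using ratio[of p q] q p HF lt by auto
      then have "?d p powr \<gamma> * (?d q ^ ?n * V p) / ?d q \<le> ?d p powr \<gamma> * (K * ?d p ^ ?n * V q) / ?d q"
        by (intro divide_right_mono mult_left_mono) auto
      moreover have "?d p powr \<gamma> * (?d q ^ ?n * V p) / ?d q = A p * ?d q ^ (?n - 1)"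
        unfolding n A_def by (simp add: field_simps)
      moreover have "?d p powr \<gamma> * (K * ?d p ^ ?n * V q) / ?d q = c1 * ?d p ^ (?n - 1) * (K / c1 * x ^ h p q * A q)"
      proof -
        have "?d p powr \<gamma> * ?d p = ?d p powr (1 + \<gamma>)" by (simp add: powr_add)
        also have "\<dots> = x ^ h p q * ?d q powr (1 + \<gamma>)"
          unfolding x_def h_def using lt by (intro dyadic_ratio_powr) auto
        also have "\<dots> = x ^ h p q * ?d q powr \<gamma> * ?d q" by (simp add: powr_add)
        finally have e: "?d p powr \<gamma> * ?d p = x ^ h p q * ?d q powr \<gamma> * ?d q" .
        have "?d p powr \<gamma> * (K * ?d p ^ ?n * V q) / ?d q = (?d p powr \<gamma> * ?d p) * (K * ?d p ^ (?n - 1) * V q) / ?d q"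
          unfolding n by (simp only: mult_ac)
        also have "\<dots> = c1 * ?d p ^ (?n - 1) * (K / c1 * x ^ h p q * A q)"
          unfolding e A_def using c1 by (simp add: field_simps)
        finally show ?thesis .
      qed
      ultimately show ?thesis by simp
    qed
    have "A p * (c1 * ?d p ^ (?n - 1)) \<le> A p * (\<Sum>q\<in>?Q p. ?d q ^ (?n - 1))"
      using heavy[OF p] A0 by (intro mult_left_mono) auto
    also have "\<dots> \<le> (\<Sum>q\<in>?Q p. c1 * ?d p ^ (?n - 1) * (K / c1 * x ^ h p q * A q))"
      unfolding sum_distrib_left by (intro sum_mono summand)
    also have "\<dots> = (\<Sum>q\<in>?Q p. K / c1 * x ^ h p q * A q) * (c1 * ?d p ^ (?n - 1))"
      unfolding sum_distrib_right by (intro sum.cong refl) (simp only: mult_ac)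
    finally show ?thesis using c1 by (subst (asm) mult_le_cancel_right_pos) auto
  qed
  have "(\<Sum>p\<in>H. A p) \<le> (\<Sum>p\<in>H. \<Sum>q\<in>?Q p. K / c1 * x ^ h p q * A q)" by (intro sum_mono each)
  also have "\<dots> \<le> (\<Sum>p\<in>F. \<Sum>q\<in>?Q p. K / c1 * x ^ h p q * A q)"
    using F HF K c1 x A0 by (intro sum_mono2) (auto intro!: sum_nonneg)
  also have "\<dots> = (\<Sum>q\<in>F. \<Sum>p\<in>{p \<in> F. fst q \<le> fst p - int N \<and> touching q p}. K / c1 * x ^ h p q * A q)"
    by (rule sum.swap_restrict[OF F F])
  also have "\<dots> \<le> (\<Sum>q\<in>F. A q / 2)"
  proof (rule sum_mono)
    fix q assume q: "q \<in> F"
    let ?P = "{p \<in> F. fst q \<le> fst p - int N \<and> touching q p}"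
    have "(\<Sum>p\<in>?P. x ^ h p q * 1) \<le> 7 ^ ?n * (x ^ N / (1 - x))"
    proof (rule sum_scales_le)
      fix i
      define Z where "Z = {p \<in> ?P. h p q = i}"
      have "card Z \<le> 7 ^ ?n"
      proof (cases "Z = {}")
        case False
        show ?thesis
        proof (rule card_touching_larger[where k = "fst q + int i" and q = q])
          show "fst p = fst q + int i" if "p \<in> Z" for p using that N by (auto simp: h_def Z_def)
        qed (use F in \<open>auto simp: Z_def\<close>)
      qed simp
      then have "real (card Z) \<le> real (7 ^ ?n)" by (rule of_nat_mono)
      then show "(\<Sum>p\<in>{p \<in> ?P. h p q = i}. 1) \<le> (7 ^ ?n :: real)"
        unfolding Z_def[symmetric] by simp
    qed (use F x N in \<open>auto simp: h_def\<close>)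
    then have "K / c1 * (\<Sum>p\<in>?P. x ^ h p q) \<le> K / c1 * (7 ^ ?n * (x ^ N / (1 - x)))"
      using K c1 by (intro mult_left_mono) auto
    also have "\<dots> \<le> 1 / 2" using small unfolding x_def by (simp add: mult.assoc)
    finally have "K / c1 * (\<Sum>p\<in>?P. x ^ h p q) * A q \<le> 1 / 2 * A q" by (intro mult_right_mono A0)
    then show "(\<Sum>p\<in>?P. K / c1 * x ^ h p q * A q) \<le> A q / 2"
      by (simp add: sum_distrib_left sum_distrib_right mult.assoc)
  qed
  finally show ?thesis by (simp add: A_def sum_divide_distrib)
qed

text \<open>
  The cubes of one scale that touch a larger cube \<open>q\<close> lie in its dilation and overlap boundedly, so their weights add up to a
  constant times that of \<open>q\<close>. The factor \<open>2^{-\<gamma> h}\<close> for the difference \<open>h\<close> of the scales is summable as \<open>\<gamma> > 0\<close>.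
\<close>
lemma dominated_cubes_absorbed:
  fixes F H :: "('n::finite cube) set" and w :: "real ^ 'n \<Rightarrow> ennreal"
  assumes \<gamma>: "0 < \<gamma>" and F: "finite F" and HF: "H \<subseteq> F" and N: "1 \<le> N"
    and wm[measurable]: "w \<in> borel_measurable borel"
    and V: "\<And>p. p \<in> F \<Longrightarrow> (\<integral>\<^sup>+x\<in>wide_of p. w x \<partial>lborel) = ennreal (V p)" and V0: "\<And>p. 0 \<le> V p"
    and dom: "\<And>p. p \<in> H \<Longrightarrow> \<exists>q\<in>F. fst p \<le> fst q - int N \<and> touching p q"
    and small: "10 ^ CARD('n) * ((2 powr (- \<gamma>)) ^ N / (1 - 2 powr (- \<gamma>))) \<le> 1 / 2"
  shows "(\<Sum>p\<in>H. dyadic (fst p) powr \<gamma> * V p) \<le> (\<Sum>p\<in>F. dyadic (fst p) powr \<gamma> * V p) / 2"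
proof -
  let ?n = "CARD('n)"
  define A where "A p = dyadic (fst p) powr \<gamma> * V p" for p
  have A0: "0 \<le> A p" for p using V0 by (simp add: A_def)
  define x where "x = 2 powr (- \<gamma>)"
  have "2 powr (- \<gamma>) < (2::real) powr 0" using \<gamma> by (intro powr_less_mono) auto
  then have x: "0 < x" "x < 1" by (auto simp: x_def)
  let ?P = "\<lambda>q. {p \<in> F. fst p \<le> fst q - int N \<and> touching p q}"
  have "(\<Sum>p\<in>H. A p) \<le> (\<Sum>p\<in>H. \<Sum>q\<in>{q \<in> F. fst p \<le> fst q - int N \<and> touching p q}. A p)"
  proof (rule sum_mono)
    fix p assume "p \<in> H"
    then obtain q where "q \<in> {q \<in> F. fst p \<le> fst q - int N \<and> touching p q}" using dom by blast
    then show "A p \<le> (\<Sum>q\<in>{q \<in> F. fst p \<le> fst q - int N \<and> touching p q}. A p)"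
      using F A0 by (intro member_le_sum) auto
  qed
  also have "\<dots> \<le> (\<Sum>p\<in>F. \<Sum>q\<in>{q \<in> F. fst p \<le> fst q - int N \<and> touching p q}. A p)"
    using F HF A0 by (intro sum_mono2) (auto intro!: sum_nonneg)
  also have "\<dots> = (\<Sum>q\<in>F. \<Sum>p\<in>?P q. A p)"
    by (rule sum.swap_restrict[OF F F])
  also have "\<dots> \<le> (\<Sum>q\<in>F. A q / 2)"
  proof (rule sum_mono)
    fix q assume q: "q \<in> F"
    define h where "h p = nat (fst q - fst p)" for p :: "'n cube"
    let ?g = "\<lambda>p. dyadic (fst q) powr \<gamma> * V p"
    have "(\<Sum>p\<in>?P q. A p) = (\<Sum>p\<in>?P q. x ^ h p * ?g p)"
    proof (rule sum.cong)
      fix p assume p: "p \<in> ?P q"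
      then have "dyadic (fst q) powr \<gamma> = (2 powr \<gamma>) ^ h p * dyadic (fst p) powr \<gamma>"
        unfolding h_def by (intro dyadic_ratio_powr) auto
      moreover have "x ^ h p * (2 powr \<gamma>) ^ h p = 1"
        unfolding power_mult_distrib[symmetric] x_def by (simp add: powr_add[symmetric])
      ultimately have "x ^ h p * ?g p = dyadic (fst p) powr \<gamma> * V p"
        by (metis mult.assoc mult_1)
      then show "A p = x ^ h p * ?g p" unfolding A_def by (rule sym)
    qed simp
    also have "\<dots> \<le> (10 ^ ?n * A q) * (x ^ N / (1 - x))"
    proof (rule sum_scales_le)
      fix i
      let ?S = "{p \<in> ?P q. h p = i}"
      have "ennreal (\<Sum>p\<in>?S. V p) = (\<Sum>p\<in>?S. \<integral>\<^sup>+x\<in>wide_of p. w x \<partial>lborel)"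
        using V V0 by (subst sum_ennreal[symmetric]) (auto intro!: sum.cong)
      also have "\<dots> = (\<integral>\<^sup>+x. (\<Sum>p\<in>?S. w x * indicator (wide_of p) x) \<partial>lborel)"
        by (subst nn_integral_sum) auto
      also have "\<dots> \<le> (\<integral>\<^sup>+x. of_nat (10 ^ ?n) * (w x * indicator (wide_of q) x) \<partial>lborel)"
      proof (rule nn_integral_mono)
        fix z
        have "(\<Sum>p\<in>?S. w z * indicator (wide_of p) z) = (\<Sum>p\<in>{p \<in> ?S. z \<in> wide_of p}. w z)"
          using F by (intro sum.mono_neutral_cong_right) (auto simp: indicator_def)
        also have "\<dots> = of_nat (card {p \<in> ?S. z \<in> wide_of p}) * w z" by simp
        also have "\<dots> \<le> of_nat (10 ^ ?n) * (w z * indicator (wide_of q) z)"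
        proof (cases "{p \<in> ?S. z \<in> wide_of p} = {}")
          case True
          show ?thesis unfolding True by simp
        next
          case False
          then obtain p where p: "p \<in> ?S" "z \<in> wide_of p" by blast
          then have "z \<in> wide_of q" using wide_subset_of_touching[of p q] N by auto
          moreover have "card {p \<in> ?S. z \<in> wide_of p} \<le> 10 ^ ?n"
          proof (rule card_wide_containing[where k = "fst q - int i" and z = z])
            show "fst p = fst q - int i" if "p \<in> {p \<in> ?S. z \<in> wide_of p}" for p using that N by (auto simp: h_def)
          qed (use F in auto)
          ultimately show ?thesis by (simp only: indicator_simps mult_1_right) (intro mult_right_mono of_nat_mono, auto)
        qed
        finally show "(\<Sum>p\<in>?S. w z * indicator (wide_of p) z) \<le> of_nat (10 ^ ?n) * (w z * indicator (wide_of q) z)" .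
      qed
      also have "\<dots> = of_nat (10 ^ ?n) * ennreal (V q)"
        unfolding V[OF q, symmetric] by (intro nn_integral_cmult) measurable
      also have "\<dots> = ennreal (10 ^ ?n * V q)"
        using V0 by (simp add: ennreal_mult ennreal_of_nat_eq_real_of_nat[symmetric] del: of_nat_power) (simp add: ennreal_of_nat_eq_real_of_nat)
      finally have "(\<Sum>p\<in>?S. V p) \<le> 10 ^ ?n * V q" using V0 by (subst (asm) ennreal_le_iff) auto
      then have "dyadic (fst q) powr \<gamma> * (\<Sum>p\<in>?S. V p) \<le> dyadic (fst q) powr \<gamma> * (10 ^ ?n * V q)"
        by (intro mult_left_mono) auto
      then show "(\<Sum>p\<in>?S. ?g p) \<le> 10 ^ ?n * A q" by (simp add: sum_distrib_left A_def mult_ac)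
    qed (use F x N A0 in \<open>auto simp: h_def\<close>)
    also have "\<dots> = 10 ^ ?n * (x ^ N / (1 - x)) * A q" by simp
    also have "\<dots> \<le> 1 / 2 * A q" using small A0 unfolding x_def by (intro mult_right_mono) auto
    finally show "(\<Sum>p\<in>?P q. A p) \<le> A q / 2" by simp
  qed
  finally show ?thesis by (simp add: A_def sum_divide_distrib)
qed

text \<open>
  Half of the sum is absorbed by the preceding lemmas when cubes at least \<open>N\<close> scales apart are considered. What remains
  are cubes whose shares of the gradient meet only if their scales differ by less than \<open>N\<close>. The assumption that the
  weights are finite is needed to subtract the absorbed half.
\<close>
lemma oscillating_cubes_sum:
  fixes \<gamma> K :: real
  assumes \<gamma>: "\<gamma> < -1 \<or> 0 < \<gamma>" and K: "0 < K"
  obtains C where "0 < C" "\<And>(f :: real ^ 'n::finite \<Rightarrow> complex) G w \<mu> F. axis_upper_gradient f G \<Longrightarrow> dyadic_A1 K w \<Longrightarrow>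
    0 < \<mu> \<Longrightarrow> finite F \<Longrightarrow> (\<And>p. p \<in> F \<Longrightarrow> oscillates f (\<mu> * dyadic (fst p) powr (1 + \<gamma>)) (star_of p)) \<Longrightarrow>
    (\<And>p. p \<in> F \<Longrightarrow> (\<integral>\<^sup>+x\<in>wide_of p. w x \<partial>lborel) < \<infinity>) \<Longrightarrow>
    (\<Sum>p\<in>F. ennreal (dyadic (fst p) powr \<gamma>) * (\<integral>\<^sup>+x\<in>wide_of p. w x \<partial>lborel))
      \<le> ennreal (C / \<mu>) * (\<integral>\<^sup>+x\<in>(\<Union>p\<in>F. star_of p). G x * w x \<partial>lborel)"
proof -
  let ?n = "CARD('n)"
  define c1 where "c1 = osc_bound TYPE('n) / (2 * ?n)"
  define c2 where "c2 = osc_bound TYPE('n) / (2 * ?n * ?n)"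
  have c: "0 < c1" "0 < c2" using osc_bound_pos[where 'n='n] by (auto simp: c1_def c2_def)
  obtain N :: nat where N: "1 \<le> N"
    and Nneg: "\<gamma> < -1 \<Longrightarrow> (K / c1 * 7 ^ ?n) * ((2 powr (1 + \<gamma>)) ^ N / (1 - 2 powr (1 + \<gamma>))) \<le> 1 / 2"
    and Npos: "0 < \<gamma> \<Longrightarrow> 10 ^ ?n * ((2 powr (- \<gamma>)) ^ N / (1 - 2 powr (- \<gamma>))) \<le> 1 / 2"
  proof (cases "\<gamma> < -1")
    case True
    have "2 powr (1 + \<gamma>) < (2::real) powr 0" using True by (intro powr_less_mono) auto
    then show ?thesis
      using geometric_tail_small[of "2 powr (1 + \<gamma>)" "K / c1 * 7 ^ ?n"] that True K c by auto
  next
    case False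
    have "2 powr (- \<gamma>) < (2::real) powr 0" using False \<gamma> by (intro powr_less_mono) auto
    then show ?thesis
      using geometric_tail_small[of "2 powr (- \<gamma>)" "10 ^ ?n"] that False by auto
  qed
  define B where "B = N * 4 ^ ?n"
  define C where "C = 2 * (K * 9 ^ ?n * B / (c2 * 3 ^ (?n - 1)))"
  have "0 < C" using K c N by (simp add: C_def B_def)
  show ?thesis
  proof (rule that[OF \<open>0 < C\<close>])
    fix f :: "real ^ 'n \<Rightarrow> complex" and G w :: "real ^ 'n \<Rightarrow> ennreal" and \<mu> :: real and F :: "('n cube) set"
    assume ug: "axis_upper_gradient f G" and A1: "dyadic_A1 K w" and \<mu>: "0 < \<mu>" and F: "finite F"
      and osc: "\<And>p. p \<in> F \<Longrightarrow> oscillates f (\<mu> * dyadic (fst p) powr (1 + \<gamma>)) (star_of p)"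
      and fin: "\<And>p. p \<in> F \<Longrightarrow> (\<integral>\<^sup>+x\<in>wide_of p. w x \<partial>lborel) < \<infinity>"
    have [measurable]: "w \<in> borel_measurable borel" "G \<in> borel_measurable borel"
      using A1 ug by (auto simp: dyadic_A1_def axis_upper_gradient_def)
    define V where "V p = enn2real (\<integral>\<^sup>+x\<in>wide_of p. w x \<partial>lborel)" for p :: "'n cube"
    have V: "(\<integral>\<^sup>+x\<in>wide_of p. w x \<partial>lborel) = ennreal (V p)" if "p \<in> F" for p
      using fin[OF that] by (simp add: V_def)
    have V0: "0 \<le> V p" for p by (simp add: V_def)
    define below where "below p = {q \<in> F. fst q \<le> fst p - int N \<and> touching q p}" for p
    (* H is the set of cubes to be absorbed, U p the region whose gradient is left to smaller cubes. *)
    define H where "H = (if \<gamma> < -1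
      then {p \<in> F. c1 * dyadic (fst p) ^ (?n - 1) < (\<Sum>q\<in>below p. dyadic (fst q) ^ (?n - 1))}
      else {p \<in> F. \<exists>q\<in>F. fst p \<le> fst q - int N \<and> touching p q})"
    define U where "U p = (if \<gamma> < -1 then \<Union>q\<in>below p. star_of q else {})" for p
    have HF: "H \<subseteq> F" by (auto simp: H_def)
    have absorbed: "(\<Sum>p\<in>H. dyadic (fst p) powr \<gamma> * V p) \<le> (\<Sum>p\<in>F. dyadic (fst p) powr \<gamma> * V p) / 2"
    proof (cases "\<gamma> < -1")
      case True
      show ?thesis
      proof (rule heavy_cubes_absorbed[OF True F HF V0 c(1) K N _ _ Nneg[OF True]])
        fix p q assume "p \<in> F" "q \<in> F" "touching q p" "fst q < fst p"
        then show "dyadic (fst q) ^ ?n * V p \<le> K * dyadic (fst p) ^ ?n * V q"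
          using V V0 by (intro wide_integral_ratio[OF A1 K] wide_subset_of_touching) auto
      qed (use True in \<open>auto simp: H_def below_def\<close>)
    next
      case False
      then have "0 < \<gamma>" using \<gamma> by auto
      then show ?thesis
        using False by (intro dominated_cubes_absorbed[OF _ F HF N _ V V0 _ Npos]) (auto simp: H_def)
    qed
    have split: "(\<Sum>p\<in>F. dyadic (fst p) powr \<gamma> * V p) = (\<Sum>p\<in>F - H. dyadic (fst p) powr \<gamma> * V p) + (\<Sum>p\<in>H. dyadic (fst p) powr \<gamma> * V p)"
      by (rule sum.subset_diff[OF HF F])
    have en: "(\<Sum>p\<in>P. ennreal (dyadic (fst p) powr \<gamma>) * (\<integral>\<^sup>+x\<in>wide_of p. w x \<partial>lborel)) = ennreal (\<Sum>p\<in>P. dyadic (fst p) powr \<gamma> * V p)"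
      if "P \<subseteq> F" for P
    proof -
      have "(\<Sum>p\<in>P. ennreal (dyadic (fst p) powr \<gamma>) * (\<integral>\<^sup>+x\<in>wide_of p. w x \<partial>lborel)) = (\<Sum>p\<in>P. ennreal (dyadic (fst p) powr \<gamma> * V p))"
      proof (rule sum.cong)
        fix p assume "p \<in> P"
        then have "(\<integral>\<^sup>+x\<in>wide_of p. w x \<partial>lborel) = ennreal (V p)" using that V by blast
        then show "ennreal (dyadic (fst p) powr \<gamma>) * (\<integral>\<^sup>+x\<in>wide_of p. w x \<partial>lborel) = ennreal (dyadic (fst p) powr \<gamma> * V p)"
          using V0 by (simp add: ennreal_mult)
      qed simp
      then show ?thesis using V0 by (simp add: sum_ennreal)
    qed
    have bfin: "finite (below p)" for p using F by (simp add: below_def)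
    have residual: "(\<Sum>p\<in>F - H. ennreal (dyadic (fst p) powr \<gamma>) * (\<integral>\<^sup>+x\<in>wide_of p. w x \<partial>lborel))
      \<le> ennreal (K * 9 ^ ?n * B / (c2 * 3 ^ (?n - 1)) / \<mu>) * (\<integral>\<^sup>+x\<in>(\<Union>p\<in>F - H. star_of p). G x * w x \<partial>lborel)"
    proof (rule residual_cubes_sum[OF A1 K c(2) \<mu>, where U = U])
      show "U p \<in> sets borel" for p using bfin by (auto simp: U_def)
    next
      fix p assume p: "p \<in> F - H"
      have "ennreal (c2 * (\<mu> * dyadic (fst p) powr (1 + \<gamma>)) * (3 * dyadic (fst p)) ^ (?n - 1))
        \<le> (\<integral>\<^sup>+x\<in>star_of p - (\<Union>q\<in>(if \<gamma> < -1 then below p else {}). star_of q). G x \<partial>lborel)"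
        unfolding c2_def
      proof (rule oscillation_forces_gradient[OF ug])
        show "(\<Sum>q\<in>(if \<gamma> < -1 then below p else {}). dyadic (fst q) ^ (?n - 1)) \<le> osc_bound TYPE('n) / (2 * ?n) * dyadic (fst p) ^ (?n - 1)"
          using p osc_bound_pos[where 'n='n] by (auto simp: H_def c1_def not_less)
      qed (use \<mu> p osc bfin in auto)
      moreover have "(\<Union>q\<in>(if \<gamma> < -1 then below p else {}). star_of q) = U p" by (auto simp: U_def)
      ultimately show "ennreal (c2 * (\<mu> * dyadic (fst p) powr (1 + \<gamma>)) * (3 * dyadic (fst p)) ^ (?n - 1))
        \<le> (\<integral>\<^sup>+x\<in>star_of p - U p. G x \<partial>lborel)" by simp
    next
      fix z
      let ?T = "{p \<in> F - H. z \<in> star_of p - U p}"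
      have Tfin: "finite ?T" using F by auto
      (* If the scales were far apart, one of the two cubes would be in H, or the point would be in U of the larger one. *)
      have close: "\<bar>fst p - fst q\<bar> < int N" if pq: "p \<in> ?T" "q \<in> ?T" for p q
      proof (rule ccontr)
        assume far: "\<not> \<bar>fst p - fst q\<bar> < int N"
        have t: "touching p q" "touching q p" using pq by (auto simp: touching_def)
        have F: "p \<in> F" "q \<in> F" using pq by auto
        consider "fst q \<le> fst p - int N" | "fst p \<le> fst q - int N" using far by linarith
        then show False
        proof cases
          case 1
          then show False
          proof (cases "\<gamma> < -1")
            case True
            then show ?thesis using 1 pq t F by (auto simp: U_def below_def)
          next
            case False
            then show ?thesis using 1 pq t F by (auto simp: H_def)
          qed
        next
          case 2
          then show False
          proof (cases "\<gamma> < -1")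
            case True
            then show ?thesis using 2 pq t F by (auto simp: U_def below_def)
          next
            case False
            then show ?thesis using 2 pq t F by (auto simp: H_def)
          qed
        qed
      qed
      show "card ?T \<le> B"
      proof (cases "?T = {}")
        case False
        define k0 where "k0 = Min (fst ` ?T)"
        obtain q where q: "q \<in> ?T" "fst q = k0"
          using Min_in[of "fst ` ?T"] False Tfin by (fastforce simp: k0_def)
        have k0: "k0 \<le> fst p" if "p \<in> ?T" for p using Tfin that by (auto simp: k0_def intro!: Min_le)
        have "?T \<subseteq> (\<Union>i\<in>{..<N}. {p \<in> ?T. fst p = k0 + int i})"
        proof
          fix p assume p: "p \<in> ?T"
          have "nat (fst p - k0) < N" using close[OF p q(1)] q(2) by linarith
          then show "p \<in> (\<Union>i\<in>{..<N}. {p \<in> ?T. fst p = k0 + int i})"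
            using p k0[OF p] by (intro UN_I[of "nat (fst p - k0)"]) auto
        qed
        then have "card ?T \<le> card (\<Union>i\<in>{..<N}. {p \<in> ?T. fst p = k0 + int i})"
          using F by (intro card_mono finite_UN_I) auto
        also have "\<dots> \<le> (\<Sum>i<N. card {p \<in> ?T. fst p = k0 + int i})" by (rule card_UN_le) simp
        also have "\<dots> \<le> (\<Sum>i<N. 4 ^ ?n)"
        proof (rule sum_mono)
          fix i
          show "card {p \<in> ?T. fst p = k0 + int i} \<le> 4 ^ ?n"
            by (rule card_star_containing[where z = z and k = "k0 + int i"]) (use F in auto)
        qed
        also have "\<dots> = B" by (simp add: B_def)
        finally show ?thesis .
      next
        case True
        then show ?thesis by (simp only: card.empty)
      qed
    qed (use F in auto)
    have "ennreal (\<Sum>p\<in>F. dyadic (fst p) powr \<gamma> * V p) \<le> ennreal (2 * (\<Sum>p\<in>F - H. dyadic (fst p) powr \<gamma> * V p))"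
      using absorbed split by (intro ennreal_leI) linarith
    also have "\<dots> = 2 * (\<Sum>p\<in>F - H. ennreal (dyadic (fst p) powr \<gamma>) * (\<integral>\<^sup>+x\<in>wide_of p. w x \<partial>lborel))"
      unfolding en[OF Diff_subset] using V0 by (simp add: ennreal_mult sum_nonneg)
    also have "\<dots> \<le> 2 * (ennreal (K * 9 ^ ?n * B / (c2 * 3 ^ (?n - 1)) / \<mu>) * (\<integral>\<^sup>+x\<in>(\<Union>p\<in>F - H. star_of p). G x * w x \<partial>lborel))"
      by (intro mult_left_mono residual) auto
    also have "\<dots> = ennreal (C / \<mu>) * (\<integral>\<^sup>+x\<in>(\<Union>p\<in>F - H. star_of p). G x * w x \<partial>lborel)"
    proof -
      have "C / \<mu> = 2 * (K * 9 ^ ?n * B / (c2 * 3 ^ (?n - 1)) / \<mu>)" by (simp add: C_def)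
      then have "ennreal (C / \<mu>) = 2 * ennreal (K * 9 ^ ?n * B / (c2 * 3 ^ (?n - 1)) / \<mu>)"
        using K c \<mu> by (simp only: ennreal_mult') (simp add: ennreal_mult)
      then show ?thesis by (simp add: mult.assoc)
    qed
    also have "\<dots> \<le> ennreal (C / \<mu>) * (\<integral>\<^sup>+x\<in>(\<Union>p\<in>F. star_of p). G x * w x \<partial>lborel)"
      by (intro mult_left_mono nn_integral_mono) (auto simp: indicator_def)
    finally show "(\<Sum>p\<in>F. ennreal (dyadic (fst p) powr \<gamma>) * (\<integral>\<^sup>+x\<in>wide_of p. w x \<partial>lborel))
      \<le> ennreal (C / \<mu>) * (\<integral>\<^sup>+x\<in>(\<Union>p\<in>F. star_of p). G x * w x \<partial>lborel)"
      unfolding en[OF order_refl] .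
  qed
qed

section \<open>The weighted level set estimate\<close>

text \<open>
  The half-open dyadic cube, given by an index pair in the form in which it is obtained from a point.
\<close>
definition half_cell :: "'n::finite cube \<Rightarrow> (real ^ 'n) set" where
  "half_cell p = {z. cell (fst p) z = snd p}"

lemma half_cell_subset: "half_cell p \<subseteq> dyadic_box (fst p) (snd p) 0"
proof
  fix z assume "z \<in> half_cell p"
  then have "cell (fst p) z i = snd p i" for i by (simp add: half_cell_def)
  then show "z \<in> dyadic_box (fst p) (snd p) 0"
    using cell_bounds(1)[of "fst p" z] cell_bounds(2)[of z _ "fst p"]
    by (simp add: mem_dyadic_box) (metis less_imp_le)
qed

lemma half_cell_borel [measurable]: "half_cell p \<in> sets borel"
proof -
  have "half_cell p = {z. \<forall>i. \<lfloor>z $ i / dyadic (fst p)\<rfloor> = snd p i}"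
    by (auto simp: half_cell_def cell_def fun_eq_iff)
  also have "\<dots> \<in> sets borel" by measurable
  finally show ?thesis .
qed

lemma emeasure_near_le:
  fixes x :: "real ^ 'n::finite"
  assumes "0 \<le> t"
  shows "emeasure lborel {y. norm (x - y) \<le> t} \<le> ennreal ((2 * t) ^ CARD('n))"
proof -
  let ?a = "\<chi> i. x $ i - t"
  have "{y. norm (x - y) \<le> t} \<subseteq> cbox ?a (?a + (\<chi> i. 2 * t))"
  proof
    fix y assume "y \<in> {y. norm (x - y) \<le> t}"
    then have "\<bar>x $ i - y $ i\<bar> \<le> t" for i using component_le_norm_cart[of "x - y" i] by simp
    then have "x $ i - t \<le> y $ i \<and> y $ i \<le> x $ i - t + 2 * t" for i by (smt (verit))
    then show "y \<in> cbox ?a (?a + (\<chi> i. 2 * t))" by (simp add: mem_box_cart)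
  qed
  then have "emeasure lborel {y. norm (x - y) \<le> t} \<le> emeasure lborel (cbox ?a (?a + (\<chi> i. 2 * t)))"
    by (intro emeasure_mono) auto
  then show ?thesis using assms by (simp add: emeasure_cube)
qed

text \<open>
  The pairs at distance at most \<open>t\<close> of which one point lies in the cube \<open>p\<close>. If it is the first point, the second ranges over a ball of volume of
  order \<open>t\<^sup>n\<close>. If it is the second one, the weight is integrated over a neighbourhood of the cube, and the \<open>A\<^sub>1\<close> property compares its
  average there with the average over the cube.
\<close>
lemma cube_pair_integral:
  fixes w :: "real ^ 'n::finite \<Rightarrow> ennreal" and j :: nat
  assumes A1: "dyadic_A1 K w" and K: "0 < K" and t_def: "t = dyadic (fst p + int j)"
  shows "(\<integral>\<^sup>+x. (\<integral>\<^sup>+y. w x * (indicator (half_cell p) x + indicator (half_cell p) y) * indicator {y. norm (x - y) \<le> t} y \<partial>lborel) \<partial>lborel)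
    \<le> ennreal ((2 ^ CARD('n) + K) * t ^ CARD('n)) * (\<integral>\<^sup>+x\<in>wide_of p. w x \<partial>lborel)"
proof -
  let ?n = "CARD('n)" and ?D = "half_cell p" and ?N = "\<lambda>x. {y. norm (x - y) \<le> t}" and ?W = "\<integral>\<^sup>+x\<in>wide_of p. w x \<partial>lborel"
  have wm[measurable]: "w \<in> borel_measurable borel" using A1 by (simp add: dyadic_A1_def)
  have t: "0 < t" by (simp add: t_def)
  have ind: "indicator (?N x) y = (if norm (x - y) \<le> t then 1 else 0 :: ennreal)" for x y by simp
  have [measurable]: "(\<lambda>z. w (fst z) * indicator ?D (fst z) * indicator (?N (fst z)) (snd z)) \<in> borel_measurable (lborel \<Otimes>\<^sub>M lborel)"
    "(\<lambda>z. w (fst z) * indicator ?D (snd z) * indicator (?N (fst z)) (snd z)) \<in> borel_measurable (lborel \<Otimes>\<^sub>M lborel)"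
    unfolding ind by measurable
  have DW: "?D \<subseteq> wide_of p"
  proof
    fix x assume "x \<in> ?D"
    then have x: "x \<in> dyadic_box (fst p) (snd p) 0" using half_cell_subset by blast
    show "x \<in> wide_of p"
      unfolding mem_wide
    proof
      fix i
      have "dyadic (fst p) * of_int (snd p i) \<le> x $ i" "x $ i \<le> dyadic (fst p) * (of_int (snd p i) + 1)"
        using x by (auto simp: mem_dyadic_box)
      then show "dyadic (fst p) * (of_int (snd p i) - 4) \<le> x $ i \<and> x $ i \<le> dyadic (fst p) * (of_int (snd p i) + 5)"
        using dyadic_pos[of "fst p"] unfolding right_diff_distrib distrib_left by linarith
    qed
  qed
  have one: "(\<integral>\<^sup>+x. (\<integral>\<^sup>+y. w x * indicator ?D x * indicator (?N x) y \<partial>lborel) \<partial>lborel) \<le> ennreal ((2 * t) ^ ?n) * ?W"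
  proof -
    have "(\<integral>\<^sup>+x. (\<integral>\<^sup>+y. w x * indicator ?D x * indicator (?N x) y \<partial>lborel) \<partial>lborel) \<le> (\<integral>\<^sup>+x. ennreal ((2 * t) ^ ?n) * (w x * indicator (wide_of p) x) \<partial>lborel)"
    proof (rule nn_integral_mono)
      fix x
      have "(\<integral>\<^sup>+y. w x * indicator ?D x * indicator (?N x) y \<partial>lborel) = w x * indicator ?D x * emeasure lborel (?N x)"
        by (intro nn_integral_cmult_indicator) measurable
      also have "\<dots> \<le> w x * indicator (wide_of p) x * ennreal ((2 * t) ^ ?n)"
        using DW t by (intro mult_mono emeasure_near_le) (auto simp: indicator_def)
      finally show "(\<integral>\<^sup>+y. w x * indicator ?D x * indicator (?N x) y \<partial>lborel) \<le> ennreal ((2 * t) ^ ?n) * (w x * indicator (wide_of p) x)"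
        by (simp add: mult.commute)
    qed
    also have "\<dots> = ennreal ((2 * t) ^ ?n) * ?W" by (rule nn_integral_cmult) measurable
    finally show ?thesis .
  qed
  let ?W' = "dyadic_box (fst p) (\<lambda>i. snd p i - 4 * 2 ^ j) (9 * 2 ^ j - 1)"
  have pj: "Suc (9 * 2 ^ j - 1) = 9 * 2 ^ j" by simp
  have tj: "t = 2 ^ j * dyadic (fst p)" by (simp add: t_def powr_add powr_realpow)
  have W': "(\<integral>\<^sup>+x\<in>?W'. w x \<partial>lborel) \<le> ennreal (K * (2 ^ j) ^ ?n) * ?W"
  proof -
    have sub: "wide_of p \<subseteq> ?W'"
    proof
      fix x assume x: "x \<in> wide_of p"
      show "x \<in> ?W'"
        unfolding mem_dyadic_box pj
      proof
        fix i
        define d e m where "d = dyadic (fst p)" and "e = 2 ^ j * dyadic (fst p)" and "m = dyadic (fst p) * of_int (snd p i)"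
        have "m - 4 * d \<le> x $ i" "x $ i \<le> m + 5 * d"
          using x by (auto simp: mem_wide d_def m_def algebra_simps)
        moreover have "d \<le> e" by (simp add: d_def e_def)
        ultimately have "m - 4 * e \<le> x $ i \<and> x $ i \<le> m - 4 * e + 9 * e" by linarith
        then show "dyadic (fst p) * of_int (snd p i - 4 * 2 ^ j) \<le> x $ i \<and>
            x $ i \<le> dyadic (fst p) * (of_int (snd p i - 4 * 2 ^ j) + real (9 * 2 ^ j))"
          by (simp add: e_def m_def algebra_simps)
      qed
    qed
    have eW': "emeasure lborel ?W' = ennreal ((dyadic (fst p) * (9 * 2 ^ j)) ^ ?n)"
      unfolding emeasure_dyadic_box pj by simp
    define I where "I = (\<integral>\<^sup>+x\<in>?W'. w x \<partial>lborel)"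
    have "I * emeasure lborel (wide_of p) = (\<integral>\<^sup>+x. I * indicator (wide_of p) x \<partial>lborel)"
      by (simp add: nn_integral_cmult_indicator)
    also have "\<dots> \<le> (\<integral>\<^sup>+x. ennreal K * emeasure lborel ?W' * (w x * indicator (wide_of p) x) \<partial>lborel)"
    proof (rule nn_integral_mono)
      fix x
      have "I \<le> ennreal K * emeasure lborel ?W' * w x" if "x \<in> wide_of p"
        using A1 sub that unfolding dyadic_A1_def I_def by blast
      then show "I * indicator (wide_of p) x \<le> ennreal K * emeasure lborel ?W' * (w x * indicator (wide_of p) x)"
        by (auto simp: indicator_def)
    qed
    also have "\<dots> = ennreal K * emeasure lborel ?W' * ?W" by (intro nn_integral_cmult) measurable
    finally have "I * ennreal ((9 * dyadic (fst p)) ^ ?n) \<le> ennreal (K * (dyadic (fst p) * (9 * 2 ^ j)) ^ ?n) * ?W"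
      using K unfolding eW' emeasure_wide by (simp add: ennreal_mult)
    then have "ennreal (1 / (9 * dyadic (fst p)) ^ ?n) * (I * ennreal ((9 * dyadic (fst p)) ^ ?n))
       \<le> ennreal (1 / (9 * dyadic (fst p)) ^ ?n) * (ennreal (K * (dyadic (fst p) * (9 * 2 ^ j)) ^ ?n) * ?W)"
      by (intro mult_left_mono) auto
    also have "ennreal (1 / (9 * dyadic (fst p)) ^ ?n) * (I * ennreal ((9 * dyadic (fst p)) ^ ?n)) = ennreal (1 / (9 * dyadic (fst p)) ^ ?n * (9 * dyadic (fst p)) ^ ?n) * I"
      by (subst ennreal_mult) (auto simp: mult_ac)
    also have "1 / (9 * dyadic (fst p)) ^ ?n * (9 * dyadic (fst p)) ^ ?n = 1" by simp
    also have "ennreal (1 / (9 * dyadic (fst p)) ^ ?n) * (ennreal (K * (dyadic (fst p) * (9 * 2 ^ j)) ^ ?n) * ?W)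
       = ennreal (1 / (9 * dyadic (fst p)) ^ ?n * (K * (dyadic (fst p) * (9 * 2 ^ j)) ^ ?n)) * ?W"
      using K by (subst ennreal_mult) (auto simp: mult_ac)
    also have "1 / (9 * dyadic (fst p)) ^ ?n * (K * (dyadic (fst p) * (9 * 2 ^ j)) ^ ?n) = K * (2 ^ j) ^ ?n"
      by (simp add: power_mult_distrib)
    finally show ?thesis by (simp add: I_def)
  qed
  have two: "(\<integral>\<^sup>+x. (\<integral>\<^sup>+y. w x * indicator ?D y * indicator (?N x) y \<partial>lborel) \<partial>lborel) \<le> ennreal (K * t ^ ?n) * ?W"
  proof -
    have "(\<integral>\<^sup>+x. (\<integral>\<^sup>+y. w x * indicator ?D y * indicator (?N x) y \<partial>lborel) \<partial>lborel)
      = (\<integral>\<^sup>+y. (\<integral>\<^sup>+x. w x * indicator ?D y * indicator (?N x) y \<partial>lborel) \<partial>lborel)"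
      by (rule lborel_pair.Fubini'[symmetric]) (simp add: case_prod_beta)
    also have "\<dots> \<le> (\<integral>\<^sup>+y. (ennreal (K * (2 ^ j) ^ ?n) * ?W) * indicator ?D y \<partial>lborel)"
    proof (rule nn_integral_mono)
      fix y
      show "(\<integral>\<^sup>+x. w x * indicator ?D y * indicator (?N x) y \<partial>lborel) \<le> ennreal (K * (2 ^ j) ^ ?n) * ?W * indicator ?D y"
      proof (cases "y \<in> ?D")
        case True
        then have y: "y \<in> dyadic_box (fst p) (snd p) 0" using half_cell_subset by blast
        have "x \<in> ?W'" if "norm (x - y) \<le> t" for x
          unfolding mem_dyadic_box pj
        proof
          fix i
          define d e m where "d = dyadic (fst p)" and "e = 2 ^ j * dyadic (fst p)" and "m = dyadic (fst p) * of_int (snd p i)"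
          have "\<bar>x $ i - y $ i\<bar> \<le> e"
            using that component_le_norm_cart[of "x - y" i] tj by (simp add: e_def)
          moreover have "m \<le> y $ i" "y $ i \<le> m + d"
            using y by (auto simp: mem_dyadic_box d_def m_def algebra_simps)
          moreover have "d \<le> e" "0 < d" by (simp_all add: d_def e_def)
          ultimately have "m - 4 * e \<le> x $ i \<and> x $ i \<le> m - 4 * e + 9 * e" by linarith
          then show "dyadic (fst p) * of_int (snd p i - 4 * 2 ^ j) \<le> x $ i \<and>
              x $ i \<le> dyadic (fst p) * (of_int (snd p i - 4 * 2 ^ j) + real (9 * 2 ^ j))"
            by (simp add: e_def m_def algebra_simps)
        qed
        then have "(\<integral>\<^sup>+x. w x * indicator ?D y * indicator (?N x) y \<partial>lborel) \<le> (\<integral>\<^sup>+x\<in>?W'. w x \<partial>lborel)"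
          by (intro nn_integral_mono) (auto simp: indicator_def)
        then have "(\<integral>\<^sup>+x. w x * indicator ?D y * indicator (?N x) y \<partial>lborel) \<le> ennreal (K * (2 ^ j) ^ ?n) * ?W"
          using W' by (rule order_trans)
        then show ?thesis using True by simp
      qed simp
    qed
    also have "\<dots> = (ennreal (K * (2 ^ j) ^ ?n) * ?W) * emeasure lborel ?D"
      by (intro nn_integral_cmult_indicator) measurable
    also have "\<dots> \<le> (ennreal (K * (2 ^ j) ^ ?n) * ?W) * ennreal (dyadic (fst p) ^ ?n)"
    proof (intro mult_left_mono)
      have "emeasure lborel ?D \<le> emeasure lborel (dyadic_box (fst p) (snd p) 0)"
        by (intro emeasure_mono half_cell_subset) simp
      then show "emeasure lborel ?D \<le> ennreal (dyadic (fst p) ^ ?n)" by (simp add: emeasure_dyadic_box)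
    qed simp
    also have "\<dots> = ennreal (K * (2 ^ j) ^ ?n * dyadic (fst p) ^ ?n) * ?W"
      using K by (subst ennreal_mult) (auto simp: mult_ac)
    also have "K * (2 ^ j) ^ ?n * dyadic (fst p) ^ ?n = K * t ^ ?n" by (simp add: tj power_mult_distrib)
    finally show ?thesis .
  qed
  have "(\<integral>\<^sup>+x. (\<integral>\<^sup>+y. w x * (indicator ?D x + indicator ?D y) * indicator (?N x) y \<partial>lborel) \<partial>lborel)
     = (\<integral>\<^sup>+x. (\<integral>\<^sup>+y. w x * indicator ?D x * indicator (?N x) y \<partial>lborel) + (\<integral>\<^sup>+y. w x * indicator ?D y * indicator (?N x) y \<partial>lborel) \<partial>lborel)"
  proof (rule nn_integral_cong)
    fix x
    have "(\<integral>\<^sup>+y. w x * (indicator ?D x + indicator ?D y) * indicator (?N x) y \<partial>lborel) =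
      (\<integral>\<^sup>+y. w x * indicator ?D x * indicator (?N x) y + w x * indicator ?D y * indicator (?N x) y \<partial>lborel)"
      by (intro nn_integral_cong) (simp add: distrib_left distrib_right)
    also have "\<dots> = (\<integral>\<^sup>+y. w x * indicator ?D x * indicator (?N x) y \<partial>lborel) + (\<integral>\<^sup>+y. w x * indicator ?D y * indicator (?N x) y \<partial>lborel)"
      by (intro nn_integral_add) measurable
    finally show "(\<integral>\<^sup>+y. w x * (indicator ?D x + indicator ?D y) * indicator (?N x) y \<partial>lborel) = \<dots>" .
  qed
  also have "\<dots> = (\<integral>\<^sup>+x. (\<integral>\<^sup>+y. w x * indicator ?D x * indicator (?N x) y \<partial>lborel) \<partial>lborel)
      + (\<integral>\<^sup>+x. (\<integral>\<^sup>+y. w x * indicator ?D y * indicator (?N x) y \<partial>lborel) \<partial>lborel)"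
    by (intro nn_integral_add lborel.borel_measurable_nn_integral_fst[where f = "\<lambda>z. w (fst z) * indicator ?D (fst z) * indicator (?N (fst z)) (snd z)", simplified]
        lborel.borel_measurable_nn_integral_fst[where f = "\<lambda>z. w (fst z) * indicator ?D (snd z) * indicator (?N (fst z)) (snd z)", simplified]) measurable
  also have "\<dots> \<le> ennreal ((2 * t) ^ ?n) * ?W + ennreal (K * t ^ ?n) * ?W" by (intro add_mono one two)
  also have "\<dots> = ennreal ((2 * t) ^ ?n + K * t ^ ?n) * ?W"
    using K t by (simp add: distrib_right[symmetric] ennreal_plus[symmetric] del: ennreal_plus)
  also have "(2 * t) ^ ?n + K * t ^ ?n = (2 ^ ?n + K) * t ^ ?n" by (simp add: power_mult_distrib distrib_right)
  finally show ?thesis .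
qed

text \<open>
  The inner integral of the theorem with \<open>b = \<gamma>\<close>, for pairs at distances between \<open>2\<^sup>-\<^sup>q\<close> and \<open>2\<^sup>q\<close> and with the first point in a ball. The truncation makes
  only finitely many cubes relevant, and the function becomes bounded.
\<close>
definition truncated_level :: "real \<Rightarrow> nat \<Rightarrow> real \<Rightarrow> (real ^ 'n::finite \<Rightarrow> complex) \<Rightarrow> real ^ 'n \<Rightarrow> ennreal" where
  "truncated_level \<gamma> q lam f x = indicator (ball 0 (2 ^ q)) x *
     (\<integral>\<^sup>+y. indicator {z. 1 / 2 ^ q < norm (fst z - snd z) \<and> norm (fst z - snd z) \<le> 2 ^ q \<and>
          norm (f (fst z) - f (snd z)) > lam * norm (fst z - snd z) powr (1 + \<gamma>)} (x, y) *
        ennreal (norm (x - y) powr (\<gamma> - real CARD('n))) \<partial>lborel)"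

lemma finite_cells_near:
  fixes R :: real
  shows "finite {p :: 'n::finite cube. fst p \<in> {a..b} \<and> (\<exists>z\<in>ball 0 R. cell (fst p) z = snd p)}"
proof -
  define M where "M k = \<lceil>\<bar>R\<bar> / dyadic k\<rceil> + 1" for k
  have "{p :: 'n cube. fst p \<in> {a..b} \<and> (\<exists>z\<in>ball 0 R. cell (fst p) z = snd p)}
    \<subseteq> (SIGMA k:{a..b}. PiE UNIV (\<lambda>i. {- M k..M k}))"
  proof (clarsimp simp: PiE_UNIV_domain)
    fix k and z :: "real ^ 'n" and i assume z: "norm z < R"
    have "\<bar>z $ i\<bar> \<le> \<bar>R\<bar>" using component_le_norm_cart[of z i] z by linarith
    then have "\<bar>z $ i / dyadic k\<bar> \<le> \<bar>R\<bar> / dyadic k" by (simp add: divide_right_mono)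
    then show "- M k \<le> cell k z i \<and> cell k z i \<le> M k"
      unfolding cell_def M_def by linarith
  qed
  moreover have "finite (SIGMA k:{a..b}. PiE (UNIV :: 'n set) (\<lambda>i. {- M k..M k}))"
    by (intro finite_SigmaI finite_PiE) auto
  ultimately show ?thesis by (rule finite_subset)
qed

lemma star_diameter:
  fixes x :: "real ^ 'n::finite"
  assumes "x \<in> star k m" "y \<in> star k m"
  shows "norm (x - y) \<le> 3 * real CARD('n) * dyadic k"
proof -
  have "\<bar>(x - y) $ i\<bar> \<le> 3 * dyadic k" for i
  proof -
    have "dyadic k * (of_int (m i) - 1) \<le> x $ i" "x $ i \<le> dyadic k * (of_int (m i) + 2)"
      "dyadic k * (of_int (m i) - 1) \<le> y $ i" "y $ i \<le> dyadic k * (of_int (m i) + 2)"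
      using assms by (auto simp: mem_star)
    then show ?thesis unfolding right_diff_distrib distrib_left vector_minus_component by linarith
  qed
  then have "(\<Sum>i\<in>UNIV. \<bar>(x - y) $ i\<bar>) \<le> (\<Sum>i\<in>(UNIV :: 'n set). 3 * dyadic k)" by (intro sum_mono)
  then show ?thesis using norm_le_l1_cart[of "x - y"] by simp
qed

lemma mem_star_cell: "x \<in> star k (cell k x)"
  using cell_bounds(1)[of k x] cell_bounds(2)[of x _ k] dyadic_pos[of k]
  unfolding mem_star by (smt (verit, ccfv_threshold) mult_left_mono)

text \<open>
  Every pair in the level set at distance comparable to \<open>2\<^sup>k\<close> is charged to a dyadic cube of side \<open>2\<^sup>k\<^sup>-\<^sup>j\<close> that contains one of its
  points and on whose dilation \<open>f\<close> oscillates. The oscillation demanded \<open>j\<close> scales below is smaller by the factor \<open>\<rho>\<^sup>j\<close>, so that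
  the total along the chain is controlled. Relative to the side of the cube the threshold contains the factor \<open>2^{(1+\<gamma>) j} \<rho>^j\<close>, and the
  kernel contributes \<open>2^{\<gamma> j}\<close>, so the charges at depth \<open>j\<close> decay like \<open>(2 \<rho>)^{-j}\<close>.
\<close>
lemma weighted_level_estimate:
  fixes \<gamma> K :: real
  assumes \<gamma>: "\<gamma> < -1 \<or> 0 < \<gamma>" and K: "0 < K"
  obtains C where "0 < C" "\<And>(f :: real ^ 'n::finite \<Rightarrow> complex) G w lam q. axis_upper_gradient f G \<Longrightarrow> dyadic_A1 K w \<Longrightarrow>
    0 < lam \<Longrightarrow> (\<And>k m. (\<integral>\<^sup>+x\<in>wide k m. w x \<partial>lborel) < \<infinity>) \<Longrightarrow>
    (\<integral>\<^sup>+x. w x * truncated_level \<gamma> q lam f x \<partial>lborel)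
      \<le> ennreal (C / lam) * (\<integral>\<^sup>+x\<in>ball 0 ((3 * real CARD('n) + 3) * 2 ^ q). G x * w x \<partial>lborel)"
proof -
  let ?n = "CARD('n)"
  obtain C1 where C1: "0 < C1" "\<And>(f :: real ^ 'n \<Rightarrow> complex) G w \<mu> F. axis_upper_gradient f G \<Longrightarrow> dyadic_A1 K w \<Longrightarrow>
    0 < \<mu> \<Longrightarrow> finite F \<Longrightarrow> (\<And>p. p \<in> F \<Longrightarrow> oscillates f (\<mu> * dyadic (fst p) powr (1 + \<gamma>)) (star_of p)) \<Longrightarrow>
    (\<And>p. p \<in> F \<Longrightarrow> (\<integral>\<^sup>+x\<in>wide_of p. w x \<partial>lborel) < \<infinity>) \<Longrightarrow>
    (\<Sum>p\<in>F. ennreal (dyadic (fst p) powr \<gamma>) * (\<integral>\<^sup>+x\<in>wide_of p. w x \<partial>lborel))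
      \<le> ennreal (C1 / \<mu>) * (\<integral>\<^sup>+x\<in>(\<Union>p\<in>F. star_of p). G x * w x \<partial>lborel)"
    using oscillating_cubes_sum[OF \<gamma> K, where 'n = 'n] by blast
  (* 32 is the factor 8 lost along the two chains times the bound 4 for the geometric series in rho.
     The power of 2 accounts for replacing the distance by the dyadic number above it. *)
  define c where "c = 2 powr (- \<bar>1 + \<gamma>\<bar>) / 32"
  define C3 where "C3 = 2 powr \<bar>\<gamma> - ?n\<bar>"
  define C4 where "C4 = C3 * (2 ^ ?n + K)"
  have pos: "0 < c" "0 < C3" "0 < C4" using K by (auto simp: c_def C3_def C4_def add_pos_pos)
  define C where "C = 4 * C4 * C1 / c"
  have "0 < C" using pos C1 by (simp add: C_def)
  (* Any ratio strictly between 1/2 and 1 serves: the thresholds decay like rho^j, and the sums over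
     cubes like (2 rho)^-j. For this choice both rates agree. *)
  define \<rho> where "\<rho> = (2::real) powr (-1/2)"
  have \<rho>: "0 < \<rho>" "\<rho> \<le> 3 / 4"
  proof -
    have "\<rho> * \<rho> = 2 powr (-1)" unfolding \<rho>_def powr_add[symmetric] by simp
    then have "\<rho> * \<rho> \<le> 3/4 * (3/4)" by (simp add: powr_minus)
    show "0 < \<rho>" by (simp add: \<rho>_def)
    show "\<rho> \<le> 3 / 4"
      by (rule power2_le_imp_le) (use \<open>\<rho> * \<rho> \<le> 3/4 * (3/4)\<close> in \<open>simp_all add: power2_eq_square\<close>)
  qed
  have geo: "(\<Sum>j\<le>J. \<rho> ^ j) \<le> 4" for J
  proof -
    have "(\<Sum>j\<le>J. \<rho> ^ j) \<le> (\<Sum>j. \<rho> ^ j)"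
      using \<rho> by (intro sum_le_suminf summable_geometric) auto
    also have "\<dots> = 1 / (1 - \<rho>)" using \<rho> by (intro suminf_geometric) auto
    also have "\<dots> \<le> 4" using \<rho> by (simp add: divide_le_eq)
    finally show ?thesis .
  qed
  show ?thesis
  proof (rule that[OF \<open>0 < C\<close>])
    fix f :: "real ^ 'n \<Rightarrow> complex" and G w :: "real ^ 'n \<Rightarrow> ennreal" and lam :: real and q :: nat
    assume ug: "axis_upper_gradient f G" and A1: "dyadic_A1 K w" and lam: "0 < lam"
      and fin: "\<And>k m. (\<integral>\<^sup>+x\<in>wide k m. w x \<partial>lborel) < \<infinity>"
    have f: "continuous_on UNIV f" and [measurable]: "G \<in> borel_measurable borel" "w \<in> borel_measurable borel"
      using ug A1 by (auto simp: axis_upper_gradient_def dyadic_A1_def)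
    have fm[measurable]: "f \<in> borel_measurable borel" using f by (rule borel_measurable_continuous_onI)
    let ?R = "(2::real) ^ q" and ?R' = "(3 * real ?n + 3) * 2 ^ q"
    let ?Ks = "{1 - int q..int q}"
    define \<tau> where "\<tau> k j = c * lam * \<rho> ^ j * dyadic k powr (1 + \<gamma>)" for k :: int and j :: nat
    have \<tau>0: "0 < \<tau> k j" for k j using pos lam \<rho> by (simp add: \<tau>_def)
    (* J is the depth at which f is almost constant on the cubes by uniform continuity; it does not enter the constants. *)
    obtain J where J: "\<And>(z :: real ^ 'n) u k. k \<in> ?Ks \<Longrightarrow> z \<in> ball 0 (2 * ?R) \<Longrightarrow> u \<in> star (k - int J) (cell (k - int J) z) \<Longrightarrow>
        norm (f u - f z) \<le> \<tau> k 0"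
    proof -
      define e where "e = Min (insert 1 ((\<lambda>k. \<tau> k 0) ` ?Ks))"
      have e1: "0 < e" using \<tau>0 by (auto simp: e_def)
      have e2: "e \<le> \<tau> k 0" if "k \<in> ?Ks" for k unfolding e_def by (rule Min_le) (use that in auto)
      note e = e1 e2
      have "uniformly_continuous_on (cball 0 ?R') f"
        by (intro compact_uniformly_continuous continuous_on_subset[OF f]) auto
      then obtain d where d: "0 < d" "\<And>x y. x \<in> cball 0 ?R' \<Longrightarrow> y \<in> cball 0 ?R' \<Longrightarrow> dist y x < d \<Longrightarrow> dist (f y) (f x) < e"
        using e(1) unfolding uniformly_continuous_on_def by blast
      obtain J where J: "3 * real ?n * 2 ^ q / d < 2 ^ J"
        using real_arch_pow[of 2 "3 * real ?n * 2 ^ q / d"] by auto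
      show ?thesis
      proof (rule that[of J])
        fix z u :: "real ^ 'n" and k assume k: "k \<in> ?Ks" and z: "z \<in> ball 0 (2 * ?R)" and u: "u \<in> star (k - int J) (cell (k - int J) z)"
        have dk: "dyadic (k - int J) \<le> 2 ^ q / 2 ^ J"
        proof -
          have "dyadic (k - int J) \<le> 2 powr (real q - real J)" using k by (intro powr_mono) auto
          then show ?thesis by (simp add: powr_diff powr_realpow)
        qed
        have "norm (u - z) \<le> 3 * real ?n * dyadic (k - int J)" by (rule star_diameter[OF u mem_star_cell])
        also have "\<dots> \<le> 3 * real ?n * (2 ^ q / 2 ^ J)" using dk by (intro mult_left_mono) auto
        finally have nz: "norm (u - z) \<le> 3 * real ?n * 2 ^ q / 2 ^ J" by simp
        also have "\<dots> < d" using J d(1) by (simp add: field_simps)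
        finally have "dist u z < d" by (simp add: dist_norm)
        have "3 * real ?n * 2 ^ q / 2 ^ J \<le> 3 * real ?n * 2 ^ q / 1"
          by (intro divide_left_mono) auto
        then have "norm (u - z) \<le> 3 * real ?n * 2 ^ q" using nz by simp
        moreover have "norm u \<le> norm z + norm (u - z)" by (metis norm_triangle_sub)
        moreover have "norm z < 2 * 2 ^ q" using z by simp
        moreover have "?R' = 3 * real ?n * 2 ^ q + 3 * 2 ^ q" by (simp add: distrib_right)
        moreover have "0 < (2::real) ^ q" "0 \<le> 3 * real ?n * 2 ^ q" by simp_all
        ultimately have "norm u \<le> ?R'" "norm z \<le> ?R'" by linarith+
        then have "dist (f u) (f z) < e" using d(2)[of z u] \<open>dist u z < d\<close> by simp
        then show "norm (f u - f z) \<le> \<tau> k 0" using e(2)[OF k] by (simp add: dist_norm)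
      qed
    qed
    (* The height of the thresholds relative to the scale of the cube itself instead of the scale k of the pair. *)
    define \<mu> where "\<mu> j = c * lam * \<rho> ^ j * (2 ^ j) powr (1 + \<gamma>)" for j :: nat
    have \<mu>0: "0 < \<mu> j" for j using pos lam \<rho> by (simp add: \<mu>_def)
    define F where "F j = {p :: 'n cube. fst p \<in> {1 - int q - int j..int q - int j} \<and> (\<exists>z\<in>ball 0 (2 * ?R). cell (fst p) z = snd p)
      \<and> oscillates f (\<mu> j * dyadic (fst p) powr (1 + \<gamma>)) (star_of p)}" for j
    have finF: "finite (F j)" for j
      by (rule finite_subset[OF _ finite_cells_near[of "1 - int q - int j" "int q - int j" "2 * ?R"]]) (auto simp: F_def)
    define t where "t p j = dyadic (fst p + int j)" for p :: "'n cube" and j :: nat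
    have t0: "0 < t p j" for p j by (simp add: t_def)
    (* The pairs charged to p at depth j. *)
    define \<Phi> where "\<Phi> p j x y = w x * (indicator (half_cell p) x + indicator (half_cell p) y) * indicator {y. norm (x - y) \<le> t p j} y"
      for p j x y
    have ind: "indicator {y. norm (x - y) \<le> s} y = (if norm (x - y) \<le> s then 1 else 0 :: ennreal)" for x y :: "real ^ 'n" and s by simp
    have \<Phi>m[measurable]: "(\<lambda>z. \<Phi> p j (fst z) (snd z)) \<in> borel_measurable (lborel \<Otimes>\<^sub>M lborel)" for p j
      unfolding \<Phi>_def ind by measurable
    have \<Phi>x[measurable]: "(\<lambda>y. \<Phi> p j x y) \<in> borel_measurable lborel" for p j x
      unfolding \<Phi>_def ind by measurable
    have \<Phi>i[measurable]: "(\<lambda>x. \<integral>\<^sup>+y. \<Phi> p j x y \<partial>lborel) \<in> borel_measurable lborel" for p j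
      using lborel.borel_measurable_nn_integral_fst[OF \<Phi>m[of p j]] by simp
    let ?E = "{z :: (real ^ 'n) \<times> (real ^ 'n). 1 / 2 ^ q < norm (fst z - snd z) \<and> norm (fst z - snd z) \<le> 2 ^ q \<and>
          norm (f (fst z) - f (snd z)) > lam * norm (fst z - snd z) powr (1 + \<gamma>)}"
    have pointwise: "w x * (indicator (ball 0 (2 ^ q)) x * (indicator ?E (x, y) * ennreal (norm (x - y) powr (\<gamma> - real ?n))))
       \<le> (\<Sum>j\<le>J. \<Sum>p\<in>F j. ennreal (C3 * t p j powr (\<gamma> - real ?n)) * \<Phi> p j x y)" for x y
    proof (cases "x \<in> ball 0 (2 ^ q) \<and> (x, y) \<in> ?E")
      case False
      then show ?thesis by auto
    next
      case True
      define r where "r = norm (x - y)"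
      have r: "1 / 2 ^ q < r" "r \<le> 2 ^ q" "norm (f x - f y) > lam * r powr (1 + \<gamma>)" using True by (auto simp: r_def)
      have "0 < (1::real) / 2 ^ q" by simp
      then have r0: "0 < r" using r(1) by linarith
      define k where "k = \<lceil>log 2 r\<rceil>"
      have k1: "r \<le> dyadic k"
      proof -
        have "log 2 r \<le> of_int k" by (simp add: k_def)
        then show ?thesis using r0 by (simp add: log_le_iff)
      qed
      have k2: "dyadic k / 2 < r"
      proof -
        have "of_int k - 1 < log 2 r" unfolding k_def by linarith
        then have "2 powr (of_int k - 1) < r" using r0 by (simp add: less_log_iff)
        then show ?thesis by (simp add: powr_diff)
      qed
      have k: "k \<in> ?Ks"
      proof -
        have "log 2 r \<le> real q" using r r0 by (simp add: log_le_iff powr_realpow)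
        then have "k \<le> int q" by (simp add: k_def ceiling_le_iff)
        moreover have "- real q < log 2 r" using r r0 by (simp add: less_log_iff powr_minus powr_realpow inverse_eq_divide)
        then have "- int q < k" unfolding k_def by linarith
        ultimately show ?thesis by simp
      qed
      have ball: "z \<in> ball 0 (2 * ?R)" if "z \<in> {x, y}" for z
      proof -
        have "norm y \<le> norm x + norm (x - y)" by (metis norm_minus_commute norm_triangle_sub)
        moreover have "norm x < 2 ^ q" using True by simp
        moreover have "norm (x - y) \<le> 2 ^ q" using r(2) by (simp add: r_def)
        moreover have "0 \<le> norm (x - y)" "0 \<le> norm x" by simp_all
        ultimately have "norm x < 2 * 2 ^ q" "norm y < 2 * 2 ^ q" by linarith+
        then show ?thesis using that by auto
      qed
      have comp: "dyadic k powr a \<le> 2 powr \<bar>a\<bar> * r powr a" "r powr a \<le> 2 powr \<bar>a\<bar> * dyadic k powr a" for a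
      proof -
        have "dyadic k powr a \<le> 2 powr \<bar>a\<bar> * r powr a \<and> r powr a \<le> 2 powr \<bar>a\<bar> * dyadic k powr a"
        proof (cases "0 \<le> a")
          case True
          have "dyadic k powr a \<le> (2 * r) powr a" using k2 True by (intro powr_mono2) auto
          moreover have "r powr a \<le> dyadic k powr a" using k1 True r0 by (intro powr_mono2) auto
          moreover have "1 \<le> 2 powr a" using True by (simp add: ge_one_powr_ge_zero)
          then have "1 * dyadic k powr a \<le> 2 powr a * dyadic k powr a" by (intro mult_right_mono) auto
          ultimately have "dyadic k powr a \<le> (2 * r) powr a \<and> r powr a \<le> 2 powr a * dyadic k powr a" by linarith
          then show ?thesis using True r0 by (simp add: powr_mult)
        next
          case False
          have "dyadic k powr a \<le> r powr a" using k1 False r0 by (intro powr_mono2') auto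
          moreover have "r powr a \<le> (dyadic k / 2) powr a" using k2 False by (intro powr_mono2') auto
          moreover have "(dyadic k / 2) powr a = 2 powr (- a) * dyadic k powr a"
            by (simp add: powr_divide powr_minus field_simps)
          moreover have "1 \<le> 2 powr (- a)" using False by (simp add: ge_one_powr_ge_zero)
          then have "1 * r powr a \<le> 2 powr (- a) * r powr a" by (intro mult_right_mono) auto
          ultimately show ?thesis using False by simp
        qed
        then show "dyadic k powr a \<le> 2 powr \<bar>a\<bar> * r powr a" "r powr a \<le> 2 powr \<bar>a\<bar> * dyadic k powr a" by auto
      qed
      have "8 * (\<Sum>j\<le>J. \<tau> k j) = 8 * (c * lam * dyadic k powr (1 + \<gamma>)) * (\<Sum>j\<le>J. \<rho> ^ j)"
        unfolding sum_distrib_left by (intro sum.cong) (simp_all add: \<tau>_def)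
      also have "\<dots> \<le> 8 * (c * lam * dyadic k powr (1 + \<gamma>)) * 4"
        using geo pos lam by (intro mult_left_mono) auto
      also have "\<dots> = lam * (2 powr (- \<bar>1 + \<gamma>\<bar>) * dyadic k powr (1 + \<gamma>))" by (simp add: c_def)
      also have "\<dots> \<le> lam * (2 powr (- \<bar>1 + \<gamma>\<bar>) * (2 powr \<bar>1 + \<gamma>\<bar> * r powr (1 + \<gamma>)))"
        using comp(1)[of "1 + \<gamma>"] lam by (intro mult_left_mono) auto
      also have "\<dots> = lam * r powr (1 + \<gamma>)" by (simp add: mult.assoc[symmetric] powr_add[symmetric])
      also have "\<dots> < norm (f x - f y)" by (rule r(3))
      finally have large: "8 * (\<Sum>j\<le>J. \<tau> k j) < norm (f x - f y)" .
      obtain j z where jz: "j \<le> J" "z \<in> {x, y}" "oscillates f (\<tau> k j) (star (k - int j) (cell (k - int j) z))"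
        by (rule oscillation_cube_of_pair[OF f, of x y k "\<tau> k" J])
          (use k1 \<tau>0 J[OF k ball] large in \<open>auto simp: r_def less_imp_le\<close>)
      define p where "p = (k - int j, cell (k - int j) z)"
      have tk: "t p j = dyadic k" by (simp add: t_def p_def)
      have "\<tau> k j = \<mu> j * dyadic (fst p) powr (1 + \<gamma>)"
      proof -
        have "dyadic k = 2 ^ j * dyadic (k - int j)" by (simp add: powr_diff powr_realpow)
        then show ?thesis by (simp add: \<tau>_def \<mu>_def p_def powr_mult)
      qed
      then have pF: "p \<in> F j" using jz k ball by (auto simp: F_def p_def)
      have zp: "z \<in> half_cell p" by (simp add: half_cell_def p_def)
      have "w x * ennreal (r powr (\<gamma> - real ?n)) \<le> ennreal (C3 * t p j powr (\<gamma> - real ?n)) * \<Phi> p j x y"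
      proof -
        have "1 \<le> indicator (half_cell p) x + (indicator (half_cell p) y :: ennreal)"
          using zp jz(2) by (auto simp: indicator_def)
        then have "w x * 1 * 1 \<le> \<Phi> p j x y"
          unfolding \<Phi>_def using k1 by (intro mult_mono) (auto simp: tk r_def)
        moreover have "ennreal (r powr (\<gamma> - real ?n)) \<le> ennreal (C3 * t p j powr (\<gamma> - real ?n))"
          unfolding tk C3_def by (intro ennreal_leI comp)
        ultimately have "ennreal (r powr (\<gamma> - real ?n)) * w x \<le> ennreal (C3 * t p j powr (\<gamma> - real ?n)) * \<Phi> p j x y"
          by (intro mult_mono) auto
        then show ?thesis by (simp add: mult.commute)
      qed
      also have "\<dots> \<le> (\<Sum>p\<in>F j. ennreal (C3 * t p j powr (\<gamma> - real ?n)) * \<Phi> p j x y)"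
        using pF finF by (intro member_le_sum) auto
      also have "\<dots> \<le> (\<Sum>j\<le>J. \<Sum>p\<in>F j. ennreal (C3 * t p j powr (\<gamma> - real ?n)) * \<Phi> p j x y)"
        using jz(1) by (intro member_le_sum[where f = "\<lambda>j. \<Sum>p\<in>F j. ennreal (C3 * t p j powr (\<gamma> - real ?n)) * \<Phi> p j x y"]) auto
      finally show ?thesis using True by (simp add: r_def)
    qed
    have Em[measurable]: "?E \<in> sets (lborel \<Otimes>\<^sub>M lborel)"
    proof -
      have "Measurable.pred (lborel \<Otimes>\<^sub>M lborel) (\<lambda>z :: (real ^ 'n) \<times> (real ^ 'n). 1 / 2 ^ q < norm (fst z - snd z) \<and> norm (fst z - snd z) \<le> 2 ^ q \<and>
          norm (f (fst z) - f (snd z)) > lam * norm (fst z - snd z) powr (1 + \<gamma>))" by measurable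
      then show ?thesis by (simp add: pred_def space_pair_measure)
    qed
    have "(\<integral>\<^sup>+x. w x * truncated_level \<gamma> q lam f x \<partial>lborel) =
       (\<integral>\<^sup>+x. (\<integral>\<^sup>+y. w x * (indicator (ball 0 (2 ^ q)) x * (indicator ?E (x, y) * ennreal (norm (x - y) powr (\<gamma> - real ?n)))) \<partial>lborel) \<partial>lborel)"
    proof (rule nn_integral_cong)
      fix x
      define h where "h y = indicator ?E (x, y) * ennreal (norm (x - y) powr (\<gamma> - real ?n))" for y
      have "(\<lambda>y. indicator ?E (x, y) :: ennreal) \<in> borel_measurable lborel"
        by (intro measurable_compose[OF measurable_Pair1' borel_measurable_indicator]) (use Em in simp_all)
      then have [measurable]: "h \<in> borel_measurable lborel" unfolding h_def by measurable
      have "w x * truncated_level \<gamma> q lam f x = w x * (indicator (ball 0 (2 ^ q)) x * (\<integral>\<^sup>+y. h y \<partial>lborel))"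
        unfolding truncated_level_def h_def ..
      also have "\<dots> = (\<integral>\<^sup>+y. w x * (indicator (ball 0 (2 ^ q)) x * h y) \<partial>lborel)"
        by (simp add: nn_integral_cmult)
      finally show "w x * truncated_level \<gamma> q lam f x =
        (\<integral>\<^sup>+y. w x * (indicator (ball 0 (2 ^ q)) x * (indicator ?E (x, y) * ennreal (norm (x - y) powr (\<gamma> - real ?n)))) \<partial>lborel)"
        unfolding h_def .
    qed
    also have "\<dots> \<le> (\<integral>\<^sup>+x. (\<integral>\<^sup>+y. (\<Sum>j\<le>J. \<Sum>p\<in>F j. ennreal (C3 * t p j powr (\<gamma> - real ?n)) * \<Phi> p j x y) \<partial>lborel) \<partial>lborel)"
      by (intro nn_integral_mono pointwise)
    also have "\<dots> = (\<Sum>j\<le>J. \<Sum>p\<in>F j. ennreal (C3 * t p j powr (\<gamma> - real ?n)) * (\<integral>\<^sup>+x. (\<integral>\<^sup>+y. \<Phi> p j x y \<partial>lborel) \<partial>lborel))"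
      by (simp add: nn_integral_sum nn_integral_cmult)
    also have "\<dots> \<le> (\<Sum>j\<le>J. ennreal (C4 * (2 powr \<gamma>) ^ j) * (\<Sum>p\<in>F j. ennreal (dyadic (fst p) powr \<gamma>) * (\<integral>\<^sup>+x\<in>wide_of p. w x \<partial>lborel)))"
      unfolding sum_distrib_left
    proof (intro sum_mono)
      fix j p assume p: "p \<in> F j"
      have "ennreal (C3 * t p j powr (\<gamma> - real ?n)) * (\<integral>\<^sup>+x. (\<integral>\<^sup>+y. \<Phi> p j x y \<partial>lborel) \<partial>lborel)
        \<le> ennreal (C3 * t p j powr (\<gamma> - real ?n)) * (ennreal ((2 ^ ?n + K) * t p j ^ ?n) * (\<integral>\<^sup>+x\<in>wide_of p. w x \<partial>lborel))"
        unfolding \<Phi>_def by (intro mult_left_mono cube_pair_integral[OF A1 K]) (auto simp: t_def)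
      also have "\<dots> = ennreal (C3 * t p j powr (\<gamma> - real ?n) * ((2 ^ ?n + K) * t p j ^ ?n)) * (\<integral>\<^sup>+x\<in>wide_of p. w x \<partial>lborel)"
        using pos K t0[of p j] by (subst ennreal_mult) (auto simp: mult.assoc)
      also have "C3 * t p j powr (\<gamma> - real ?n) * ((2 ^ ?n + K) * t p j ^ ?n) = C4 * t p j powr \<gamma>"
      proof -
        have "t p j powr (\<gamma> - real ?n) * t p j ^ ?n = t p j powr \<gamma>"
          using t0[of p j] by (simp add: powr_diff powr_realpow)
        then have "C3 * (2 ^ ?n + K) * (t p j powr (\<gamma> - real ?n) * t p j ^ ?n) = C3 * (2 ^ ?n + K) * t p j powr \<gamma>" by simp
        then show ?thesis by (simp only: C4_def mult_ac)
      qed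
      also have "t p j powr \<gamma> = (2 powr \<gamma>) ^ j * dyadic (fst p) powr \<gamma>"
        using dyadic_ratio_powr[of "fst p" "fst p + int j" \<gamma>] by (simp add: t_def)
      also have "ennreal (C4 * ((2 powr \<gamma>) ^ j * dyadic (fst p) powr \<gamma>)) = ennreal (C4 * (2 powr \<gamma>) ^ j) * ennreal (dyadic (fst p) powr \<gamma>)"
        using pos by (subst ennreal_mult[symmetric]) (auto simp: mult.assoc)
      finally show "ennreal (C3 * t p j powr (\<gamma> - real ?n)) * (\<integral>\<^sup>+x. (\<integral>\<^sup>+y. \<Phi> p j x y \<partial>lborel) \<partial>lborel)
        \<le> ennreal (C4 * (2 powr \<gamma>) ^ j) * (ennreal (dyadic (fst p) powr \<gamma>) * (\<integral>\<^sup>+x\<in>wide_of p. w x \<partial>lborel))"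
        by (simp add: mult.assoc)
    qed
    also have "\<dots> \<le> (\<Sum>j\<le>J. ennreal (C4 * C1 / (c * lam) * \<rho> ^ j) * (\<integral>\<^sup>+x\<in>ball 0 ?R'. G x * w x \<partial>lborel))"
    proof (rule sum_mono)
      fix j
      have "(\<Sum>p\<in>F j. ennreal (dyadic (fst p) powr \<gamma>) * (\<integral>\<^sup>+x\<in>wide_of p. w x \<partial>lborel))
        \<le> ennreal (C1 / \<mu> j) * (\<integral>\<^sup>+x\<in>(\<Union>p\<in>F j. star_of p). G x * w x \<partial>lborel)"
        by (rule C1(2)[OF ug A1 \<mu>0 finF]) (auto simp: F_def fin[simplified])
      also have "\<dots> \<le> ennreal (C1 / \<mu> j) * (\<integral>\<^sup>+x\<in>ball 0 ?R'. G x * w x \<partial>lborel)"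
      proof (rule mult_left_mono, rule nn_integral_mono)
        fix x
        have "x \<in> ball 0 ?R'" if p: "p \<in> F j" and x: "x \<in> star_of p" for p
        proof -
          obtain z where z: "norm z < 2 * ?R" "cell (fst p) z = snd p" using p by (auto simp: F_def)
          have "norm (x - z) \<le> 3 * real ?n * dyadic (fst p)"
            using star_diameter[OF x] mem_star_cell[of z "fst p"] z(2) by metis
          also have "dyadic (fst p) \<le> 2 powr real q" using p by (intro powr_mono) (auto simp: F_def)
          then have "3 * real ?n * dyadic (fst p) \<le> 3 * real ?n * 2 ^ q" by (simp add: powr_realpow)
          finally have "norm (x - z) \<le> 3 * real ?n * 2 ^ q" .
          moreover have "norm x \<le> norm z + norm (x - z)" by (metis norm_triangle_sub)
          moreover have "?R' = 3 * real ?n * 2 ^ q + 3 * 2 ^ q" by (simp add: distrib_right)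
          moreover have "0 < (2::real) ^ q" by simp
          ultimately have "norm x < ?R'" using z(1) by linarith
          then show ?thesis by simp
        qed
        then show "G x * w x * indicator (\<Union>p\<in>F j. star_of p) x \<le> G x * w x * indicator (ball 0 ?R') x"
          by (auto simp: indicator_def)
      qed simp
      finally have "ennreal (C4 * (2 powr \<gamma>) ^ j) * (\<Sum>p\<in>F j. ennreal (dyadic (fst p) powr \<gamma>) * (\<integral>\<^sup>+x\<in>wide_of p. w x \<partial>lborel))
        \<le> ennreal (C4 * (2 powr \<gamma>) ^ j) * (ennreal (C1 / \<mu> j) * (\<integral>\<^sup>+x\<in>ball 0 ?R'. G x * w x \<partial>lborel))"
        by (rule mult_left_mono) simp
      also have "\<dots> = ennreal (C4 * (2 powr \<gamma>) ^ j * (C1 / \<mu> j)) * (\<integral>\<^sup>+x\<in>ball 0 ?R'. G x * w x \<partial>lborel)"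
        using pos C1(1) \<mu>0[of j] by (subst ennreal_mult) (auto simp: mult.assoc)
      also have "C4 * (2 powr \<gamma>) ^ j * (C1 / \<mu> j) = C4 * C1 / (c * lam) * \<rho> ^ j"
      proof -
        have a: "((2::real) ^ j) powr (1 + \<gamma>) = 2 ^ j * (2 powr \<gamma>) ^ j"
          by (simp add: powr_add powr_realpow[symmetric] powr_powr mult.commute)
        have b: "\<rho> ^ j * \<rho> ^ j * 2 ^ j = 1"
        proof -
          have "\<rho> * \<rho> * 2 = 1" unfolding \<rho>_def powr_add[symmetric] by (simp add: powr_minus)
          then show ?thesis by (metis power_mult_distrib power_one)
        qed
        have "C4 * (2 powr \<gamma>) ^ j * (C1 / \<mu> j) = C4 * C1 / (c * lam) * (1 / (\<rho> ^ j * 2 ^ j))"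
          unfolding \<mu>_def a using pos lam \<rho> by (simp add: field_simps)
        also have "1 / (\<rho> ^ j * 2 ^ j) = \<rho> ^ j" using b \<rho> by (simp add: field_simps)
        finally show ?thesis .
      qed
      finally show "ennreal (C4 * (2 powr \<gamma>) ^ j) * (\<Sum>p\<in>F j. ennreal (dyadic (fst p) powr \<gamma>) * (\<integral>\<^sup>+x\<in>wide_of p. w x \<partial>lborel))
        \<le> ennreal (C4 * C1 / (c * lam) * \<rho> ^ j) * (\<integral>\<^sup>+x\<in>ball 0 ?R'. G x * w x \<partial>lborel)" .
    qed
    also have "\<dots> = ennreal (\<Sum>j\<le>J. C4 * C1 / (c * lam) * \<rho> ^ j) * (\<integral>\<^sup>+x\<in>ball 0 ?R'. G x * w x \<partial>lborel)"
      unfolding sum_distrib_right[symmetric] using pos C1(1) lam \<rho> by (subst sum_ennreal) auto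
    also have "\<dots> \<le> ennreal (C / lam) * (\<integral>\<^sup>+x\<in>ball 0 ?R'. G x * w x \<partial>lborel)"
    proof (intro mult_right_mono ennreal_leI)
      have "(\<Sum>j\<le>J. C4 * C1 / (c * lam) * \<rho> ^ j) \<le> C4 * C1 / (c * lam) * 4"
        unfolding sum_distrib_left[symmetric] using geo pos C1(1) lam by (intro mult_left_mono) auto
      then show "(\<Sum>j\<le>J. C4 * C1 / (c * lam) * \<rho> ^ j) \<le> C / lam" by (simp add: C_def mult_ac)
    qed simp
    finally show "(\<integral>\<^sup>+x. w x * truncated_level \<gamma> q lam f x \<partial>lborel)
      \<le> ennreal (C / lam) * (\<integral>\<^sup>+x\<in>ball 0 ?R'. G x * w x \<partial>lborel)" .
  qed
qed

section \<open>The level set estimate in function spaces\<close>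

lemma truncated_level_measurable:
  fixes f :: "real ^ 'n::finite \<Rightarrow> complex"
  assumes fm[measurable]: "f \<in> borel_measurable borel"
  shows "truncated_level \<gamma> q lam f \<in> borel_measurable borel"
proof -
  let ?E = "{z :: (real ^ 'n) \<times> (real ^ 'n). 1 / 2 ^ q < norm (fst z - snd z) \<and> norm (fst z - snd z) \<le> 2 ^ q \<and>
          norm (f (fst z) - f (snd z)) > lam * norm (fst z - snd z) powr (1 + \<gamma>)}"
  have [measurable]: "?E \<in> sets (lborel \<Otimes>\<^sub>M lborel)"
  proof -
    have "Measurable.pred (lborel \<Otimes>\<^sub>M lborel) (\<lambda>z :: (real ^ 'n) \<times> (real ^ 'n). 1 / 2 ^ q < norm (fst z - snd z) \<and> norm (fst z - snd z) \<le> 2 ^ q \<and>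
          norm (f (fst z) - f (snd z)) > lam * norm (fst z - snd z) powr (1 + \<gamma>))" by measurable
    then show ?thesis by (simp add: pred_def space_pair_measure)
  qed
  have "(\<lambda>z. indicator ?E z * ennreal (norm (fst z - snd z) powr (\<gamma> - real CARD('n)))) \<in> borel_measurable (lborel \<Otimes>\<^sub>M lborel)"
    by measurable
  then have [measurable]: "(\<lambda>x. \<integral>\<^sup>+y. indicator ?E (x, y) * ennreal (norm (x - y) powr (\<gamma> - real CARD('n))) \<partial>lborel) \<in> borel_measurable borel"
    using lborel.borel_measurable_nn_integral_fst[of "\<lambda>z. indicator ?E z * ennreal (norm (fst z - snd z) powr (\<gamma> - real CARD('n)))" lborel] by simp
  show ?thesis unfolding truncated_level_def by measurable
qed

lemma truncated_level_bounded:
  fixes f :: "real ^ 'n::finite \<Rightarrow> complex"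
  obtains B where "0 \<le> B" "\<And>x. truncated_level \<gamma> q lam f x \<le> ennreal B"
proof -
  define b where "b = ((2::real) ^ q) powr \<bar>\<gamma> - real CARD('n)\<bar>"
  have q1: "(1::real) \<le> 2 ^ q" by simp
  have rb: "r powr (\<gamma> - real CARD('n)) \<le> b" if r: "1 / 2 ^ q < r" "r \<le> 2 ^ q" for r
  proof (cases "0 \<le> \<gamma> - real CARD('n)")
    case True
    have "0 \<le> r" using r(1) q1 by (smt (verit) divide_nonneg_nonneg)
    then show ?thesis unfolding b_def using r True by (simp add: powr_mono2)
  next
    case False
    have "r powr (\<gamma> - real CARD('n)) \<le> (1 / 2 ^ q) powr (\<gamma> - real CARD('n))"
      using r False by (intro powr_mono2') auto
    moreover have "\<bar>\<gamma> - real CARD('n)\<bar> = - (\<gamma> - real CARD('n))" using False by simp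
    then have "b = (1 / 2 ^ q) powr (\<gamma> - real CARD('n))"
      unfolding b_def by (simp only: powr_minus_divide) (simp add: powr_divide)
    ultimately show ?thesis by simp
  qed
  have "truncated_level \<gamma> q lam f x \<le> ennreal (b * (2 * 2 ^ q) ^ CARD('n))" for x
  proof -
    have "truncated_level \<gamma> q lam f x \<le> (\<integral>\<^sup>+y. ennreal b * indicator {y. norm (x - y) \<le> 2 ^ q} y \<partial>lborel)"
    proof -
      have "indicator (ball 0 (2 ^ q)) x * I \<le> I" for I :: ennreal by (auto simp: indicator_def)
      then show ?thesis
        unfolding truncated_level_def
        by (rule order_trans) (intro nn_integral_mono, auto simp: indicator_def intro!: ennreal_leI rb)
    qed
    also have "\<dots> = ennreal b * emeasure lborel {y. norm (x - y) \<le> 2 ^ q}"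
      by (intro nn_integral_cmult_indicator) measurable
    also have "\<dots> \<le> ennreal b * ennreal ((2 * 2 ^ q) ^ CARD('n))" by (intro mult_left_mono emeasure_near_le) auto
    also have "\<dots> = ennreal (b * (2 * 2 ^ q) ^ CARD('n))" by (simp add: b_def ennreal_mult)
    finally show ?thesis .
  qed
  then show ?thesis by (intro that[of "b * (2 * 2 ^ q) ^ CARD('n)"]) (auto simp: b_def)
qed

lemma dual_weight_wide_finite:
  fixes N :: "'n::finite fnorm"
  assumes N: "ball_banach_function_space N" and w: "dual_weight N c w"
  shows "(\<integral>\<^sup>+x\<in>wide k m. w x \<partial>lborel) < \<infinity>"
proof -
  have "bounded (wide k m)" unfolding wide_def dyadic_box_def by (rule bounded_cbox)
  then obtain r where r: "wide k m \<subseteq> ball 0 r" by (meson bounded_subset_ballD)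
  have "(\<integral>\<^sup>+x\<in>wide k m. w x \<partial>lborel) \<le> (\<integral>\<^sup>+x. w x * ennreal \<bar>indicator (ball 0 r) x\<bar> \<partial>lborel)"
    using r by (intro nn_integral_mono) (auto simp: indicator_def)
  also have "\<dots> \<le> ennreal c * N (indicator (ball 0 r))"
    by (intro dual_weightD[OF w] borel_imp_Meas) simp
  also have "\<dots> < \<infinity>" using bbfs_ball_finite[OF N] by (simp add: ennreal_mult_less_top)
  finally show ?thesis .
qed

text \<open>
  The constant depends on the space only through the bound for the maximal operator on its associate space. This uniformity is used for
  the endpoint condition.
\<close>
lemma truncated_level_norm:
  fixes \<gamma> C0 :: real
  assumes \<gamma>: "\<gamma> < -1 \<or> 0 < \<gamma>" and C0: "1 \<le> C0"
  obtains C where "0 < C" "\<And>(N :: 'n::finite fnorm) f G lam q. ball_banach_function_space N \<Longrightarrow> absolutely_continuous_norm N \<Longrightarrow>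
    (\<And>u. u \<in> fspace (assoc_norm N) \<Longrightarrow> ext_norm (assoc_norm N) (HL_maximal u) \<le> ennreal C0 * assoc_norm N u) \<Longrightarrow>
    axis_upper_gradient f (\<lambda>x. ennreal (G x)) \<Longrightarrow> (\<And>x. 0 \<le> G x) \<Longrightarrow> G \<in> borel_measurable borel \<Longrightarrow> 0 < lam \<Longrightarrow>
    ext_norm N (truncated_level \<gamma> q lam f)
      \<le> ennreal (C / lam) * N (\<lambda>x. G x * indicator (ball 0 ((3 * real CARD('n) + 3) * 2 ^ q)) x)"
proof -
  obtain C where C: "0 < C" "\<And>(f :: real ^ 'n \<Rightarrow> complex) G w lam q. axis_upper_gradient f G \<Longrightarrow> dyadic_A1 (2 * C0) w \<Longrightarrow>
    0 < lam \<Longrightarrow> (\<And>k m. (\<integral>\<^sup>+x\<in>wide k m. w x \<partial>lborel) < \<infinity>) \<Longrightarrow>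
    (\<integral>\<^sup>+x. w x * truncated_level \<gamma> q lam f x \<partial>lborel)
      \<le> ennreal (C / lam) * (\<integral>\<^sup>+x\<in>ball 0 ((3 * real CARD('n) + 3) * 2 ^ q). G x * w x \<partial>lborel)"
    using weighted_level_estimate[OF \<gamma>, of "2 * C0", where 'n = 'n] C0 by auto
  show ?thesis
  proof (rule that[of "2 * C"])
    show "0 < 2 * C" using C(1) by simp
  next
    fix N :: "'n fnorm" and f :: "real ^ 'n \<Rightarrow> complex" and G lam q
    assume N: "ball_banach_function_space N" and ac: "absolutely_continuous_norm N"
      and M: "\<And>u. u \<in> fspace (assoc_norm N) \<Longrightarrow> ext_norm (assoc_norm N) (HL_maximal u) \<le> ennreal C0 * assoc_norm N u"
      and ug: "axis_upper_gradient f (\<lambda>x. ennreal (G x))" and G0: "\<And>x. 0 \<le> G x" and Gm[measurable]: "G \<in> borel_measurable borel"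
      and lam: "0 < (lam :: real)"
    let ?B = "ball 0 ((3 * real CARD('n) + 3) * 2 ^ q) :: (real ^ 'n) set"
    have fm: "f \<in> borel_measurable borel"
      using ug by (auto simp: axis_upper_gradient_def intro: borel_measurable_continuous_onI)
    show "ext_norm N (truncated_level \<gamma> q lam f) \<le> ennreal (2 * C / lam) * N (\<lambda>x. G x * indicator ?B x)"
    proof (rule ext_norm_le_by_duality[OF N ac truncated_level_measurable[OF fm]])
      fix \<psi> assume \<psi>: "dual_weight N 1 \<psi>"
      obtain w where w: "dyadic_A1 (2 * C0) w" "dual_weight N 2 w" "\<And>x. \<psi> x \<le> w x"
        using rubio_de_francia[OF N C0 M \<psi>] by blast
      have "(\<integral>\<^sup>+x. \<psi> x * truncated_level \<gamma> q lam f x \<partial>lborel) \<le> (\<integral>\<^sup>+x. w x * truncated_level \<gamma> q lam f x \<partial>lborel)"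
        using w(3) by (intro nn_integral_mono mult_right_mono) auto
      also have "\<dots> \<le> ennreal (C / lam) * (\<integral>\<^sup>+x\<in>?B. ennreal (G x) * w x \<partial>lborel)"
        by (rule C(2)[OF ug w(1) lam dual_weight_wide_finite[OF N w(2)]])
      also have "(\<integral>\<^sup>+x\<in>?B. ennreal (G x) * w x \<partial>lborel) = (\<integral>\<^sup>+x. w x * ennreal \<bar>G x * indicator ?B x\<bar> \<partial>lborel)"
        using G0 by (intro nn_integral_cong) (auto simp: indicator_def mult.commute)
      also have "ennreal (C / lam) * \<dots> \<le> ennreal (C / lam) * (ennreal 2 * N (\<lambda>x. G x * indicator ?B x))"
        by (intro mult_left_mono dual_weightD[OF w(2)] borel_imp_Meas) auto
      also have "\<dots> = ennreal (2 * C / lam) * N (\<lambda>x. G x * indicator ?B x)"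
      proof -
        have "ennreal (2 * C / lam) = ennreal (C / lam) * ennreal 2"
          using C(1) lam by (subst ennreal_mult[symmetric]) (auto simp: mult.commute)
        then show ?thesis by (simp only: mult.assoc)
      qed
      finally show "(\<integral>\<^sup>+x. \<psi> x * truncated_level \<gamma> q lam f x \<partial>lborel) \<le> ennreal (2 * C / lam) * N (\<lambda>x. G x * indicator ?B x)" .
    qed
  qed
qed

lemma epowr_mono: "x \<le> y \<Longrightarrow> 0 \<le> a \<Longrightarrow> epowr x a \<le> epowr y a"
proof (cases "y = top")
  case False
  assume le: "x \<le> y" and a: "0 \<le> a"
  have y: "y < top" using False by (simp add: less_top)
  then have x: "x < top" using le by (rule le_less_trans[rotated])
  have "enn2real x \<le> enn2real y" using le y by (rule enn2real_mono)
  then show ?thesis using x y a by (auto simp: epowr_def intro!: ennreal_leI powr_mono2)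
qed (simp add: epowr_def)

lemma epowr_ennreal: "0 \<le> r \<Longrightarrow> epowr (ennreal r) a = ennreal (r powr a)"
  by (simp add: epowr_def)

lemma epowr_inverse: "0 < a \<Longrightarrow> epowr (epowr x a) (1 / a) = x"
  by (cases x) (auto simp: epowr_def powr_powr)

lemma convexified_acn:
  fixes N :: "'n::finite fnorm"
  assumes ac: "absolutely_continuous_norm N" and r: "0 < r"
  shows "absolutely_continuous_norm (convexified_norm N r)"
  unfolding absolutely_continuous_norm_def
proof (intro ballI allI impI, elim conjE)
  fix f :: "real ^ 'n \<Rightarrow> real" and E :: "nat \<Rightarrow> (real ^ 'n) set"
  assume f: "f \<in> fspace (convexified_norm N r)" and E: "\<forall>j. E j \<in> sets lebesgue"
    "AE x in lebesgue. (\<lambda>j. indicator (E j) x :: real) \<longlonglongrightarrow> 0"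
  let ?h = "\<lambda>x. \<bar>f x\<bar> powr r"
  have fm: "f \<in> Meas" using f by (simp add: fspace_def)
  have hm: "?h \<in> Meas" using fm by measurable
  have "N ?h < \<infinity>"
    using f r by (auto simp: fspace_def convexified_norm_def epowr_def less_top split: if_splits)
  then have lim: "(\<lambda>j. N (\<lambda>x. ?h x * indicator (E j) x)) \<longlonglongrightarrow> 0"
    using acn_tendsto[OF ac hm] E by blast
  have eq: "(\<lambda>x. \<bar>f x * indicator (E j) x\<bar> powr r) = (\<lambda>x. ?h x * indicator (E j) x)" for j
    by (auto simp: indicator_def)
  have fin: "\<forall>\<^sub>F j in sequentially. N (\<lambda>x. ?h x * indicator (E j) x) < 1"
    using lim by (rule order_tendstoD) simp
  have "(\<lambda>j. enn2real (N (\<lambda>x. ?h x * indicator (E j) x))) \<longlonglongrightarrow> 0"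
    by (rule tendsto_enn2real) (use lim in simp_all)
  then have "(\<lambda>j. enn2real (N (\<lambda>x. ?h x * indicator (E j) x)) powr (1 / r)) \<longlonglongrightarrow> 0"
    using r by (auto intro!: tendsto_zero_powrI[where b = "1 / r"] tendsto_const)
  then have "(\<lambda>j. ennreal (enn2real (N (\<lambda>x. ?h x * indicator (E j) x)) powr (1 / r))) \<longlonglongrightarrow> ennreal 0"
    by (rule tendsto_ennrealI)
  moreover have "\<forall>\<^sub>F j in sequentially. ennreal (enn2real (N (\<lambda>x. ?h x * indicator (E j) x)) powr (1 / r)) =
      convexified_norm N r (\<lambda>x. f x * indicator (E j) x)"
    using fin by eventually_elim (auto simp: convexified_norm_def eq epowr_def)
  ultimately show "(\<lambda>j. convexified_norm N r (\<lambda>x. f x * indicator (E j) x)) \<longlonglongrightarrow> 0"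
    by (auto intro: Lim_transform_eventually)
qed

text \<open>
  For \<open>t = 1/\<theta> > 1\<close> the estimate in \<open>X^t\<close> bounds \<open>N(F^t)\<close> by \<open>N(G^t)\<close> for the truncated level function \<open>F\<close>, with a constant that stays
  bounded as \<open>t \<rightarrow> 1\<close>. To pass to the limit, \<open>G^t\<close> is compared with \<open>G\<close>, which is possible as \<open>G\<close> is bounded on the relevant
  ball, and \<open>F\<close> with \<open>F^t\<close>, which is possible where \<open>F \<ge> \<delta>\<close>. Both comparisons become equalities in the
  limit, and finally \<open>\<delta> \<rightarrow> 0\<close>.
\<close>
lemma endpoint_truncated_level_norm:
  fixes \<gamma> :: real and N :: "'n::finite fnorm"
  assumes \<gamma>: "\<gamma> < -1 \<or> 0 < \<gamma>" and N: "ball_banach_function_space N" and ac: "absolutely_continuous_norm N"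
    and ep: "HL_endpoint_bounded_on_assoc N"
  obtains C where "0 < C" "\<And>f G lam q. axis_upper_gradient f (\<lambda>x. ennreal (G x)) \<Longrightarrow> (\<And>x. 0 \<le> G x) \<Longrightarrow>
    G \<in> borel_measurable borel \<Longrightarrow> (\<And>r. \<exists>b. \<forall>x\<in>ball 0 r. G x \<le> b) \<Longrightarrow> 0 < lam \<Longrightarrow>
    ext_norm N (truncated_level \<gamma> q lam f)
      \<le> ennreal (C / lam) * N (\<lambda>x. G x * indicator (ball 0 ((3 * real CARD('n) + 3) * 2 ^ q)) x)"
proof -
  obtain \<theta> L where \<theta>: "\<And>m::nat. 0 < \<theta> m \<and> \<theta> m < 1" "\<theta> \<longlonglongrightarrow> 1"
    and Y: "\<And>m. ball_banach_function_space (convexified_norm N (1 / \<theta> m))"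
    and L: "(\<lambda>m. operator_norm (assoc_norm (convexified_norm N (1 / \<theta> m))) HL_maximal) \<longlonglongrightarrow> ennreal L"
    using ep unfolding HL_endpoint_bounded_on_assoc_def by blast
  (* A bound for the operator norms that is valid from some index on. *)
  define C0 where "C0 = \<bar>L\<bar> + 1"
  have C0: "1 \<le> C0" by (simp add: C0_def)
  let ?Y = "\<lambda>m. convexified_norm N (1 / \<theta> m)"
  have "ennreal L < ennreal C0" by (auto simp: C0_def ennreal_less_iff ennreal_neg intro: le_less_trans[of _ "ennreal \<bar>L\<bar>"])
  then have ev: "\<forall>\<^sub>F m in sequentially. operator_norm (assoc_norm (?Y m)) HL_maximal < ennreal C0"
    using L by (intro order_tendstoD)
  have M: "ext_norm (assoc_norm (?Y m)) (HL_maximal u) \<le> ennreal C0 * assoc_norm (?Y m) u"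
    if m: "operator_norm (assoc_norm (?Y m)) HL_maximal < ennreal C0" and u: "u \<in> fspace (assoc_norm (?Y m))" for m u
  proof -
    obtain c where c: "\<forall>f\<in>fspace (assoc_norm (?Y m)). ext_norm (assoc_norm (?Y m)) (HL_maximal f) \<le> c * assoc_norm (?Y m) f" "c < ennreal C0"
      using m unfolding operator_norm_def Inf_less_iff by blast
    have "ext_norm (assoc_norm (?Y m)) (HL_maximal u) \<le> c * assoc_norm (?Y m) u" using c(1) u by blast
    also have "\<dots> \<le> ennreal C0 * assoc_norm (?Y m) u" using c(2) by (intro mult_right_mono) auto
    finally show ?thesis .
  qed
  obtain C where C: "0 < C" "\<And>(N :: 'n fnorm) f G lam q. ball_banach_function_space N \<Longrightarrow> absolutely_continuous_norm N \<Longrightarrow>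
    (\<And>u. u \<in> fspace (assoc_norm N) \<Longrightarrow> ext_norm (assoc_norm N) (HL_maximal u) \<le> ennreal C0 * assoc_norm N u) \<Longrightarrow>
    axis_upper_gradient f (\<lambda>x. ennreal (G x)) \<Longrightarrow> (\<And>x. 0 \<le> G x) \<Longrightarrow> G \<in> borel_measurable borel \<Longrightarrow> 0 < lam \<Longrightarrow>
    ext_norm N (truncated_level \<gamma> q lam f)
      \<le> ennreal (C / lam) * N (\<lambda>x. G x * indicator (ball 0 ((3 * real CARD('n) + 3) * 2 ^ q)) x)"
    using truncated_level_norm[OF \<gamma> C0, where 'n = 'n] by blast
  show ?thesis
  proof (rule that[OF C(1)])
    fix f :: "real ^ 'n \<Rightarrow> complex" and G lam q
    assume ug: "axis_upper_gradient f (\<lambda>x. ennreal (G x))" and G0: "\<And>x. 0 \<le> G x" and Gm[measurable]: "G \<in> borel_measurable borel"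
      and Gb: "\<And>r. \<exists>b. \<forall>x\<in>ball 0 r. G x \<le> b" and lam: "0 < (lam :: real)"
    let ?B = "ball 0 ((3 * real CARD('n) + 3) * 2 ^ q) :: (real ^ 'n) set"
    define h where "h x = G x * indicator ?B x" for x
    have hm[measurable]: "h \<in> borel_measurable borel" unfolding h_def by measurable
    have h0: "0 \<le> h x" for x using G0 by (simp add: h_def)
    obtain b where b: "\<And>x. x \<in> ?B \<Longrightarrow> G x \<le> b" using Gb by blast
    define M0 where "M0 = max 1 b"
    have M0: "1 \<le> M0" "h x \<le> M0" for x using b[of x] by (auto simp: M0_def h_def indicator_def)
    have Nh: "N h < \<infinity>"
    proof -
      have "N h \<le> N (\<lambda>x. M0 * indicator ?B x)"
      proof (intro bbfs_mono[OF N] borel_imp_Meas AE_I2)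
        fix x
        show "\<bar>h x\<bar> \<le> \<bar>M0 * indicator ?B x\<bar>"
          using M0(1) M0(2)[of x] h0[of x] by (cases "x \<in> ?B") (simp_all add: h_def del: mem_ball)
      qed auto
      also have "\<dots> = ennreal \<bar>M0\<bar> * N (indicator ?B)" by (intro bbfs_cmult[OF N] borel_imp_Meas) auto
      also have "\<dots> < \<infinity>" using bbfs_ball_finite[OF N] by (simp add: ennreal_mult_less_top)
      finally show ?thesis .
    qed
    define nh where "nh = enn2real (N h)"
    have nh: "N h = ennreal nh" "0 \<le> nh" using Nh by (auto simp: nh_def)
    have fm: "f \<in> borel_measurable borel"
      using ug by (auto simp: axis_upper_gradient_def intro: borel_measurable_continuous_onI)
    obtain B where B: "0 \<le> B" "\<And>x. truncated_level \<gamma> q lam f x \<le> ennreal B"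
      using truncated_level_bounded by blast
    define F where "F x = enn2real (truncated_level \<gamma> q lam f x)" for x
    have FT: "truncated_level \<gamma> q lam f x = ennreal (F x)" for x
    proof -
      have "truncated_level \<gamma> q lam f x < top" using B(2)[of x] by (rule le_less_trans) simp
      then show ?thesis by (simp add: F_def)
    qed
    have Fm[measurable]: "F \<in> borel_measurable borel"
      unfolding F_def using truncated_level_measurable[OF fm] by measurable
    have F0: "0 \<le> F x" for x by (simp add: F_def)
    have est: "N (\<lambda>x. F x * indicator {x. \<delta> \<le> F x} x)
        \<le> ennreal (\<delta> powr (1 - 1 / \<theta> m) * ((C / lam) powr (1 / \<theta> m) * (M0 powr (1 / \<theta> m - 1) * nh)))"
      if \<delta>: "0 < \<delta>" and m: "operator_norm (assoc_norm (?Y m)) HL_maximal < ennreal C0" for m \<delta>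
    proof -
      define t where "t = 1 / \<theta> m"
      have t: "1 < t" "\<theta> m = 1 / t" using \<theta>(1)[of m] by (auto simp: t_def)
      have "ext_norm (?Y m) (\<lambda>x. ennreal (F x)) \<le> ennreal (C / lam) * ?Y m h"
        unfolding FT[symmetric] h_def
        using C(2)[OF Y convexified_acn[OF ac] M[OF m] ug G0 Gm lam] \<theta>(1)[of m] by simp
      then have "?Y m F \<le> ennreal (C / lam) * ?Y m h"
        by (subst (asm) ext_norm_ennreal[OF Y borel_imp_Meas[OF Fm] F0])
      then have "epowr (?Y m F) t \<le> epowr (ennreal (C / lam) * ?Y m h) t" using t by (intro epowr_mono) auto
      moreover have "epowr (?Y m F) t = N (\<lambda>x. F x powr t)"
        using F0 t epowr_inverse[of "1 / t" "N (\<lambda>x. F x powr t)"] by (simp add: convexified_norm_def)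
      moreover have "epowr (ennreal (C / lam) * ?Y m h) t \<le> ennreal ((C / lam) powr t * (M0 powr (t - 1) * nh))"
      proof -
        have "N (\<lambda>x. h x powr t) \<le> N (\<lambda>x. M0 powr (t - 1) * h x)"
        proof (intro bbfs_mono[OF N] borel_imp_Meas AE_I2)
          fix x
          have "h x powr t = h x powr (t - 1) * h x" using h0[of x] t by (cases "h x = 0") (auto simp: powr_diff)
          also have "\<dots> \<le> M0 powr (t - 1) * h x" using h0 M0 t by (intro mult_right_mono powr_mono2) auto
          finally show "\<bar>h x powr t\<bar> \<le> \<bar>M0 powr (t - 1) * h x\<bar>" using h0 by (simp add: abs_mult)
        qed auto
        also have "\<dots> = ennreal (M0 powr (t - 1) * nh)"
          using nh by (subst bbfs_cmult[OF N borel_imp_Meas[OF hm]]) (simp add: ennreal_mult)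
        finally have "?Y m h \<le> epowr (ennreal (M0 powr (t - 1) * nh)) (1 / t)"
          using h0 t by (auto simp: convexified_norm_def intro!: epowr_mono)
        also have "\<dots> = ennreal ((M0 powr (t - 1) * nh) powr (1 / t))"
          using nh by (intro epowr_ennreal) auto
        finally have "ennreal (C / lam) * ?Y m h \<le> ennreal (C / lam) * ennreal ((M0 powr (t - 1) * nh) powr (1 / t))"
          by (intro mult_left_mono) auto
        also have "\<dots> = ennreal (C / lam * (M0 powr (t - 1) * nh) powr (1 / t))"
          using C(1) lam by (subst ennreal_mult[symmetric]) auto
        finally have "epowr (ennreal (C / lam) * ?Y m h) t \<le> epowr (ennreal (C / lam * (M0 powr (t - 1) * nh) powr (1 / t))) t"
          using t by (intro epowr_mono) auto
        also have "\<dots> = ennreal ((C / lam * (M0 powr (t - 1) * nh) powr (1 / t)) powr t)"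
          using C(1) lam by (intro epowr_ennreal) auto
        also have "(C / lam * (M0 powr (t - 1) * nh) powr (1 / t)) powr t = (C / lam) powr t * (M0 powr (t - 1) * nh)"
        proof -
          define z where "z = M0 powr (t - 1) * nh"
          have "0 \<le> z" using nh by (simp add: z_def)
          then have "(C / lam * z powr (1 / t)) powr t = (C / lam) powr t * z"
            using C(1) lam t by (subst powr_mult) (auto simp: powr_powr)
          then show ?thesis by (simp add: z_def)
        qed
        finally show ?thesis .
      qed
      ultimately have NF: "N (\<lambda>x. F x powr t) \<le> ennreal ((C / lam) powr t * (M0 powr (t - 1) * nh))" by simp
      have "N (\<lambda>x. F x * indicator {x. \<delta> \<le> F x} x) \<le> N (\<lambda>x. \<delta> powr (1 - t) * F x powr t)"
      proof (intro bbfs_mono[OF N] borel_imp_Meas AE_I2)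
        fix x
        have "F x \<le> \<delta> powr (1 - t) * F x powr t" if "\<delta> \<le> F x"
        proof -
          have "F x powr (1 - t) \<le> \<delta> powr (1 - t)" using that \<delta> t by (intro powr_mono2') auto
          then have "F x powr (1 - t) * F x powr t \<le> \<delta> powr (1 - t) * F x powr t" by (intro mult_right_mono) auto
          then show ?thesis using that \<delta> by (simp add: powr_add[symmetric])
        qed
        then show "\<bar>F x * indicator {x. \<delta> \<le> F x} x\<bar> \<le> \<bar>\<delta> powr (1 - t) * F x powr t\<bar>"
          using F0 by (auto simp: indicator_def)
      qed auto
      also have "\<dots> = ennreal (\<delta> powr (1 - t)) * N (\<lambda>x. F x powr t)"
        by (subst bbfs_cmult[OF N borel_imp_Meas]) auto
      also have "\<dots> \<le> ennreal (\<delta> powr (1 - t)) * ennreal ((C / lam) powr t * (M0 powr (t - 1) * nh))"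
        by (intro mult_left_mono NF) auto
      also have "\<dots> = ennreal (\<delta> powr (1 - t) * ((C / lam) powr t * (M0 powr (t - 1) * nh)))"
        using nh C(1) lam by (simp add: ennreal_mult)
      finally show ?thesis by (simp add: t_def)
    qed
    have lim: "N (\<lambda>x. F x * indicator {x. \<delta> \<le> F x} x) \<le> ennreal (C / lam * nh)" if \<delta>: "0 < \<delta>" for \<delta>
    proof (rule tendsto_lowerbound)
      have "(\<lambda>m. 1 / \<theta> m) \<longlonglongrightarrow> 1 / 1" by (intro tendsto_intros \<theta>) auto
      then have lt: "(\<lambda>m. 1 / \<theta> m) \<longlonglongrightarrow> 1" by simp
      have "(\<lambda>m. \<delta> powr (1 - 1 / \<theta> m) * ((C / lam) powr (1 / \<theta> m) * (M0 powr (1 / \<theta> m - 1) * nh)))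
        \<longlonglongrightarrow> \<delta> powr (1 - 1) * ((C / lam) powr 1 * (M0 powr (1 - 1) * nh))"
        using \<delta> C(1) lam M0(1) by (intro tendsto_intros lt) auto
      then show "(\<lambda>m. ennreal (\<delta> powr (1 - 1 / \<theta> m) * ((C / lam) powr (1 / \<theta> m) * (M0 powr (1 / \<theta> m - 1) * nh)))) \<longlonglongrightarrow> ennreal (C / lam * nh)"
        using \<delta> C(1) lam M0(1) by (intro tendsto_ennrealI) simp
      show "\<forall>\<^sub>F m in sequentially. N (\<lambda>x. F x * indicator {x. \<delta> \<le> F x} x) \<le>
        ennreal (\<delta> powr (1 - 1 / \<theta> m) * ((C / lam) powr (1 / \<theta> m) * (M0 powr (1 / \<theta> m - 1) * nh)))"
        using ev by eventually_elim (rule est[OF \<delta>])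
    qed simp
    let ?H = "\<lambda>j x. F x * indicator {x. 1 / real (Suc j) \<le> F x} x"
    have "ext_norm N (truncated_level \<gamma> q lam f) \<le> ennreal (C / lam * nh)"
    proof (rule ext_norm_fatou[OF N])
      show "(\<lambda>x. ennreal (?H j x)) \<in> borel_measurable lebesgue" for j by (intro measurable_completion) measurable
      show "truncated_level \<gamma> q lam f \<in> borel_measurable lebesgue"
        using truncated_level_measurable[OF fm] by (intro measurable_completion) simp
      show "ext_norm N (\<lambda>x. ennreal (?H j x)) \<le> ennreal (C / lam * nh)" for j
      proof -
        have "?H j \<in> borel_measurable borel" by measurable
        then have "ext_norm N (\<lambda>x. ennreal (?H j x)) = N (?H j)"
          using F0 by (intro ext_norm_ennreal[OF N borel_imp_Meas]) auto
        also have "\<dots> \<le> ennreal (C / lam * nh)" by (rule lim) simp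
        finally show ?thesis .
      qed
      have "(\<lambda>j. ennreal (?H j x)) \<longlonglongrightarrow> truncated_level \<gamma> q lam f x" for x
      proof (cases "F x = 0")
        case True then show ?thesis by (simp add: FT)
      next
        case False
        then obtain i where i: "1 / real (Suc i) < F x" using F0[of x] nat_approx_posE[of "F x"] by (metis less_eq_real_def)
        have "\<forall>\<^sub>F j in sequentially. ennreal (F x) = ennreal (?H j x)"
          using eventually_ge_at_top[of i]
        proof eventually_elim
          case (elim j)
          have "1 / real (Suc j) \<le> 1 / real (Suc i)" using elim by (intro divide_left_mono) auto
          then show ?case using i by (simp add: indicator_def)
        qed
        then show ?thesis unfolding FT by (rule Lim_transform_eventually[OF tendsto_const])
      qed
      then show "AE x in lebesgue. truncated_level \<gamma> q lam f x \<le> liminf (\<lambda>j. ennreal (?H j x))"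
        by (intro AE_I2) (metis lim_imp_Liminf order_refl sequentially_bot)
    qed
    also have "\<dots> = ennreal (C / lam) * N (\<lambda>x. G x * indicator ?B x)"
    proof -
      have "N (\<lambda>x. G x * indicator ?B x) = ennreal nh" using nh by (simp add: h_def[abs_def])
      then show ?thesis using nh(2) C(1) lam by (simp only:) (subst ennreal_mult[symmetric], auto)
    qed
    finally show "ext_norm N (truncated_level \<gamma> q lam f) \<le> ennreal (C / lam) * N (\<lambda>x. G x * indicator ?B x)" .
  qed
qed

lemma ball_ge_cube:
  fixes x :: "real ^ 'n::finite"
  assumes "0 < r"
  shows "ennreal ((r / real CARD('n)) ^ CARD('n)) \<le> emeasure lborel (ball x r)"
proof -
  let ?n = "real CARD('n)"
  let ?a = "\<chi> i. x $ i - r / (2 * ?n)"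
  have "cbox ?a (?a + (\<chi> i. r / ?n)) \<subseteq> ball x r"
  proof
    fix y assume y: "y \<in> cbox ?a (?a + (\<chi> i. r / ?n))"
    have "\<bar>(x - y) $ i\<bar> \<le> r / (2 * ?n)" for i
    proof -
      have "x $ i - r / (2 * ?n) \<le> y $ i" "y $ i \<le> x $ i - r / (2 * ?n) + r / ?n" using y by (auto simp: mem_box_cart)
      moreover have "r / ?n = 2 * (r / (2 * ?n))" by simp
      ultimately show ?thesis unfolding vector_minus_component by linarith
    qed
    then have "(\<Sum>i\<in>UNIV. \<bar>(x - y) $ i\<bar>) \<le> (\<Sum>i\<in>(UNIV :: 'n set). r / (2 * ?n))" by (intro sum_mono)
    then have "norm (x - y) \<le> r / 2" using norm_le_l1_cart[of "x - y"] by simp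
    then show "y \<in> ball x r" using assms by (simp add: dist_norm)
  qed
  then have "emeasure lborel (cbox ?a (?a + (\<chi> i. r / ?n))) \<le> emeasure lborel (ball x r)"
    by (intro emeasure_mono) auto
  then show ?thesis using assms by (simp add: emeasure_cube)
qed

lemma ball_average_borel:
  fixes h :: "real ^ 'n::finite \<Rightarrow> real"
  assumes "AE x in lborel. h x = h' x"
  shows "ball_average r h x = (\<integral>\<^sup>+y\<in>ball x r. ennreal \<bar>h' y\<bar> \<partial>lborel) / emeasure lborel (ball (0 :: real ^ 'n) r)"
proof -
  have "emeasure lebesgue (ball x r) = emeasure lborel (ball (0 :: real ^ 'n) r)"
    using emeasure_lebesgue_affine[of 1 x "ball 0 r"] image_add_ball[of x 0 r] by (simp add: add.commute)
  moreover have "(\<integral>\<^sup>+y\<in>ball x r. ennreal \<bar>h y\<bar> \<partial>lebesgue) = (\<integral>\<^sup>+y\<in>ball x r. ennreal \<bar>h' y\<bar> \<partial>lborel)"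
    unfolding nn_integral_completion using assms by (intro nn_integral_cong_AE) (auto elim!: eventually_mono)
  ultimately show ?thesis by (simp add: ball_average_def)
qed

lemma ball_average_measurable:
  fixes h :: "real ^ 'n::finite \<Rightarrow> real"
  assumes h: "h \<in> Meas"
  shows "ball_average r h \<in> borel_measurable borel"
proof -
  obtain h' where h'[measurable]: "h' \<in> borel_measurable borel" and ae: "AE x in lborel. h x = h' x"
    using completion_ex_borel_measurable_real[OF h] by auto
  have "(\<lambda>z :: (real ^ 'n) \<times> (real ^ 'n). ennreal \<bar>h' (snd z)\<bar> * (if norm (fst z - snd z) < r then 1 else 0)) \<in> borel_measurable (lborel \<Otimes>\<^sub>M lborel)"
    by measurable
  from lborel.borel_measurable_nn_integral_fst[OF this]
  have "(\<lambda>x. \<integral>\<^sup>+y. ennreal \<bar>h' y\<bar> * (if norm (x - y) < r then 1 else 0) \<partial>lborel) \<in> borel_measurable borel" by simp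
  also have "(\<lambda>x. \<integral>\<^sup>+y. ennreal \<bar>h' y\<bar> * (if norm (x - y) < r then 1 else 0) \<partial>lborel) = (\<lambda>x. \<integral>\<^sup>+y\<in>ball x r. ennreal \<bar>h' y\<bar> \<partial>lborel)"
    by (intro ext nn_integral_cong) (auto simp: dist_norm)
  finally have [measurable]: "(\<lambda>x. \<integral>\<^sup>+y\<in>ball x r. ennreal \<bar>h' y\<bar> \<partial>lborel) \<in> borel_measurable borel" .
  have "ball_average r h = (\<lambda>x. (\<integral>\<^sup>+y\<in>ball x r. ennreal \<bar>h' y\<bar> \<partial>lborel) / emeasure lborel (ball (0 :: real ^ 'n) r))"
    using ball_average_borel[OF ae] by auto
  then show ?thesis by simp
qed

text \<open>
  Ball averages are symmetric, so they can be moved to the dual function, where they are dominated by the maximal function.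
\<close>
lemma ball_averages_bounded_by_duality:
  fixes N :: "'n::finite fnorm"
  assumes N: "ball_banach_function_space N" and ac: "absolutely_continuous_norm N" and C0: "1 \<le> C0"
    and M: "\<And>u. u \<in> fspace (assoc_norm N) \<Longrightarrow> ext_norm (assoc_norm N) (HL_maximal u) \<le> ennreal C0 * assoc_norm N u"
  shows "ball_averages_uniformly_bounded N"
  unfolding ball_averages_uniformly_bounded_def
proof (intro exI allI impI ballI)
  let ?n = "CARD('n)" and ?c = "(6 * real CARD('n)) ^ CARD('n)"
  fix r :: real and h assume r: "0 < r" and h: "h \<in> fspace N"
  then have hM: "h \<in> Meas" by (simp add: fspace_def)
  obtain h' where h'[measurable]: "h' \<in> borel_measurable borel" and ae: "AE x in lborel. h x = h' x"
    using completion_ex_borel_measurable_real[OF hM] by auto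
  define v where "v = emeasure lborel (ball (0 :: real ^ 'n) r)"
  have v: "ennreal ((r / real ?n) ^ ?n) \<le> v" "v < top" unfolding v_def using ball_ge_cube[OF r, of "0 :: real ^ 'n"] emeasure_lborel_ball_finite[of "0 :: real ^ 'n" r] by auto
  show "ext_norm N (ball_average r h) \<le> ennreal (?c * C0) * N h"
  proof (rule ext_norm_le_by_duality[OF N ac ball_average_measurable[OF hM]])
    fix \<psi> assume \<psi>: "dual_weight N 1 \<psi>"
    then have \<psi>m[measurable]: "\<psi> \<in> borel_measurable borel" by (simp add: dual_weight_def)
    have D: "dual_weight N C0 (dyadic_maximal \<psi>)" using dual_weight_dyadic_maximal[OF N C0 _ M \<psi>] by simp
    have avg: "(\<integral>\<^sup>+x\<in>ball y r. \<psi> x \<partial>lborel) \<le> ennreal ?c * v * dyadic_maximal \<psi> y" for y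
    proof -
      define k where "k = \<lceil>log 2 r\<rceil>"
      have k1: "r \<le> dyadic k"
      proof -
        have "log 2 r \<le> of_int k" by (simp add: k_def)
        then show ?thesis using r by (simp add: log_le_iff)
      qed
      have k2: "dyadic k < 2 * r"
      proof -
        have "of_int k - 1 < log 2 r" unfolding k_def by linarith
        then have "2 powr (of_int k - 1) < r" using r by (simp add: less_log_iff)
        then show ?thesis by (simp add: powr_diff)
      qed
      have sub: "ball y r \<subseteq> star k (cell k y)"
      proof
        fix x assume "x \<in> ball y r"
        then have nx: "norm (x - y) \<le> dyadic k" using k1 by (simp add: dist_norm norm_minus_commute)
        have "x \<in> dyadic_box k (cell k x) 0"
          using half_cell_subset[of "(k, cell k x)"] by (auto simp: half_cell_def)
        then show "x \<in> star k (cell k y)" using star_contains_neighbour[OF nx] by blast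
      qed
      have "(\<integral>\<^sup>+x\<in>ball y r. \<psi> x \<partial>lborel) \<le> (\<integral>\<^sup>+x\<in>star k (cell k y). \<psi> x \<partial>lborel)"
        using sub by (intro nn_integral_mono) (auto simp: indicator_def)
      also have "\<dots> \<le> emeasure lborel (star k (cell k y)) * dyadic_maximal \<psi> y"
        using mem_star_cell[of y k] unfolding star_def by (rule dyadic_maximal_ge)
      also have "\<dots> \<le> (ennreal ?c * v) * dyadic_maximal \<psi> y"
      proof (intro mult_right_mono)
        have "(3 * dyadic k) ^ ?n \<le> (6 * r) ^ ?n" using k2 by (intro power_mono) auto
        also have "(6 * r) ^ ?n = ?c * (r / real ?n) ^ ?n" unfolding power_mult_distrib[symmetric] by simp
        finally have "ennreal ((3 * dyadic k) ^ ?n) \<le> ennreal (?c * (r / real ?n) ^ ?n)" by (rule ennreal_leI)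
        also have "\<dots> = ennreal ?c * ennreal ((r / real ?n) ^ ?n)" using r by (intro ennreal_mult) auto
        also have "\<dots> \<le> ennreal ?c * v" using v by (intro mult_left_mono) auto
        finally show "emeasure lborel (star k (cell k y)) \<le> ennreal ?c * v" by (simp add: emeasure_star)
      qed simp
      finally show ?thesis .
    qed
    have sym: "indicator (ball x r) y = (if norm (x - y) < r then 1 else 0 :: ennreal)" for x y :: "real ^ 'n"
      by (auto simp: dist_norm)
    have [measurable]: "(\<lambda>z. \<psi> (fst z) * (ennreal \<bar>h' (snd z)\<bar> * (if norm (fst z - snd z) < r then 1 else 0))) \<in> borel_measurable (lborel \<Otimes>\<^sub>M lborel)"
      by measurable
    have i1: "(\<lambda>y. ennreal \<bar>h' y\<bar> * indicator (ball x r) y) \<in> borel_measurable lborel" for x by measurable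
    have "(\<integral>\<^sup>+x. \<psi> x * ball_average r h x \<partial>lborel) = (\<integral>\<^sup>+x. inverse v * (\<integral>\<^sup>+y. \<psi> x * (ennreal \<bar>h' y\<bar> * (if norm (x - y) < r then 1 else 0)) \<partial>lborel) \<partial>lborel)"
      using i1 by (intro nn_integral_cong)
        (simp add: ball_average_borel[OF ae] v_def[symmetric] divide_ennreal_def nn_integral_cmult sym[symmetric] mult_ac)
    also have "\<dots> = inverse v * (\<integral>\<^sup>+x. (\<integral>\<^sup>+y. \<psi> x * (ennreal \<bar>h' y\<bar> * (if norm (x - y) < r then 1 else 0)) \<partial>lborel) \<partial>lborel)"
      using lborel.borel_measurable_nn_integral_fst[of "\<lambda>z. \<psi> (fst z) * (ennreal \<bar>h' (snd z)\<bar> * (if norm (fst z - snd z) < r then 1 else 0))" lborel]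
      by (intro nn_integral_cmult) simp
    also have "(\<integral>\<^sup>+x. (\<integral>\<^sup>+y. \<psi> x * (ennreal \<bar>h' y\<bar> * (if norm (x - y) < r then 1 else 0)) \<partial>lborel) \<partial>lborel)
       = (\<integral>\<^sup>+y. (\<integral>\<^sup>+x. \<psi> x * (ennreal \<bar>h' y\<bar> * (if norm (x - y) < r then 1 else 0)) \<partial>lborel) \<partial>lborel)"
      by (rule lborel_pair.Fubini'[symmetric]) (simp add: case_prod_beta)
    also have "\<dots> = (\<integral>\<^sup>+y. ennreal \<bar>h' y\<bar> * (\<integral>\<^sup>+x\<in>ball y r. \<psi> x \<partial>lborel) \<partial>lborel)"
    proof (rule nn_integral_cong)
      fix y
      have "(\<integral>\<^sup>+x. \<psi> x * (ennreal \<bar>h' y\<bar> * (if norm (x - y) < r then 1 else 0)) \<partial>lborel)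
        = (\<integral>\<^sup>+x. ennreal \<bar>h' y\<bar> * (\<psi> x * indicator (ball y r) x) \<partial>lborel)"
        unfolding sym norm_minus_commute[of y] by (intro nn_integral_cong) (simp add: mult_ac)
      then show "(\<integral>\<^sup>+x. \<psi> x * (ennreal \<bar>h' y\<bar> * (if norm (x - y) < r then 1 else 0)) \<partial>lborel) = ennreal \<bar>h' y\<bar> * (\<integral>\<^sup>+x\<in>ball y r. \<psi> x \<partial>lborel)"
        by (simp add: nn_integral_cmult)
    qed
    also have "\<dots> \<le> (\<integral>\<^sup>+y. ennreal ?c * v * (dyadic_maximal \<psi> y * ennreal \<bar>h' y\<bar>) \<partial>lborel)"
    proof (rule nn_integral_mono)
      fix y
      have "ennreal \<bar>h' y\<bar> * (\<integral>\<^sup>+x\<in>ball y r. \<psi> x \<partial>lborel) \<le> ennreal \<bar>h' y\<bar> * (ennreal ?c * v * dyadic_maximal \<psi> y)"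
        by (intro mult_left_mono avg) auto
      then show "ennreal \<bar>h' y\<bar> * (\<integral>\<^sup>+x\<in>ball y r. \<psi> x \<partial>lborel) \<le> ennreal ?c * v * (dyadic_maximal \<psi> y * ennreal \<bar>h' y\<bar>)"
        by (simp add: mult_ac)
    qed
    also have "\<dots> = ennreal ?c * v * (\<integral>\<^sup>+y. dyadic_maximal \<psi> y * ennreal \<bar>h' y\<bar> \<partial>lborel)"
      by (intro nn_integral_cmult) measurable
    also have "\<dots> \<le> ennreal ?c * v * (ennreal C0 * N h')"
      by (intro mult_left_mono dual_weightD[OF D] borel_imp_Meas) auto
    also have "N h' \<le> N h"
      using ae by (intro bbfs_mono[OF N hM borel_imp_Meas[OF h']]) (auto intro!: AE_completion elim: eventually_mono)
    then have "ennreal ?c * v * (ennreal C0 * N h') \<le> ennreal ?c * v * (ennreal C0 * N h)" by (intro mult_left_mono) auto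
    finally have "(\<integral>\<^sup>+x. \<psi> x * ball_average r h x \<partial>lborel) \<le> inverse v * (ennreal ?c * v * (ennreal C0 * N h))"
      by (simp add: mult_left_mono)
    also have "\<dots> = (inverse v * v) * (ennreal ?c * ennreal C0) * N h" by (simp only: mult_ac)
    also have "inverse v * v = 1"
    proof -
      have "0 < (r / real ?n) ^ ?n" using r by simp
      then have "0 < ennreal ((r / real ?n) ^ ?n)" by (simp only: ennreal_less_zero_iff)
      then have "v \<noteq> 0" using v(1) by (metis leD)
      then show ?thesis using v(2) ennreal_divide_self[of v] by (simp add: divide_ennreal_def mult.commute)
    qed
    also have "1 * (ennreal ?c * ennreal C0) * N h = ennreal (?c * C0) * N h"
      using C0 by (simp add: ennreal_mult)
    finally show "(\<integral>\<^sup>+x. \<psi> x * ball_average r h x \<partial>lborel) \<le> ennreal (?c * C0) * N h" .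
  qed
qed

section \<open>Smooth bump functions\<close>

text \<open>
  The powers of \<open>t\<close> in the denominator make the family closed under differentiation, so that smoothness of
  \<open>bump 0\<close> follows by induction.
\<close>
definition bump :: "nat \<Rightarrow> real \<Rightarrow> real" where
  "bump m t = (if 0 < t then exp (- (1 / t)) / t ^ m else 0)"

lemma bump_nonneg: "0 \<le> bump m t" by (simp add: bump_def)

text \<open>
  The exponential function beats every power.
\<close>
lemma bump_quotient_tendsto_0: "((\<lambda>t. bump m t) \<longlongrightarrow> 0) (at 0)"
proof -
  have "((\<lambda>t. bump m t) \<longlongrightarrow> 0) (at_left 0)"
    by (rule tendsto_eventually) (auto simp: eventually_at_filter bump_def)
  moreover have "((\<lambda>t. bump m t) \<longlongrightarrow> 0) (at_right 0)"
  proof -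
    have "((\<lambda>t. inverse t ^ m / exp (inverse t)) \<longlongrightarrow> 0) (at_right (0::real))"
      by (rule filterlim_compose[OF tendsto_power_div_exp_0 filterlim_inverse_at_top_right])
    moreover have "\<forall>\<^sub>F t in at_right (0::real). inverse t ^ m / exp (inverse t) = bump m t"
      by (auto simp: eventually_at_filter bump_def exp_minus field_simps power_divide)
    ultimately show ?thesis by (rule Lim_transform_eventually)
  qed
  ultimately show ?thesis by (simp add: filterlim_at_split)
qed

lemma bump_derivative:
  "(bump m has_real_derivative (bump (m + 2) t - real m * bump (m + 1) t)) (at t)"
proof (cases t "0::real" rule: linorder_cases)
  case less
  have "\<forall>\<^sub>F s in nhds t. bump m s = 0"
    using eventually_nhds_in_open[of "{..<0}" t] less by (auto elim!: eventually_mono simp: bump_def)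
  then show ?thesis using less
    by (subst DERIV_cong_ev[OF refl _ refl, of _ "\<lambda>_. 0"]) (auto simp: bump_def)
next
  case greater
  have ev: "\<forall>\<^sub>F s in nhds t. bump m s = exp (- (1 / s)) / s ^ m"
    using eventually_nhds_in_open[of "{0<..}" t] greater by (auto elim!: eventually_mono simp: bump_def)
  have "((\<lambda>s. exp (- (1 / s)) / s ^ m) has_real_derivative (bump (m + 2) t - real m * bump (m + 1) t)) (at t)"
  proof (rule DERIV_cong[OF DERIV_divide[OF _ DERIV_pow]])
    show "((\<lambda>s. exp (- (1 / s))) has_real_derivative exp (- (1 / t)) / t\<^sup>2) (at t)"
      using greater by (auto intro!: derivative_eq_intros simp: power2_eq_square)
    show "(exp (- (1 / t)) / t\<^sup>2 * t ^ m - exp (- (1 / t)) * (real m * t ^ (m - Suc 0))) / (t ^ m * t ^ m) =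
        bump (m + 2) t - real m * bump (m + 1) t"
      using greater by (cases m) (simp_all add: bump_def field_simps power2_eq_square)
  qed (use greater in simp)
  then show ?thesis by (subst DERIV_cong_ev[OF refl ev refl])
next
  case equal
  have "((\<lambda>h. (bump m (0 + h) - bump m 0) / h) \<longlongrightarrow> 0) (at 0)"
  proof (rule Lim_transform_eventually[OF bump_quotient_tendsto_0[of "m + 1"]])
    show "\<forall>\<^sub>F h in at 0. bump (m + 1) h = (bump m (0 + h) - bump m 0) / h"
      by (auto simp: eventually_at_filter bump_def)
  qed
  then show ?thesis unfolding equal by (simp add: DERIV_def bump_def)
qed

lemma bump_continuous: "continuous_on UNIV (bump m)"
  using bump_derivative by (meson DERIV_isCont continuous_at_imp_continuous_on)

lemma C_diff_Suc_imp: "C_diff (Suc k) \<phi> \<Longrightarrow> C_diff k \<phi>"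
proof (induction k arbitrary: \<phi>)
  case 0
  then show ?case by (auto intro!: continuous_at_imp_continuous_on differentiable_imp_continuous_within)
next
  case (Suc k)
  then show ?case by (metis C_diff.simps(2))
qed

lemma C_diff_const: "C_diff k (\<lambda>x. c)"
  by (induction k arbitrary: c) (auto simp: frechet_derivative_const)

lemma C_diff_add: "C_diff k \<phi> \<Longrightarrow> C_diff k \<psi> \<Longrightarrow> C_diff k (\<lambda>x. \<phi> x + \<psi> x)"
proof (induction k arbitrary: \<phi> \<psi>)
  case (Suc k)
  have "partial_deriv i (\<lambda>x. \<phi> x + \<psi> x) = (\<lambda>x. partial_deriv i \<phi> x + partial_deriv i \<psi> x)" for i
  proof
    fix x
    have "\<phi> differentiable at x" "\<psi> differentiable at x" using Suc.prems by auto
    then have "((\<lambda>x. \<phi> x + \<psi> x) has_derivative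
        (\<lambda>h. frechet_derivative \<phi> (at x) h + frechet_derivative \<psi> (at x) h)) (at x)"
      by (intro has_derivative_add) (auto simp: frechet_derivative_works[symmetric])
    from frechet_derivative_at[OF this, symmetric]
    show "partial_deriv i (\<lambda>x. \<phi> x + \<psi> x) x = partial_deriv i \<phi> x + partial_deriv i \<psi> x" by simp
  qed
  then show ?case using Suc by simp
qed (auto intro: continuous_on_add)

lemma C_diff_mult: "C_diff k \<phi> \<Longrightarrow> C_diff k \<psi> \<Longrightarrow> C_diff k (\<lambda>x. \<phi> x * \<psi> x)"
proof (induction k arbitrary: \<phi> \<psi>)
  case (Suc k)
  have "partial_deriv i (\<lambda>x. \<phi> x * \<psi> x) = (\<lambda>x. \<phi> x * partial_deriv i \<psi> x + partial_deriv i \<phi> x * \<psi> x)" for i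
  proof
    fix x
    have "\<phi> differentiable at x" "\<psi> differentiable at x" using Suc.prems by auto
    then have "((\<lambda>x. \<phi> x * \<psi> x) has_derivative
        (\<lambda>h. \<phi> x * frechet_derivative \<psi> (at x) h + frechet_derivative \<phi> (at x) h * \<psi> x)) (at x)"
      by (intro has_derivative_mult) (auto simp: frechet_derivative_works[symmetric])
    from frechet_derivative_at[OF this, symmetric]
    show "partial_deriv i (\<lambda>x. \<phi> x * \<psi> x) x = \<phi> x * partial_deriv i \<psi> x + partial_deriv i \<phi> x * \<psi> x" by simp
  qed
  then show ?case using Suc.IH Suc.prems C_diff_Suc_imp[OF Suc.prems(1)] C_diff_Suc_imp[OF Suc.prems(2)]
    by (auto intro!: C_diff_add differentiable_mult)
qed (auto intro: continuous_on_mult)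

lemma C_diff_coordinate: "C_diff k (\<lambda>x :: real ^ 'n::finite. x $ i)"
proof (cases k)
  case (Suc l)
  have d: "((\<lambda>x :: real ^ 'n. x $ i) has_derivative (\<lambda>h. h $ i)) (at x)" for x
    by (rule bounded_linear_imp_has_derivative) (rule bounded_linear_vec_nth)
  have "partial_deriv j (\<lambda>x :: real ^ 'n. x $ i) = (\<lambda>x. axis j 1 $ i)" for j
    by (rule ext) (simp add: frechet_derivative_at[OF d, symmetric])
  then show ?thesis using d Suc C_diff_const by (auto simp: differentiable_def)
qed (auto intro: continuous_intros)

definition radial_bump :: "nat \<Rightarrow> real \<Rightarrow> real ^ 'n::finite \<Rightarrow> real ^ 'n \<Rightarrow> real" where
  "radial_bump m a u y = bump m (1 - a * ((y - u) \<bullet> (y - u)))"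

lemma radial_bump_derivative:
  "(radial_bump m a u has_derivative (\<lambda>h. (- 2 * a * ((y - u) \<bullet> h)) *
     (radial_bump (m + 2) a u y - real m * radial_bump (m + 1) a u y))) (at y)"
proof -
  have 1: "((\<lambda>y. 1 - a * ((y - u) \<bullet> (y - u))) has_derivative (\<lambda>h. - (a * (2 * ((y - u) \<bullet> h))))) (at y)"
    by (auto intro!: derivative_eq_intros simp: inner_commute algebra_simps)
  have 2: "(bump m has_derivative (\<lambda>h. h * (bump (m + 2) (1 - a * ((y - u) \<bullet> (y - u))) - real m * bump (m + 1) (1 - a * ((y - u) \<bullet> (y - u))))))
     (at (1 - a * ((y - u) \<bullet> (y - u))))"
    by (rule has_derivative_eq_rhs[OF bump_derivative[unfolded has_field_derivative_def]]) (simp add: fun_eq_iff mult.commute)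
  show ?thesis unfolding radial_bump_def[abs_def]
    by (rule has_derivative_eq_rhs[OF has_derivative_compose[OF 1 2]]) (simp add: fun_eq_iff mult_ac)
qed

lemma partial_deriv_radial_bump:
  "partial_deriv i (radial_bump m a u) y = (- 2 * a * (y $ i - u $ i)) * (radial_bump (m + 2) a u y - real m * radial_bump (m + 1) a u y)"
  unfolding frechet_derivative_at[OF radial_bump_derivative, symmetric] by (simp add: inner_axis)

lemma C_diff_radial_bump: "C_diff k (radial_bump m a u)"
proof (induction k arbitrary: m)
  case 0
  show ?case unfolding C_diff.simps(1) radial_bump_def[abs_def]
    by (intro continuous_on_compose2[OF bump_continuous] continuous_intros) auto
next
  case (Suc k)
  have "C_diff k (\<lambda>y. (- 2 * a * (y $ i + (- 1) * u $ i)) * (radial_bump (m + 2) a u y + (- real m) * radial_bump (m + 1) a u y))" for i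
    by (intro C_diff_mult C_diff_add C_diff_const C_diff_coordinate Suc)
  moreover have "radial_bump m a u differentiable at x" for x
    by (rule differentiableI[OF radial_bump_derivative])
  ultimately show ?case by (simp add: partial_deriv_radial_bump[abs_def])
qed

section \<open>Mollification of Sobolev functions\<close>

definition bump_mass :: "'n::finite itself \<Rightarrow> real \<Rightarrow> real" where
  "bump_mass _ e = (\<integral>y. radial_bump 0 (1 / e\<^sup>2) (0 :: real ^ 'n) y \<partial>lborel)"

definition mollifier :: "real \<Rightarrow> real ^ 'n::finite \<Rightarrow> real ^ 'n \<Rightarrow> real" where
  "mollifier e u y = (1 / bump_mass TYPE('n) e) * radial_bump 0 (1 / e\<^sup>2) u y"

lemma radial_bump_support: "0 < e \<Longrightarrow> e \<le> norm (y - u) \<Longrightarrow> radial_bump m (1 / e\<^sup>2) u y = 0"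
proof -
  assume e: "0 < e" and le: "e \<le> norm (y - u)"
  have "e\<^sup>2 \<le> (norm (y - u))\<^sup>2" using e le by (intro power_mono) auto
  then have "1 - 1 / e\<^sup>2 * ((y - u) \<bullet> (y - u)) \<le> 0" using e by (simp add: power2_norm_eq_inner field_simps)
  then show ?thesis by (simp add: radial_bump_def bump_def)
qed

lemma radial_bump_le_1: "radial_bump 0 a u y \<le> 1"
  by (simp add: radial_bump_def bump_def)

lemma radial_bump_nonneg: "0 \<le> radial_bump m a u y"
  by (simp add: radial_bump_def bump_nonneg)

lemma radial_bump_measurable [measurable]:
  "(\<lambda>p. radial_bump m a (fst p) (snd p)) \<in> borel_measurable (borel \<Otimes>\<^sub>M borel)"
  unfolding borel_prod radial_bump_def
  by (intro borel_measurable_continuous_onI continuous_on_compose2[OF bump_continuous] continuous_intros) auto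

lemma radial_bump_measurable_1 [measurable]: "radial_bump m a u \<in> borel_measurable borel"
  using C_diff_radial_bump[of 0 m a u] by (intro borel_measurable_continuous_onI) simp

lemma radial_bump_integrable:
  assumes e: "0 < e"
  shows "integrable lborel (radial_bump 0 (1 / e\<^sup>2) (u :: real ^ 'n::finite))"
proof (rule Bochner_Integration.integrable_bound)
  show "integrable lborel (indicator (ball u e) :: real ^ 'n \<Rightarrow> real)"
    by (intro integrable_real_indicator) (use emeasure_lborel_ball_finite[of u e] in auto)
  show "AE y in lborel. norm (radial_bump 0 (1 / e\<^sup>2) u y) \<le> norm (indicator (ball u e) y :: real)"
    using radial_bump_le_1[of "1 / e\<^sup>2" u] radial_bump_nonneg[of 0 "1 / e\<^sup>2" u] radial_bump_support[OF e, of _ u 0]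
    by (intro AE_I2) (auto simp: indicator_def dist_norm norm_minus_commute not_less)
qed measurable

lemma radial_bump_shift: "radial_bump m a u y = radial_bump m a 0 (y - u)"
  by (simp add: radial_bump_def)

lemma radial_bump_integral:
  "(\<integral>y. radial_bump 0 (1 / e\<^sup>2) (u :: real ^ 'n::finite) y \<partial>lborel) = bump_mass TYPE('n) e"
proof -
  have "(\<integral>y. radial_bump 0 (1 / e\<^sup>2) 0 y \<partial>distr lborel borel ((+) (- u))) = (\<integral>y. radial_bump 0 (1 / e\<^sup>2) 0 (- u + y) \<partial>lborel)"
    by (rule integral_distr) auto
  moreover have "distr lborel borel ((+) (- u)) = lborel" by (rule lborel_distr_plus)
  moreover have "radial_bump 0 (1 / e\<^sup>2) 0 (- u + y) = radial_bump 0 (1 / e\<^sup>2) u y" for y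
    using radial_bump_shift[of 0 "1 / e\<^sup>2" u y] by simp
  ultimately show ?thesis by (simp add: bump_mass_def)
qed

lemma bump_mass_ge:
  assumes e: "0 < e"
  shows "exp (- 2) * (e / (2 * real CARD('n::finite))) ^ CARD('n) \<le> bump_mass TYPE('n) e"
proof -
  let ?B = "ball (0 :: real ^ 'n) (e / 2)"
  have "(e / 2 / real CARD('n)) ^ CARD('n) \<le> measure lborel ?B"
  proof -
    have "ennreal ((e / 2 / real CARD('n)) ^ CARD('n)) \<le> emeasure lborel ?B" using e by (intro ball_ge_cube) auto
    also have "\<dots> = ennreal (measure lborel ?B)" using emeasure_lborel_ball_finite by (intro emeasure_eq_ennreal_measure) (simp add: less_top)
    finally show ?thesis by simp
  qed
  then have "exp (- 2) * (e / (2 * real CARD('n))) ^ CARD('n) \<le> exp (- 2) * measure lborel ?B"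
    by (intro mult_left_mono) auto
  also have "\<dots> = (\<integral>y. exp (- 2) * indicator ?B y \<partial>lborel)" by simp
  also have "\<dots> \<le> (\<integral>y. radial_bump 0 (1 / e\<^sup>2) (0 :: real ^ 'n) y \<partial>lborel)"
  proof (rule integral_mono)
    show "integrable lborel (\<lambda>y. exp (- 2) * indicator ?B y :: real)"
      using emeasure_lborel_ball_finite[of "0 :: real ^ 'n" "e / 2"] by (intro integrable_mult_right integrable_real_indicator) auto
    show "integrable lborel (radial_bump 0 (1 / e\<^sup>2) (0 :: real ^ 'n))" by (rule radial_bump_integrable[OF e])
    fix y :: "real ^ 'n"
    show "exp (- 2) * indicator ?B y \<le> radial_bump 0 (1 / e\<^sup>2) 0 y"
    proof (cases "y \<in> ?B")
      case True
      then have "(norm y)\<^sup>2 \<le> (e / 2)\<^sup>2" by (intro power_mono) auto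
      then have "y \<bullet> y / e\<^sup>2 \<le> 1 / 4" using e by (simp add: power2_norm_eq_inner power_divide field_simps)
      then have q: "1 / e\<^sup>2 * ((y - 0) \<bullet> (y - 0)) \<le> 1 / 4" by simp
      define z where "z = 1 - 1 / e\<^sup>2 * ((y - 0) \<bullet> (y - 0))"
      have z: "1 / 2 \<le> z" using q unfolding z_def by linarith
      then have "1 / z \<le> 2" by (simp add: divide_le_eq)
      then have "exp (- 2) \<le> bump 0 z" using z by (simp add: bump_def)
      then show ?thesis using True unfolding radial_bump_def z_def by simp
    qed (simp add: radial_bump_nonneg)
  qed
  finally show ?thesis by (simp add: bump_mass_def)
qed

lemma bump_mass_pos: "0 < e \<Longrightarrow> 0 < bump_mass TYPE('n::finite) e"
  using bump_mass_ge[of e, where 'n = 'n] by (intro less_le_trans[OF _ bump_mass_ge]) auto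

lemma mollifier_nonneg: "0 < e \<Longrightarrow> 0 \<le> mollifier e u y"
  by (simp add: mollifier_def radial_bump_nonneg bump_mass_pos less_imp_le)

lemma mollifier_support: "0 < e \<Longrightarrow> e \<le> norm (y - u) \<Longrightarrow> mollifier e u y = 0"
  by (simp add: mollifier_def radial_bump_support)

lemma mollifier_commute: "mollifier e u y = mollifier e y u"
  by (simp add: mollifier_def radial_bump_def inner_commute inner_diff_left inner_diff_right algebra_simps)

lemma mollifier_integral: "0 < e \<Longrightarrow> (\<integral>y. mollifier e (u :: real ^ 'n::finite) y \<partial>lborel) = 1"
  using bump_mass_pos[of e, where 'n = 'n] by (simp add: mollifier_def radial_bump_integral)

lemma mollifier_measurable [measurable]:
  "(\<lambda>p. mollifier e (fst p) (snd p)) \<in> borel_measurable (borel \<Otimes>\<^sub>M borel)" "mollifier e u \<in> borel_measurable borel"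
  unfolding mollifier_def[abs_def] by measurable

lemma mollifier_integrable: "0 < e \<Longrightarrow> integrable lborel (mollifier e u)"
  unfolding mollifier_def[abs_def] by (intro integrable_mult_right radial_bump_integrable)

lemma mollifier_nn_integral: "0 < e \<Longrightarrow> (\<integral>\<^sup>+y. ennreal (mollifier e (u :: real ^ 'n::finite) y) \<partial>lborel) = 1"
  by (subst nn_integral_eq_integral) (auto simp: mollifier_nonneg mollifier_integral mollifier_integrable)

text \<open>
  Differentiability of all orders reduces to products of coordinate functions and radial bumps.
\<close>
lemma mollifier_test_function:
  assumes e: "0 < e"
  shows "mollifier e u \<in> test_functions"
  unfolding test_functions_def
proof (intro CollectI conjI allI exI)
  show "C_diff k (mollifier e u)" for k
    unfolding mollifier_def[abs_def] by (intro C_diff_mult C_diff_const C_diff_radial_bump)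
  show "compact (cball u e)" by simp
  show "y \<notin> cball u e \<longrightarrow> mollifier e u y = 0" for y
    using mollifier_support[OF e, of y u] by (auto simp: dist_norm norm_minus_commute)
qed

definition mollifier_const :: "'n::finite itself \<Rightarrow> real" where
  "mollifier_const _ = exp 2 * (4 * real CARD('n)) ^ CARD('n)"

text \<open>
  The kernel is at most a constant, independent of \<open>e\<close>, times the kernel of the ball average.
\<close>
lemma mollifier_le:
  fixes u y :: "real ^ 'n::finite"
  assumes e: "0 < e"
  shows "ennreal (mollifier e u y) \<le> ennreal (mollifier_const TYPE('n)) * indicator (ball u e) y / emeasure lborel (ball u e)"
proof (cases "y \<in> ball u e")
  case False
  then show ?thesis using mollifier_support[OF e, of y u] by (auto simp: dist_norm norm_minus_commute not_less)
next
  case True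
  let ?n = "CARD('n)"
  have "ball u e \<subseteq> {y. norm (u - y) \<le> e}" by (auto simp: dist_norm)
  then have "emeasure lborel (ball u e) \<le> emeasure lborel {y. norm (u - y) \<le> e}" by (intro emeasure_mono) measurable
  also have "\<dots> \<le> ennreal ((2 * e) ^ ?n)" using e by (intro emeasure_near_le) auto
  finally have vol: "emeasure lborel (ball u e) \<le> ennreal ((2 * e) ^ ?n)" .
  have v0: "emeasure lborel (ball u e) \<noteq> 0" "emeasure lborel (ball u e) < top"
  proof -
    have "0 < (e / real ?n) ^ ?n" using e by simp
    then have "0 < ennreal ((e / real ?n) ^ ?n)" by (simp only: ennreal_less_zero_iff)
    then show "emeasure lborel (ball u e) \<noteq> 0" using ball_ge_cube[OF e, of u] by (metis leD)
    show "emeasure lborel (ball u e) < top" using emeasure_lborel_ball_finite[of u e] by simp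
  qed
  have "mollifier e u y * (2 * e) ^ ?n \<le> mollifier_const TYPE('n)"
  proof -
    have "mollifier e u y \<le> 1 / bump_mass TYPE('n) e * 1"
      unfolding mollifier_def using bump_mass_pos[OF e, where 'n='n] by (intro mult_left_mono radial_bump_le_1) auto
    also have "\<dots> \<le> 1 / (exp (- 2) * (e / (2 * real ?n)) ^ ?n)"
      using e bump_mass_pos[OF e, where 'n='n] bump_mass_ge[OF e, where 'n='n] by (simp add: divide_left_mono)
    finally have "mollifier e u y * (2 * e) ^ ?n \<le> 1 / (exp (- 2) * (e / (2 * real ?n)) ^ ?n) * (2 * e) ^ ?n"
      using e by (intro mult_right_mono) auto
    also have "\<dots> = exp 2 * ((2 * e) / (e / (2 * real ?n))) ^ ?n"
    proof -
      define A B where "A = (e / (2 * real ?n)) ^ ?n" and "B = (2 * e) ^ ?n"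
      have "((2 * e) / (e / (2 * real ?n))) ^ ?n = B / A" unfolding A_def B_def by (rule power_divide)
      moreover have "1 / (exp (- 2) * A) * B = exp 2 * (B / A)" by (simp add: exp_minus divide_inverse mult_ac)
      ultimately show ?thesis by (simp only: A_def B_def)
    qed
    also have "(2 * e) / (e / (2 * real ?n)) = 4 * real ?n" using e by simp
    finally show ?thesis by (simp add: mollifier_const_def)
  qed
  then have "ennreal (mollifier e u y * (2 * e) ^ ?n) \<le> ennreal (mollifier_const TYPE('n))" by (rule ennreal_leI)
  then have "ennreal (mollifier e u y) * ennreal ((2 * e) ^ ?n) \<le> ennreal (mollifier_const TYPE('n))"
    using e mollifier_nonneg[OF e, of u y] by (simp add: ennreal_mult)
  then have "ennreal (mollifier e u y) * emeasure lborel (ball u e) \<le> ennreal (mollifier_const TYPE('n))"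
    using vol by (meson mult_left_mono order_trans zero_le)
  then have "ennreal (mollifier e u y) * emeasure lborel (ball u e) / emeasure lborel (ball u e) \<le> ennreal (mollifier_const TYPE('n)) / emeasure lborel (ball u e)"
    by (rule divide_right_mono_ennreal)
  then show ?thesis using True v0 by (simp add: ennreal_mult_divide_eq)
qed

section \<open>Regularity and convergence of mollified functions\<close>

lemma norm_integral_le_nn_integral:
  fixes F :: "'a \<Rightarrow> 'b::{banach, second_countable_topology}"
  shows "ennreal (norm (integral\<^sup>L M F)) \<le> (\<integral>\<^sup>+x. ennreal (norm (F x)) \<partial>M)"
proof (cases "integrable M F")
  case False
  show ?thesis unfolding not_integrable_integral_eq[OF False] by simp
qed (rule integral_norm_bound_ennreal)

definition mollify :: "real \<Rightarrow> (real ^ 'n::finite \<Rightarrow> complex) \<Rightarrow> real ^ 'n \<Rightarrow> complex" where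
  "mollify e f u = (\<integral>y. mollifier e u y *\<^sub>R f y \<partial>lborel)"

lemma cball_in_borel [measurable]: "cball a r \<in> sets borel"
  by simp

definition locally_L1 :: "(real ^ 'n::finite \<Rightarrow> 'b::real_normed_vector) \<Rightarrow> bool" where
  "locally_L1 f \<longleftrightarrow> f \<in> borel_measurable borel \<and> (\<forall>R. (\<integral>\<^sup>+y\<in>cball 0 R. ennreal (norm (f y)) \<partial>lborel) < \<infinity>)"

lemma locally_L1_integrable:
  fixes f :: "real ^ 'n::finite \<Rightarrow> complex"
  assumes f: "locally_L1 f" and hm[measurable]: "h \<in> borel_measurable borel"
    and b: "\<And>y. \<bar>h y\<bar> \<le> b * indicator (cball 0 R) y"
  shows "integrable lborel (\<lambda>y. h y *\<^sub>R f y)"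
proof (rule integrableI_bounded)
  have fm[measurable]: "f \<in> borel_measurable borel" using f by (simp add: locally_L1_def)
  show "(\<lambda>y. h y *\<^sub>R f y) \<in> borel_measurable lborel" by measurable
  have "(\<integral>\<^sup>+y. ennreal (norm (h y *\<^sub>R f y)) \<partial>lborel) \<le> (\<integral>\<^sup>+y. ennreal \<bar>b\<bar> * (ennreal (norm (f y)) * indicator (cball 0 R) y) \<partial>lborel)"
  proof (rule nn_integral_mono)
    fix y
    have "\<bar>h y\<bar> \<le> \<bar>b\<bar> * indicator (cball 0 R) y" using b[of y] by (auto simp: indicator_def split: if_splits)
    then have "\<bar>h y\<bar> * norm (f y) \<le> \<bar>b\<bar> * indicator (cball 0 R) y * norm (f y)" by (intro mult_right_mono) auto
    then have "ennreal (norm (h y *\<^sub>R f y)) \<le> ennreal (\<bar>b\<bar> * indicator (cball 0 R) y * norm (f y))" by (intro ennreal_leI) simp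
    also have "\<dots> = ennreal \<bar>b\<bar> * (ennreal (norm (f y)) * indicator (cball 0 R) y)" by (auto simp: indicator_def ennreal_mult)
    finally show "ennreal (norm (h y *\<^sub>R f y)) \<le> \<dots>" .
  qed
  also have "\<dots> = ennreal \<bar>b\<bar> * (\<integral>\<^sup>+y\<in>cball 0 R. ennreal (norm (f y)) \<partial>lborel)" by (rule nn_integral_cmult) measurable
  also have "\<dots> < \<infinity>" using f by (simp add: locally_L1_def ennreal_mult_less_top)
  finally show "(\<integral>\<^sup>+y. ennreal (norm (h y *\<^sub>R f y)) \<partial>lborel) < \<infinity>" .
qed

lemma mollifier_bound:
  fixes u :: "real ^ 'n::finite"
  assumes e: "0 < e" and u: "norm u \<le> R"
  shows "\<bar>mollifier e u y\<bar> \<le> 1 / bump_mass TYPE('n) e * indicator (cball 0 (R + e)) y"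
proof (cases "norm (y - u) < e")
  case True
  then have "norm y \<le> R + e" using u norm_triangle_sub[of y u] by linarith
  then show ?thesis
    using mollifier_nonneg[OF e, of u y] radial_bump_le_1[of "1 / e\<^sup>2" u y] bump_mass_pos[OF e, where 'n = 'n]
    by (simp add: mollifier_def radial_bump_nonneg divide_right_mono)
next
  case False
  then show ?thesis using mollifier_support[OF e, of y u] bump_mass_pos[OF e, where 'n = 'n] by (simp add: indicator_def)
qed

lemma mollify_integrable:
  fixes f :: "real ^ 'n::finite \<Rightarrow> complex"
  assumes f: "locally_L1 f" and e: "0 < e"
  shows "integrable lborel (\<lambda>y. mollifier e u y *\<^sub>R f y)"
  by (rule locally_L1_integrable[OF f _ mollifier_bound[OF e order_refl]]) measurable

lemma mollifier_continuous: "continuous_on UNIV (\<lambda>u. mollifier e u y)"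
  unfolding mollifier_def radial_bump_def
  by (intro continuous_intros continuous_on_compose2[OF bump_continuous]) auto

lemma mollify_continuous:
  fixes f :: "real ^ 'n::finite \<Rightarrow> complex"
  assumes f: "locally_L1 f" and e: "0 < e"
  shows "continuous_on UNIV (mollify e f)"
proof (rule continuous_at_imp_continuous_on, intro ballI)
  fix u :: "real ^ 'n"
  have [measurable]: "f \<in> borel_measurable borel" using f by (simp add: locally_L1_def)
  show "isCont (mollify e f) u"
    unfolding continuous_at_sequentially comp_def
  proof (intro allI impI)
    fix X assume X: "X \<longlonglongrightarrow> u"
    then obtain R where R: "\<And>n. norm (X n) \<le> R" using convergent_imp_Bseq[of X] by (auto simp: convergent_def Bseq_def)
    let ?c = "1 / bump_mass TYPE('n) e"
    show "(\<lambda>n. mollify e f (X n)) \<longlonglongrightarrow> mollify e f u"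
      unfolding mollify_def
    proof (rule integral_dominated_convergence)
      show "integrable lborel (\<lambda>y. norm ((?c * indicator (cball 0 (R + e)) y) *\<^sub>R f y))"
        by (intro integrable_norm locally_L1_integrable[OF f, of _ "?c" "R + e"])
          (use bump_mass_pos[OF e, where 'n = 'n] in \<open>auto simp: abs_mult\<close>)
      show "AE y in lborel. (\<lambda>n. mollifier e (X n) y *\<^sub>R f y) \<longlonglongrightarrow> mollifier e u y *\<^sub>R f y"
        using mollifier_continuous[of e] X
        by (intro AE_I2 tendsto_intros) (auto simp: continuous_on_eq_continuous_at continuous_at_sequentially comp_def)
      show "AE y in lborel. norm (mollifier e (X n) y *\<^sub>R f y) \<le> norm ((?c * indicator (cball 0 (R + e)) y) *\<^sub>R f y)" for n
      proof (rule AE_I2)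
        fix y
        have "\<bar>mollifier e (X n) y\<bar> \<le> \<bar>?c * indicator (cball 0 (R + e)) y\<bar>"
          using mollifier_bound[OF e R, of n y] by linarith
        then show "norm (mollifier e (X n) y *\<^sub>R f y) \<le> norm ((?c * indicator (cball 0 (R + e)) y) *\<^sub>R f y)"
          unfolding norm_scaleR by (rule mult_right_mono) simp
      qed
    qed measurable
  qed
qed

lemma mollifier_line_derivative:
  "((\<lambda>s. mollifier e (upd u i s) y) has_vector_derivative - partial_deriv i (mollifier e (upd u i s)) y) (at s within A)"
proof -
  let ?c = "1 / bump_mass TYPE('a) e" and ?a = "1 / e\<^sup>2"
  let ?B = "\<lambda>s. radial_bump 2 ?a (upd u i s) y"
  have p: "partial_deriv i (mollifier e (upd u i s)) y = ?c * (- 2 * ?a * (y $ i - s) * ?B s)"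
  proof -
    have "(mollifier e (upd u i s) has_derivative (\<lambda>h. ?c * ((- 2 * ?a * ((y - upd u i s) \<bullet> h)) * (?B s - real 0 * radial_bump 1 ?a (upd u i s) y)))) (at y)"
      unfolding mollifier_def[abs_def] using radial_bump_derivative[of 0 ?a "upd u i s" y]
      by (intro has_derivative_mult_right) (simp add: numeral_2_eq_2)
    from frechet_derivative_at[OF this, symmetric] show ?thesis by (simp add: inner_axis)
  qed
  define Q where "Q = (\<Sum>j\<in>UNIV-{i}. (y $ j - u $ j)\<^sup>2)"
  have q: "(y - upd u i s) \<bullet> (y - upd u i s) = (y $ i - s)\<^sup>2 + Q" for s
    unfolding inner_vec_def Q_def by (subst sum.remove[of _ i]) (auto simp: power2_eq_square intro!: sum.cong)
  have "((\<lambda>s. ?c * bump 0 (1 - ?a * ((y $ i - s)\<^sup>2 + Q))) has_real_derivative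
      ?c * ((bump (0 + 2) (1 - ?a * ((y $ i - s)\<^sup>2 + Q)) - real 0 * bump (0 + 1) (1 - ?a * ((y $ i - s)\<^sup>2 + Q))) * (?a * (2 * (y $ i - s))))) (at s)"
  proof (intro DERIV_cmult DERIV_chain2[OF bump_derivative])
    have "((\<lambda>s. 1 - k * ((y $ i - s)\<^sup>2 + Q)) has_real_derivative k * (2 * (y $ i - s))) (at s)" for k
      by (auto intro!: derivative_eq_intros simp: algebra_simps)
    then show "((\<lambda>s. 1 - ?a * ((y $ i - s)\<^sup>2 + Q)) has_real_derivative ?a * (2 * (y $ i - s))) (at s)" .
  qed
  then have "((\<lambda>s. mollifier e (upd u i s) y) has_real_derivative - partial_deriv i (mollifier e (upd u i s)) y) (at s)"
    unfolding p mollifier_def radial_bump_def q by (simp add: mult_ac numeral_2_eq_2)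
  then show ?thesis
    unfolding has_real_derivative_iff_has_vector_derivative by (rule has_vector_derivative_at_within)
qed

lemma partial_deriv_mollifier:
  fixes u :: "real ^ 'n::finite"
  shows "partial_deriv i (mollifier e u) y = 1 / bump_mass TYPE('n) e * (- 2 * (1 / e\<^sup>2) * (y $ i - u $ i) * radial_bump 2 (1 / e\<^sup>2) u y)"
proof -
  have "(mollifier e u has_derivative (\<lambda>h. 1 / bump_mass TYPE('n) e * ((- 2 * (1 / e\<^sup>2) * ((y - u) \<bullet> h)) * (radial_bump 2 (1 / e\<^sup>2) u y - real 0 * radial_bump 1 (1 / e\<^sup>2) u y)))) (at y)"
    unfolding mollifier_def[abs_def] using radial_bump_derivative[of 0 "1 / e\<^sup>2" u y]
    by (intro has_derivative_mult_right) (simp add: numeral_2_eq_2)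
  from frechet_derivative_at[OF this, symmetric] show ?thesis by (simp add: inner_axis)
qed

lemma bump_bounded:
  obtains b where "0 \<le> b" "\<And>t. t \<le> 1 \<Longrightarrow> bump m t \<le> b"
proof -
  have "bounded (bump m ` {0..1})"
    by (intro compact_imp_bounded compact_continuous_image continuous_on_subset[OF bump_continuous]) auto
  then obtain b where b: "\<forall>t\<in>{0..1}. \<bar>bump m t\<bar> \<le> b" by (auto simp: bounded_iff)
  have "bump m t \<le> max 0 b" if "t \<le> 1" for t
  proof (cases "0 \<le> t")
    case True then show ?thesis using b that by force
  next
    case False then show ?thesis by (simp add: bump_def)
  qed
  then show ?thesis by (intro that[of "max 0 b"]) auto
qed

text \<open>
  The derivative of the mollified function in direction \<open>i\<close> is the integral of \<open>f\<close> against minus the partial derivative of the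
  kernel in the integration variable, hence by the weak formulation the mollified \<open>i\<close>-th component of the gradient. The identity is
  integrated along the segment first, so that only Fubini and the fundamental theorem of calculus for the kernel are used.
\<close>
lemma mollify_axis_upper_gradient_real:
  fixes f :: "real ^ 'n::finite \<Rightarrow> complex" and g :: "real ^ 'n \<Rightarrow> complex ^ 'n"
  assumes f: "locally_L1 f" and e: "0 < e" and ab: "a \<le> b"
    and weak: "\<And>u. (\<integral>y. partial_deriv i (mollifier e u) y *\<^sub>R f y \<partial>lborel) = - (\<integral>y. mollifier e u y *\<^sub>R (g y $ i) \<partial>lebesgue)"
    and bound: "\<And>u. ennreal (norm (\<integral>y. mollifier e u y *\<^sub>R (g y $ i) \<partial>lebesgue)) \<le> G u"
  shows "ennreal (norm (mollify e f (upd u i b) - mollify e f (upd u i a))) \<le> (\<integral>\<^sup>+s\<in>{a..b}. G (upd u i s) \<partial>lborel)"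
proof -
  have fm[measurable]: "f \<in> borel_measurable borel" using f by (simp add: locally_L1_def)
  define D where "D s y = partial_deriv i (mollifier e (upd u i s)) y" for s y
  obtain B where B: "0 \<le> B" "\<And>t. t \<le> 1 \<Longrightarrow> bump 2 t \<le> B" using bump_bounded by blast
  define R where "R = norm u + \<bar>a\<bar> + \<bar>b\<bar> + \<bar>u $ i\<bar>"
  have uR: "norm (upd u i s) \<le> R" if s: "s \<in> {a..b}" for s
  proof -
    have "upd u i s = u + (s - u $ i) *\<^sub>R axis i 1" by (auto simp: vec_eq_iff axis_def)
    then have "norm (upd u i s) \<le> norm u + norm ((s - u $ i) *\<^sub>R (axis i 1 :: real ^ 'n))" by (metis norm_triangle_ineq)
    also have "\<dots> = norm u + \<bar>s - u $ i\<bar>" by (simp add: norm_axis_1)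
    also have "\<dots> \<le> R" using s by (auto simp: R_def)
    finally show ?thesis .
  qed
  let ?c = "1 / bump_mass TYPE('n) e"
  have c0: "0 < ?c" using bump_mass_pos[OF e, where 'n = 'n] by simp
  define b0 where "b0 = ?c * (2 * (1 / e\<^sup>2) * e * B)"
  have b00: "0 \<le> b0" using c0 B(1) e by (simp add: b0_def)
  have Dform: "D s y = ?c * (- 2 * (1 / e\<^sup>2) * (y $ i - s) * radial_bump 2 (1 / e\<^sup>2) (upd u i s) y)" for s y
    unfolding D_def partial_deriv_mollifier by simp
  have Db: "\<bar>D s y\<bar> \<le> b0 * indicator (cball 0 (R + e)) y" if s: "s \<in> {a..b}" for s y
  proof (cases "norm (y - upd u i s) < e")
    case False
    then show ?thesis unfolding Dform using radial_bump_support[OF e, of y "upd u i s" 2] c0 B(1) e by (simp add: b0_def indicator_def)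
  next
    case True
    then have "norm y \<le> R + e" using uR[OF s] norm_triangle_sub[of y "upd u i s"] by linarith
    moreover have "\<bar>y $ i - s\<bar> \<le> e" using True component_le_norm_cart[of "y - upd u i s" i] by simp
    moreover have "\<bar>radial_bump 2 (1 / e\<^sup>2) (upd u i s) y\<bar> \<le> B"
      unfolding radial_bump_def using B(2)[of "1 - 1 / e\<^sup>2 * ((y - upd u i s) \<bullet> (y - upd u i s))"] bump_nonneg by simp
    ultimately have "?c * (2 * (1 / e\<^sup>2) * \<bar>y $ i - s\<bar> * \<bar>radial_bump 2 (1 / e\<^sup>2) (upd u i s) y\<bar>) \<le> b0"
      unfolding b0_def using c0 e B(1) by (intro mult_left_mono mult_mono) auto
    moreover have "\<bar>D s y\<bar> = ?c * (2 * (1 / e\<^sup>2) * \<bar>y $ i - s\<bar> * \<bar>radial_bump 2 (1 / e\<^sup>2) (upd u i s) y\<bar>)"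
      unfolding Dform abs_mult using c0 by simp
    ultimately show ?thesis using \<open>norm y \<le> R + e\<close> by simp
  qed
  have Dm[measurable]: "(\<lambda>z. D (fst z) (snd z)) \<in> borel_measurable (borel \<Otimes>\<^sub>M borel)"
  proof -
    have "continuous_on UNIV (\<lambda>z. D (fst z) (snd z))"
      unfolding Dform radial_bump_def upd_def
      by (intro continuous_intros continuous_on_compose2[OF bump_continuous] continuous_on_vec_lambda continuous_on_if_const) auto
    then show ?thesis unfolding borel_prod by (rule borel_measurable_continuous_onI)
  qed
  have Dm1[measurable]: "D s \<in> borel_measurable borel" for s
    using measurable_compose[OF measurable_Pair1'[of s borel borel] Dm] by simp
  have Dm2: "(\<lambda>z. D (fst z) (snd z)) \<in> borel_measurable (lborel \<Otimes>\<^sub>M lborel)"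
    using Dm by (simp cong: measurable_cong_sets)
  define A where "A s y = indicator {a..b} s *\<^sub>R (D s y *\<^sub>R f y)" for s y
  have int: "integrable (lborel \<Otimes>\<^sub>M lborel) (\<lambda>(s, y). A s y)"
  proof (rule integrableI_bounded)
    note [measurable] = Dm2
    show "(\<lambda>(s, y). A s y) \<in> borel_measurable (lborel \<Otimes>\<^sub>M lborel)"
      unfolding A_def case_prod_beta by measurable
    have "(\<integral>\<^sup>+z. ennreal (norm (case z of (s, y) \<Rightarrow> A s y)) \<partial>(lborel \<Otimes>\<^sub>M lborel)) \<le>
      (\<integral>\<^sup>+z. indicator {a..b} (fst z) * (ennreal b0 * (ennreal (norm (f (snd z))) * indicator (cball 0 (R + e)) (snd z))) \<partial>(lborel \<Otimes>\<^sub>M lborel))"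
    proof (rule nn_integral_mono)
      fix z :: "real \<times> (real ^ 'n)"
      obtain s y where z: "z = (s, y)" by (cases z)
      show "ennreal (norm (case z of (s, y) \<Rightarrow> A s y)) \<le> indicator {a..b} (fst z) * (ennreal b0 * (ennreal (norm (f (snd z))) * indicator (cball 0 (R + e)) (snd z)))"
      proof (cases "s \<in> {a..b}")
        case True
        have "\<bar>D s y\<bar> * norm (f y) \<le> b0 * indicator (cball 0 (R + e)) y * norm (f y)" using Db[OF True] by (intro mult_right_mono) auto
        then have "ennreal (\<bar>D s y\<bar> * norm (f y)) \<le> ennreal (b0 * indicator (cball 0 (R + e)) y * norm (f y))" by (rule ennreal_leI)
        also have "\<dots> = ennreal b0 * (ennreal (norm (f y)) * indicator (cball 0 (R + e)) y)"
          using b00 by (auto simp: indicator_def ennreal_mult)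
        finally show ?thesis using True by (simp add: z A_def)
      qed (simp add: z A_def)
    qed
    also have "\<dots> = (\<integral>\<^sup>+s. (\<integral>\<^sup>+y. indicator {a..b} s * (ennreal b0 * (ennreal (norm (f y)) * indicator (cball 0 (R + e)) y)) \<partial>lborel) \<partial>lborel)"
      by (subst lborel.nn_integral_fst[symmetric]) auto
    also have "\<dots> = ennreal (b - a) * (ennreal b0 * (\<integral>\<^sup>+y\<in>cball 0 (R + e). ennreal (norm (f y)) \<partial>lborel))"
    proof -
      let ?I = "ennreal b0 * (\<integral>\<^sup>+y\<in>cball 0 (R + e). ennreal (norm (f y)) \<partial>lborel)"
      have "(\<integral>\<^sup>+y. indicator {a..b} s * (ennreal b0 * (ennreal (norm (f y)) * indicator (cball 0 (R + e)) y)) \<partial>lborel) = indicator {a..b} s * ?I" for s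
        by (subst nn_integral_cmult, measurable)+
      then show ?thesis using ab by (simp add: nn_integral_multc)
    qed
    also have "\<dots> < \<infinity>" using f by (simp add: locally_L1_def ennreal_mult_less_top)
    finally show "(\<integral>\<^sup>+z. ennreal (norm (case z of (s, y) \<Rightarrow> A s y)) \<partial>(lborel \<Otimes>\<^sub>M lborel)) < \<infinity>" .
  qed
  have contD: "continuous_on {a..b} (\<lambda>s. D s y)" for y
    unfolding Dform radial_bump_def upd_def
    by (intro continuous_intros continuous_on_compose2[OF bump_continuous] continuous_on_vec_lambda continuous_on_if_const) auto
  have inner: "(\<integral>s. A s y \<partial>lborel) = (mollifier e (upd u i a) y - mollifier e (upd u i b) y) *\<^sub>R f y" for y
  proof -
    have "(\<integral>s. indicator {a..b} s *\<^sub>R (- D s y) \<partial>lborel) = mollifier e (upd u i b) y - mollifier e (upd u i a) y"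
    proof (rule integral_FTC_atLeastAtMost[OF ab])
      show "((\<lambda>s. mollifier e (upd u i s) y) has_vector_derivative - D s y) (at s within {a..b})" for s
        unfolding D_def by (rule mollifier_line_derivative)
      show "continuous_on {a..b} (\<lambda>s. - D s y)" by (intro continuous_on_minus contD)
    qed
    then have e1: "(\<integral>s. indicator {a..b} s *\<^sub>R D s y \<partial>lborel) = mollifier e (upd u i a) y - mollifier e (upd u i b) y" by simp
    have "(\<integral>s. A s y \<partial>lborel) = (\<integral>s. (indicator {a..b} s *\<^sub>R D s y) *\<^sub>R f y \<partial>lborel)"
      by (simp add: A_def)
    also have "\<dots> = (\<integral>s. indicator {a..b} s *\<^sub>R D s y \<partial>lborel) *\<^sub>R f y"
      by (intro integral_scaleR_left borel_integrable_compact contD) auto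
    finally show ?thesis unfolding e1 .
  qed
  have "mollify e f (upd u i a) - mollify e f (upd u i b) = (\<integral>y. (mollifier e (upd u i a) y - mollifier e (upd u i b) y) *\<^sub>R f y \<partial>lborel)"
    unfolding mollify_def scaleR_diff_left by (rule Bochner_Integration.integral_diff[symmetric]) (intro mollify_integrable f e)+
  also have "\<dots> = (\<integral>y. (\<integral>s. A s y \<partial>lborel) \<partial>lborel)" by (simp add: inner)
  also have "\<dots> = (\<integral>s. (\<integral>y. A s y \<partial>lborel) \<partial>lborel)" by (rule lborel_pair.Fubini_integral[OF int])
  also have "\<dots> = (\<integral>s. indicator {a..b} s *\<^sub>R (- (\<integral>y. mollifier e (upd u i s) y *\<^sub>R (g y $ i) \<partial>lebesgue)) \<partial>lborel)"
  proof (rule Bochner_Integration.integral_cong[OF refl])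
    fix s
    have "(\<integral>y. A s y \<partial>lborel) = indicator {a..b} s *\<^sub>R (\<integral>y. D s y *\<^sub>R f y \<partial>lborel)"
      unfolding A_def by (rule integral_scaleR_right)
    then show "(\<integral>y. A s y \<partial>lborel) = indicator {a..b} s *\<^sub>R (- (\<integral>y. mollifier e (upd u i s) y *\<^sub>R (g y $ i) \<partial>lebesgue))"
      unfolding D_def weak .
  qed
  finally have eq: "mollify e f (upd u i a) - mollify e f (upd u i b) = \<dots>" .
  have "ennreal (norm (\<integral>s. indicator {a..b} s *\<^sub>R (- (\<integral>y. mollifier e (upd u i s) y *\<^sub>R (g y $ i) \<partial>lebesgue)) \<partial>lborel))
    \<le> (\<integral>\<^sup>+s. ennreal (norm (indicator {a..b} s *\<^sub>R (- (\<integral>y. mollifier e (upd u i s) y *\<^sub>R (g y $ i) \<partial>lebesgue)))) \<partial>lborel)"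
    by (rule norm_integral_le_nn_integral)
  also have "\<dots> \<le> (\<integral>\<^sup>+s\<in>{a..b}. G (upd u i s) \<partial>lborel)"
    using bound by (intro nn_integral_mono) (auto simp: indicator_def)
  finally show ?thesis unfolding eq[symmetric] by (subst norm_minus_commute)
qed

lemma mollify_axis_upper_gradient:
  fixes f :: "real ^ 'n::finite \<Rightarrow> complex" and g :: "real ^ 'n \<Rightarrow> complex ^ 'n"
  assumes f: "locally_L1 f" and e: "0 < e" and Gm: "G \<in> borel_measurable borel"
    and weak: "\<And>i u. (\<integral>y. partial_deriv i (mollifier e u) y *\<^sub>R f y \<partial>lborel) = - (\<integral>y. mollifier e u y *\<^sub>R (g y $ i) \<partial>lebesgue)"
    and bound: "\<And>i u. ennreal (norm (\<integral>y. mollifier e u y *\<^sub>R (g y $ i) \<partial>lebesgue)) \<le> G u"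
  shows "axis_upper_gradient (mollify e f) G"
  unfolding axis_upper_gradient_def
proof (intro conjI allI Gm mollify_continuous[OF f e])
  fix u :: "real ^ 'n" and i t
  have self: "upd u i (u $ i) = u" by (simp add: vec_eq_iff)
  note * = mollify_axis_upper_gradient_real[OF f e _ weak bound, of _ _ u i]
  show "ennreal (norm (mollify e f (upd u i t) - mollify e f u)) \<le> (\<integral>\<^sup>+s\<in>{min t (u $ i)..max t (u $ i)}. G (upd u i s) \<partial>lborel)"
  proof (cases "t \<le> u $ i")
    case True
    then show ?thesis using *[of t "u $ i"] by (simp add: self norm_minus_commute)
  next
    case False
    then show ?thesis using *[of "u $ i" t] by (simp add: self)
  qed
qed

lemma mollify_gradient_bound:
  fixes g :: "real ^ 'n::finite \<Rightarrow> complex ^ 'n"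
  assumes e: "0 < e" and gm: "(\<lambda>y. norm (g y)) \<in> Meas"
  shows "ennreal (norm (\<integral>y. mollifier e u y *\<^sub>R (g y $ i) \<partial>lebesgue))
    \<le> ennreal (mollifier_const TYPE('n)) * ball_average e (\<lambda>y. norm (g y)) u"
proof -
  have "ennreal (norm (\<integral>y. mollifier e u y *\<^sub>R (g y $ i) \<partial>lebesgue)) \<le> (\<integral>\<^sup>+y. ennreal (norm (mollifier e u y *\<^sub>R (g y $ i))) \<partial>lebesgue)"
    by (rule norm_integral_le_nn_integral)
  also have "\<dots> \<le> (\<integral>\<^sup>+y. ennreal (mollifier_const TYPE('n)) / emeasure lborel (ball u e) * (ennreal \<bar>norm (g y)\<bar> * indicator (ball u e) y) \<partial>lebesgue)"
  proof (rule nn_integral_mono)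
    fix y
    have "mollifier e u y * norm (g y $ i) \<le> mollifier e u y * norm (g y)"
      by (intro mult_left_mono Finite_Cartesian_Product.norm_nth_le mollifier_nonneg e)
    then have "ennreal (norm (mollifier e u y *\<^sub>R (g y $ i))) \<le> ennreal (mollifier e u y * norm (g y))"
      using mollifier_nonneg[OF e, of u y] by (intro ennreal_leI) simp
    also have "\<dots> = ennreal (mollifier e u y) * ennreal (norm (g y))"
      using mollifier_nonneg[OF e, of u y] by (intro ennreal_mult) auto
    finally have "ennreal (norm (mollifier e u y *\<^sub>R (g y $ i))) \<le> ennreal (mollifier e u y) * ennreal (norm (g y))" .
    also have "\<dots> \<le> (ennreal (mollifier_const TYPE('n)) * indicator (ball u e) y / emeasure lborel (ball u e)) * ennreal (norm (g y))"
      by (intro mult_right_mono mollifier_le e) auto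
    also have "\<dots> = ennreal (mollifier_const TYPE('n)) / emeasure lborel (ball u e) * (ennreal \<bar>norm (g y)\<bar> * indicator (ball u e) y)"
      by (simp add: divide_ennreal_def mult_ac)
    finally show "ennreal (norm (mollifier e u y *\<^sub>R (g y $ i))) \<le> \<dots>" .
  qed
  also have "\<dots> \<le> ennreal (mollifier_const TYPE('n)) / emeasure lborel (ball u e) * (\<integral>\<^sup>+y\<in>ball u e. ennreal \<bar>norm (g y)\<bar> \<partial>lebesgue)"
    by (intro eq_refl nn_integral_cmult borel_measurable_times_ennreal Meas_ennreal_abs gm borel_measurable_indicator) simp
  also have "\<dots> = ennreal (mollifier_const TYPE('n)) * ball_average e (\<lambda>y. norm (g y)) u"
    by (simp add: ball_average_def divide_ennreal_def mult_ac)
  finally show ?thesis .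
qed

text \<open>
  Bounded truncations of \<open>f\<close> are approximated in two steps, both by dominated convergence: a measurable
  function is an almost everywhere limit of continuous ones, and clipping keeps these bounded.
\<close>
lemma continuous_L1_approximation:
  fixes f :: "real ^ 'n::finite \<Rightarrow> complex"
  assumes f: "locally_L1 f" and d: "0 < d"
  obtains h where "continuous_on UNIV h" "(\<integral>\<^sup>+y\<in>cball 0 R. ennreal (norm (f y - h y)) \<partial>lborel) \<le> ennreal d"
proof -
  have fm[measurable]: "f \<in> borel_measurable borel" using f by (simp add: locally_L1_def)
  let ?B = "cball 0 R :: (real ^ 'n) set"
  let ?clip = "\<lambda>b z :: complex. (1 / max 1 (norm z / b)) *\<^sub>R z"
  have Bfin: "emeasure lborel ?B < \<infinity>" using emeasure_lborel_cball_finite[of "0 :: real ^ 'n" R] by simp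
  have clip_le: "norm (?clip b z) \<le> b" if "0 < b" for b z
    using that by (auto simp: max_def field_simps)
  have clip_id: "?clip b z = z" if "norm z \<le> b" "0 < b" for b z using that by (simp add: max_def field_simps)
  have clip_cont: "continuous_on UNIV (?clip b)" if "0 < b" for b
    using that by (intro continuous_intros) auto
  have clip_norm: "norm (?clip b z) \<le> norm z" if "0 < b" for b z
    using that by (auto simp: max_def field_simps)
  have clipm: "(\<lambda>y. ?clip b (F y)) \<in> borel_measurable borel" if "F \<in> borel_measurable borel" for b and F :: "real ^ 'n \<Rightarrow> complex"
    using that by measurable
  have lim1: "(\<lambda>k. \<integral>\<^sup>+y. ennreal (norm (f y - ?clip (real (Suc k)) (f y))) * indicator ?B y \<partial>lborel) \<longlonglongrightarrow> (\<integral>\<^sup>+y. 0 \<partial>(lborel :: (real ^ 'n) measure))"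
  proof (rule nn_integral_dominated_convergence[where w = "\<lambda>y. 2 * (ennreal (norm (f y)) * indicator ?B y)"])
    show "AE y in lborel. ennreal (norm (f y - ?clip (real (Suc j)) (f y))) * indicator ?B y \<le> 2 * (ennreal (norm (f y)) * indicator ?B y)" for j
    proof (rule AE_I2)
      fix y
      have "norm (f y - ?clip (real (Suc j)) (f y)) \<le> 2 * norm (f y)"
        using norm_triangle_ineq4[of "f y" "?clip (real (Suc j)) (f y)"] clip_norm[of "real (Suc j)" "f y"] by linarith
      then have "ennreal (norm (f y - ?clip (real (Suc j)) (f y))) \<le> ennreal (2 * norm (f y))" by (rule ennreal_leI)
      also have "\<dots> = 2 * ennreal (norm (f y))" by (simp add: ennreal_mult)
      finally show "ennreal (norm (f y - ?clip (real (Suc j)) (f y))) * indicator ?B y \<le> 2 * (ennreal (norm (f y)) * indicator ?B y)"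
        by (auto simp: indicator_def)
    qed
    show "(\<integral>\<^sup>+y. 2 * (ennreal (norm (f y)) * indicator ?B y) \<partial>lborel) < \<infinity>"
      using f by (subst nn_integral_cmult) (auto simp: locally_L1_def ennreal_mult_less_top)
    show "AE y in lborel. (\<lambda>k. ennreal (norm (f y - ?clip (real (Suc k)) (f y))) * indicator ?B y) \<longlonglongrightarrow> 0"
    proof (rule AE_I2, rule tendsto_eventually)
      fix y
      obtain k0 where "norm (f y) \<le> real k0" using real_arch_simple by blast
      then have "norm (f y) \<le> real (Suc k)" if "k0 \<le> k" for k using that by linarith
      then have z: "f y - ?clip (real (Suc k)) (f y) = 0" if "k0 \<le> k" for k using clip_id[of "f y" "real (Suc k)"] that by simp
      show "\<forall>\<^sub>F k in sequentially. ennreal (norm (f y - ?clip (real (Suc k)) (f y))) * indicator ?B y = 0"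
        by (rule eventually_sequentiallyI[of k0]) (simp only: z norm_zero ennreal_0 mult_zero_left)
    qed
  qed measurable
  then have "\<forall>\<^sub>F k in sequentially. (\<integral>\<^sup>+y. ennreal (norm (f y - ?clip (real (Suc k)) (f y))) * indicator ?B y \<partial>lborel) < ennreal (d / 2)"
    using d by (intro order_tendstoD[OF lim1[simplified nn_integral_const]]) simp
  then obtain k where k: "(\<integral>\<^sup>+y. ennreal (norm (f y - ?clip (real (Suc k)) (f y))) * indicator ?B y \<partial>lborel) < ennreal (d / 2)"
    by (auto simp: eventually_sequentially)
  define b where "b = real (Suc k)"
  have b: "0 < b" by (simp add: b_def)
  define f1 where "f1 y = ?clip b (f y)" for y
  have f1m[measurable]: "f1 \<in> borel_measurable borel" unfolding f1_def by measurable
  have "f1 measurable_on UNIV"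
    by (rule lebesgue_measurable_imp_measurable_on) (auto intro: measurable_completion)
  then obtain Z g where Z: "negligible Z" and gc: "\<And>n. continuous_on UNIV (g n)" and gl: "\<And>y. y \<notin> Z \<Longrightarrow> (\<lambda>n. g n y) \<longlonglongrightarrow> f1 y"
    unfolding measurable_on_def by auto
  define h where "h n y = ?clip b (g n y)" for n y
  have hc: "continuous_on UNIV (h n)" for n
    unfolding h_def using continuous_on_compose2[OF clip_cont[OF b] gc[of n]] by simp
  have hm[measurable]: "h n \<in> borel_measurable borel" for n using hc by (rule borel_measurable_continuous_onI)
  have aeZ: "AE y in lborel. y \<notin> Z"
    using Z by (metis AE_not_in AE_completion_iff negligible_iff_null_sets)
  have lim2: "(\<lambda>n. \<integral>\<^sup>+y. ennreal (norm (f1 y - h n y)) * indicator ?B y \<partial>lborel) \<longlonglongrightarrow> (\<integral>\<^sup>+y. 0 \<partial>(lborel :: (real ^ 'n) measure))"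
  proof (rule nn_integral_dominated_convergence[where w = "\<lambda>y. ennreal (2 * b) * indicator ?B y"])
    show "AE y in lborel. ennreal (norm (f1 y - h n y)) * indicator ?B y \<le> ennreal (2 * b) * indicator ?B y" for n
    proof (rule AE_I2)
      fix y
      have "norm (f1 y - h n y) \<le> 2 * b"
        using norm_triangle_ineq4[of "f1 y" "h n y"] clip_le[OF b, of "f y"] clip_le[OF b, of "g n y"] unfolding f1_def h_def by linarith
      then show "ennreal (norm (f1 y - h n y)) * indicator ?B y \<le> ennreal (2 * b) * indicator ?B y"
        by (intro mult_right_mono ennreal_leI) auto
    qed
    show "(\<integral>\<^sup>+y. ennreal (2 * b) * indicator ?B y \<partial>lborel) < \<infinity>"
      using Bfin by (subst nn_integral_cmult_indicator) (auto simp: ennreal_mult_less_top)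
    show "AE y in lborel. (\<lambda>n. ennreal (norm (f1 y - h n y)) * indicator ?B y) \<longlonglongrightarrow> 0"
      using aeZ
    proof eventually_elim
      case (elim y)
      have "(\<lambda>n. h n y) \<longlonglongrightarrow> ?clip b (f1 y)"
        unfolding h_def using gl[OF elim] b by (intro tendsto_intros) auto
      also have "?clip b (f1 y) = f1 y" by (rule clip_id) (use clip_le[OF b] b in \<open>auto simp: f1_def\<close>)
      finally have "(\<lambda>n. norm (f1 y - h n y)) \<longlonglongrightarrow> norm (f1 y - f1 y)" by (intro tendsto_intros)
      then have "(\<lambda>n. ennreal (norm (f1 y - h n y))) \<longlonglongrightarrow> ennreal 0" by (intro tendsto_ennrealI) simp
      then show ?case by (cases "y \<in> ?B") auto
    qed
  qed measurable
  then have "\<forall>\<^sub>F n in sequentially. (\<integral>\<^sup>+y. ennreal (norm (f1 y - h n y)) * indicator ?B y \<partial>lborel) < ennreal (d / 2)"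
    using d by (intro order_tendstoD[OF lim2[simplified nn_integral_const]]) simp
  then obtain n where n: "(\<integral>\<^sup>+y. ennreal (norm (f1 y - h n y)) * indicator ?B y \<partial>lborel) < ennreal (d / 2)"
    by (auto simp: eventually_sequentially)
  have "(\<integral>\<^sup>+y\<in>?B. ennreal (norm (f y - h n y)) \<partial>lborel) \<le>
    (\<integral>\<^sup>+y. ennreal (norm (f y - f1 y)) * indicator ?B y + ennreal (norm (f1 y - h n y)) * indicator ?B y \<partial>lborel)"
  proof (rule nn_integral_mono)
    fix y
    have "norm (f y - h n y) \<le> norm (f y - f1 y) + norm (f1 y - h n y)"
      using norm_triangle_ineq[of "f y - f1 y" "f1 y - h n y"] by simp
    then have "ennreal (norm (f y - h n y)) \<le> ennreal (norm (f y - f1 y)) + ennreal (norm (f1 y - h n y))"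
      by (simp add: ennreal_plus[symmetric] del: ennreal_plus)
    then show "ennreal (norm (f y - h n y)) * indicator ?B y \<le> ennreal (norm (f y - f1 y)) * indicator ?B y + ennreal (norm (f1 y - h n y)) * indicator ?B y"
      by (auto simp: indicator_def)
  qed
  also have "\<dots> = (\<integral>\<^sup>+y. ennreal (norm (f y - f1 y)) * indicator ?B y \<partial>lborel) + (\<integral>\<^sup>+y. ennreal (norm (f1 y - h n y)) * indicator ?B y \<partial>lborel)"
    by (intro nn_integral_add) measurable
  also have "\<dots> \<le> ennreal (d / 2) + ennreal (d / 2)"
    using k n unfolding f1_def b_def by (intro add_mono) auto
  also have "\<dots> = ennreal d" using d by (simp add: ennreal_plus[symmetric] del: ennreal_plus)
  finally show ?thesis using hc by (intro that[of "h n"]) auto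
qed

text \<open>
  The averages over small balls of a continuous function are uniformly close to it on compact sets, and mollification does not
  increase the \<open>L\<^sup>1\<close> norm of the difference to \<open>f\<close>.
\<close>
lemma mollify_L1_close:
  fixes f :: "real ^ 'n::finite \<Rightarrow> complex"
  assumes f: "locally_L1 f" and d: "0 < d"
  obtains e where "0 < e" "(\<integral>\<^sup>+x\<in>cball 0 R. ennreal (norm (mollify e f x - f x)) \<partial>lborel) \<le> ennreal d"
proof -
  have fm[measurable]: "f \<in> borel_measurable borel" using f by (simp add: locally_L1_def)
  let ?B = "cball 0 R :: (real ^ 'n) set" and ?B1 = "cball 0 (R + 1) :: (real ^ 'n) set"
  obtain h where h: "continuous_on UNIV h" "(\<integral>\<^sup>+y\<in>?B1. ennreal (norm (f y - h y)) \<partial>lborel) \<le> ennreal (d / 3)"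
    using continuous_L1_approximation[OF f, of "d / 3" "R + 1"] d by auto
  have hm[measurable]: "h \<in> borel_measurable borel" using h(1) by (rule borel_measurable_continuous_onI)
  define v where "v = measure lborel ?B"
  have v: "emeasure lborel ?B = ennreal v" "0 \<le> v"
    using emeasure_lborel_cball_finite[of "0 :: real ^ 'n" R] by (auto simp: v_def emeasure_eq_ennreal_measure less_top)
  define r where "r = d / (3 * (v + 1))"
  have r: "0 < r" using d v by (simp add: r_def)
  have "uniformly_continuous_on ?B1 h" by (intro compact_uniformly_continuous continuous_on_subset[OF h(1)]) auto
  then obtain e0 where e0: "0 < e0" "\<And>x y. x \<in> ?B1 \<Longrightarrow> y \<in> ?B1 \<Longrightarrow> dist y x < e0 \<Longrightarrow> dist (h y) (h x) < r"
    using r unfolding uniformly_continuous_on_def by blast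
  define e where "e = min 1 e0"
  have e: "0 < e" "e \<le> 1" "e \<le> e0" using e0 by (auto simp: e_def)
  let ?k = "\<lambda>x y. ennreal (mollifier e x y)"
  have km[measurable]: "(\<lambda>z. ?k (fst z) (snd z)) \<in> borel_measurable (lborel \<Otimes>\<^sub>M lborel)"
    using mollifier_measurable(1)[of e] by (simp cong: measurable_cong_sets)
  have k1: "(\<integral>\<^sup>+y. ?k x y \<partial>lborel) = 1" for x :: "real ^ 'n" by (rule mollifier_nn_integral[OF e(1)])
  have pt: "ennreal (norm (mollify e f x - f x)) * indicator ?B x \<le>
     (\<integral>\<^sup>+y. ?k y x * (ennreal (norm (f y - h y)) * indicator ?B1 y) \<partial>lborel) + (ennreal r * indicator ?B x + ennreal (norm (f x - h x)) * indicator ?B1 x)" for x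
  proof (cases "x \<in> ?B")
    case True
    have "mollify e f x - f x = (\<integral>y. mollifier e x y *\<^sub>R f y \<partial>lborel) - (\<integral>y. mollifier e x y *\<^sub>R f x \<partial>lborel)"
      using mollifier_integrable[OF e(1), of x] mollifier_integral[OF e(1), of x] by (simp add: mollify_def)
    also have "\<dots> = (\<integral>y. mollifier e x y *\<^sub>R (f y - f x) \<partial>lborel)"
      unfolding scaleR_diff_right
      by (intro Bochner_Integration.integral_diff[symmetric] mollify_integrable f e integrable_scaleR_left mollifier_integrable)
    finally have eq: "mollify e f x - f x = (\<integral>y. mollifier e x y *\<^sub>R (f y - f x) \<partial>lborel)" .
    have "ennreal (norm (mollify e f x - f x)) \<le> (\<integral>\<^sup>+y. ennreal (norm (mollifier e x y *\<^sub>R (f y - f x))) \<partial>lborel)"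
      unfolding eq scaleR_diff_right
      by (intro integral_norm_bound_ennreal Bochner_Integration.integrable_diff mollify_integrable f e integrable_scaleR_left mollifier_integrable)
    also have "\<dots> \<le> (\<integral>\<^sup>+y. ?k x y * (ennreal (norm (f y - h y)) * indicator ?B1 y) + ?k x y * (ennreal r + ennreal (norm (f x - h x))) \<partial>lborel)"
    proof (rule nn_integral_mono)
      fix y
      show "ennreal (norm (mollifier e x y *\<^sub>R (f y - f x))) \<le> ?k x y * (ennreal (norm (f y - h y)) * indicator ?B1 y) + ?k x y * (ennreal r + ennreal (norm (f x - h x)))"
      proof (cases "norm (y - x) < e")
        case False
        then show ?thesis using mollifier_support[OF e(1), of y x] by simp
      next
        case near: True
        have xB: "x \<in> ?B1" using True by simp
        have "norm y \<le> norm x + norm (y - x)" by (metis norm_triangle_sub)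
        then have yB: "y \<in> ?B1" using True near e by simp
        have "norm (h y - h x) < r" using e0(2)[OF xB yB] near e by (simp add: dist_norm)
        moreover have "norm (f y - f x) \<le> norm (f y - h y) + (norm (h y - h x) + norm (f x - h x))"
          using norm_triangle_ineq[of "f y - h y" "(h y - h x) - (f x - h x)"] norm_triangle_ineq4[of "h y - h x" "f x - h x"] by simp
        ultimately have "mollifier e x y * norm (f y - f x) \<le> mollifier e x y * (norm (f y - h y) + (r + norm (f x - h x)))"
          using mollifier_nonneg[OF e(1), of x y] by (intro mult_left_mono) auto
        then have "ennreal (norm (mollifier e x y *\<^sub>R (f y - f x))) \<le> ennreal (mollifier e x y * (norm (f y - h y) + (r + norm (f x - h x))))"
          using mollifier_nonneg[OF e(1), of x y] by (intro ennreal_leI) simp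
        also have "\<dots> = ?k x y * (ennreal (norm (f y - h y)) + (ennreal r + ennreal (norm (f x - h x))))"
          using mollifier_nonneg[OF e(1), of x y] r by (simp add: ennreal_mult ennreal_plus[symmetric] del: ennreal_plus)
        finally show ?thesis using yB by (simp add: distrib_left)
      qed
    qed
    also have "\<dots> = (\<integral>\<^sup>+y. ?k x y * (ennreal (norm (f y - h y)) * indicator ?B1 y) \<partial>lborel) + (ennreal r + ennreal (norm (f x - h x)))"
      by (subst nn_integral_add) (auto simp: nn_integral_multc k1)
    finally show ?thesis using True by (simp add: mollifier_commute[of e x])
  qed simp
  have "(\<integral>\<^sup>+x\<in>?B. ennreal (norm (mollify e f x - f x)) \<partial>lborel) \<le>
    (\<integral>\<^sup>+x. (\<integral>\<^sup>+y. ?k y x * (ennreal (norm (f y - h y)) * indicator ?B1 y) \<partial>lborel) + (ennreal r * indicator ?B x + ennreal (norm (f x - h x)) * indicator ?B1 x) \<partial>lborel)"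
    by (intro nn_integral_mono pt)
  also have "\<dots> = (\<integral>\<^sup>+x. (\<integral>\<^sup>+y. ?k y x * (ennreal (norm (f y - h y)) * indicator ?B1 y) \<partial>lborel) \<partial>lborel)
     + ((\<integral>\<^sup>+x. ennreal r * indicator ?B x \<partial>lborel) + (\<integral>\<^sup>+x. ennreal (norm (f x - h x)) * indicator ?B1 x \<partial>lborel))"
  proof -
    have "(\<lambda>z. ?k (snd z) (fst z) * (ennreal (norm (f (snd z) - h (snd z))) * indicator ?B1 (snd z))) \<in> borel_measurable (lborel \<Otimes>\<^sub>M lborel)"
      using mollifier_commute[of e] by (subst mollifier_commute) measurable
    from lborel.borel_measurable_nn_integral_fst[OF this]
    have m1: "(\<lambda>x. \<integral>\<^sup>+y. ?k y x * (ennreal (norm (f y - h y)) * indicator ?B1 y) \<partial>lborel) \<in> borel_measurable lborel" by simp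
    have m2: "(\<lambda>x. ennreal r * indicator ?B x + ennreal (norm (f x - h x)) * indicator ?B1 x) \<in> borel_measurable lborel"
      by measurable
    have e2: "(\<integral>\<^sup>+x. ennreal r * indicator ?B x + ennreal (norm (f x - h x)) * indicator ?B1 x \<partial>lborel)
        = (\<integral>\<^sup>+x. ennreal r * indicator ?B x \<partial>lborel) + (\<integral>\<^sup>+x. ennreal (norm (f x - h x)) * indicator ?B1 x \<partial>lborel)"
      by (rule nn_integral_add) measurable
    show ?thesis unfolding nn_integral_add[OF m1 m2] e2 ..
  qed
  also have "(\<integral>\<^sup>+x. (\<integral>\<^sup>+y. ?k y x * (ennreal (norm (f y - h y)) * indicator ?B1 y) \<partial>lborel) \<partial>lborel)
     = (\<integral>\<^sup>+y. (\<integral>\<^sup>+x. ?k y x * (ennreal (norm (f y - h y)) * indicator ?B1 y) \<partial>lborel) \<partial>lborel)"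
    by (rule lborel_pair.Fubini') (simp add: case_prod_beta, measurable)
  also have "\<dots> = (\<integral>\<^sup>+y\<in>?B1. ennreal (norm (f y - h y)) \<partial>lborel)"
    by (intro nn_integral_cong) (simp add: nn_integral_multc k1)
  also have "(\<integral>\<^sup>+x. ennreal r * indicator ?B x \<partial>lborel) = ennreal (r * v)"
    using v r by (subst nn_integral_cmult_indicator) (auto simp: ennreal_mult)
  also have "(\<integral>\<^sup>+y\<in>?B1. ennreal (norm (f y - h y)) \<partial>lborel) + (ennreal (r * v) + (\<integral>\<^sup>+x\<in>?B1. ennreal (norm (f x - h x)) \<partial>lborel))
    \<le> ennreal (d / 3) + (ennreal (d / 3) + ennreal (d / 3))"
  proof (intro add_mono h ennreal_leI)
    have "r * v \<le> r * (v + 1)" using r by simp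
    also have "\<dots> = d / 3" using v by (simp add: r_def field_simps)
    finally show "r * v \<le> d / 3" .
  qed
  also have "\<dots> = ennreal d" using d by (simp add: ennreal_plus[symmetric] del: ennreal_plus)
  finally show ?thesis using e by (intro that[of e]) auto
qed

text \<open>
  If the \<open>L\<^sup>1\<close> distances on growing balls are summable, the sum of the differences is finite almost everywhere.
\<close>
lemma mollify_converges_AE:
  fixes f :: "real ^ 'n::finite \<Rightarrow> complex"
  assumes f: "locally_L1 f"
  obtains e :: "nat \<Rightarrow> real" where "\<And>m. 0 < e m" "AE x in lborel. (\<lambda>m. mollify (e m) f x) \<longlonglongrightarrow> f x"
proof -
  have fm[measurable]: "f \<in> borel_measurable borel" using f by (simp add: locally_L1_def)
  have "\<exists>e. 0 < e \<and> (\<integral>\<^sup>+x\<in>cball 0 (real m). ennreal (norm (mollify e f x - f x)) \<partial>lborel) \<le> ennreal ((1/2) ^ m)" for m :: nat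
    using mollify_L1_close[OF f, of "(1/2) ^ m" "real m"] by auto
  then obtain e where e: "\<And>m. 0 < e m" "\<And>m :: nat. (\<integral>\<^sup>+x\<in>cball 0 (real m). ennreal (norm (mollify (e m) f x - f x)) \<partial>lborel) \<le> ennreal ((1/2) ^ m)"
    by metis
  have mm[measurable]: "mollify (e m) f \<in> borel_measurable borel" for m
    using mollify_continuous[OF f e(1)] by (rule borel_measurable_continuous_onI)
  let ?t = "\<lambda>m x. ennreal (norm (mollify (e m) f x - f x)) * indicator (cball 0 (real m)) x"
  have "(\<integral>\<^sup>+x. (\<Sum>m. ?t m x) \<partial>lborel) = (\<Sum>m. \<integral>\<^sup>+x. ?t m x \<partial>lborel)" by (intro nn_integral_suminf) measurable
  also have "\<dots> \<le> (\<Sum>m. ennreal ((1/2) ^ m))" using e(2) by (intro suminf_le) auto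
  also have "\<dots> = ennreal 2" using geometric_sums[of "1/2::real"] by (intro suminf_ennreal_eq) auto
  finally have "(\<integral>\<^sup>+x. (\<Sum>m. ?t m x) \<partial>lborel) \<noteq> \<infinity>" by (auto simp: top_unique)
  then have "AE x in lborel. (\<Sum>m. ?t m x) \<noteq> \<infinity>" by (intro nn_integral_PInf_AE) measurable
  then have "AE x in lborel. (\<lambda>m. mollify (e m) f x) \<longlonglongrightarrow> f x"
  proof eventually_elim
    case (elim x)
    let ?s = "\<lambda>m. norm (mollify (e m) f x - f x) * indicator (cball 0 (real m)) x"
    have "ennreal (?s m) = ?t m x" for m by (auto simp: indicator_def)
    then have "summable ?s" using elim by (intro summable_suminf_not_top) auto
    then have s0: "?s \<longlonglongrightarrow> 0" by (rule summable_LIMSEQ_zero)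
    obtain k where k: "norm x \<le> real k" using real_arch_simple by blast
    have "\<forall>\<^sub>F m in sequentially. ?s m = norm (mollify (e m) f x - f x)"
      using eventually_ge_at_top[of k] by eventually_elim (use k in auto)
    then have "(\<lambda>m. norm (mollify (e m) f x - f x)) \<longlonglongrightarrow> 0" by (rule Lim_transform_eventually[OF s0])
    then show ?case by (simp add: tendsto_norm_zero_iff LIM_zero_iff)
  qed
  then show ?thesis using e(1) by (intro that[of e]) auto
qed

section \<open>The level set estimate for Sobolev functions\<close>

definition weighted_level :: "real \<Rightarrow> real \<Rightarrow> real \<Rightarrow> (real ^ 'n::finite \<Rightarrow> complex) \<Rightarrow> real ^ 'n \<Rightarrow> ennreal" where
  "weighted_level \<gamma> lam b f x =
     (\<integral>\<^sup>+y. indicator (level_set lam b f) (x, y) * ennreal (norm (x - y) powr (\<gamma> - real CARD('n))) \<partial>lebesgue)"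

text \<open>
  Lebesgue measure is complete.
\<close>
lemma lebesgue_measurable_AE_eq:
  fixes F :: "real ^ 'n::finite \<Rightarrow> ennreal"
  assumes F: "F \<in> borel_measurable lebesgue" and ae: "AE x in lebesgue. G x = F x"
  shows "G \<in> borel_measurable lebesgue"
proof (rule measurableI)
  fix A :: "ennreal set" assume "A \<in> sets borel"
  then have s: "F -` A \<inter> space lebesgue \<in> sets lebesgue" using F by (rule measurable_sets[rotated])
  have a: "AE x in lebesgue. x \<in> F -` A \<inter> space lebesgue \<longleftrightarrow> x \<in> G -` A \<inter> space lebesgue"
    using ae by eventually_elim simp
  show "G -` A \<inter> space lebesgue \<in> sets lebesgue"
    by (rule completion.in_sets_AE[OF a s]) simp
qed simp

lemma locally_integrable_measurable:
  fixes f :: "real ^ 'n::finite \<Rightarrow> 'b::euclidean_space"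
  assumes f: "locally_integrable f"
  shows "f \<in> borel_measurable lebesgue"
proof (rule borel_measurable_LIMSEQ_metric)
  show "(\<lambda>x. indicator (cball 0 (real k)) x *\<^sub>R f x) \<in> borel_measurable lebesgue" for k :: nat
    using f compact_cball[of "0 :: real ^ 'n" "real k"] unfolding locally_integrable_def set_integrable_def by (blast intro: borel_measurable_integrable)
  fix x :: "real ^ 'n"
  obtain k where k: "norm x \<le> real k" using real_arch_simple by blast
  show "(\<lambda>k. indicator (cball 0 (real k)) x *\<^sub>R f x) \<longlonglongrightarrow> f x"
    by (rule tendsto_eventually, rule eventually_sequentiallyI[of k]) (use k in auto)
qed

lemma locally_integrable_nn_integral:
  fixes f :: "real ^ 'n::finite \<Rightarrow> 'b::euclidean_space"
  assumes f: "locally_integrable f"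
  shows "(\<integral>\<^sup>+y\<in>cball 0 R. ennreal (norm (f y)) \<partial>lebesgue) < \<infinity>"
proof -
  have "integrable lebesgue (\<lambda>x. indicator (cball 0 R) x *\<^sub>R f x)"
    using f compact_cball[of "0 :: real ^ 'n" R] unfolding locally_integrable_def set_integrable_def by blast
  then have "(\<integral>\<^sup>+y. ennreal (norm (indicator (cball 0 R) y *\<^sub>R f y)) \<partial>lebesgue) < \<infinity>"
    unfolding integrable_iff_bounded by blast
  also have "(\<integral>\<^sup>+y. ennreal (norm (indicator (cball 0 R) y *\<^sub>R f y)) \<partial>lebesgue) = (\<integral>\<^sup>+y\<in>cball 0 R. ennreal (norm (f y)) \<partial>lebesgue)"
    by (intro nn_integral_cong) (auto simp: indicator_def)
  finally show ?thesis .
qed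

lemma locally_integrable_borel_version:
  fixes f :: "real ^ 'n::finite \<Rightarrow> complex"
  assumes f: "locally_integrable f"
  obtains f' where "locally_L1 f'" "AE x in lborel. f x = f' x"
proof -
  note fm[measurable] = locally_integrable_measurable[OF f]
  obtain r where r[measurable]: "r \<in> borel_measurable lborel" "AE x in lborel. Re (f x) = r x"
    using completion_ex_borel_measurable_real[of "\<lambda>x. Re (f x)" lborel] by auto
  obtain j where j[measurable]: "j \<in> borel_measurable lborel" "AE x in lborel. Im (f x) = j x"
    using completion_ex_borel_measurable_real[of "\<lambda>x. Im (f x)" lborel] by auto
  define f' where "f' x = Complex (r x) (j x)" for x
  have ae: "AE x in lborel. f x = f' x"
    using r(2) j(2) by eventually_elim (simp add: f'_def complex_eq_iff)
  have m: "f' \<in> borel_measurable borel"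
    using r(1) j(1) unfolding f'_def Complex_eq by simp
  have "(\<integral>\<^sup>+y\<in>cball 0 R. ennreal (norm (f' y)) \<partial>lborel) < \<infinity>" for R
  proof -
    have "(\<integral>\<^sup>+y\<in>cball 0 R. ennreal (norm (f' y)) \<partial>lborel) = (\<integral>\<^sup>+y\<in>cball 0 R. ennreal (norm (f y)) \<partial>lborel)"
      using ae by (intro nn_integral_cong_AE) (auto elim: eventually_mono)
    then show ?thesis using locally_integrable_nn_integral[OF f, of R] by (simp add: nn_integral_completion)
  qed
  then show ?thesis using m ae by (intro that[of f']) (auto simp: locally_L1_def)
qed

lemma ball_average_locally_bounded:
  fixes h :: "real ^ 'n::finite \<Rightarrow> real"
  assumes h: "\<And>R. (\<integral>\<^sup>+y\<in>cball 0 R. ennreal \<bar>h y\<bar> \<partial>lebesgue) < \<infinity>" and e: "0 < e"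
  obtains b :: real where "\<And>x. x \<in> ball 0 r \<Longrightarrow> ball_average e h x \<le> ennreal b"
proof -
  define I where "I = (\<integral>\<^sup>+y\<in>cball 0 (r + e). ennreal \<bar>h y\<bar> \<partial>lebesgue)"
  define v where "v = emeasure lebesgue (ball (0 :: real ^ 'n) e)"
  have v: "emeasure lebesgue (ball x e) = v" for x :: "real ^ 'n"
    unfolding v_def using content_ball_conv_unit_ball[of e x] content_ball_conv_unit_ball[of e "0 :: real ^ 'n"] e
      emeasure_lborel_ball_finite[of x e] emeasure_lborel_ball_finite[of "0 :: real ^ 'n" e]
    by (simp add: emeasure_eq_ennreal_measure)
  have v0: "v \<noteq> 0"
  proof -
    have "0 < measure lborel (ball (0 :: real ^ 'n) e)" using content_ball_pos[OF e] by simp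
    then show ?thesis using emeasure_lborel_ball_finite[of "0 :: real ^ 'n" e] by (auto simp: v_def measure_def)
  qed
  have "ball_average e h x \<le> I / v" if x: "x \<in> ball 0 r" for x
  proof -
    have "(\<integral>\<^sup>+y\<in>ball x e. ennreal \<bar>h y\<bar> \<partial>lebesgue) \<le> I"
      unfolding I_def
    proof (intro nn_integral_mono mult_left_mono)
      fix y
      show "indicator (ball x e) y \<le> (indicator (cball 0 (r + e)) y :: ennreal)"
      proof (cases "y \<in> ball x e")
        case True
        then have "norm y \<le> norm x + e" using norm_triangle_sub[of y x] by (simp add: dist_norm norm_minus_commute)
        then show ?thesis using x True by (simp add: indicator_def)
      qed simp
    qed simp
    then show ?thesis unfolding ball_average_def v by (rule divide_right_mono_ennreal)
  qed
  moreover have "I / v < \<infinity>"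
    using h[of "r + e"] v0 unfolding I_def[symmetric] by (simp add: less_top[symmetric] ennreal_divide_eq_top_iff)
  ultimately show ?thesis by (intro that[of "enn2real (I / v)"]) auto
qed

lemma partial_deriv_mollifier_measurable:
  "partial_deriv i (mollifier e u) \<in> borel_measurable borel"
  unfolding partial_deriv_mollifier radial_bump_def
  by (intro borel_measurable_continuous_onI continuous_intros continuous_on_compose2[OF bump_continuous]) auto

lemma weak_gradient_mollified:
  fixes f f' :: "real ^ 'n::finite \<Rightarrow> complex"
  assumes fg: "has_weak_gradient f g" and e: "0 < e" and m: "f' \<in> borel_measurable borel" and ae: "AE x in lborel. f x = f' x"
  shows "(\<integral>y. partial_deriv i (mollifier e u) y *\<^sub>R f' y \<partial>lborel) = - (\<integral>y. mollifier e u y *\<^sub>R (g y $ i) \<partial>lebesgue)"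
proof -
  note [measurable] = m partial_deriv_mollifier_measurable
  have fm: "f \<in> borel_measurable lebesgue" using fg locally_integrable_measurable by (auto simp: has_weak_gradient_def)
  have "(\<integral>y. partial_deriv i (mollifier e u) y *\<^sub>R f' y \<partial>lborel) = (\<integral>y. partial_deriv i (mollifier e u) y *\<^sub>R f' y \<partial>lebesgue)"
    by (rule integral_completion[symmetric]) simp
  also have "\<dots> = (\<integral>y. partial_deriv i (mollifier e u) y *\<^sub>R f y \<partial>lebesgue)"
  proof (rule integral_cong_AE)
    have p: "partial_deriv i (mollifier e u) \<in> borel_measurable lebesgue" by (rule borel_imp_Meas[OF partial_deriv_mollifier_measurable])
    have m': "f' \<in> borel_measurable lebesgue" using m by (simp add: measurable_completion)
    show "(\<lambda>y. partial_deriv i (mollifier e u) y *\<^sub>R f' y) \<in> borel_measurable lebesgue"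
      by (rule borel_measurable_scaleR[OF p m'])
    show "(\<lambda>y. partial_deriv i (mollifier e u) y *\<^sub>R f y) \<in> borel_measurable lebesgue"
      by (rule borel_measurable_scaleR[OF p fm])
    show "AE y in lebesgue. partial_deriv i (mollifier e u) y *\<^sub>R f' y = partial_deriv i (mollifier e u) y *\<^sub>R f y"
      using ae unfolding AE_completion_iff by eventually_elim simp
  qed
  also have "\<dots> = - (\<integral>y. mollifier e u y *\<^sub>R (g y $ i) \<partial>lebesgue)"
    using fg mollifier_test_function[OF e, of u] unfolding has_weak_gradient_def by blast
  finally show ?thesis .
qed

lemma mollified_truncated_level_norm:
  fixes N :: "'n::finite fnorm"
  assumes N: "ball_banach_function_space N"
    and est: "\<And>f G lam q. axis_upper_gradient f (\<lambda>x. ennreal (G x)) \<Longrightarrow> (\<And>x. 0 \<le> G x) \<Longrightarrow>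
      G \<in> borel_measurable borel \<Longrightarrow> (\<And>r. \<exists>b. \<forall>x\<in>ball 0 r. G x \<le> b) \<Longrightarrow> 0 < lam \<Longrightarrow>
      ext_norm N (truncated_level \<gamma> q lam f)
        \<le> ennreal (C / lam) * N (\<lambda>x. G x * indicator (ball 0 ((3 * real CARD('n) + 3) * 2 ^ q)) x)"
    and av: "\<And>r h. 0 < r \<Longrightarrow> h \<in> fspace N \<Longrightarrow> ext_norm N (ball_average r h) \<le> ennreal B * N h"
    and fg: "has_weak_gradient f g" and gN: "(\<lambda>x. norm (g x)) \<in> fspace N"
    and f': "locally_L1 f'" and ae: "AE x in lborel. f x = f' x" and e: "0 < e" and lam: "0 < lam"
  shows "ext_norm N (truncated_level \<gamma> q lam (mollify e f'))
    \<le> ennreal (C / lam) * (ennreal (mollifier_const TYPE('n)) * (ennreal B * N (\<lambda>x. norm (g x))))"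
proof -
  let ?c = "mollifier_const TYPE('n)" and ?h = "\<lambda>x. norm (g x)"
  have c0: "0 \<le> ?c" by (simp add: mollifier_const_def)
  have hM: "?h \<in> Meas" using gN by (simp add: fspace_def)
  have hfin: "(\<integral>\<^sup>+y\<in>cball 0 R. ennreal \<bar>?h y\<bar> \<partial>lebesgue) < \<infinity>" for R
    using locally_integrable_nn_integral[of g R] fg by (simp add: has_weak_gradient_def)
  define K where "K x = enn2real (ball_average e ?h x)" for x
  have Kb: "\<exists>b. \<forall>x\<in>ball 0 r. ball_average e ?h x \<le> ennreal b" for r
    by (rule ball_average_locally_bounded[OF hfin e, of r]) blast
  have K: "ball_average e ?h x = ennreal (K x)" for x
  proof -
    obtain b where "\<forall>y\<in>ball 0 (norm x + 1). ball_average e ?h y \<le> ennreal b" using Kb by blast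
    then have "ball_average e ?h x \<le> ennreal b" by simp
    then have "ball_average e ?h x < \<infinity>" by (rule le_less_trans) simp
    then show ?thesis by (simp add: K_def)
  qed
  have K0: "0 \<le> K x" for x by (simp add: K_def)
  have Km[measurable]: "K \<in> borel_measurable borel"
    unfolding K_def[abs_def] using ball_average_measurable[OF hM, of e] by measurable
  define G where "G x = ?c * K x" for x
  have Gm[measurable]: "G \<in> borel_measurable borel" unfolding G_def[abs_def] by measurable
  have G0: "0 \<le> G x" for x using c0 K0 by (simp add: G_def)
  have Genn: "ennreal (G x) = ennreal ?c * ball_average e ?h x" for x
    unfolding K G_def using c0 K0 by (simp add: ennreal_mult)
  have Gb: "\<exists>b. \<forall>x\<in>ball 0 r. G x \<le> b" for r
  proof -
    obtain b where b: "\<forall>x\<in>ball 0 r. ball_average e ?h x \<le> ennreal b" using Kb by blast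
    have "G x \<le> ?c * max 0 b" if "x \<in> ball 0 r" for x
    proof -
      have "ennreal (K x) \<le> ennreal b" using b that unfolding K by blast
      also have "\<dots> \<le> ennreal (max 0 b)" by (rule ennreal_leI) simp
      finally have "K x \<le> max 0 b" by (subst (asm) ennreal_le_iff) auto
      then show ?thesis unfolding G_def by (intro mult_left_mono c0)
    qed
    then show ?thesis by blast
  qed
  have up: "axis_upper_gradient (mollify e f') (\<lambda>x. ennreal (G x))"
  proof (rule mollify_axis_upper_gradient[OF f' e])
    show "(\<lambda>x. ennreal (G x)) \<in> borel_measurable borel" by measurable
    show "(\<integral>y. partial_deriv i (mollifier e u) y *\<^sub>R f' y \<partial>lborel) = - (\<integral>y. mollifier e u y *\<^sub>R (g y $ i) \<partial>lebesgue)" for i u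
      using f' by (intro weak_gradient_mollified[OF fg e _ ae]) (simp add: locally_L1_def)
    show "ennreal (norm (\<integral>y. mollifier e u y *\<^sub>R (g y $ i) \<partial>lebesgue)) \<le> ennreal (G u)" for i u
      unfolding Genn by (rule mollify_gradient_bound[OF e hM])
  qed
  have "ext_norm N (truncated_level \<gamma> q lam (mollify e f'))
    \<le> ennreal (C / lam) * N (\<lambda>x. G x * indicator (ball 0 ((3 * real CARD('n) + 3) * 2 ^ q)) x)"
    by (rule est[OF up G0 Gm Gb lam])
  also have "\<dots> \<le> ennreal (C / lam) * (ennreal ?c * (ennreal B * N ?h))"
  proof (rule mult_left_mono)
    have "N (\<lambda>x. G x * indicator (ball 0 ((3 * real CARD('n) + 3) * 2 ^ q)) x) \<le> N G"
    proof (rule bbfs_mono[OF N])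
      show "G \<in> Meas" by (rule borel_imp_Meas[OF Gm])
      show "(\<lambda>x. G x * indicator (ball 0 ((3 * real CARD('n) + 3) * 2 ^ q)) x) \<in> Meas"
        by (rule borel_imp_Meas) measurable
    qed (auto simp: indicator_def)
    also have "N G = ennreal ?c * N K"
      using bbfs_cmult[OF N borel_imp_Meas[OF Km], of ?c] c0 by (simp add: G_def[abs_def])
    also have "N K = ext_norm N (ball_average e ?h)"
      using ext_norm_ennreal[OF N borel_imp_Meas[OF Km] K0] by (simp add: K[abs_def])
    also have "\<dots> \<le> ennreal B * N ?h" by (rule av[OF e gN])
    finally show "N (\<lambda>x. G x * indicator (ball 0 ((3 * real CARD('n) + 3) * 2 ^ q)) x) \<le> ennreal ?c * (ennreal B * N ?h)"
      by (simp add: mult_left_mono)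
  qed simp
  finally show ?thesis .
qed

lemma level_set_integrand_measurable:
  fixes f :: "real ^ 'n::finite \<Rightarrow> complex"
  assumes f[measurable]: "f \<in> borel_measurable borel"
  shows "(\<lambda>z. indicator (level_set lam b f) z * ennreal (norm (fst z - snd z) powr (\<gamma> - real CARD('n)))) \<in> borel_measurable (borel \<Otimes>\<^sub>M borel)"
proof -
  have "(\<lambda>z. (if fst z - snd z \<noteq> 0 \<and> norm (f (fst z) - f (snd z)) > lam * norm (fst z - snd z) powr (1 + b) then 1 else 0) * ennreal (norm (fst z - snd z) powr (\<gamma> - real CARD('n)))) \<in> borel_measurable (borel \<Otimes>\<^sub>M borel)"
    by measurable
  also have "(\<lambda>z. (if fst z - snd z \<noteq> 0 \<and> norm (f (fst z) - f (snd z)) > lam * norm (fst z - snd z) powr (1 + b) then 1 else 0) * ennreal (norm (fst z - snd z) powr (\<gamma> - real CARD('n))))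
    = (\<lambda>z. indicator (level_set lam b f) z * ennreal (norm (fst z - snd z) powr (\<gamma> - real CARD('n))))"
    by (rule ext) (auto simp: level_set_def indicator_def split: prod.splits)
  finally show ?thesis .
qed

lemma weighted_level_borel_version:
  fixes f f' :: "real ^ 'n::finite \<Rightarrow> complex"
  assumes ae: "AE x in lborel. f x = f' x"
  shows "AE x in lborel. weighted_level \<gamma> lam b f x = weighted_level \<gamma> lam b f' x"
  using ae
proof eventually_elim
  case (elim x)
  show ?case
    unfolding weighted_level_def nn_integral_completion
  proof (rule nn_integral_cong_AE)
    show "AE y in lborel. indicator (level_set lam b f) (x, y) * ennreal (norm (x - y) powr (\<gamma> - real CARD('n)))
        = indicator (level_set lam b f') (x, y) * ennreal (norm (x - y) powr (\<gamma> - real CARD('n)))"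
      using ae by eventually_elim (simp add: level_set_def indicator_def elim)
  qed
qed

lemma weighted_level_borel:
  fixes f :: "real ^ 'n::finite \<Rightarrow> complex"
  assumes f: "f \<in> borel_measurable borel"
  shows "weighted_level \<gamma> lam b f \<in> borel_measurable borel"
proof -
  have "(\<lambda>z. indicator (level_set lam b f) z * ennreal (norm (fst z - snd z) powr (\<gamma> - real CARD('n)))) \<in> borel_measurable (lborel \<Otimes>\<^sub>M lborel)"
    using level_set_integrand_measurable[OF f] by (simp cong: measurable_cong_sets)
  from lborel.borel_measurable_nn_integral_fst[OF this]
  show ?thesis unfolding weighted_level_def[abs_def] nn_integral_completion by simp
qed

lemma weighted_level_measurable:
  fixes f :: "real ^ 'n::finite \<Rightarrow> complex"
  assumes f: "locally_integrable f"
  shows "weighted_level \<gamma> lam b f \<in> borel_measurable lebesgue"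
proof -
  obtain f' where f': "locally_L1 f'" "AE x in lborel. f x = f' x" by (rule locally_integrable_borel_version[OF f])
  have "weighted_level \<gamma> lam b f' \<in> borel_measurable lebesgue"
    using weighted_level_borel[of f'] f'(1) by (intro measurable_completion) (simp add: locally_L1_def)
  then show ?thesis
    by (rule lebesgue_measurable_AE_eq) (simp add: AE_completion_iff weighted_level_borel_version[OF f'(2)])
qed

text \<open>
  The inequality defining the level set is strict and thus stable under limits, so each pair in the level set of the limit
  eventually belongs to the truncated level sets of the sequence.
\<close>
lemma weighted_level_le_liminf:
  fixes f :: "real ^ 'n::finite \<Rightarrow> complex"
  assumes Fm: "\<And>m. F m \<in> borel_measurable borel"
    and lim: "AE y in lborel. (\<lambda>m. F m y) \<longlonglongrightarrow> f y" and x: "(\<lambda>m. F m x) \<longlonglongrightarrow> f x"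
  shows "weighted_level \<gamma> lam \<gamma> f x \<le> liminf (\<lambda>m. truncated_level \<gamma> m lam (F m) x)"
proof -
  note [measurable] = Fm
  define S where "S m = {z. 1 / 2 ^ m < norm (fst z - snd z) \<and> norm (fst z - snd z) \<le> 2 ^ m \<and>
          norm (F m (fst z) - F m (snd z)) > lam * norm (fst z - snd z) powr (1 + \<gamma>)}" for m :: nat
  let ?k = "\<lambda>y. ennreal (norm (x - y) powr (\<gamma> - real CARD('n)))"
  have Sm: "(\<lambda>y. indicator (S m) (x, y) * ?k y) \<in> borel_measurable lborel" for m
  proof -
    have "(\<lambda>y. (if 1 / 2 ^ m < norm (x - y) \<and> norm (x - y) \<le> 2 ^ m \<and> norm (F m x - F m y) > lam * norm (x - y) powr (1 + \<gamma>) then 1 else 0) * ?k y) \<in> borel_measurable borel"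
      by measurable
    then show ?thesis by (simp add: S_def indicator_def)
  qed
  have "weighted_level \<gamma> lam \<gamma> f x = (\<integral>\<^sup>+y. indicator (level_set lam \<gamma> f) (x, y) * ?k y \<partial>lborel)"
    unfolding weighted_level_def nn_integral_completion ..
  also have "\<dots> \<le> (\<integral>\<^sup>+y. liminf (\<lambda>m. indicator (S m) (x, y) * ?k y) \<partial>lborel)"
  proof (rule nn_integral_mono_AE, use lim in eventually_elim)
    case (elim y)
    show ?case
    proof (cases "(x, y) \<in> level_set lam \<gamma> f")
      case True
      let ?d = "norm (x - y)"
      have d: "0 < ?d" and gt: "lam * ?d powr (1 + \<gamma>) < norm (f x - f y)" using True by (auto simp: level_set_def)
      have "(\<lambda>m. norm (F m x - F m y)) \<longlonglongrightarrow> norm (f x - f y)" using x elim by (intro tendsto_intros)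
      then have e1: "\<forall>\<^sub>F m in sequentially. lam * ?d powr (1 + \<gamma>) < norm (F m x - F m y)" using gt by (rule order_tendstoD)
      have "(\<lambda>m. (1 / 2 :: real) ^ m) \<longlonglongrightarrow> 0" by (intro LIMSEQ_power_zero) simp
      then have e2: "\<forall>\<^sub>F m in sequentially. (1 / 2) ^ m < ?d" using d by (rule order_tendstoD)
      obtain k where k: "?d \<le> real k" using real_arch_simple by blast
      have e3: "\<forall>\<^sub>F m in sequentially. ?d \<le> 2 ^ m"
      proof (rule eventually_sequentiallyI[of k])
        fix m assume "k \<le> m"
        then have "?d \<le> real m" using k by linarith
        also have "\<dots> \<le> 2 ^ m" by (rule of_nat_less_two_power[THEN less_imp_le])
        finally show "?d \<le> 2 ^ m" .
      qed
      have "\<forall>\<^sub>F m in sequentially. ?k y \<le> indicator (S m) (x, y) * ?k y"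
        using e1 e2 e3 by eventually_elim (simp add: S_def power_one_over)
      then have "?k y \<le> liminf (\<lambda>m. indicator (S m) (x, y) * ?k y)" by (rule Liminf_bounded)
      then show ?thesis using True by simp
    qed simp
  qed
  also have "\<dots> \<le> liminf (\<lambda>m. \<integral>\<^sup>+y. indicator (S m) (x, y) * ?k y \<partial>lborel)"
    by (rule nn_integral_liminf[OF Sm])
  also have "\<dots> \<le> liminf (\<lambda>m. truncated_level \<gamma> m lam (F m) x)"
  proof (rule Liminf_mono)
    obtain k where k: "norm x < real k" using reals_Archimedean2 by blast
    show "\<forall>\<^sub>F m in sequentially. (\<integral>\<^sup>+y. indicator (S m) (x, y) * ?k y \<partial>lborel) \<le> truncated_level \<gamma> m lam (F m) x"
    proof (rule eventually_sequentiallyI[of k])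
      fix m assume "k \<le> m"
      then have "norm x < real m" using k by linarith
      also have "\<dots> < 2 ^ m" by (rule of_nat_less_two_power)
      finally have "x \<in> ball 0 (2 ^ m)" by simp
      then show "(\<integral>\<^sup>+y. indicator (S m) (x, y) * ?k y \<partial>lborel) \<le> truncated_level \<gamma> m lam (F m) x"
        unfolding truncated_level_def S_def by simp
    qed
  qed
  finally show ?thesis .
qed

lemma sobolev_level_estimate_of_truncated:
  fixes N :: "'n::finite fnorm"
  assumes N: "ball_banach_function_space N"
    and est: "\<And>f G lam q. axis_upper_gradient f (\<lambda>x. ennreal (G x)) \<Longrightarrow> (\<And>x. 0 \<le> G x) \<Longrightarrow>
      G \<in> borel_measurable borel \<Longrightarrow> (\<And>r. \<exists>b. \<forall>x\<in>ball 0 r. G x \<le> b) \<Longrightarrow> 0 < lam \<Longrightarrow>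
      ext_norm N (truncated_level \<gamma> q lam f)
        \<le> ennreal (C / lam) * N (\<lambda>x. G x * indicator (ball 0 ((3 * real CARD('n) + 3) * 2 ^ q)) x)"
    and av: "\<And>r h. 0 < r \<Longrightarrow> h \<in> fspace N \<Longrightarrow> ext_norm N (ball_average r h) \<le> ennreal B * N h"
    and fg: "has_weak_gradient f g" and gN: "(\<lambda>x. norm (g x)) \<in> fspace N" and lam: "0 < lam"
  shows "ext_norm N (weighted_level \<gamma> lam \<gamma> f)
    \<le> ennreal (C / lam) * (ennreal (mollifier_const TYPE('n)) * (ennreal B * N (\<lambda>x. norm (g x))))"
proof -
  have fl: "locally_integrable f" using fg by (simp add: has_weak_gradient_def)
  obtain f' where f': "locally_L1 f'" and ae: "AE x in lborel. f x = f' x" by (rule locally_integrable_borel_version[OF fl])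
  obtain e where e: "\<And>m. 0 < e m" and lim: "AE x in lborel. (\<lambda>m. mollify (e m) f' x) \<longlonglongrightarrow> f' x"
    using mollify_converges_AE[OF f'] by blast
  have mm: "mollify (e m) f' \<in> borel_measurable borel" for m
    using mollify_continuous[OF f' e] by (rule borel_measurable_continuous_onI)
  show ?thesis
  proof (rule ext_norm_fatou[OF N])
    show "truncated_level \<gamma> m lam (mollify (e m) f') \<in> borel_measurable lebesgue" for m
      by (intro measurable_completion) (simp add: truncated_level_measurable[OF mm])
    show "weighted_level \<gamma> lam \<gamma> f \<in> borel_measurable lebesgue" by (rule weighted_level_measurable[OF fl])
    show "ext_norm N (truncated_level \<gamma> m lam (mollify (e m) f'))
      \<le> ennreal (C / lam) * (ennreal (mollifier_const TYPE('n)) * (ennreal B * N (\<lambda>x. norm (g x))))" for m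
      by (rule mollified_truncated_level_norm[OF N est av fg gN f' ae e lam])
    show "AE x in lebesgue. weighted_level \<gamma> lam \<gamma> f x \<le> liminf (\<lambda>m. truncated_level \<gamma> m lam (mollify (e m) f') x)"
      unfolding AE_completion_iff
      using weighted_level_borel_version[OF ae, of \<gamma> lam \<gamma>] lim
    proof eventually_elim
      case (elim x)
      show ?case unfolding elim(1) by (rule weighted_level_le_liminf[OF mm lim elim(2)])
    qed
  qed
qed

lemma sobolev_level_estimate:
  fixes N :: "'n::finite fnorm"
  assumes \<gamma>: "\<gamma> < -1 \<or> 0 < \<gamma>" and N: "ball_banach_function_space N" and ac: "absolutely_continuous_norm N"
    and M: "bounded_operator (assoc_norm N) HL_maximal \<or> (HL_endpoint_bounded_on_assoc N \<and> ball_averages_uniformly_bounded N)"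
  obtains K :: real where "0 \<le> K" "\<And>f g lam. has_weak_gradient f g \<Longrightarrow> (\<lambda>x. norm (g x)) \<in> fspace N \<Longrightarrow> 0 < lam \<Longrightarrow>
    ext_norm N (weighted_level \<gamma> lam \<gamma> f) \<le> ennreal (K / lam) * N (\<lambda>x. norm (g x))"
proof -
  have "\<exists>C. 0 < C \<and> (\<forall>f G lam q. axis_upper_gradient f (\<lambda>x. ennreal (G x)) \<longrightarrow> (\<forall>x. 0 \<le> G x) \<longrightarrow>
      G \<in> borel_measurable borel \<longrightarrow> (\<forall>r. \<exists>b. \<forall>x\<in>ball 0 r. G x \<le> b) \<longrightarrow> 0 < lam \<longrightarrow>
      ext_norm N (truncated_level \<gamma> q lam f)
        \<le> ennreal (C / lam) * N (\<lambda>x. G x * indicator (ball 0 ((3 * real CARD('n) + 3) * 2 ^ q)) x))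
    \<and> ball_averages_uniformly_bounded N"
    using M
  proof
    assume "bounded_operator (assoc_norm N) HL_maximal"
    then obtain C' where C': "\<And>u. u \<in> fspace (assoc_norm N) \<Longrightarrow> ext_norm (assoc_norm N) (HL_maximal u) \<le> ennreal C' * assoc_norm N u"
      unfolding bounded_operator_def by blast
    have C0: "ext_norm (assoc_norm N) (HL_maximal u) \<le> ennreal (max 1 C') * assoc_norm N u" if "u \<in> fspace (assoc_norm N)" for u
      by (rule order_trans[OF C'[OF that]]) (intro mult_right_mono ennreal_leI, auto)
    obtain C where C: "0 < C" "\<And>(N :: 'n fnorm) f G lam q. ball_banach_function_space N \<Longrightarrow> absolutely_continuous_norm N \<Longrightarrow>
      (\<And>u. u \<in> fspace (assoc_norm N) \<Longrightarrow> ext_norm (assoc_norm N) (HL_maximal u) \<le> ennreal (max 1 C') * assoc_norm N u) \<Longrightarrow>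
      axis_upper_gradient f (\<lambda>x. ennreal (G x)) \<Longrightarrow> (\<And>x. 0 \<le> G x) \<Longrightarrow> G \<in> borel_measurable borel \<Longrightarrow> 0 < lam \<Longrightarrow>
      ext_norm N (truncated_level \<gamma> q lam f)
        \<le> ennreal (C / lam) * N (\<lambda>x. G x * indicator (ball 0 ((3 * real CARD('n) + 3) * 2 ^ q)) x)"
      by (fact truncated_level_norm[OF \<gamma> max.cobounded1])
    have "ball_averages_uniformly_bounded N"
      by (rule ball_averages_bounded_by_duality[OF N ac _ C0]) simp
    then show ?thesis using C(1) C(2)[OF N ac C0] by (intro exI[of _ C]) simp
  next
    assume b: "HL_endpoint_bounded_on_assoc N \<and> ball_averages_uniformly_bounded N"
    obtain C where C: "0 < C" "\<And>f G lam q. axis_upper_gradient f (\<lambda>x. ennreal (G x)) \<Longrightarrow> (\<And>x. 0 \<le> G x) \<Longrightarrow>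
      G \<in> borel_measurable borel \<Longrightarrow> (\<And>r. \<exists>b. \<forall>x\<in>ball 0 r. G x \<le> b) \<Longrightarrow> 0 < lam \<Longrightarrow>
      ext_norm N (truncated_level \<gamma> q lam f)
        \<le> ennreal (C / lam) * N (\<lambda>x. G x * indicator (ball 0 ((3 * real CARD('n) + 3) * 2 ^ q)) x)"
      by (fact endpoint_truncated_level_norm[OF \<gamma> N ac conjunct1[OF b]])
    then show ?thesis using b by (intro exI[of _ C]) simp
  qed
  then obtain C where C: "0 < C" "\<And>f G lam q. axis_upper_gradient f (\<lambda>x. ennreal (G x)) \<Longrightarrow> (\<And>x. 0 \<le> G x) \<Longrightarrow>
      G \<in> borel_measurable borel \<Longrightarrow> (\<And>r. \<exists>b. \<forall>x\<in>ball 0 r. G x \<le> b) \<Longrightarrow> 0 < lam \<Longrightarrow>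
      ext_norm N (truncated_level \<gamma> q lam f)
        \<le> ennreal (C / lam) * N (\<lambda>x. G x * indicator (ball 0 ((3 * real CARD('n) + 3) * 2 ^ q)) x)"
    and avb: "ball_averages_uniformly_bounded N" by blast
  obtain B where B: "\<And>r h. 0 < r \<Longrightarrow> h \<in> fspace N \<Longrightarrow> ext_norm N (ball_average r h) \<le> ennreal B * N h"
    using avb unfolding ball_averages_uniformly_bounded_def by blast
  have B': "ext_norm N (ball_average r h) \<le> ennreal (max 0 B) * N h" if "0 < r" "h \<in> fspace N" for r h
    by (rule order_trans[OF B[OF that]]) (intro mult_right_mono ennreal_leI, auto)
  let ?c = "mollifier_const TYPE('n)"
  have c0: "0 \<le> ?c" by (simp add: mollifier_const_def)
  show ?thesis
  proof (rule that[of "C * (?c * max 0 B)"])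
    show "0 \<le> C * (?c * max 0 B)" using C(1) c0 by simp
    fix f g and lam :: real assume fg: "has_weak_gradient f g" "(\<lambda>x. norm (g x)) \<in> fspace N" "0 < lam"
    have "ennreal (C / lam) * (ennreal ?c * (ennreal (max 0 B) * N (\<lambda>x. norm (g x)))) = ennreal (C * (?c * max 0 B) / lam) * N (\<lambda>x. norm (g x))"
    proof -
      have "ennreal (C * (?c * max 0 B) / lam) = ennreal (C / lam) * (ennreal ?c * ennreal (max 0 B))"
        using C(1) c0 fg(3) by (simp add: ennreal_mult[symmetric])
      then show ?thesis by (simp add: mult.assoc)
    qed
    moreover have "ext_norm N (weighted_level \<gamma> lam \<gamma> f) \<le> ennreal (C / lam) * (ennreal ?c * (ennreal (max 0 B) * N (\<lambda>x. norm (g x))))"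
      by (rule sobolev_level_estimate_of_truncated[OF N _ _ fg]) (fact C(2), fact B')
    ultimately show "ext_norm N (weighted_level \<gamma> lam \<gamma> f) \<le> ennreal (C * (?c * max 0 B) / lam) * N (\<lambda>x. norm (g x))"
      by (rule subst)
  qed
qed

section \<open>Interpolation\<close>

lemma level_functional_weighted_level:
  "level_functional N \<gamma> b p f = (SUP lam\<in>{0<..}. ennreal lam * epowr (ext_norm N (weighted_level \<gamma> lam b f)) (1 / p))"
  unfolding level_functional_def weighted_level_def[abs_def] ..

lemma weighted_level_le_level_functional:
  assumes p: "0 < p" and lam: "0 < lam" and A: "level_functional N \<gamma> b p f \<le> ennreal a" and a: "0 \<le> a"
  shows "ext_norm N (weighted_level \<gamma> lam b f) \<le> ennreal ((a / lam) powr p)"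
proof -
  let ?E = "ext_norm N (weighted_level \<gamma> lam b f)"
  have "ennreal lam * epowr ?E (1 / p) \<le> level_functional N \<gamma> b p f"
    unfolding level_functional_weighted_level by (rule SUP_upper) (use lam in simp)
  then have "ennreal lam * epowr ?E (1 / p) \<le> ennreal a" using A by (rule order_trans)
  then have "ennreal (1 / lam) * (ennreal lam * epowr ?E (1 / p)) \<le> ennreal (1 / lam) * ennreal a" by (rule mult_left_mono) simp
  then have "epowr ?E (1 / p) \<le> ennreal (a / lam)"
    using lam a by (simp add: mult.assoc[symmetric] ennreal_mult[symmetric])
  then have "epowr (epowr ?E (1 / p)) (1 / (1 / p)) \<le> epowr (ennreal (a / lam)) (1 / (1 / p))" using p by (intro epowr_mono) auto
  then show ?thesis using p lam a by (subst (asm) epowr_inverse) (auto simp: epowr_ennreal)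
qed

lemma ext_norm_eq_0_AE:
  assumes N: "ball_banach_function_space N" and F: "F \<in> borel_measurable lebesgue" and z: "ext_norm N F = 0"
  shows "AE x in lebesgue. F x = 0"
proof -
  have "(\<lambda>x. enn2real (min (F x) (of_nat 1))) \<in> Meas" using Meas_enn2real_min[OF F] .
  moreover have "N (\<lambda>x. enn2real (min (F x) (of_nat 1))) = 0"
  proof -
    have "N (\<lambda>x. enn2real (min (F x) (of_nat 1))) \<le> ext_norm N F" unfolding ext_norm_def by (rule SUP_upper) simp
    then show ?thesis using z by simp
  qed
  ultimately have "AE x in lebesgue. enn2real (min (F x) (of_nat 1)) = 0" by (rule bbfs_eq_0_AE[OF N])
  then show ?thesis
  proof eventually_elim
    case (elim x)
    then show ?case by (auto simp: enn2real_eq_0_iff min_def top_unique split: if_splits)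
  qed
qed

text \<open>
  If all level sets for one exponent are null sets, then \<open>f\<close> is constant almost everywhere.
\<close>
lemma vanishing_levels_transfer:
  fixes f :: "real ^ 'n::finite \<Rightarrow> complex"
  assumes N: "ball_banach_function_space N" and f: "locally_integrable f"
    and z: "\<And>lam. 0 < lam \<Longrightarrow> ext_norm N (weighted_level \<gamma> lam b f) = 0" and lam': "0 < lam'"
  shows "ext_norm N (weighted_level \<gamma> lam' b' f) = 0"
proof -
  note fm[measurable] = locally_integrable_measurable[OF f]
  note Wm = weighted_level_measurable[OF f]
  have "AE x in lebesgue. weighted_level \<gamma> (1 / real (Suc k)) b f x = 0" for k
    by (rule ext_norm_eq_0_AE[OF N Wm z]) simp
  then have "AE x in lebesgue. \<forall>k. weighted_level \<gamma> (1 / real (Suc k)) b f x = 0" by (simp add: AE_all_countable)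
  then have "AE x in lebesgue. weighted_level \<gamma> lam' b' f x \<le> 0"
  proof eventually_elim
    case (elim x)
    let ?w = "\<lambda>y. ennreal (norm (x - y) powr (\<gamma> - real CARD('n)))"
    have "AE y in lebesgue. indicator (level_set (1 / real (Suc k)) b f) (x, y) * ?w y = 0" for k
    proof -
      have "(\<lambda>y. (if x - y \<noteq> 0 \<and> norm (f x - f y) > 1 / real (Suc k) * norm (x - y) powr (1 + b) then 1 else 0) * ?w y) \<in> borel_measurable lebesgue"
      proof -
        have [measurable]: "(\<lambda>y. y) \<in> borel_measurable (lebesgue :: (real ^ 'n) measure)" by (simp add: measurable_completion)
        show ?thesis by measurable
      qed
      then have "(\<lambda>y. indicator (level_set (1 / real (Suc k)) b f) (x, y) * ?w y) \<in> borel_measurable lebesgue"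
        by (simp add: level_set_def indicator_def of_bool_def)
      then show ?thesis using elim[rule_format, of k] unfolding weighted_level_def by (simp only: nn_integral_0_iff_AE)
    qed
    then have "AE y in lebesgue. \<forall>k. indicator (level_set (1 / real (Suc k)) b f) (x, y) * ?w y = 0" unfolding AE_all_countable by blast
    then have "AE y in lebesgue. indicator (level_set lam' b' f) (x, y) * ?w y = 0"
    proof eventually_elim
      case (elim y)
      have "(x, y) \<notin> level_set lam' b' f"
      proof
        assume l: "(x, y) \<in> level_set lam' b' f"
        let ?d = "norm (x - y)"
        have d: "0 < ?d" and "lam' * ?d powr (1 + b') < norm (f x - f y)" using l by (auto simp: level_set_def)
        moreover have "0 \<le> lam' * ?d powr (1 + b')" using lam' by simp
        ultimately have "0 < norm (f x - f y) / ?d powr (1 + b)" by (intro divide_pos_pos) auto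
        then obtain k where "inverse (real (Suc k)) < norm (f x - f y) / ?d powr (1 + b)" using reals_Archimedean by blast
        then have "1 / real (Suc k) * ?d powr (1 + b) < norm (f x - f y)"
          using d by (simp only: pos_less_divide_eq powr_gt_zero inverse_eq_divide)
        then have "(x, y) \<in> level_set (1 / real (Suc k)) b f" using d by (auto simp: level_set_def)
        then show False using elim[rule_format, of k] d by simp
      qed
      then show ?case by simp
    qed
    then have "weighted_level \<gamma> lam' b' f x = (\<integral>\<^sup>+y. 0 \<partial>(lebesgue :: (real ^ 'n) measure))"
      unfolding weighted_level_def by (rule nn_integral_cong_AE)
    then show ?case by simp
  qed
  then have "ext_norm N (weighted_level \<gamma> lam' b' f) \<le> ext_norm N (\<lambda>x. 0)"
    by (intro ext_norm_mono[OF N Wm]) auto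
  also have "\<dots> = 0" using bbfs_zero[OF N] by (simp add: ext_norm_def)
  finally show ?thesis by simp
qed

lemma level_set_interpolation:
  fixes \<theta> :: real
  assumes \<theta>: "0 < \<theta>" "\<theta> < 1" and lam: "0 < lam0" "0 < lam1" "lam = lam0 powr (1 - \<theta>) * lam1 powr \<theta>"
    and b: "1 + b = (1 - \<theta>) * (1 + b0) + \<theta> * (1 + b1)"
  shows "level_set lam b f \<subseteq> level_set lam0 b0 f \<union> level_set lam1 b1 f"
proof (rule ccontr)
  assume "\<not> ?thesis"
  then obtain x y where xy: "(x, y) \<in> level_set lam b f" "(x, y) \<notin> level_set lam0 b0 f" "(x, y) \<notin> level_set lam1 b1 f" by auto
  let ?d = "norm (x - y)" and ?D = "norm (f x - f y)"
  have d: "0 < ?d" and gt: "lam * ?d powr (1 + b) < ?D" and D0: "?D \<le> lam0 * ?d powr (1 + b0)" and D1: "?D \<le> lam1 * ?d powr (1 + b1)"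
    using xy by (auto simp: level_set_def not_less)
  have "0 \<le> lam * ?d powr (1 + b)" using lam by simp
  then have D: "0 < ?D" using gt by linarith
  have "?D = ?D powr (1 - \<theta>) * ?D powr \<theta>" using D by (simp add: powr_add[symmetric])
  also have "\<dots> \<le> (lam0 * ?d powr (1 + b0)) powr (1 - \<theta>) * (lam1 * ?d powr (1 + b1)) powr \<theta>"
    using D D0 D1 \<theta> by (intro mult_mono powr_mono2) auto
  also have "\<dots> = (lam0 powr (1 - \<theta>) * ?d powr ((1 + b0) * (1 - \<theta>))) * (lam1 powr \<theta> * ?d powr ((1 + b1) * \<theta>))"
    using lam d by (simp add: powr_mult powr_powr)
  also have "\<dots> = lam * (?d powr ((1 + b0) * (1 - \<theta>)) * ?d powr ((1 + b1) * \<theta>))" unfolding lam(3) by (simp only: mult_ac)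
  also have "\<dots> = lam * ?d powr (1 + b)" unfolding b powr_add[symmetric] by (simp only: mult.commute)
  finally show False using gt by simp
qed

lemma weighted_level_interpolation:
  fixes f :: "real ^ 'n::finite \<Rightarrow> complex"
  assumes N: "ball_banach_function_space N" and f: "locally_integrable f"
    and sub: "level_set lam b f \<subseteq> level_set lam0 b0 f \<union> level_set lam1 b1 f"
  shows "ext_norm N (weighted_level \<gamma> lam b f) \<le> ext_norm N (weighted_level \<gamma> lam0 b0 f) + ext_norm N (weighted_level \<gamma> lam1 b1 f)"
proof -
  note Wm = weighted_level_measurable[OF f]
  obtain f' where f': "locally_L1 f'" and ae: "AE x in lborel. f x = f' x" by (rule locally_integrable_borel_version[OF f])
  have f'm: "f' \<in> borel_measurable borel" using f' by (simp add: locally_L1_def)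
  have sect: "(\<lambda>y. indicator (level_set l c f') (x, y) * ennreal (norm (x - y) powr (\<gamma> - real CARD('n)))) \<in> borel_measurable lborel" for l c x
    using measurable_compose[OF measurable_Pair1'[of x borel borel] level_set_integrand_measurable[OF f'm, of l c \<gamma>]] by simp
  have "AE x in lebesgue. weighted_level \<gamma> lam b f x \<le> weighted_level \<gamma> lam0 b0 f x + weighted_level \<gamma> lam1 b1 f x"
    unfolding AE_completion_iff
    using ae weighted_level_borel_version[OF ae, of \<gamma> lam0 b0] weighted_level_borel_version[OF ae, of \<gamma> lam1 b1]
  proof eventually_elim
    case (elim x)
    have "weighted_level \<gamma> lam b f x \<le> (\<integral>\<^sup>+y. indicator (level_set lam0 b0 f') (x, y) * ennreal (norm (x - y) powr (\<gamma> - real CARD('n)))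
        + indicator (level_set lam1 b1 f') (x, y) * ennreal (norm (x - y) powr (\<gamma> - real CARD('n))) \<partial>lborel)"
      unfolding weighted_level_def nn_integral_completion
    proof (rule nn_integral_mono_AE, use ae in eventually_elim)
      case y: (elim y)
      have "(x, y) \<in> level_set l c f \<longleftrightarrow> (x, y) \<in> level_set l c f'" for l c
        by (simp add: level_set_def elim(1) y)
      then have i: "indicator (level_set l c f') (x, y) = (indicator (level_set l c f) (x, y) :: ennreal)" for l c
        by (simp add: indicator_def)
      have "indicator (level_set lam b f) (x, y) \<le> indicator (level_set lam0 b0 f) (x, y) + (indicator (level_set lam1 b1 f) (x, y) :: ennreal)"
        using sub by (auto simp: indicator_def)
      then show ?case unfolding i distrib_right[symmetric] by (rule mult_right_mono) simp
    qed
    also have "\<dots> = weighted_level \<gamma> lam0 b0 f' x + weighted_level \<gamma> lam1 b1 f' x"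
      unfolding weighted_level_def nn_integral_completion by (rule nn_integral_add[OF sect sect])
    finally show ?case unfolding elim(2,3) .
  qed
  then have "ext_norm N (weighted_level \<gamma> lam b f) \<le> ext_norm N (\<lambda>x. weighted_level \<gamma> lam0 b0 f x + weighted_level \<gamma> lam1 b1 f x)"
    by (intro ext_norm_mono[OF N Wm] borel_measurable_add Wm)
  also have "\<dots> \<le> ext_norm N (weighted_level \<gamma> lam0 b0 f) + ext_norm N (weighted_level \<gamma> lam1 b1 f)"
    by (rule ext_norm_triangle[OF N Wm Wm])
  finally show ?thesis .
qed

text \<open>
  Both summands in the interpolation of level sets are of the order of a common number \<open>R\<close> when
  \<open>\<lambda>_0 = d / R\<close> and \<open>\<lambda>_1 = a R^{-1/p_1}\<close>; the relation of the exponents determines \<open>R\<close> from \<open>\<lambda>\<close>.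
\<close>
lemma level_functional_interpolation:
  fixes f :: "real ^ 'n::finite \<Rightarrow> complex" and \<theta> :: real
  assumes N: "ball_banach_function_space N" and f: "locally_integrable f"
    and \<theta>: "0 < \<theta>" "\<theta> < 1" and p: "0 < p" "0 < p1" "1 / p = 1 - \<theta> + \<theta> / p1" and K: "0 \<le> K"
    and b: "1 + b = (1 - \<theta>) * (1 + b0) + \<theta> * (1 + b1)"
    and a: "0 < a" "level_functional N \<gamma> b1 p1 f \<le> ennreal a"
    and d: "0 < d" "\<And>lam. 0 < lam \<Longrightarrow> ext_norm N (weighted_level \<gamma> lam b0 f) \<le> ennreal (K / lam * d)"
  shows "level_functional N \<gamma> b p f \<le> ennreal ((K + 1) powr (1 / p) * a powr \<theta> * d powr (1 - \<theta>))"
  unfolding level_functional_weighted_level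
proof (rule SUP_least)
  fix lam :: real assume "lam \<in> {0<..}"
  then have lam: "0 < lam" by simp
  define u where "u = d powr (1 - \<theta>) * a powr \<theta>"
  have u: "0 < u" using a d by (simp add: u_def)
  define R where "R = (u / lam) powr p"
  have R: "0 < R" using u lam by (simp add: R_def)
  have Rp: "R powr (1 / p) = u / lam" using u lam p(1) by (simp add: R_def powr_powr)
  define lam0 where "lam0 = d / R"
  define lam1 where "lam1 = a * R powr (- (1 / p1))"
  have l: "0 < lam0" "0 < lam1" using a d R by (auto simp: lam0_def lam1_def)
  have "lam0 powr (1 - \<theta>) * lam1 powr \<theta> = (d powr (1 - \<theta>) * R powr (- (1 - \<theta>))) * (a powr \<theta> * R powr (- (1 / p1) * \<theta>))"
  proof -
    have "lam0 powr (1 - \<theta>) = d powr (1 - \<theta>) * R powr (- (1 - \<theta>))"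
      unfolding lam0_def powr_minus using d(1) R by (simp add: powr_divide inverse_eq_divide)
    moreover have "lam1 powr \<theta> = a powr \<theta> * R powr (- (1 / p1) * \<theta>)"
      unfolding lam1_def using a(1) R by (simp add: powr_mult powr_powr)
    ultimately show ?thesis by simp
  qed
  also have "\<dots> = u * (R powr (- (1 - \<theta>)) * R powr (- (1 / p1) * \<theta>))" by (simp add: u_def mult_ac)
  also have "R powr (- (1 - \<theta>)) * R powr (- (1 / p1) * \<theta>) = R powr (- (1 / p))"
    unfolding powr_add[symmetric] p(3) by (simp add: mult.commute)
  also have "u * R powr (- (1 / p)) = lam" using Rp u lam by (simp add: powr_minus)
  finally have eq: "lam = lam0 powr (1 - \<theta>) * lam1 powr \<theta>" by simp
  have e1: "ext_norm N (weighted_level \<gamma> lam1 b1 f) \<le> ennreal R"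
  proof -
    have "a / lam1 = R powr (1 / p1)" using a(1) R by (simp add: lam1_def powr_minus inverse_eq_divide)
    then have "(a / lam1) powr p1 = R" using R p(2) by (simp add: powr_powr)
    then show ?thesis using weighted_level_le_level_functional[OF p(2) l(2) a(2)] a(1) by simp
  qed
  have e0: "ext_norm N (weighted_level \<gamma> lam0 b0 f) \<le> ennreal (K * R)"
    using d(2)[OF l(1)] d(1) R by (simp add: lam0_def)
  have "ext_norm N (weighted_level \<gamma> lam b f) \<le> ennreal (K * R) + ennreal R"
    using weighted_level_interpolation[OF N f level_set_interpolation[OF \<theta> l eq b], of \<gamma>] add_mono[OF e0 e1] by (rule order_trans)
  also have "\<dots> = ennreal ((K + 1) * R)" using K R by (simp add: ennreal_plus[symmetric] algebra_simps del: ennreal_plus)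
  finally have "epowr (ext_norm N (weighted_level \<gamma> lam b f)) (1 / p) \<le> epowr (ennreal ((K + 1) * R)) (1 / p)"
    using p(1) by (intro epowr_mono) auto
  also have "\<dots> = ennreal (((K + 1) * R) powr (1 / p))" using K R by (intro epowr_ennreal) simp
  also have "((K + 1) * R) powr (1 / p) = (K + 1) powr (1 / p) * (u / lam)" using K R by (simp add: powr_mult Rp)
  finally have "ennreal lam * epowr (ext_norm N (weighted_level \<gamma> lam b f)) (1 / p) \<le> ennreal lam * ennreal ((K + 1) powr (1 / p) * (u / lam))"
    by (rule mult_left_mono) simp
  also have "\<dots> = ennreal (lam * ((K + 1) powr (1 / p) * (u / lam)))" using lam by (intro ennreal_mult'[symmetric]) simp
  also have "lam * ((K + 1) powr (1 / p) * (u / lam)) = (K + 1) powr (1 / p) * a powr \<theta> * d powr (1 - \<theta>)"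
    using lam by (simp add: u_def)
  finally show "ennreal lam * epowr (ext_norm N (weighted_level \<gamma> lam b f)) (1 / p) \<le> ennreal ((K + 1) powr (1 / p) * a powr \<theta> * d powr (1 - \<theta>))" .
qed

lemma level_functional_eq_0:
  fixes f :: "real ^ 'n::finite \<Rightarrow> complex"
  assumes N: "ball_banach_function_space N" and f: "locally_integrable f" and p: "0 < p"
    and z: "\<And>lam. 0 < lam \<Longrightarrow> ext_norm N (weighted_level \<gamma> lam b f) = 0"
  shows "level_functional N \<gamma> b' p f = 0"
proof -
  have "epowr 0 (1 / p) = 0" by (simp add: epowr_def)
  then have "level_functional N \<gamma> b' p f \<le> 0"
    unfolding level_functional_weighted_level by (intro SUP_least) (simp add: vanishing_levels_transfer[OF N f z])
  then show ?thesis by simp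
qed

theorem theorem6p3:
  fixes N :: "'n::finite fnorm"
    and \<gamma> s s1 p p1 \<theta> :: real
  assumes "\<gamma> \<in> {..< -1} \<union> {0<..}"
    and "s \<in> {0..<1}" and "s1 \<in> {0..<1}"
    and "p \<in> {1<..}" and "p1 \<in> {1<..}"
    and "\<theta> \<in> {0<..<1}"
    and "s = 1 - \<theta> + \<theta> * s1"
    and "1 / p = 1 - \<theta> + \<theta> / p1"
    and "ball_banach_function_space N"
    and "absolutely_continuous_norm N"
    and "bounded_operator (assoc_norm N) HL_maximal \<or>
         (HL_endpoint_bounded_on_assoc N \<and> ball_averages_uniformly_bounded N)"
  shows "\<exists>C::real. C > 0 \<and>
    (\<forall>f\<in>hom_sobolev N. \<forall>g. has_weak_gradient f g \<longrightarrow>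
       level_functional N \<gamma> (\<gamma> / p + s - 1) p f
         \<le> ennreal C
            * epowr (level_functional N \<gamma> (\<gamma> / p1 + s1 - 1) p1 f) \<theta>
            * epowr (N (\<lambda>x. norm (g x))) (1 - \<theta>))"
proof -
  note N = assms(9)
  have \<gamma>: "\<gamma> < -1 \<or> 0 < \<gamma>" and p: "0 < p" "0 < p1" and \<theta>: "0 < \<theta>" "\<theta> < 1" using assms(1,4,5,6) by auto
  obtain K :: real where K: "0 \<le> K" and est: "\<And>f g lam. has_weak_gradient f g \<Longrightarrow> (\<lambda>x. norm (g x)) \<in> fspace N \<Longrightarrow> 0 < lam \<Longrightarrow>
    ext_norm N (weighted_level \<gamma> lam \<gamma> f) \<le> ennreal (K / lam) * N (\<lambda>x. norm (g x))"
    by (fact sobolev_level_estimate[OF \<gamma> N assms(10,11)])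
  let ?C = "(K + 1) powr (1 / p)"
  let ?b = "\<gamma> / p + s - 1" and ?b1 = "\<gamma> / p1 + s1 - 1"
  have "\<gamma> / p = \<gamma> * (1 - \<theta> + \<theta> / p1)" unfolding assms(8)[symmetric] by simp
  then have b: "1 + ?b = (1 - \<theta>) * (1 + \<gamma>) + \<theta> * (1 + ?b1)"
    unfolding assms(7) by (simp add: algebra_simps)
  show ?thesis
  proof (intro exI[of _ ?C] conjI ballI allI impI)
    show "0 < ?C" using K by simp
    fix f g assume fs: "f \<in> hom_sobolev N" and fg: "has_weak_gradient f g"
    let ?L = "level_functional N \<gamma> ?b p f" and ?A = "level_functional N \<gamma> ?b1 p1 f" and ?G = "N (\<lambda>x. norm (g x))"
    have fl: "locally_integrable f" and gl: "locally_integrable g" using fg by (auto simp: has_weak_gradient_def)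
    have gM: "(\<lambda>x. norm (g x)) \<in> Meas" using locally_integrable_measurable[OF gl] by measurable
    show "?L \<le> ennreal ?C * epowr ?A \<theta> * epowr ?G (1 - \<theta>)"
    (* A product of 0 and infinity is 0 here, so a vanishing factor has to be treated on its own. *)
    proof (cases "?A = 0 \<or> ?G = 0")
      case True
      have "?L = 0"
        using True
      proof
        assume A: "?A = 0"
        have "ext_norm N (weighted_level \<gamma> lam ?b1 f) = 0" if "0 < lam" for lam
          using weighted_level_le_level_functional[OF p(2) that, of N \<gamma> ?b1 f 0] A p by simp
        then show ?thesis by (rule level_functional_eq_0[OF N fl p(1)])
      next
        assume G: "?G = 0"
        then have "(\<lambda>x. norm (g x)) \<in> fspace N" using gM by (simp add: fspace_def)
        from est[OF fg this] have "ext_norm N (weighted_level \<gamma> lam \<gamma> f) = 0" if "0 < lam" for lam using that G by simp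
        then show ?thesis by (rule level_functional_eq_0[OF N fl p(1)])
      qed
      then show ?thesis by simp
    next
      case False
      show ?thesis
      proof (cases "?A = \<infinity> \<or> ?G = \<infinity>")
        case True
        have pos: "epowr x c \<noteq> 0" if "x \<noteq> 0" for x c
          using that by (cases x) (auto simp: epowr_def)
        have "epowr \<infinity> c = \<infinity>" for c by (simp add: epowr_def)
        then have "ennreal ?C * epowr ?A \<theta> * epowr ?G (1 - \<theta>) = \<infinity>"
          using True False pos[of ?A \<theta>] pos[of ?G "1 - \<theta>"] K by (auto simp: ennreal_mult_eq_top_iff)
        then show ?thesis by simp
      next
        case fin: False
        define a where "a = enn2real ?A"
        define d where "d = enn2real ?G"
        have less: "?A < top" "?G < top" using fin by (simp_all add: less_top[symmetric])
        have a: "?A = ennreal a" "0 < a" using False less by (simp_all add: a_def enn2real_positive_iff zero_less_iff_neq_zero)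
        have d: "?G = ennreal d" "0 < d" using False less by (simp_all add: d_def enn2real_positive_iff zero_less_iff_neq_zero)
        have gN: "(\<lambda>x. norm (g x)) \<in> fspace N" using gM d by (simp add: fspace_def)
        have "ext_norm N (weighted_level \<gamma> lam \<gamma> f) \<le> ennreal (K / lam * d)" if "0 < lam" for lam
        proof -
          have "ennreal (K / lam * d) = ennreal (K / lam) * ennreal d" by (rule ennreal_mult) (use K d that in auto)
          then show ?thesis using est[OF fg gN that] d(1) by simp
        qed
        then have "?L \<le> ennreal (?C * a powr \<theta> * d powr (1 - \<theta>))"
          using level_functional_interpolation[OF N fl \<theta> p assms(8) K b a(2) _ d(2)] a(1) by simp
        also have "\<dots> = ennreal ?C * epowr ?A \<theta> * epowr ?G (1 - \<theta>)"
          unfolding a(1) d(1) using a(2) d(2) by (simp add: epowr_ennreal ennreal_mult)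
        finally show ?thesis .
      qed
    qed
  qed
qed

end
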